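(* Let $T>0$ and let $\mathbb{E}^2\in\{\mathbb{R}^2,\mathbb{S}^2,\mathbb{H}^2\}$ (the simply connected complete surface of constant curvature $0$, $1$, $-1$, respectively). The set of closed finite gap curves in $\mathbb{E}^2$ with respect to the period $T$ is $W^{2,2}$-dense in the space of all closed $W^{2,2}$-curves of length $T$ in $\mathbb{E}^2$.
   Context: Closed curves of length $T$ in $\mathbb{E}^2$ are $T$-periodic unit-speed curves $\gamma:\mathbb{R}\to\mathbb{E}^2$ of class $W^{2,2}_{loc}$; the $W^{2,2}$-topology is that of $W^{2,2}([0,T])$-maps into the usual ambient linear space ($\mathbb{R}^2$, $\mathbb{R}^3$, respectively Minkowski space $\mathbb{R}^{(2,1)}$). The potential of such a curve is its signed geodesic curvature $q=\kappa\in L^2([0,T],\mathbb{R})$, extended $T$-periodically (viewing $\gamma$ as a torsion-free curve in the 3-dimensional space form, this is its complex curvature). Finite gap. Put $\varepsilon=\begin{pmatrix} i&0\\0&-i\end{pmatrix}$, $\varepsilon_+=\begin{pmatrix}0&1\\0&0\end{pmatrix}$, $\varepsilon_-=\begin{pmatrix}0&0\\-1&0\end{pmatrix}$. For a $T$-periodic $q\in L^2([0,T],\mathbb{C})$ let $\alpha^q=\tfrac12(\lambda\varepsilon+q\varepsilon_++\bar q\varepsilon_-)$, let $F(t,\lambda)$ solve $\tfrac{d}{dt}F=F\alpha^q$, $F(0,\lambda)=\mathbb{1}$, and put $M(\lambda)=F(T,\lambda)$ (the monodromy, entire in $\lambda$), $\Delta=\operatorname{tr}M$, $N=M-\tfrac12\Delta\mathbb{1}$.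 The potential $q$ is of finite gap if $\sum_{\lambda\in\mathbb{C}}\bigl(\operatorname{ord}_\lambda(\Delta^2-4)-2\operatorname{ord}_\lambda N\bigr)<\infty$ (all summands are $\ge 0$; this expresses that the eigenline curve of $M$ has finite arithmetic genus; equivalently, $q$ is stationary under all but finitely many flows of the self-focusing nonlinear Schrödinger hierarchy). A closed curve of length $T$ is a finite gap curve with respect to the period $T$ if its potential is of finite gap. *)

theory Defs
  imports "HOL-Complex_Analysis.Complex_Analysis"
begin

section \<open>The three surfaces\<close>

text \<open>
  A surface inside its ambient linear space: its points, the ambient bilinear form restricting to
  the Riemannian metric on tangent spaces, and the rotation by \<open>+90\<close> degrees of the tangent plane
  at a point (first argument: the point, second argument: the tangent vector).
\<close>

record 'a surface =
  points :: "'a set"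
  form :: "'a \<Rightarrow> 'a \<Rightarrow> real"
  rot :: "'a \<Rightarrow> 'a \<Rightarrow> 'a"

definition euclidean_plane :: "(real^2) surface" where
  "euclidean_plane =
     \<lparr> points = UNIV,
       form = (\<lambda>v w. v \<bullet> w),
       rot = (\<lambda>p v. vector [- v$2, v$1]) \<rparr>"

definition round_sphere :: "(real^3) surface" where
  "round_sphere =
     \<lparr> points = sphere 0 1,
       form = (\<lambda>v w. v \<bullet> w),
       rot = (\<lambda>p v. cross3 p v) \<rparr>"

definition minkowski :: "real^3 \<Rightarrow> real^3 \<Rightarrow> real" where
  "minkowski v w = v$1 * w$1 + v$2 * w$2 - v$3 * w$3"

text \<open>
  The hyperboloid model. The rotation is the Lorentzian cross product \<open>n\<close> of \<open>p\<close> and \<open>v\<close>,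
  characterised by \<open>minkowski n w = det (p, v, w)\<close> for all \<open>w\<close>.
\<close>

definition hyperbolic_plane :: "(real^3) surface" where
  "hyperbolic_plane =
     \<lparr> points = {p. minkowski p p = -1 \<and> p$3 > 0},
       form = minkowski,
       rot = (\<lambda>p v. vector [cross3 p v $ 1, cross3 p v $ 2, - (cross3 p v $ 3)]) \<rparr>"


section \<open>Curves of class \<open>W\<^sup>2\<^sup>,\<^sup>2\<close>\<close>

definition L2_loc :: "(real \<Rightarrow> 'a::euclidean_space) \<Rightarrow> bool" where
  "L2_loc g \<longleftrightarrow>
     g \<in> borel_measurable lebesgue \<and> (\<forall>a b. (\<lambda>t. (norm (g t))\<^sup>2) integrable_on {a..b})"

text \<open>
  Sobolev functions of one variable are identified with their continuous representatives, so
  \<open>f\<close> is locally \<open>W\<^sup>1\<^sup>,\<^sup>2\<close> iff it is an indefinite integral of some locally square integrable \<open>g\<close>.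
  This \<open>g\<close> is the weak derivative of \<open>f\<close>; it is unique up to null sets.
\<close>

definition has_L2_derivative :: "(real \<Rightarrow> 'a::euclidean_space) \<Rightarrow> (real \<Rightarrow> 'a) \<Rightarrow> bool" where
  "has_L2_derivative f g \<longleftrightarrow>
     L2_loc g \<and> (\<forall>a b. a \<le> b \<longrightarrow> (g has_integral (f b - f a)) {a..b})"

definition velocity :: "(real \<Rightarrow> 'a::euclidean_space) \<Rightarrow> real \<Rightarrow> 'a" where
  "velocity \<gamma> t = vector_derivative \<gamma> (at t)"

text \<open>A representative of the second weak derivative; only its class modulo null sets matters.\<close>

definition acceleration :: "(real \<Rightarrow> 'a::euclidean_space) \<Rightarrow> real \<Rightarrow> 'a" where
  "acceleration \<gamma> = (SOME g. has_L2_derivative (velocity \<gamma>) g)"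

definition W22_loc :: "(real \<Rightarrow> 'a::euclidean_space) \<Rightarrow> bool" where
  "W22_loc \<gamma> \<longleftrightarrow> \<gamma> differentiable_on UNIV \<and> (\<exists>g. has_L2_derivative (velocity \<gamma>) g)"

text \<open>Distance for the \<open>W\<^sup>2\<^sup>,\<^sup>2\<close>-norm on \<open>[0, T]\<close>, taken with the Euclidean norm of the ambient space.\<close>

definition W22_dist ::
  "real \<Rightarrow> (real \<Rightarrow> 'a::euclidean_space) \<Rightarrow> (real \<Rightarrow> 'a) \<Rightarrow> real" where
  "W22_dist T \<gamma> \<delta> =
     sqrt (integral {0..T} (\<lambda>t. (norm (\<gamma> t - \<delta> t))\<^sup>2
                              + (norm (velocity \<gamma> t - velocity \<delta> t))\<^sup>2
                              + (norm (acceleration \<gamma> t - acceleration \<delta> t))\<^sup>2))"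

definition W22_dense_in ::
  "real \<Rightarrow> (real \<Rightarrow> 'a::euclidean_space) set \<Rightarrow> (real \<Rightarrow> 'a) set \<Rightarrow> bool" where
  "W22_dense_in T A B \<longleftrightarrow>
     A \<subseteq> B \<and> (\<forall>\<gamma>\<in>B. \<forall>e>0. \<exists>\<delta>\<in>A. W22_dist T \<gamma> \<delta> < e)"

definition closed_curves :: "'a::euclidean_space surface \<Rightarrow> real \<Rightarrow> (real \<Rightarrow> 'a) set" where
  "closed_curves S T =
     {\<gamma>. (\<forall>t. \<gamma> t \<in> points S)
        \<and> W22_loc \<gamma>
        \<and> (\<forall>t. form S (velocity \<gamma> t) (velocity \<gamma> t) = 1)
        \<and> (\<forall>t. \<gamma> (t + T) = \<gamma> t)}"

text \<open>
  Signed geodesic curvature of a unit-speed curve. Since \<open>rot\<close> takes values in the tangent plane,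
  the ambient second derivative may replace the covariant derivative of the velocity.
\<close>

definition geodesic_curvature ::
  "'a::euclidean_space surface \<Rightarrow> (real \<Rightarrow> 'a) \<Rightarrow> real \<Rightarrow> real" where
  "geodesic_curvature S \<gamma> t = form S (acceleration \<gamma> t) (rot S (\<gamma> t) (velocity \<gamma> t))"


section \<open>Finite gap potentials\<close>

definition cscale :: "complex \<Rightarrow> complex^2^2 \<Rightarrow> complex^2^2" where
  "cscale c A = (\<chi> i j. c * A $ i $ j)"

definition eps :: "complex^2^2" where
  "eps = vector [vector [\<i>, 0], vector [0, - \<i>]]"

definition eps_plus :: "complex^2^2" where
  "eps_plus = vector [vector [0, 1], vector [0, 0]]"

definition eps_minus :: "complex^2^2" where
  "eps_minus = vector [vector [0, 0], vector [-1, 0]]"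

definition alpha :: "(real \<Rightarrow> complex) \<Rightarrow> complex \<Rightarrow> real \<Rightarrow> complex^2^2" where
  "alpha q z t =
     cscale (1/2) (cscale z eps + cscale (q t) eps_plus + cscale (cnj (q t)) eps_minus)"

text \<open>
  As the potential is only square integrable, the equation \<open>F' = F \<alpha>\<close>, \<open>F(0) = 1\<close> is understood in
  the sense of Caratheodory, that is, as an integral equation. Everything below depends only on the
  class modulo null sets of the potential on \<open>[0, T]\<close>.
\<close>

definition solves_frame_eq ::
  "real \<Rightarrow> (real \<Rightarrow> complex) \<Rightarrow> complex \<Rightarrow> (real \<Rightarrow> complex^2^2) \<Rightarrow> bool" where
  "solves_frame_eq T q z F \<longleftrightarrow>
     continuous_on {0..T} F
     \<and> (\<forall>t\<in>{0..T}. ((\<lambda>s. F s ** alpha q z s) has_integral (F t - mat 1)) {0..t})"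

definition monodromy :: "real \<Rightarrow> (real \<Rightarrow> complex) \<Rightarrow> complex \<Rightarrow> complex^2^2" where
  "monodromy T q z = (THE M. \<exists>F. solves_frame_eq T q z F \<and> M = F T)"

definition Delta :: "real \<Rightarrow> (real \<Rightarrow> complex) \<Rightarrow> complex \<Rightarrow> complex" where
  "Delta T q z = trace (monodromy T q z)"

definition tracefree_part :: "real \<Rightarrow> (real \<Rightarrow> complex) \<Rightarrow> complex \<Rightarrow> complex^2^2" where
  "tracefree_part T q z = monodromy T q z - cscale (Delta T q z / 2) (mat 1)"

text \<open>
  Vanishing order at \<open>z\<close> of a matrix-valued entire function that is not identically zero. Entries
  that vanish identically have infinite order and do not contribute to the minimum; they have to be
  left out because \<open>zorder\<close> is unspecified for the zero function.
\<close>

definition matrix_order :: "(complex \<Rightarrow> complex^2^2) \<Rightarrow> complex \<Rightarrow> int" where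
  "matrix_order A z = Min {zorder (\<lambda>w. A w $ i $ j) z | i j. \<exists>w. A w $ i $ j \<noteq> 0}"

text \<open>
  The function \<open>\<Delta>\<^sup>2 - 4\<close> is entire and never identically zero, and the summands are nonnegative
  integers, so summability over the plane says that their sum is finite.
\<close>

definition finite_gap :: "real \<Rightarrow> (real \<Rightarrow> complex) \<Rightarrow> bool" where
  "finite_gap T q \<longleftrightarrow>
     (\<lambda>z. real_of_int (zorder (\<lambda>w. (Delta T q w)\<^sup>2 - 4) z - 2 * matrix_order (tracefree_part T q) z))
       summable_on (UNIV :: complex set)"

definition finite_gap_curves :: "'a::euclidean_space surface \<Rightarrow> real \<Rightarrow> (real \<Rightarrow> 'a) set" where
  "finite_gap_curves S T =
     {\<gamma> \<in> closed_curves S T. finite_gap T (\<lambda>t. complex_of_real (geodesic_curvature S \<gamma> t))}"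

end

theory Submission
  imports Defs
begin

text \<open>
  The moving frame of a unit-speed curve solves a linear equation whose coefficient is the curvature
  \<open>\<kappa>\<close>. Approximate \<open>\<kappa>\<close> in \<open>L\<^sup>2\<close> by a periodic \<open>C\<^sup>2\<close> function \<open>p\<close> and look for a potential
  \<open>q = p + \<Sum>\<^sub>i s\<^sub>i w\<^sub>i + 2 Re \<Sum>\<^sub>n cnj g\<^sub>n exp (\<i> \<omega> n t)\<close> with \<open>n > N\<close> and \<open>\<omega> = 2 \<pi> / T\<close>. Three equations
  say that the frame of \<open>q\<close> is closed, and for every \<open>n > N\<close> the equations \<open>M\<^sub>1\<^sub>2 = 0\<close> and \<open>Im M\<^sub>1\<^sub>1 = 0\<close>
  at \<open>\<lambda> = \<omega> n + \<mu>\<^sub>n\<close> say that the \<open>n\<close>-th gap is closed. To first order the left-hand sides are, up to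
  signs, \<open>s\<close>, \<open>T g\<^sub>n / 2\<close> and \<open>T \<mu>\<^sub>n / 2\<close>, provided that the \<open>w\<^sub>i\<close> are dual to the coordinates of the curve. Hence
  a Newton step maps a small compact box of parameters \<open>(s, g, \<mu>)\<close> into itself, and by Brouwer's
  theorem on finite-dimensional truncations it has a fixed point. Dual functions exist unless
  the curve is a geodesic, whose potential vanishes and is therefore of finite gap.

  If all but finitely many gaps are closed, then comparison with the vacuum shows that far out the
  zeros of \<open>\<Delta>\<^sup>2 - 4\<close> are exactly the prescribed double ones, where \<open>M - \<Delta> / 2\<close> has a simple zero, so
  that only finitely many summands of the arithmetic genus are nonzero.
\<close>


text \<open>At real \<lambda> the monodromy lies in SU(2), so a double point costs three real
  equations; they match the three real unknowns of gap n, the complex coefficient g_n and the shift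
  \<mu>_n. The obstacle is that infinitely many gaps have to be closed at once, with errors that
  couple all of them. The fixed-point argument asks only for continuity in each coordinate and for
  bounds on these errors over the box, and the bounds dictate its shape. A product of the potential
  with its oscillating primitive shifts \<mu>_n by a multiple of 1/n however small the box is, so
  \<mu>_n is confined to A/n only. The equation for g_n has errors of order 1/n^2, from the smooth
  part of the potential and from quadratic terms, so g_n may be confined to n^(-7/4): as 7/4 < 2,
  all gap equations map the box into itself once N is large. The closing equations feel the tail of
  the potential only through its sup norm, which is small for large N. Hence the order of choices:
  dual functions, radius of s, then p, and N last.\<close>

section \<open>Linear differential equations and the Hilbert cube\<close>

text \<open>Kuhn's labelling argument behind Brouwer's theorem is run on grids whose dimension and
  number of cells per axis are the same \<open>k\<close>, so that one compactness argument removes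
  truncation and mesh together. The hypothesis \<open>cont\<close> is sequential continuity for the
  product topology on the box. A radius 0 freezes a coordinate.\<close>

lemma hilbert_cube_fixed_point:
  fixes f :: "(nat \<Rightarrow> real) \<Rightarrow> nat \<Rightarrow> real" and R :: "nat \<Rightarrow> real"
  assumes R: "\<And>i. R i \<ge> 0"
    and into: "\<And>x i. (\<And>j. \<bar>x j\<bar> \<le> R j) \<Longrightarrow> \<bar>f x i\<bar> \<le> R i"
    and cont: "\<And>X x i. (\<And>k j. \<bar>X k j\<bar> \<le> R j) \<Longrightarrow> (\<And>j. (\<lambda>k::nat. X k j) \<longlonglongrightarrow> x j)
       \<Longrightarrow> (\<lambda>k. f (X k) i) \<longlonglongrightarrow> f x i"
  obtains x where "\<And>j. \<bar>x j\<bar> \<le> R j" "\<And>i. f x i = x i"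
proof -
  \<comment> \<open>Grid coordinates are normalised to [-1, 1] and scaled by \<open>R\<close> only
    in \<open>pt\<close>: convergent subsequences are extracted from \<open>co\<close>, which is
    bounded whatever the radii are. Coordinates from \<open>k\<close> on sit at the centre.\<close>
  define co where "co k q j = (if j < k then 2 * real (q j) / real k - 1 else 0)"
    for k :: nat and q :: "nat \<Rightarrow> nat" and j
  define pt where "pt k q j = co k q j * R j" for k :: nat and q :: "nat \<Rightarrow> nat" and j
  have co_le: "\<bar>co k q j\<bar> \<le> 1" if "k > 0" "\<forall>j<k. q j \<le> k" for k q j
    using that by (auto simp: co_def abs_le_iff field_simps)
  have box: "\<bar>pt k q j\<bar> \<le> R j" if "k > 0" "\<forall>j<k. q j \<le> k" for k q j
    using mult_right_mono[OF co_le[OF that, of j] R[of j]] R[of j] by (simp add: pt_def abs_mult)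
  \<comment> \<open>Label 0 means that the map does not push coordinate \<open>i\<close> down, label
    1 that it does not push it up. The clauses on the faces \<open>q i = 0\<close> and
    \<open>q i = k\<close> are what Kuhn's lemma demands; they agree with this meaning because the
    map stays in the box.\<close>
  define label where "label k q i = (if q i = 0 \<or> (q i < k \<and> f (pt k q) i \<ge> pt k q i) then 0 else (1::nat))"
    for k q i
  have lab0: "f (pt k q) i \<ge> pt k q i" if "k > 0" "\<forall>j<k. q j \<le> k" "i < k" "label k q i = 0" for k q i
  proof (cases "q i = 0")
    case True
    then have "pt k q i = - R i" using that by (simp add: pt_def co_def)
    then show ?thesis using into[OF box[OF that(1,2)], of i] by (simp add: abs_le_iff)
  next
    case False
    then show ?thesis using that by (simp add: label_def split: if_splits)
  qed
  have lab1: "f (pt k q) i \<le> pt k q i" if "k > 0" "\<forall>j<k. q j \<le> k" "i < k" "label k q i \<noteq> 0" for k q i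
  proof (cases "q i < k")
    case True
    then show ?thesis using that by (simp add: label_def split: if_splits)
  next
    case False
    then have "q i = k" using that by (simp add: le_antisym)
    then have "pt k q i = R i" using that by (simp add: pt_def co_def)
    then show ?thesis using into[OF box[OF that(1,2)], of i] by (simp add: abs_le_iff)
  qed
  have "\<exists>q. (\<forall>i<k. q i < k) \<and> (\<forall>i<k. \<exists>r s. (\<forall>j<k. q j \<le> r j \<and> r j \<le> q j + 1) \<and>
        (\<forall>j<k. q j \<le> s j \<and> s j \<le> q j + 1) \<and> f (pt k r) i \<ge> pt k r i \<and> f (pt k s) i \<le> pt k s i)"
    if k: "k > 0" for k
  proof -
    have "\<forall>x. (\<forall>i<k. x i \<le> k) \<longrightarrow> (\<forall>i<k. label k x i = (0::nat) \<or> label k x i = 1)"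
      "\<forall>x. (\<forall>i<k. x i \<le> k) \<longrightarrow> (\<forall>i<k. x i = 0 \<longrightarrow> label k x i = 0)"
      "\<forall>x. (\<forall>i<k. x i \<le> k) \<longrightarrow> (\<forall>i<k. x i = k \<longrightarrow> label k x i = 1)"
      using k by (auto simp: label_def)
    from kuhn_lemma[OF k this] obtain q where q: "\<forall>i<k. q i < k"
      "\<forall>i<k. \<exists>r s. (\<forall>j<k. q j \<le> r j \<and> r j \<le> q j + 1) \<and> (\<forall>j<k. q j \<le> s j \<and> s j \<le> q j + 1)
          \<and> label k r i \<noteq> label k s i" by blast
    have "\<exists>r s. (\<forall>j<k. q j \<le> r j \<and> r j \<le> q j + 1) \<and> (\<forall>j<k. q j \<le> s j \<and> s j \<le> q j + 1) \<and>
         f (pt k r) i \<ge> pt k r i \<and> f (pt k s) i \<le> pt k s i" if i: "i < k" for i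
    proof -
      from q(2) i obtain r s where rs: "\<forall>j<k. q j \<le> r j \<and> r j \<le> q j + 1"
        "\<forall>j<k. q j \<le> s j \<and> s j \<le> q j + 1" "label k r i \<noteq> label k s i" by blast
      have bb: "\<forall>j<k. r j \<le> k" "\<forall>j<k. s j \<le> k"
        using rs(1,2) q(1) by (metis Suc_eq_plus1 Suc_leI le_trans)+
      show ?thesis
      proof (cases "label k r i = 0")
        case True
        then have "label k s i \<noteq> 0" using rs(3) by simp
        then show ?thesis using lab0[OF k bb(1) i True] lab1[OF k bb(2) i] rs by blast
      next
        case False
        then have "label k s i = 0" using rs(3) by (auto simp: label_def split: if_splits)
        then show ?thesis using lab0[OF k bb(2) i] lab1[OF k bb(1) i False] rs by blast
      qed
    qed
    then show ?thesis using q(1) by blast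
  qed
  then obtain Q where Q1: "\<And>k i. k > 0 \<Longrightarrow> i < k \<Longrightarrow> Q k i < k"
    and Q2: "\<And>k i. k > 0 \<Longrightarrow> i < k \<Longrightarrow> \<exists>r s. (\<forall>j<k. Q k j \<le> r j \<and> r j \<le> Q k j + 1) \<and>
        (\<forall>j<k. Q k j \<le> s j \<and> s j \<le> Q k j + 1) \<and> f (pt k r) i \<ge> pt k r i \<and> f (pt k s) i \<le> pt k s i"
    by metis
  define Y where "Y k = co (Suc k) (Q (Suc k))" for k
  have Y1: "norm (Y k j) \<le> 1" for k j
    unfolding Y_def real_norm_def by (intro co_le) (auto intro: less_imp_le Q1)
  obtain \<sigma> :: "nat \<Rightarrow> nat" where \<sigma>: "strict_mono \<sigma>" "\<And>j. \<exists>l. (\<lambda>k. Y (\<sigma> k) j) \<longlonglongrightarrow> l"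
  proof (rule function_convergent_subsequence[of "UNIV :: nat set" Y 1])
    show "countable (UNIV :: nat set)" by simp
    show "norm (Y n x) \<le> 1" for n x by (rule Y1)
    fix k assume "strict_mono k" "\<And>x. x \<in> UNIV \<Longrightarrow> \<exists>l. (\<lambda>n. Y (k n) x) \<longlonglongrightarrow> l"
    then show thesis by (intro that) auto
  qed
  then obtain y where y: "\<And>j. (\<lambda>k. Y (\<sigma> k) j) \<longlonglongrightarrow> y j" by metis
  define x where "x j = y j * R j" for j
  have \<sigma>k: "\<sigma> k \<ge> k" for k using \<sigma>(1) by (rule seq_suble)
  \<comment> \<open>Vertices of one cell differ from its corner \<open>Q\<close> by at most one grid
    step per coordinate, so they share its limit.\<close>
  have near: "(\<lambda>k. pt (Suc (\<sigma> k)) (r k) j) \<longlonglongrightarrow> x j"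
    if r: "\<And>k. k \<ge> i \<Longrightarrow> \<forall>j<Suc (\<sigma> k). Q (Suc (\<sigma> k)) j \<le> r k j \<and> r k j \<le> Q (Suc (\<sigma> k)) j + 1" for r i j
  proof -
    have lim0: "(\<lambda>k. 2 / real (Suc k)) \<longlonglongrightarrow> 0"
      using LIMSEQ_Suc[OF lim_const_over_n[of "2::real"]] by simp
    have "(\<lambda>k. co (Suc (\<sigma> k)) (r k) j - Y (\<sigma> k) j) \<longlonglongrightarrow> 0"
    proof (rule Lim_null_comparison[OF _ lim0])
      show "\<forall>\<^sub>F k in sequentially. norm (co (Suc (\<sigma> k)) (r k) j - Y (\<sigma> k) j) \<le> 2 / real (Suc k)"
      proof (rule eventually_sequentiallyI[of i])
        fix k assume k: "i \<le> k"
        show "norm (co (Suc (\<sigma> k)) (r k) j - Y (\<sigma> k) j) \<le> 2 / real (Suc k)"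
        proof (cases "j < Suc (\<sigma> k)")
          case True
          have "Q (Suc (\<sigma> k)) j \<le> r k j" "r k j \<le> Q (Suc (\<sigma> k)) j + 1" using r[OF k] True by auto
          then have "\<bar>real (r k j) - real (Q (Suc (\<sigma> k)) j)\<bar> \<le> 1" by linarith
          then have "\<bar>2 * (real (r k j) - real (Q (Suc (\<sigma> k)) j)) / real (Suc (\<sigma> k))\<bar> \<le> 2 / real (Suc (\<sigma> k))"
            by (simp add: abs_mult divide_right_mono)
          also have "\<dots> \<le> 2 / real (Suc k)" using \<sigma>k[of k] by (simp add: frac_le)
          finally show ?thesis using True by (simp add: co_def Y_def diff_divide_distrib right_diff_distrib)
        qed (simp add: co_def Y_def)
      qed
    qed
    from tendsto_add[OF this y[of j]] have "(\<lambda>k. co (Suc (\<sigma> k)) (r k) j) \<longlonglongrightarrow> y j" by simp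
    then show ?thesis unfolding pt_def x_def by (intro tendsto_mult tendsto_const)
  qed
  have xR: "\<bar>x j\<bar> \<le> R j" for j
  proof -
    have "(\<lambda>k. \<bar>pt (Suc (\<sigma> k)) (Q (Suc (\<sigma> k))) j\<bar>) \<longlonglongrightarrow> \<bar>x j\<bar>"
      using near[of 0 "\<lambda>k. Q (Suc (\<sigma> k))" j] by (intro tendsto_rabs) auto
    moreover have "\<forall>k\<ge>0. \<bar>pt (Suc (\<sigma> k)) (Q (Suc (\<sigma> k))) j\<bar> \<le> R j"
      by (intro allI impI box) (simp_all add: Q1 less_imp_le)
    ultimately show ?thesis using LIMSEQ_le_const2 by blast
  qed
  have fx: "f x i = x i" for i
  proof -
    \<comment> \<open>For \<open>k < i\<close> the grid may have no coordinate \<open>i\<close>; the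
      corner then stands in for both vertices and nothing is claimed about it.\<close>
    have "\<exists>r s. (\<forall>j<Suc (\<sigma> k). Q (Suc (\<sigma> k)) j \<le> r j \<and> r j \<le> Q (Suc (\<sigma> k)) j + 1) \<and>
        (\<forall>j<Suc (\<sigma> k). Q (Suc (\<sigma> k)) j \<le> s j \<and> s j \<le> Q (Suc (\<sigma> k)) j + 1) \<and>
        (k \<ge> i \<longrightarrow> f (pt (Suc (\<sigma> k)) r) i \<ge> pt (Suc (\<sigma> k)) r i \<and> f (pt (Suc (\<sigma> k)) s) i \<le> pt (Suc (\<sigma> k)) s i)" for k
    proof (cases "k \<ge> i")
      case True
      then have "i < Suc (\<sigma> k)" using \<sigma>k[of k] by linarith
      then show ?thesis using Q2[of "Suc (\<sigma> k)" i] by auto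
    next
      case False
      then show ?thesis by (intro exI[of _ "Q (Suc (\<sigma> k))"]) auto
    qed
    then obtain r s where rs: "\<And>k. \<forall>j<Suc (\<sigma> k). Q (Suc (\<sigma> k)) j \<le> r k j \<and> r k j \<le> Q (Suc (\<sigma> k)) j + 1"
        "\<And>k. \<forall>j<Suc (\<sigma> k). Q (Suc (\<sigma> k)) j \<le> s k j \<and> s k j \<le> Q (Suc (\<sigma> k)) j + 1"
        "\<And>k. k \<ge> i \<Longrightarrow> f (pt (Suc (\<sigma> k)) (r k)) i \<ge> pt (Suc (\<sigma> k)) (r k) i"
        "\<And>k. k \<ge> i \<Longrightarrow> f (pt (Suc (\<sigma> k)) (s k)) i \<le> pt (Suc (\<sigma> k)) (s k) i" by metis
    have bd: "\<And>k j. \<bar>pt (Suc (\<sigma> k)) (r k) j\<bar> \<le> R j" "\<And>k j. \<bar>pt (Suc (\<sigma> k)) (s k) j\<bar> \<le> R j"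
    proof -
      have Q': "Q (Suc (\<sigma> k)) j + 1 \<le> Suc (\<sigma> k)" if "j < Suc (\<sigma> k)" for k j using Q1[of "Suc (\<sigma> k)" j] that by simp
      show "\<bar>pt (Suc (\<sigma> k)) (r k) j\<bar> \<le> R j" "\<bar>pt (Suc (\<sigma> k)) (s k) j\<bar> \<le> R j" for k j
        by (intro box; use rs(1,2) Q' le_trans in blast)+
    qed
    have r: "(\<lambda>k. pt (Suc (\<sigma> k)) (r k) j) \<longlonglongrightarrow> x j" "(\<lambda>k. pt (Suc (\<sigma> k)) (s k) j) \<longlonglongrightarrow> x j" for j
      using near rs(1,2) by blast+
    have fr: "(\<lambda>k. f (pt (Suc (\<sigma> k)) (r k)) i) \<longlonglongrightarrow> f x i" "(\<lambda>k. f (pt (Suc (\<sigma> k)) (s k)) i) \<longlonglongrightarrow> f x i"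
      by (rule cont; use bd r in blast)+
    have "x i \<le> f x i" using r(1)[of i] fr(1) by (rule LIMSEQ_le) (use rs(3) in blast)
    moreover have "f x i \<le> x i" using fr(2) r(2)[of i] by (rule LIMSEQ_le) (use rs(4) in blast)
    ultimately show ?thesis by simp
  qed
  show thesis using that xR fx by blast
qed

section \<open>Gronwall's inequality and linear differential equations in Banach spaces\<close>

lemma gronwall:
  fixes u w :: "real \<Rightarrow> real"
  assumes u: "continuous_on {0..T} u" and w: "continuous_on {0..T} w" "\<And>t. t \<in> {0..T} \<Longrightarrow> w t \<ge> 0"
    and le: "\<And>t. t \<in> {0..T} \<Longrightarrow> u t \<le> e + integral {0..t} (\<lambda>s. w s * u s)"
    and t: "t \<in> {0..T}"
  shows "u t \<le> e * exp (integral {0..t} w)"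
proof -
  define Y where "Y t = e + integral {0..t} (\<lambda>s. w s * u s)" for t
  define Z where "Z t = Y t * exp (- integral {0..t} w)" for t
  have dY: "(Y has_real_derivative w t * u t) (at t within {0..T})" if "t \<in> {0..T}" for t
    unfolding Y_def using integral_has_real_derivative[of 0 T "\<lambda>s. w s * u s" t] that u w
    by (auto intro!: derivative_eq_intros continuous_intros)
  have dZ: "(Z has_real_derivative (w t * u t - w t * Y t) * exp (- integral {0..t} w)) (at t within {0..T})"
    if "t \<in> {0..T}" for t
    unfolding Z_def using integral_has_real_derivative[OF w(1) that] dY[OF that]
    by (auto intro!: derivative_eq_intros simp: algebra_simps)
  have "Z t \<le> Z 0"
  proof (cases "t = 0")
    case False
    show ?thesis
    proof (rule DERIV_nonpos_imp_decreasing_open[of 0 t Z])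
      show "0 \<le> t" using t by auto
      fix s assume s: "0 < s" "s < t"
      then have sT: "s \<in> {0..T}" using t by auto
      have "at s within {0..T} = at s" using s t by (intro at_within_interior) (auto simp: interior_atLeastAtMost_real)
      then have "(Z has_real_derivative (w s * u s - w s * Y s) * exp (- integral {0..s} w)) (at s)"
        using dZ[OF sT] by simp
      moreover have "w s * u s \<le> w s * Y s" using le[OF sT] w(2)[OF sT] unfolding Y_def by (rule mult_left_mono)
      ultimately show "\<exists>y. (Z has_real_derivative y) (at s) \<and> y \<le> 0"
        by (intro exI conjI) (auto simp: mult_nonpos_nonneg)
    next
      have "continuous_on {0..T} Z" by (rule DERIV_continuous_on) (rule dZ)
      then show "continuous_on {0..t} Z" by (rule continuous_on_subset) (use t in auto)
    qed
  qed simp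
  then have "Y t \<le> e * exp (integral {0..t} w)"
    by (simp add: Z_def Y_def exp_minus field_simps)
  then show ?thesis using le[OF t] by (simp add: Y_def)
qed

lemma primitive_exists:
  fixes g :: "real \<Rightarrow> 'a::banach"
  assumes "continuous_on UNIV g"
  shows "\<exists>G. G 0 = 0 \<and> (\<forall>t. (G has_vector_derivative g t) (at t))"
proof -
  define G where "G t = (if 0 \<le> t then integral {0..t} g else - integral {t..0} g)" for t
  have int: "g integrable_on {a..b}" for a b
    using assms by (intro integrable_continuous_real) (auto intro: continuous_on_subset)
  have eq: "G t = integral {-a..t} g - integral {-a..0} g" if "a > 0" "-a \<le> t" "t \<le> a" for a t
    using that Henstock_Kurzweil_Integration.integral_combine[OF _ _ int, of "-a" 0 t]
      Henstock_Kurzweil_Integration.integral_combine[OF _ _ int, of "-a" t 0]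
    by (cases "0 \<le> t") (auto simp: G_def algebra_simps)
  have "(G has_vector_derivative g t) (at t)" for t
  proof -
    define a where "a = \<bar>t\<bar> + 1"
    have ta: "t \<in> {-a..a}" "t \<in> {-a<..<a}" "a > 0" by (auto simp: a_def)
    have "((\<lambda>u. integral {-a..u} g - integral {-a..0} g) has_vector_derivative g t) (at t within {-a..a})"
      using integral_has_vector_derivative[OF continuous_on_subset[OF assms] ta(1)]
      by (auto intro!: derivative_eq_intros)
    then have "((\<lambda>u. integral {-a..u} g - integral {-a..0} g) has_vector_derivative g t) (at t)"
      using ta by (subst (asm) at_within_interior) (auto simp: interior_atLeastAtMost_real)
    then show ?thesis
      by (rule has_vector_derivative_transform_within_open[of _ _ _ "{-a<..<a}"]) (use ta in \<open>auto intro!: eq[symmetric]\<close>)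
  qed
  moreover have "G 0 = 0" by (simp add: G_def)
  ultimately show ?thesis by blast
qed

lemma vector_derivative_reflect:
  assumes "(x has_vector_derivative d) (at (-t))"
  shows "((\<lambda>t. x (-t)) has_vector_derivative - d) (at t)"
proof -
  have "(uminus has_vector_derivative (-1::real)) (at t)" by (auto intro!: derivative_eq_intros)
  from vector_diff_chain_at[OF this assms] show ?thesis by (simp add: o_def)
qed

lemma linear_ode_unique_pos:
  fixes x :: "real \<Rightarrow> 'a::banach"
  assumes d: "\<And>t. t \<in> {0..T} \<Longrightarrow> (x has_vector_derivative d t) (at t within {0..T})"
    and le: "\<And>t. t \<in> {0..T} \<Longrightarrow> norm (d t) \<le> C * norm (x t)" and x0: "x 0 = 0" and t: "t \<in> {0..T}" and C: "C \<ge> 0"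
  shows "x t = 0"
proof -
  have cx: "continuous_on {0..T} x" by (rule continuous_on_vector_derivative) (rule d)
  have "norm (x t) \<le> 0 * exp (integral {0..t} (\<lambda>_. C))"
  proof (rule gronwall[of T "\<lambda>t. norm (x t)" "\<lambda>_. C"])
    fix t assume t: "t \<in> {0..T}"
    have hi: "(d has_integral x t - x 0) {0..t}"
      using t by (intro fundamental_theorem_of_calculus)
        (auto intro!: has_vector_derivative_within_subset[OF d])
    have "norm (integral {0..t} d) \<le> integral {0..t} (\<lambda>s. C * norm (x s))"
      using t by (intro integral_norm_bound_integral has_integral_integrable[OF hi])
        (auto intro!: integrable_continuous_real continuous_intros continuous_on_subset[OF cx] le)
    then show "norm (x t) \<le> 0 + integral {0..t} (\<lambda>s. C * norm (x s))"
      using hi x0 by (simp add: integral_unique)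
  qed (use cx t C in \<open>auto intro!: continuous_intros\<close>)
  then show ?thesis by simp
qed

lemma linear_ode_unique:
  fixes x :: "real \<Rightarrow> 'a::banach"
  assumes d: "\<And>t. (x has_vector_derivative d t) (at t)"
    and le: "\<And>t. norm (d t) \<le> C * norm (x t)" and x0: "x 0 = 0" and C: "C \<ge> 0"
  shows "x t = 0"
proof (cases "t \<ge> 0")
  case True
  show ?thesis
  proof (rule linear_ode_unique_pos[of t x d C])
    show "(x has_vector_derivative d s) (at s within {0..t})" for s
      by (rule has_vector_derivative_at_within) (rule d)
    show "norm (d s) \<le> C * norm (x s)" for s by (rule le)
    show "t \<in> {0..t}" using True by simp
  qed fact+
next
  case False
  have "(\<lambda>t. x (-t)) (-t) = 0"
  proof (rule linear_ode_unique_pos[of "-t" "\<lambda>t. x (-t)" "\<lambda>t. - d (-t)" C])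
    show "((\<lambda>t. x (- t)) has_vector_derivative - d (- s)) (at s within {0..- t})" for s
      by (rule has_vector_derivative_at_within, rule vector_derivative_reflect) (rule d)
    show "norm (- d (- s)) \<le> C * norm (x (- s))" for s unfolding norm_minus_cancel by (rule le)
    show "- t \<in> {0..- t}" using False by simp
    show "x (- 0) = 0" using x0 by simp
  qed fact
  then show ?thesis by simp
qed

text \<open>The Picard series is summed directly: its \<open>n\<close>-th term is at most
  \<open>norm x0 * (C * r) ^ n / fact n\<close> for times of modulus at most \<open>r\<close>, so
  the solution is global at once and no local solutions have to be glued. The hypothesis
  \<open>cont\<close> takes the place of joint continuity of \<open>L\<close>.\<close>

lemma linear_ode_exists:
  fixes L :: "real \<Rightarrow> 'a::banach \<Rightarrow> 'a"
  assumes lin: "\<And>t. linear (L t)" and C: "C \<ge> 0" and bound: "\<And>t x. norm (L t x) \<le> C * norm x"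
    and cont: "\<And>y. continuous_on UNIV y \<Longrightarrow> continuous_on UNIV (\<lambda>t. L t (y t))"
  shows "\<exists>x. x 0 = x0 \<and> (\<forall>t. (x has_vector_derivative L t (x t)) (at t))"
proof -
  have "\<exists>P. \<forall>g::real\<Rightarrow>'a. continuous_on UNIV g \<longrightarrow> P g 0 = 0 \<and> (\<forall>t. (P g has_vector_derivative g t) (at t))"
    using primitive_exists by metis
  then obtain P :: "(real \<Rightarrow> 'a) \<Rightarrow> real \<Rightarrow> 'a" where
    P: "\<And>g. continuous_on UNIV g \<Longrightarrow> P g 0 = 0"
       "\<And>g t. continuous_on UNIV g \<Longrightarrow> (P g has_vector_derivative g t) (at t)" by blast
  define X where "X = rec_nat (\<lambda>_. x0) (\<lambda>n f. P (\<lambda>t. L t (f t)))"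
  have X0: "X 0 = (\<lambda>_. x0)" and XS: "\<And>n. X (Suc n) = P (\<lambda>t. L t (X n t))" by (simp_all add: X_def)
  have cX: "continuous_on UNIV (X n)" for n
  proof (induction n)
    case (Suc n)
    then show ?case unfolding XS using P(2)[OF cont[OF Suc]]
      by (metis continuous_at_imp_continuous_on has_vector_derivative_continuous)
  qed (simp add: X0)
  have dX: "(X (Suc n) has_vector_derivative L t (X n t)) (at t)" for n t
    unfolding XS by (intro P cont cX)
  have Xz: "X (Suc n) 0 = 0" for n unfolding XS by (intro P cont cX)
  have bd: "norm (X n t) \<le> norm x0 * (C * \<bar>t\<bar>) ^ n / fact n" for n t
  proof (induction n arbitrary: t)
    case (Suc n)
    have phi: "((\<lambda>s. norm x0 * (C * s) ^ Suc n / fact (Suc n)) has_vector_derivative C * (norm x0 * (C * s) ^ n / fact n)) (at s)" for s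
    proof -
      have "((\<lambda>s. (C * s) ^ Suc n) has_real_derivative real (Suc n) * (C * (C * s) ^ n)) (at s)"
        using DERIV_power[of "\<lambda>s. C * s" C s UNIV "Suc n"] by (auto intro!: derivative_eq_intros)
      from DERIV_cdivide[OF DERIV_cmult[OF this, of "norm x0"], of "fact (Suc n)"]
      have "((\<lambda>s. norm x0 * (C * s) ^ Suc n / fact (Suc n)) has_real_derivative C * (norm x0 * (C * s) ^ n / fact n)) (at s)"
        by (rule back_subst[of "\<lambda>d. (_ has_real_derivative d) (at s)"]) (simp add: field_simps del: power_Suc of_nat_Suc)
      then show ?thesis by (simp only: has_real_derivative_iff_has_vector_derivative)
    qed
    \<comment> \<open>Stated for an arbitrary curve \<open>Y\<close>, so that negative times follow
      by applying it to the reflected term of the series.\<close>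
    have *: "norm (Y a) \<le> norm x0 * (C * a) ^ Suc n / fact (Suc n)"
      if Y: "Y 0 = 0" "\<And>s. (Y has_vector_derivative d s) (at s)"
        and d: "\<And>s. s \<ge> 0 \<Longrightarrow> norm (d s) \<le> C * (norm x0 * (C * s) ^ n / fact n)" and a: "a \<ge> 0" for Y d a
    proof (cases "a = 0")
      case False
      then have "norm (Y a - Y 0) \<le> norm x0 * (C * a) ^ Suc n / fact (Suc n) - norm x0 * (C * 0) ^ Suc n / fact (Suc n)"
        using a by (intro differentiable_bound_general[where f' = d and \<phi>' = "\<lambda>s. C * (norm x0 * (C * s) ^ n / fact n)"])
          (use False a d Y(2) phi in \<open>auto intro!: continuous_intros continuous_at_imp_continuous_on
             has_vector_derivative_continuous[OF Y(2)] simp del: power_Suc fact_Suc of_nat_Suc\<close>)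
      then show ?thesis using Y(1) by simp
    qed (use Y in simp)
    show ?case
    proof (cases "t \<ge> 0")
      case True
      have "norm (X (Suc n) t) \<le> norm x0 * (C * t) ^ Suc n / fact (Suc n)"
      proof (rule *)
        show "norm (L s (X n s)) \<le> C * (norm x0 * (C * s) ^ n / fact n)" if "s \<ge> 0" for s
          using order_trans[OF bound mult_left_mono[OF Suc[of s] C], of s] that by simp
      qed (use True Xz dX in auto)
      then show ?thesis using True by simp
    next
      case False
      have "norm ((\<lambda>s. X (Suc n) (-s)) (-t)) \<le> norm x0 * (C * (-t)) ^ Suc n / fact (Suc n)"
      proof (rule *)
        show "((\<lambda>s. X (Suc n) (- s)) has_vector_derivative - L (-s) (X n (-s))) (at s)" for s
          by (intro vector_derivative_reflect dX)
        show "norm (- L (- s) (X n (- s))) \<le> C * (norm x0 * (C * s) ^ n / fact n)" if "s \<ge> 0" for s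
          using order_trans[OF bound mult_left_mono[OF Suc[of "-s"] C], of "-s"] that by simp
      qed (use False Xz in auto)
      then show ?thesis using False by simp
    qed
  qed (simp add: X0)
  define M where "M r n = norm x0 * (C * r) ^ n / fact n" for r :: real and n
  have sM: "summable (M r)" for r
    using summable_mult[OF summable_exp_generic[of "C * r"], of "norm x0"] by (simp add: M_def[abs_def] field_simps)
  have bd': "norm (X n t) \<le> M r n" if "\<bar>t\<bar> \<le> r" for n t r
  proof -
    have "(C * \<bar>t\<bar>) ^ n \<le> (C * r) ^ n" using that C by (intro power_mono mult_left_mono) auto
    then have "norm x0 * (C * \<bar>t\<bar>) ^ n / fact n \<le> M r n"
      unfolding M_def by (intro divide_right_mono mult_left_mono) auto
    then show ?thesis using bd order_trans by blast
  qed
  define x where "x t = (\<Sum>n. X n t)" for t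
  have sX: "summable (\<lambda>n. X n t)" for t
    by (rule summable_comparison_test[OF _ sM[of "\<bar>t\<bar>"]]) (use bd' in auto)
  have ul: "uniform_limit {-r..r} (\<lambda>n t. \<Sum>i<n. X i t) x sequentially" for r
    unfolding x_def by (rule Weierstrass_m_test[OF _ sM[of r]]) (use bd' in auto)
  have "(x has_vector_derivative L t (x t)) (at t)" for t
  proof -
    define r where "r = \<bar>t\<bar> + 1"
    have tr: "t \<in> {-r..r}" "t \<in> {-r<..<r}" by (auto simp: r_def)
    have "\<exists>g. \<forall>s\<in>{-r..r}. (\<lambda>n. X n s) sums g s \<and> (g has_derivative (\<lambda>h. h *\<^sub>R L s (x s))) (at s within {-r..r})"
    proof (rule has_derivative_series[where x = t and l = "x t"])
      show "(X n has_derivative (\<lambda>h. h *\<^sub>R (if n = 0 then 0 else L s (X (n - 1) s)))) (at s within {-r..r})" for n s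
        using dX[of "n - 1" s] X0
        by (cases n) (auto simp: has_vector_derivative_def intro: has_derivative_at_withinI)
      show "(\<lambda>n. X n t) sums x t" unfolding x_def using sX by (rule summable_sums)
      show "t \<in> {-r..r}" by fact
      fix e :: real assume e: "e > 0"
      have "\<forall>\<^sub>F n in sequentially. \<forall>s\<in>{-r..r}. dist (\<Sum>i<n. X i s) (x s) < e / (C + 1)"
        using uniform_limitD[OF ul] e C by auto
      then obtain N where N: "\<And>n s. n \<ge> N \<Longrightarrow> s \<in> {-r..r} \<Longrightarrow> norm ((\<Sum>i<n. X i s) - x s) < e / (C + 1)"
        unfolding eventually_sequentially dist_norm by blast
      show "\<forall>\<^sub>F n in sequentially. \<forall>s\<in>{- r..r}. \<forall>h. norm ((\<Sum>i<n. h *\<^sub>R (if i = 0 then 0 else L s (X (i - 1) s))) - h *\<^sub>R L s (x s)) \<le> e * norm h"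
      proof (rule eventually_sequentiallyI[of "Suc N"], intro ballI allI)
        fix n s h assume n: "Suc N \<le> n" and s: "s \<in> {-r..r}"
        then obtain m where m: "n = Suc m" "m \<ge> N" by (cases n) auto
        have "(\<Sum>i<n. h *\<^sub>R (if i = 0 then 0 else L s (X (i - 1) s))) = h *\<^sub>R L s (\<Sum>i<m. X i s)"
          unfolding m(1) by (subst sum.lessThan_Suc_shift) (simp add: scaleR_sum_right linear_sum[OF lin] o_def)
        then have "norm ((\<Sum>i<n. h *\<^sub>R (if i = 0 then 0 else L s (X (i - 1) s))) - h *\<^sub>R L s (x s))
            = \<bar>h\<bar> * norm (L s ((\<Sum>i<m. X i s) - x s))"
          by (simp add: linear_diff[OF lin] scaleR_diff_right[symmetric])
        also have "\<dots> \<le> \<bar>h\<bar> * (C * (e / (C + 1)))"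
          using N[OF m(2) s] C by (intro mult_left_mono order_trans[OF bound]) auto
        also have "\<dots> \<le> e * norm h"
          using C e mult_right_mono[of "C * (e / (C + 1))" e "\<bar>h\<bar>"] by (auto simp: field_simps)
        finally show "norm ((\<Sum>i<n. h *\<^sub>R (if i = 0 then 0 else L s (X (i - 1) s))) - h *\<^sub>R L s (x s)) \<le> e * norm h" .
      qed
    qed simp
    then obtain g where g: "\<And>s. s \<in> {-r..r} \<Longrightarrow> (\<lambda>n. X n s) sums g s"
      "\<And>s. s \<in> {-r..r} \<Longrightarrow> (g has_vector_derivative L s (x s)) (at s within {-r..r})"
      unfolding has_vector_derivative_def by blast
    have gx: "g s = x s" if "s \<in> {-r..r}" for s using g(1)[OF that] by (simp add: x_def sums_iff)
    have "(g has_vector_derivative L t (x t)) (at t)"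
      using g(2)[OF tr(1)] tr by (subst (asm) at_within_interior) (auto simp: interior_atLeastAtMost_real)
    then show ?thesis
      by (rule has_vector_derivative_transform_within_open[of _ _ _ "{-r<..<r}"]) (use tr gx in auto)
  qed
  moreover have "x 0 = x0"
  proof -
    have "(\<lambda>n. X n 0) = (\<lambda>n. if n = 0 then x0 else 0)"
      using X0 Xz by (auto simp: fun_eq_iff gr0_conv_Suc split: nat.splits)
    then show ?thesis unfolding x_def using suminf_finite[of "{0::nat}" "\<lambda>n. if n = 0 then x0 else 0"] by simp
  qed
  ultimately show ?thesis by blast
qed

section \<open>Locally square integrable functions\<close>

lemma lebesgue_on_measurable: "f \<in> borel_measurable lebesgue \<Longrightarrow> f \<in> borel_measurable (lebesgue_on S)"
  by (simp add: measurable_restrict_space1)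

lemma L2_loc_absolutely_integrable:
  fixes g :: "real \<Rightarrow> 'a::euclidean_space"
  assumes "L2_loc g"
  shows "g absolutely_integrable_on {a..b}"
proof (rule measurable_bounded_by_integrable_imp_absolutely_integrable)
  show "g \<in> borel_measurable (lebesgue_on {a..b})" using assms by (simp add: L2_loc_def lebesgue_on_measurable)
  show "(\<lambda>t. 1 + (norm (g t))\<^sup>2) integrable_on {a..b}"
    using assms by (intro integrable_add) (auto simp: L2_loc_def)
  show "norm (g t) \<le> 1 + (norm (g t))\<^sup>2" for t
  proof -
    have "0 \<le> (norm (g t) - 1)\<^sup>2" by simp
    then have "2 * norm (g t) \<le> (norm (g t))\<^sup>2 + 1" by (simp add: power2_diff)
    then show ?thesis using norm_ge_zero[of "g t"] by linarith
  qed
qed simp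

lemma L2_loc_integrable: "L2_loc g \<Longrightarrow> g integrable_on {a..b}"
  using L2_loc_absolutely_integrable absolutely_integrable_on_def by blast

lemma L2_loc_norm_integrable: "L2_loc g \<Longrightarrow> (\<lambda>t. norm (g t)) integrable_on {a..b}"
  using L2_loc_absolutely_integrable absolutely_integrable_on_def by blast

lemma L2_loc_continuous:
  fixes g :: "real \<Rightarrow> 'a::euclidean_space"
  assumes "continuous_on UNIV g"
  shows "L2_loc g"
  unfolding L2_loc_def
proof (intro conjI allI)
  show "g \<in> borel_measurable lebesgue"
    using borel_measurable_continuous_onI[OF assms] by (intro measurable_completion) simp
  show "(\<lambda>t. (norm (g t))\<^sup>2) integrable_on {a..b}" for a b
    by (intro integrable_continuous_real continuous_intros continuous_on_subset[OF assms]) auto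
qed

lemma L2_loc_bound:
  fixes f :: "real \<Rightarrow> 'a::euclidean_space"
  assumes m: "f \<in> borel_measurable lebesgue" and g: "\<And>a b. g integrable_on {a..b}"
    and le: "\<And>t. (norm (f t))\<^sup>2 \<le> g t"
  shows "L2_loc f"
  unfolding L2_loc_def
proof (intro conjI allI m)
  have "(\<lambda>t. (norm (f t))\<^sup>2) \<in> borel_measurable lebesgue" using m by measurable
  then show "(\<lambda>t. (norm (f t))\<^sup>2) integrable_on {a..b}" for a b
    by (intro measurable_bounded_by_integrable_imp_integrable[OF _ g] lebesgue_on_measurable) (auto intro: le)
qed

lemma L2_loc_add:
  fixes f g :: "real \<Rightarrow> 'a::euclidean_space"
  assumes "L2_loc f" "L2_loc g"
  shows "L2_loc (\<lambda>t. f t + g t)"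
proof (rule L2_loc_bound)
  show "(\<lambda>t. f t + g t) \<in> borel_measurable lebesgue" using assms by (auto simp: L2_loc_def)
  show "(\<lambda>t. 2 * (norm (f t))\<^sup>2 + 2 * (norm (g t))\<^sup>2) integrable_on {a..b}" for a b
    using assms by (intro integrable_add integrable_on_mult_right) (auto simp: L2_loc_def)
  show "(norm (f t + g t))\<^sup>2 \<le> 2 * (norm (f t))\<^sup>2 + 2 * (norm (g t))\<^sup>2" for t
  proof -
    have "(norm (f t + g t))\<^sup>2 \<le> (norm (f t) + norm (g t))\<^sup>2" by (intro power_mono norm_triangle_ineq) auto
    also have "\<dots> \<le> 2 * (norm (f t))\<^sup>2 + 2 * (norm (g t))\<^sup>2"
      using sum_squares_bound[of "norm (f t)" "norm (g t)"] by (simp add: power2_sum)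
    finally show ?thesis .
  qed
qed

lemma L2_loc_bilinear:
  fixes f :: "real \<Rightarrow> 'a::euclidean_space" and g :: "real \<Rightarrow> 'b::euclidean_space" and h :: "'a \<Rightarrow> 'b \<Rightarrow> 'c::euclidean_space"
  assumes h: "bounded_bilinear h" and f: "continuous_on UNIV f" "\<And>t. norm (f t) \<le> B" and g: "L2_loc g"
  shows "L2_loc (\<lambda>t. h (f t) (g t))"
proof -
  obtain K where K: "K > 0" "\<And>x y. norm (h x y) \<le> norm x * norm y * K"
    using bounded_bilinear.pos_bounded[OF h] by blast
  have mf: "f \<in> borel_measurable lebesgue" using L2_loc_continuous[OF f(1)] by (simp add: L2_loc_def)
  show ?thesis
  proof (rule L2_loc_bound)
    show "(\<lambda>t. h (f t) (g t)) \<in> borel_measurable lebesgue"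
      using borel_measurable_bilinear[of h f UNIV g] h mf g by (simp add: L2_loc_def bilinear_conv_bounded_bilinear lebesgue_on_UNIV_eq)
    show "(\<lambda>t. (B * K)\<^sup>2 * (norm (g t))\<^sup>2) integrable_on {a..b}" for a b
      using g by (intro integrable_on_mult_right) (auto simp: L2_loc_def)
    show "(norm (h (f t) (g t)))\<^sup>2 \<le> (B * K)\<^sup>2 * (norm (g t))\<^sup>2" for t
    proof -
      have "norm (h (f t) (g t)) \<le> B * norm (g t) * K"
        using K(2)[of "f t" "g t"] f(2)[of t] K(1) by (meson less_imp_le mult_right_mono norm_ge_zero order_trans)
      then have "(norm (h (f t) (g t)))\<^sup>2 \<le> (B * norm (g t) * K)\<^sup>2" by (intro power_mono) auto
      then show ?thesis by (simp add: power_mult_distrib mult_ac)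
    qed
  qed
qed

lemma L2_loc_linear:
  fixes g :: "real \<Rightarrow> 'b::euclidean_space" and h :: "'b \<Rightarrow> 'c::euclidean_space"
  assumes h: "bounded_linear h" and g: "L2_loc g"
  shows "L2_loc (\<lambda>t. h (g t))"
proof -
  have "bounded_bilinear (\<lambda>(r::real) x. r *\<^sub>R h x)"
    using bounded_bilinear.comp[OF bounded_bilinear_scaleR bounded_linear_ident h] by simp
  from L2_loc_bilinear[OF this, of "\<lambda>_. 1" 1 g] g show ?thesis by simp
qed

lemma L2_loc_mult_integrable:
  fixes f g :: "real \<Rightarrow> real"
  assumes "L2_loc f" "L2_loc g"
  shows "(\<lambda>t. f t * g t) integrable_on {a..b}"
proof (rule measurable_bounded_by_integrable_imp_integrable)
  show "(\<lambda>t. f t * g t) \<in> borel_measurable (lebesgue_on {a..b})"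
    using assms by (auto simp: L2_loc_def intro!: lebesgue_on_measurable)
  show "(\<lambda>t. (norm (f t))\<^sup>2 + (norm (g t))\<^sup>2) integrable_on {a..b}"
    using assms by (intro integrable_add) (auto simp: L2_loc_def)
  show "norm (f t * g t) \<le> (norm (f t))\<^sup>2 + (norm (g t))\<^sup>2" for t
  proof -
    have "0 \<le> \<bar>f t\<bar> * \<bar>g t\<bar>" by simp
    then show ?thesis using sum_squares_bound[of "\<bar>f t\<bar>" "\<bar>g t\<bar>"] unfolding real_norm_def abs_mult by linarith
  qed
qed simp

lemma zero_integrals_imp_zero_AE:
  fixes f :: "real \<Rightarrow> 'a::euclidean_space"
  assumes f: "\<And>a b. f integrable_on {a..b}"
    and z: "\<And>a b. l \<le> a \<Longrightarrow> a \<le> b \<Longrightarrow> b \<le> u \<Longrightarrow> integral {a..b} f = 0"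
  obtains N where "negligible N" "\<And>t. t \<in> {l..u} - N \<Longrightarrow> f t = 0"
proof -
  obtain N where N: "negligible N" "\<And>x e. \<lbrakk>x \<notin> N; 0 < e\<rbrakk> \<Longrightarrow> \<exists>d>0. \<forall>h. 0 < h \<and> h < d \<longrightarrow>
       norm(integral (cbox x (x + h *\<^sub>R One)) f /\<^sub>R h ^ DIM(real) - f x) < e"
    using integrable_ccontinuous_explicit[of f] f by (metis box_real(2))
  \<comment> \<open>Lebesgue's differentiation theorem is used with averages over
    \<open>{t..t + h}\<close>. These leave \<open>{l..u}\<close> when \<open>t = u\<close>, hence
    \<open>u\<close> joins the null set.\<close>
  show thesis
  proof (rule that[of "insert u N"])
    fix t assume t: "t \<in> {l..u} - insert u N"
    have "norm (f t) \<le> e" if "e > 0" for e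
    proof -
      have "t \<notin> N" using t by simp
      from N(2)[OF this that] have "\<exists>d>0. \<forall>h. 0 < h \<and> h < d \<longrightarrow> norm (integral {t..t + h} f /\<^sub>R h - f t) < e" by simp
      then obtain d where d: "d > 0" "\<forall>h. 0 < h \<and> h < d \<longrightarrow> norm (integral {t..t + h} f /\<^sub>R h - f t) < e" by blast
      define h where "h = min (d/2) (u - t)"
      have h: "0 < h" "h < d" "t + h \<le> u" using d t by (auto simp: h_def)
      have "integral {t..t + h} f = 0" using z[of t "t + h"] h t by simp
      then show ?thesis using d(2)[rule_format, of h] h by simp
    qed
    then show "f t = 0" using field_le_epsilon[of "norm (f t)" 0] by simp
  qed (use N in simp)
qed

text \<open>Let \<open>\<Phi>\<close> be the product minus the integral of its formal derivative. By
  uniform continuity of \<open>f\<close> and \<open>g\<close>, the increment of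
  \<open>\<Phi>\<close> over a short interval is at most \<open>e\<close> times the increment of
  \<open>H\<close>, the integral of the absolute values of \<open>f'\<close> and \<open>g'\<close>.
  Telescoping over a fine partition bounds the total increment by \<open>e * H b\<close> for every
  \<open>e\<close>.\<close>

lemma absolutely_continuous_product:
  fixes f g f' g' :: "real \<Rightarrow> real"
  assumes f': "L2_loc f'" and g': "L2_loc g'"
    and f: "\<And>s t. a \<le> s \<Longrightarrow> s \<le> t \<Longrightarrow> t \<le> b \<Longrightarrow> (f' has_integral f t - f s) {s..t}"
    and g: "\<And>s t. a \<le> s \<Longrightarrow> s \<le> t \<Longrightarrow> t \<le> b \<Longrightarrow> (g' has_integral g t - g s) {s..t}"
    and cf: "continuous_on UNIV f" and cg: "continuous_on UNIV g" and ab: "a \<le> b"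
  shows "((\<lambda>t. f' t * g t + f t * g' t) has_integral f b * g b - f a * g a) {a..b}"
proof -
  have i1: "(\<lambda>t. f' t * g t) integrable_on {s..t}" "(\<lambda>t. f t * g' t) integrable_on {s..t}" for s t
    using L2_loc_mult_integrable L2_loc_continuous f' g' cf cg by blast+
  define \<Phi> where "\<Phi> t = f t * g t - integral {a..t} (\<lambda>t. f' t * g t + f t * g' t)" for t
  define H where "H t = integral {a..t} (\<lambda>u. \<bar>f' u\<bar> + \<bar>g' u\<bar>)" for t
  have iH: "(\<lambda>u. \<bar>f' u\<bar> + \<bar>g' u\<bar>) integrable_on {s..t}" for s t
    using L2_loc_norm_integrable[OF f'] L2_loc_norm_integrable[OF g'] by (intro integrable_add) auto
  have est: "\<bar>\<Phi> t - \<Phi> s\<bar> \<le> e * (H t - H s)"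
    if st: "a \<le> s" "s \<le> t" "t \<le> b" and e: "\<And>u. u \<in> {s..t} \<Longrightarrow> \<bar>f u - f s\<bar> \<le> e" "\<And>u. u \<in> {s..t} \<Longrightarrow> \<bar>g t - g u\<bar> \<le> e" for s t e
  proof -
    have c1: "integral {a..t} F = integral {a..s} F + integral {s..t} F" if "\<And>u v. F integrable_on {u..v}" for F :: "real \<Rightarrow> real"
      using Henstock_Kurzweil_Integration.integral_combine[OF st(1,2) that] by simp
    \<comment> \<open>The increment of the product is split with \<open>g\<close> frozen at the
      right end and \<open>f\<close> at the left end, which makes the splitting exact.\<close>
    have "\<Phi> t - \<Phi> s = (f t - f s) * g t + f s * (g t - g s) - integral {s..t} (\<lambda>t. f' t * g t + f t * g' t)"
      unfolding \<Phi>_def by (subst c1) (auto intro!: integrable_add i1 simp: algebra_simps)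
    also have "(f t - f s) * g t = integral {s..t} (\<lambda>u. f' u * g t)"
      by (rule integral_unique[OF has_integral_mult_left[OF f[OF st]], symmetric])
    also have "f s * (g t - g s) = integral {s..t} (\<lambda>u. f s * g' u)"
      by (rule integral_unique[OF has_integral_mult_right[OF g[OF st]], symmetric])
    also have "integral {s..t} (\<lambda>u. f' u * g t) + integral {s..t} (\<lambda>u. f s * g' u) - integral {s..t} (\<lambda>t. f' t * g t + f t * g' t)
       = integral {s..t} (\<lambda>u. (f' u * g t + f s * g' u) - (f' u * g u + f u * g' u))"
      using L2_loc_integrable[OF f'] L2_loc_integrable[OF g'] i1
      by (subst Henstock_Kurzweil_Integration.integral_diff, auto intro!: integrable_add integrable_on_mult_left integrable_on_mult_right)
         (subst Henstock_Kurzweil_Integration.integral_add, auto intro!: integrable_add integrable_on_mult_left integrable_on_mult_right)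
    finally have eq: "\<Phi> t - \<Phi> s = integral {s..t} (\<lambda>u. (f' u * g t + f s * g' u) - (f' u * g u + f u * g' u))" .
    have "norm (integral {s..t} (\<lambda>u. (f' u * g t + f s * g' u) - (f' u * g u + f u * g' u))) \<le> integral {s..t} (\<lambda>u. e * (\<bar>f' u\<bar> + \<bar>g' u\<bar>))"
    proof (rule integral_norm_bound_integral)
      show "(\<lambda>u. (f' u * g t + f s * g' u) - (f' u * g u + f u * g' u)) integrable_on {s..t}"
        using L2_loc_integrable[OF f'] L2_loc_integrable[OF g'] i1
        by (intro integrable_diff integrable_add integrable_on_mult_left integrable_on_mult_right) auto
      show "(\<lambda>u. e * (\<bar>f' u\<bar> + \<bar>g' u\<bar>)) integrable_on {s..t}" using iH by (rule integrable_on_mult_right)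
      fix u assume u: "u \<in> {s..t}"
      have "(f' u * g t + f s * g' u) - (f' u * g u + f u * g' u) = f' u * (g t - g u) - (f u - f s) * g' u"
        by (simp add: algebra_simps)
      also have "norm \<dots> \<le> \<bar>f' u\<bar> * \<bar>g t - g u\<bar> + \<bar>f u - f s\<bar> * \<bar>g' u\<bar>"
        by (simp add: abs_mult[symmetric] abs_triangle_ineq4)
      also have "\<dots> \<le> \<bar>f' u\<bar> * e + e * \<bar>g' u\<bar>"
        by (intro add_mono mult_left_mono mult_right_mono e u) auto
      finally show "norm ((f' u * g t + f s * g' u) - (f' u * g u + f u * g' u)) \<le> e * (\<bar>f' u\<bar> + \<bar>g' u\<bar>)" by (simp add: algebra_simps)
    qed
    also have "\<dots> = e * (H t - H s)" unfolding H_def using c1[OF iH] by simp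
    finally show ?thesis using eq by simp
  qed
  have le_eps: "\<bar>\<Phi> b - \<Phi> a\<bar> \<le> e * H b" if e: "e > 0" for e
  proof -
    have uf: "uniformly_continuous_on {a..b} f" and ug: "uniformly_continuous_on {a..b} g"
      using cf cg by (auto intro!: compact_uniformly_continuous intro: continuous_on_subset)
    obtain d1 where d1: "d1 > 0" "\<And>x y. x \<in> {a..b} \<Longrightarrow> y \<in> {a..b} \<Longrightarrow> dist y x < d1 \<Longrightarrow> dist (f y) (f x) < e"
      by (rule uniformly_continuous_onE[OF uf e]) blast
    obtain d2 where d2: "d2 > 0" "\<And>x y. x \<in> {a..b} \<Longrightarrow> y \<in> {a..b} \<Longrightarrow> dist y x < d2 \<Longrightarrow> dist (g y) (g x) < e"
      by (rule uniformly_continuous_onE[OF ug e]) blast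
    note d = d1(1) d2(1) d1(2) d2(2)
    obtain n where n: "n > 0" "(b - a) / real n < min d1 d2"
    proof -
      obtain n where n: "b - a < real n * min d1 d2" using reals_Archimedean3[of "min d1 d2"] d(1,2) by auto
      then have "n > 0" using ab by (cases n) auto
      then show thesis using n by (intro that[of n]) (simp_all only: pos_divide_less_eq of_nat_0_less_iff mult.commute)
    qed
    define \<delta> where "\<delta> = (b - a) / real n"
    define \<tau> where "\<tau> i = a + real i * \<delta>" for i
    have \<tau>: "\<tau> 0 = a" "\<tau> n = b" using n by (auto simp: \<tau>_def \<delta>_def)
    have step: "\<bar>\<Phi> (\<tau> (Suc i)) - \<Phi> (\<tau> i)\<bar> \<le> e * (H (\<tau> (Suc i)) - H (\<tau> i))" if i: "i < n" for i
    proof (rule est)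
      have \<delta>: "0 \<le> \<delta>" using ab by (simp add: \<delta>_def)
      then show 1: "a \<le> \<tau> i" "\<tau> i \<le> \<tau> (Suc i)" unfolding \<tau>_def by (auto intro!: mult_right_mono)
      have "\<tau> (Suc i) \<le> \<tau> n" unfolding \<tau>_def using i \<delta> by (intro add_left_mono mult_right_mono) auto
      then show 2: "\<tau> (Suc i) \<le> b" using \<tau> by simp
      have 3: "\<tau> (Suc i) - \<tau> i < min d1 d2" using n(2) by (simp add: \<tau>_def \<delta>_def[symmetric] algebra_simps)
      fix u assume u: "u \<in> {\<tau> i..\<tau> (Suc i)}"
      show "\<bar>f u - f (\<tau> i)\<bar> \<le> e" using d(3)[of "\<tau> i" u] u 1 2 3 by (simp add: dist_real_def)
      show "\<bar>g (\<tau> (Suc i)) - g u\<bar> \<le> e" using d(4)[of u "\<tau> (Suc i)"] u 1 2 3 by (simp add: dist_real_def)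
    qed
    have "\<bar>\<Phi> b - \<Phi> a\<bar> = \<bar>\<Sum>i<n. \<Phi> (\<tau> (Suc i)) - \<Phi> (\<tau> i)\<bar>"
      using sum_lessThan_telescope[of "\<lambda>i. \<Phi> (\<tau> i)" n] \<tau> by simp
    also have "\<dots> \<le> (\<Sum>i<n. e * (H (\<tau> (Suc i)) - H (\<tau> i)))"
      by (rule order_trans[OF sum_abs sum_mono]) (use step in auto)
    also have "\<dots> = e * H b"
      using sum_lessThan_telescope[of "\<lambda>i. H (\<tau> i)" n] \<tau> by (simp add: H_def sum_distrib_left[symmetric])
    finally show ?thesis .
  qed
  have *: "\<bar>\<Phi> b - \<Phi> a\<bar> \<le> e * \<bar>H b\<bar>" if "e > 0" for e
    using order_trans[OF le_eps[OF that] mult_left_mono[of "H b" "\<bar>H b\<bar>" e]] that by simp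
  have "\<bar>\<Phi> b - \<Phi> a\<bar> \<le> 0 + e" if "e > 0" for e
  proof -
    have "\<bar>\<Phi> b - \<Phi> a\<bar> \<le> e / (\<bar>H b\<bar> + 1) * \<bar>H b\<bar>" by (intro * divide_pos_pos that) simp
    also have "\<dots> \<le> e" using that by (simp add: field_simps)
    finally show ?thesis by simp
  qed
  then have "\<Phi> b = \<Phi> a" using field_le_epsilon[of "\<bar>\<Phi> b - \<Phi> a\<bar>" 0] by auto
  then have "integral {a..b} (\<lambda>t. f' t * g t + f t * g' t) = f b * g b - f a * g a" by (simp add: \<Phi>_def)
  moreover have "(\<lambda>t. f' t * g t + f t * g' t) integrable_on {a..b}" by (intro integrable_add i1)
  ultimately show ?thesis by (simp add: has_integral_integrable_integral)
qed

section \<open>Periodic approximation\<close>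

text \<open>Truncation at height \<open>B\<close> and then pointwise approximation by continuous
  functions are both justified by dominated convergence. The zero end values make the result a
  continuous function on the circle.\<close>

lemma L2_approx_continuous:
  fixes f :: "real \<Rightarrow> real"
  assumes f: "L2_loc f" and ab: "a < b" and e: "e > 0"
  obtains g where "continuous_on UNIV g" "g a = 0" "g b = 0" "integral {a..b} (\<lambda>t. (f t - g t)\<^sup>2) < e"
proof -
  have m: "f \<in> borel_measurable lebesgue" and f2: "(\<lambda>t. (f t)\<^sup>2) integrable_on {a..b}"
    using f by (auto simp: L2_loc_def)
  define cl where "cl B x = max (-B) (min B x)" for B x :: real
  have cl: "\<bar>cl B x\<bar> \<le> B" "\<bar>x - cl B x\<bar> \<le> \<bar>x\<bar>" if "B \<ge> 0" for B x using that by (auto simp: cl_def max_def min_def)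
  have mcl: "(\<lambda>t. cl B (g t)) \<in> borel_measurable lebesgue" if "g \<in> borel_measurable lebesgue" for B g
    unfolding cl_def using that by measurable
  have i1: "(\<lambda>t. (f t - cl B (f t))\<^sup>2) integrable_on {a..b}" if "B \<ge> 0" for B
  proof (rule measurable_bounded_by_integrable_imp_integrable[OF _ f2])
    show "(\<lambda>t. (f t - cl B (f t))\<^sup>2) \<in> borel_measurable (lebesgue_on {a..b})"
      by (rule lebesgue_on_measurable) (use m mcl[OF m] in measurable)
    show "norm ((f t - cl B (f t))\<^sup>2) \<le> (f t)\<^sup>2" for t using cl(2)[OF that, of "f t"] by (simp add: abs_le_square_iff)
  qed simp
  have "(\<lambda>n::nat. integral {a..b} (\<lambda>t. (f t - cl (real n) (f t))\<^sup>2)) \<longlonglongrightarrow> integral {a..b} (\<lambda>t. 0)"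
  proof (rule dominated_convergence[OF _ f2])
    show "(\<lambda>t. (f t - cl (real k) (f t))\<^sup>2) integrable_on {a..b}" for k by (rule i1) simp
    show "norm ((f t - cl (real k) (f t))\<^sup>2) \<le> (f t)\<^sup>2" for t k using cl(2)[of "real k" "f t"] by (simp add: abs_le_square_iff)
    fix t
    obtain n where "\<bar>f t\<bar> \<le> real n" using real_arch_simple by blast
    then have "\<forall>\<^sub>F k in sequentially. (f t - cl (real k) (f t))\<^sup>2 = 0"
      by (intro eventually_sequentiallyI[of n]) (auto simp: cl_def max_def min_def)
    then show "(\<lambda>k. (f t - cl (real k) (f t))\<^sup>2) \<longlonglongrightarrow> 0" by (rule tendsto_eventually)
  qed
  then have "\<forall>\<^sub>F n::nat in sequentially. integral {a..b} (\<lambda>t. (f t - cl (real n) (f t))\<^sup>2) < e / 4"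
    using e by (intro order_tendstoD(2)[of _ 0]) auto
  then obtain n0 :: nat where n0: "integral {a..b} (\<lambda>t. (f t - cl (real n0) (f t))\<^sup>2) < e / 4"
    by (auto simp: eventually_sequentially)
  define B where "B = real n0"
  have B: "B \<ge> 0" by (simp add: B_def)
  have "f measurable_on UNIV" using lebesgue_measurable_imp_measurable_on[of f UNIV] m by simp
  then obtain N G where N: "negligible N" and G: "\<And>n. continuous_on UNIV (G n)"
    "\<And>t. t \<notin> N \<Longrightarrow> (\<lambda>n. G n t) \<longlonglongrightarrow> f t"
    unfolding measurable_on_def by auto
  \<comment> \<open>The two factors with \<open>min\<close> cut the function off at \<open>a\<close>
    and \<open>b\<close>; away from these points they tend to 1.\<close>
  define h where "h n t = cl B (G n t) * (min 1 (real n * \<bar>t - a\<bar>) * min 1 (real n * \<bar>t - b\<bar>))" for n t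
  have ch: "continuous_on UNIV (h n)" for n unfolding h_def cl_def by (intro continuous_intros G)
  have hB: "\<bar>h n t\<bar> \<le> B" for n t
  proof -
    have "\<bar>min 1 (real n * \<bar>t - a\<bar>) * min 1 (real n * \<bar>t - b\<bar>)\<bar> \<le> 1"
      by (auto simp: abs_mult intro!: mult_le_one)
    from mult_mono[OF cl(1)[OF B, of "G n t"] this] B show ?thesis by (simp add: h_def abs_mult)
  qed
  have lim: "(\<lambda>n. h n t) \<longlonglongrightarrow> cl B (f t)" if t: "t \<notin> insert a (insert b N)" for t
  proof -
    have *: "(\<lambda>n. min 1 (real n * c)) \<longlonglongrightarrow> 1" if "c > 0" for c
    proof -
      obtain n where n: "1 < real n * c" using reals_Archimedean3[OF \<open>c > 0\<close>] by blast
      then have "\<forall>\<^sub>F k in sequentially. min 1 (real k * c) = 1"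
        using \<open>c > 0\<close> by (intro eventually_sequentiallyI[of n]) (smt (verit) mult_right_mono of_nat_mono)
      then show ?thesis by (rule tendsto_eventually)
    qed
    have "(\<lambda>n. h n t) \<longlonglongrightarrow> cl B (f t) * (1 * 1)"
      unfolding h_def cl_def using t by (intro tendsto_intros * G) auto
    then show ?thesis by simp
  qed
  have i2: "(\<lambda>t. (cl B (f t) - h n t)\<^sup>2) integrable_on {a..b}" for n
  proof (rule measurable_bounded_by_integrable_imp_integrable[where g = "\<lambda>_. (2 * B)\<^sup>2"])
    have "h n \<in> borel_measurable lebesgue" using L2_loc_continuous[OF ch] by (simp add: L2_loc_def)
    then show "(\<lambda>t. (cl B (f t) - h n t)\<^sup>2) \<in> borel_measurable (lebesgue_on {a..b})"
      by (intro lebesgue_on_measurable) (use m mcl[OF m] in measurable)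
    show "norm ((cl B (f t) - h n t)\<^sup>2) \<le> (2 * B)\<^sup>2" for t
    proof -
      have "\<bar>cl B (f t) - h n t\<bar> \<le> \<bar>2 * B\<bar>" using hB[of n t] cl(1)[OF B, of "f t"] by linarith
      then show ?thesis by (simp only: abs_le_square_iff real_norm_def abs_power2)
    qed
  qed (auto simp: integrable_const_ivl)
  define F where "F n t = (if t \<in> insert a (insert b N) then 0 else (cl B (f t) - h n t)\<^sup>2)" for n t
  have Nn: "negligible (insert a (insert b N))" using N by simp
  have "(\<lambda>n. integral {a..b} (F n)) \<longlonglongrightarrow> integral {a..b} (\<lambda>_. 0)"
  proof (rule dominated_convergence[where h = "\<lambda>_. (2 * B)\<^sup>2"])
    show "F k integrable_on {a..b}" for k
      by (rule integrable_spike[OF i2[of k] Nn]) (auto simp: F_def)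
    show "norm (F k t) \<le> (2 * B)\<^sup>2" for k t
    proof -
      have "\<bar>cl B (f t) - h k t\<bar> \<le> \<bar>2 * B\<bar>" using hB[of k t] cl(1)[OF B, of "f t"] by linarith
      then have "(cl B (f t) - h k t)\<^sup>2 \<le> (2 * B)\<^sup>2" by (simp only: abs_le_square_iff)
      then show ?thesis by (simp add: F_def)
    qed
    show "(\<lambda>k. F k t) \<longlonglongrightarrow> 0" for t
    proof (cases "t \<in> insert a (insert b N)")
      case False
      have "(\<lambda>k. (cl B (f t) - h k t)\<^sup>2) \<longlonglongrightarrow> (cl B (f t) - cl B (f t))\<^sup>2"
        by (intro tendsto_intros lim False)
      then show ?thesis using False by (simp add: F_def)
    qed (auto simp: F_def)
  qed (simp add: integrable_const_ivl)
  moreover have "integral {a..b} (F n) = integral {a..b} (\<lambda>t. (cl B (f t) - h n t)\<^sup>2)" for n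
    by (rule integral_spike[OF Nn]) (auto simp: F_def)
  ultimately have "(\<lambda>n. integral {a..b} (\<lambda>t. (cl B (f t) - h n t)\<^sup>2)) \<longlonglongrightarrow> 0" by simp
  then have "\<forall>\<^sub>F n in sequentially. integral {a..b} (\<lambda>t. (cl B (f t) - h n t)\<^sup>2) < e / 4"
    using e by (intro order_tendstoD(2)[of _ 0]) auto
  then obtain n where n: "integral {a..b} (\<lambda>t. (cl B (f t) - h n t)\<^sup>2) < e / 4"
    by (auto simp: eventually_sequentially)
  show thesis
  proof (rule that[OF ch])
    show "h n a = 0" "h n b = 0" by (auto simp: h_def)
    have i3: "(\<lambda>t. 2 * (f t - cl B (f t))\<^sup>2 + 2 * (cl B (f t) - h n t)\<^sup>2) integrable_on {a..b}"
      using i1[OF B] i2 by (intro integrable_add integrable_on_mult_right)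
    have le: "(f t - h n t)\<^sup>2 \<le> 2 * (f t - cl B (f t))\<^sup>2 + 2 * (cl B (f t) - h n t)\<^sup>2" for t
      using sum_squares_bound[of "f t - cl B (f t)" "cl B (f t) - h n t"]
        power2_sum[of "f t - cl B (f t)" "cl B (f t) - h n t"] by simp
    have "L2_loc (\<lambda>t. f t + - h n t)"
      by (rule L2_loc_add[OF f L2_loc_continuous[OF continuous_on_minus[OF ch]]])
    then have "(\<lambda>t. (f t - h n t)\<^sup>2) integrable_on {a..b}" by (simp add: L2_loc_def)
    then have "integral {a..b} (\<lambda>t. (f t - h n t)\<^sup>2) \<le> integral {a..b} (\<lambda>t. 2 * (f t - cl B (f t))\<^sup>2 + 2 * (cl B (f t) - h n t)\<^sup>2)"
      using i3 le by (intro integral_le) auto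
    also have "\<dots> = 2 * integral {a..b} (\<lambda>t. (f t - cl B (f t))\<^sup>2) + 2 * integral {a..b} (\<lambda>t. (cl B (f t) - h n t)\<^sup>2)"
      using i1[OF B] i2 by (subst Henstock_Kurzweil_Integration.integral_add) (auto intro!: integrable_on_mult_right)
    also have "\<dots> < e" using n n0 by (simp add: B_def)
    finally show "integral {a..b} (\<lambda>t. (f t - h n t)\<^sup>2) < e" .
  qed
qed

text \<open>Two derivatives with matching end values are what two integrations by parts use to get
  Fourier coefficients of order 1/n^2, a rate that has to beat \<open>decay\<close>.\<close>

definition C2_periodic :: "real \<Rightarrow> (real \<Rightarrow> real) \<Rightarrow> bool" where
  "C2_periodic T w \<longleftrightarrow> (\<exists>w1 w2. (\<forall>t. (w has_real_derivative w1 t) (at t)) \<and>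
     (\<forall>t. (w1 has_real_derivative w2 t) (at t)) \<and> continuous_on UNIV w2 \<and>
     (\<forall>t. w (t + T) = w t) \<and> (\<forall>t. w1 (t + T) = w1 t))"

lemma C2_periodicI:
  assumes "\<And>t. (w has_real_derivative dw t) (at t)" "\<And>t. (dw has_real_derivative ddw t) (at t)"
    "continuous_on UNIV ddw" "\<And>t. w (t + T) = w t" "\<And>t. dw (t + T) = dw t"
  shows "C2_periodic T w"
  using assms unfolding C2_periodic_def by blast

lemma continuous_on_DERIV_UNIV: "(\<And>t. (w has_real_derivative w1 t) (at t)) \<Longrightarrow> continuous_on UNIV w"
  by (intro continuous_at_imp_continuous_on ballI DERIV_isCont)

lemma C2_periodic_continuous: "C2_periodic T w \<Longrightarrow> continuous_on UNIV w"
  unfolding C2_periodic_def by (auto intro: continuous_on_DERIV_UNIV)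

lemma C2_periodic_const: "C2_periodic T (\<lambda>_. c)"
  by (rule C2_periodicI[where dw = "\<lambda>_. 0" and ddw = "\<lambda>_. 0"]) auto

lemma C2_periodic_add:
  assumes "C2_periodic T v" "C2_periodic T w"
  shows "C2_periodic T (\<lambda>t. v t + w t)"
proof -
  obtain v1 v2 where v: "\<And>t. (v has_real_derivative v1 t) (at t)" "\<And>t. (v1 has_real_derivative v2 t) (at t)"
    "continuous_on UNIV v2" "\<And>t. v (t + T) = v t" "\<And>t. v1 (t + T) = v1 t"
    using assms(1) unfolding C2_periodic_def by auto
  obtain w1 w2 where w: "\<And>t. (w has_real_derivative w1 t) (at t)" "\<And>t. (w1 has_real_derivative w2 t) (at t)"
    "continuous_on UNIV w2" "\<And>t. w (t + T) = w t" "\<And>t. w1 (t + T) = w1 t"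
    using assms(2) unfolding C2_periodic_def by auto
  show ?thesis
    by (rule C2_periodicI[where dw = "\<lambda>t. v1 t + w1 t" and ddw = "\<lambda>t. v2 t + w2 t"])
      (auto intro!: DERIV_add continuous_intros v(1-3) w(1-3) simp: v(4,5) w(4,5))
qed

lemma C2_periodic_mult:
  assumes "C2_periodic T v" "C2_periodic T w"
  shows "C2_periodic T (\<lambda>t. v t * w t)"
proof -
  obtain v1 v2 where v: "\<And>t. (v has_real_derivative v1 t) (at t)" "\<And>t. (v1 has_real_derivative v2 t) (at t)"
    "continuous_on UNIV v2" "\<And>t. v (t + T) = v t" "\<And>t. v1 (t + T) = v1 t"
    using assms(1) unfolding C2_periodic_def by auto
  obtain w1 w2 where w: "\<And>t. (w has_real_derivative w1 t) (at t)" "\<And>t. (w1 has_real_derivative w2 t) (at t)"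
    "continuous_on UNIV w2" "\<And>t. w (t + T) = w t" "\<And>t. w1 (t + T) = w1 t"
    using assms(2) unfolding C2_periodic_def by auto
  show ?thesis
  proof (rule C2_periodicI[where dw = "\<lambda>t. v1 t * w t + w1 t * v t" and ddw = "\<lambda>t. (v2 t * w t + w1 t * v1 t) + (w2 t * v t + v1 t * w1 t)"])
    show "continuous_on UNIV (\<lambda>t. (v2 t * w t + w1 t * v1 t) + (w2 t * v t + v1 t * w1 t))"
      using continuous_on_DERIV_UNIV[OF v(1)] continuous_on_DERIV_UNIV[OF v(2)]
        continuous_on_DERIV_UNIV[OF w(1)] continuous_on_DERIV_UNIV[OF w(2)] v(3) w(3)
      by (intro continuous_intros)
    show "((\<lambda>t. v1 t * w t + w1 t * v t) has_real_derivative
        (v2 t * w t + w1 t * v1 t) + (w2 t * v t + v1 t * w1 t)) (at t)" for t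
      by (rule DERIV_add[OF DERIV_mult[OF v(2) w(1)] DERIV_mult[OF w(2) v(1)]])
  qed (auto intro!: DERIV_mult v(1-2) w(1-2) simp: v(4,5) w(4,5))
qed

lemma C2_periodic_sum:
  "finite I \<Longrightarrow> (\<And>i. i \<in> I \<Longrightarrow> C2_periodic T (w i)) \<Longrightarrow> C2_periodic T (\<lambda>t. \<Sum>i\<in>I. w i t)"
  by (induction I rule: finite_induct) (auto intro: C2_periodic_add C2_periodic_const)

lemma C2_periodic_cos_sin:
  assumes "T > 0"
  shows "C2_periodic T (\<lambda>t. cos (2 * pi / T * t))" "C2_periodic T (\<lambda>t. sin (2 * pi / T * t))"
proof -
  define w where "w = 2 * pi / T"
  have per: "cos (w * (t + T)) = cos (w * t)" "sin (w * (t + T)) = sin (w * t)" for t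
    using assms by (simp_all add: w_def ring_distribs)
  show "C2_periodic T (\<lambda>t. cos (2 * pi / T * t))" unfolding w_def[symmetric]
    by (rule C2_periodicI[where dw = "\<lambda>t. - w * sin (w * t)" and ddw = "\<lambda>t. - w * (w * cos (w * t))"])
      (auto intro!: derivative_eq_intros continuous_intros simp: per)
  show "C2_periodic T (\<lambda>t. sin (2 * pi / T * t))" unfolding w_def[symmetric]
    by (rule C2_periodicI[where dw = "\<lambda>t. w * cos (w * t)" and ddw = "\<lambda>t. w * (- w * sin (w * t))"])
      (auto intro!: derivative_eq_intros continuous_intros simp: per)
qed

lemma C2_periodic_polynomial:
  assumes "T > 0" "real_polynomial_function (P :: complex \<Rightarrow> real)"
  shows "C2_periodic T (\<lambda>t. P (cis (2 * pi / T * t)))"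
  using assms(2)
proof (induction rule: real_polynomial_function.induct)
  case (linear f)
  have "f (cis (2 * pi / T * t)) = cos (2 * pi / T * t) * f 1 + sin (2 * pi / T * t) * f \<i>" for t
  proof -
    have "cis (2 * pi / T * t) = cos (2 * pi / T * t) *\<^sub>R 1 + sin (2 * pi / T * t) *\<^sub>R \<i>"
      by (simp add: complex_eq_iff)
    then show ?thesis using linear by (simp only: bounded_linear.linear linear_add linear_scale real_scaleR_def)
  qed
  then show ?case
    by (simp only:) (intro C2_periodic_add C2_periodic_mult C2_periodic_const C2_periodic_cos_sin assms)
qed (intro C2_periodic_add C2_periodic_mult C2_periodic_const; assumption)+

text \<open>On the circle Stone-Weierstrass applies, and its polynomials pull back to trigonometric
  polynomials in \<open>t\<close>. Continuity at the point 1, where \<open>Arg2pi\<close> jumps, is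
  obtained by turning the constant homotopy of a loop into one of circle maps.\<close>

lemma C2_periodic_uniform_approx:
  fixes g :: "real \<Rightarrow> real"
  assumes T: "T > 0" and g: "continuous_on {0..T} g" "g 0 = g T" and e: "e > 0"
  obtains w where "C2_periodic T w" "\<And>t. t \<in> {0..T} \<Longrightarrow> \<bar>g t - w t\<bar> < e"
proof -
  define p where "p s = g (T * s)" for s
  have "path p" unfolding path_def p_def
    by (rule continuous_on_compose2[OF g(1)]) (use T in \<open>auto intro!: continuous_intros simp: mult_left_le\<close>)
  then have "homotopic_loops UNIV p p"
    using g(2) T by (simp add: homotopic_loops_refl pathfinish_def pathstart_def p_def)
  from homotopic_with_imp_continuous[OF homotopic_loops_imp_homotopic_circlemaps[OF this]]
  have cont: "continuous_on (sphere 0 1) (p \<circ> (\<lambda>z. Arg2pi z / (2 * pi)))" by simp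
  obtain P where P: "real_polynomial_function P"
    "\<And>z. z \<in> sphere 0 1 \<Longrightarrow> \<bar>(p \<circ> (\<lambda>z. Arg2pi z / (2 * pi))) z - P z\<bar> < e"
    using Stone_Weierstrass_real_polynomial_function[OF compact_sphere cont e] by blast
  show thesis
  proof (rule that[OF C2_periodic_polynomial[OF T P(1)]])
    fix t assume t: "t \<in> {0..T}"
    \<comment> \<open>\<open>Arg2pi\<close> takes values in [0, 2 pi), so the end
      \<open>t = T\<close> is represented by 0.\<close>
    define u where "u = (if t = T then 0 else t)"
    have u: "0 \<le> u" "u < T" "g u = g t" using t g(2) T by (auto simp: u_def)
    have "cis (2 * pi / T * t) = cis (2 * pi / T * u)" using T by (simp add: u_def)
    moreover have "Arg2pi (cis (2 * pi / T * u)) = 2 * pi / T * u"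
      by (rule Arg2pi_unique[of 1]) (use u T in \<open>auto simp: cis_conv_exp field_simps\<close>)
    ultimately have "(p \<circ> (\<lambda>z. Arg2pi z / (2 * pi))) (cis (2 * pi / T * t)) = g t"
      using T u by (simp add: p_def)
    then show "\<bar>g t - P (cis (2 * pi / T * t))\<bar> < e" using P(2)[of "cis (2 * pi / T * t)"] by simp
  qed
qed

lemma C2_periodic_L2_approx:
  fixes f :: "real \<Rightarrow> real"
  assumes f: "L2_loc f" and T: "T > 0" and e: "e > 0"
  obtains w where "C2_periodic T w" "integral {0..T} (\<lambda>t. (f t - w t)\<^sup>2) < e"
proof -
  obtain g where g: "continuous_on UNIV g" "g 0 = 0" "g T = 0" "integral {0..T} (\<lambda>t. (f t - g t)\<^sup>2) < e / 4"
    using L2_approx_continuous[OF f T, of "e/4"] e by auto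
  define \<delta> where "\<delta> = sqrt (e / (4 * T))"
  have \<delta>: "\<delta> > 0" "\<delta>\<^sup>2 * T = e / 4" using e T by (auto simp: \<delta>_def)
  obtain w where w: "C2_periodic T w" "\<And>t. t \<in> {0..T} \<Longrightarrow> \<bar>g t - w t\<bar> < \<delta>"
    using C2_periodic_uniform_approx[of T g \<delta>] T g \<delta>(1) continuous_on_subset[OF g(1)] by auto
  show thesis
  proof (rule that[OF w(1)])
    note cw = C2_periodic_continuous[OF w(1)]
    have i1: "(\<lambda>t. (f t - g t)\<^sup>2) integrable_on {0..T}" "(\<lambda>t. (f t - w t)\<^sup>2) integrable_on {0..T}"
      using L2_loc_add[OF f L2_loc_continuous[OF continuous_on_minus[OF g(1)]]]
        L2_loc_add[OF f L2_loc_continuous[OF continuous_on_minus[OF cw]]] by (auto simp: L2_loc_def)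
    have "integral {0..T} (\<lambda>t. (f t - w t)\<^sup>2) \<le> integral {0..T} (\<lambda>t. 2 * (f t - g t)\<^sup>2 + 2 * \<delta>\<^sup>2)"
    proof (rule integral_le)
      fix t assume "t \<in> {0..T}"
      then have "\<bar>g t - w t\<bar> \<le> \<bar>\<delta>\<bar>" using w(2)[of t] by simp
      then have "(g t - w t)\<^sup>2 \<le> \<delta>\<^sup>2" by (simp only: abs_le_square_iff)
      then show "(f t - w t)\<^sup>2 \<le> 2 * (f t - g t)\<^sup>2 + 2 * \<delta>\<^sup>2"
        using sum_squares_bound[of "f t - g t" "g t - w t"] power2_sum[of "f t - g t" "g t - w t"] by simp
    qed (use i1 in \<open>auto intro!: integrable_add integrable_on_mult_right\<close>)
    also have "\<dots> = 2 * integral {0..T} (\<lambda>t. (f t - g t)\<^sup>2) + 2 * (\<delta>\<^sup>2 * T)"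
      using i1 T by (subst Henstock_Kurzweil_Integration.integral_add) (auto intro!: integrable_on_mult_right)
    also have "\<dots> < e" using g(4) \<delta>(2) by simp
    finally show "integral {0..T} (\<lambda>t. (f t - w t)\<^sup>2) < e" .
  qed
qed

section \<open>The monodromy of a real potential\<close>

lemma integral_of_derivative:
  fixes f :: "real \<Rightarrow> 'a::banach"
  assumes "\<And>t. (f has_vector_derivative f' t) (at t)" "a \<le> b"
  shows "(f' has_integral f b - f a) {a..b}"
  by (rule fundamental_theorem_of_calculus[OF assms(2)]) (rule has_vector_derivative_at_within[OF assms(1)])

text \<open>One row \<open>(a, b)\<close> of the frame for a real potential. In
  \<open>F' = F \<alpha>\<close> both rows solve this same system and differ only in their initial
  values.\<close>

definition zs_solution :: "(real \<Rightarrow> real) \<Rightarrow> complex \<Rightarrow> (real \<Rightarrow> complex) \<Rightarrow> (real \<Rightarrow> complex) \<Rightarrow> bool" where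
  "zs_solution q z a b \<longleftrightarrow> (\<forall>t.
     (a has_vector_derivative (\<i> * z / 2 * a t - of_real (q t) / 2 * b t)) (at t) \<and>
     (b has_vector_derivative (of_real (q t) / 2 * a t - \<i> * z / 2 * b t)) (at t))"

lemma zs_solution_exists:
  assumes q: "continuous_on UNIV q" "\<And>t. \<bar>q t\<bar> \<le> Q"
  shows "\<exists>a b. zs_solution q z a b \<and> a 0 = a0 \<and> b 0 = b0"
proof -
  define L where "L t p = (\<i> * z / 2 * fst p - of_real (q t) / 2 * snd p, of_real (q t) / 2 * fst p - \<i> * z / 2 * snd p)"
    for t and p :: "complex \<times> complex"
  have "\<exists>x. x 0 = (a0, b0) \<and> (\<forall>t. (x has_vector_derivative L t (x t)) (at t))"
  proof (rule linear_ode_exists[where C = "2 * (cmod z + \<bar>Q\<bar>)"])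
    show "linear (L t)" for t unfolding L_def by (rule linearI) (simp_all add: algebra_simps scaleR_conv_of_real add_divide_distrib diff_divide_distrib)
    show "norm (L t p) \<le> 2 * (cmod z + \<bar>Q\<bar>) * norm p" for t p
    proof -
      have n: "cmod (fst p) \<le> norm p" "cmod (snd p) \<le> norm p" by (metis norm_fst_le prod.collapse, metis norm_snd_le prod.collapse)
      have z: "cmod (\<i> * z / 2 * x) \<le> cmod z * norm p" if "cmod x \<le> norm p" for x
      proof -
        have "cmod z * cmod x \<le> cmod z * norm p" by (rule mult_left_mono[OF that]) simp
        moreover have "0 \<le> cmod z * cmod x" by simp
        moreover have "cmod (\<i> * z / 2 * x) = cmod z * cmod x / 2" by (simp add: norm_mult norm_divide)
        ultimately show ?thesis by linarith
      qed
      have qq: "cmod (of_real (q t) / 2 * x) \<le> \<bar>Q\<bar> * norm p" if "cmod x \<le> norm p" for x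
      proof -
        have "\<bar>q t\<bar> * cmod x \<le> \<bar>Q\<bar> * norm p" using q(2)[of t] that by (intro mult_mono) auto
        moreover have "0 \<le> \<bar>q t\<bar> * cmod x" by simp
        moreover have "cmod (of_real (q t) / 2 * x) = \<bar>q t\<bar> * cmod x / 2" by (simp add: norm_mult norm_divide)
        ultimately show ?thesis by linarith
      qed
      have "norm (L t p) \<le> cmod (fst (L t p)) + cmod (snd (L t p))" by (metis norm_Pair_le prod.collapse)
      also have "cmod (fst (L t p)) \<le> cmod z * norm p + \<bar>Q\<bar> * norm p"
        unfolding L_def fst_conv by (rule order_trans[OF norm_triangle_ineq4 add_mono[OF z[OF n(1)] qq[OF n(2)]]])
      also have "cmod (snd (L t p)) \<le> \<bar>Q\<bar> * norm p + cmod z * norm p"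
        unfolding L_def snd_conv by (rule order_trans[OF norm_triangle_ineq4 add_mono[OF qq[OF n(1)] z[OF n(2)]]])
      finally show ?thesis by (simp add: algebra_simps)
    qed
    show "continuous_on UNIV (\<lambda>t. L t (y t))" if "continuous_on UNIV y" for y
      unfolding L_def by (intro continuous_intros that q(1)) auto
  qed simp
  then obtain x where x: "x 0 = (a0, b0)" "\<And>t. (x has_vector_derivative L t (x t)) (at t)" by blast
  have "zs_solution q z (\<lambda>t. fst (x t)) (\<lambda>t. snd (x t))"
    unfolding zs_solution_def
  proof (intro allI conjI)
    fix t
    show "((\<lambda>t. fst (x t)) has_vector_derivative \<i> * z / 2 * fst (x t) - of_real (q t) / 2 * snd (x t)) (at t)"
      using bounded_linear.has_vector_derivative[OF bounded_linear_fst x(2)[of t]] by (simp add: L_def)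
    show "((\<lambda>t. snd (x t)) has_vector_derivative of_real (q t) / 2 * fst (x t) - \<i> * z / 2 * snd (x t)) (at t)"
      using bounded_linear.has_vector_derivative[OF bounded_linear_snd x(2)[of t]] by (simp add: L_def)
  qed
  then show ?thesis using x(1) by (intro exI[of _ "\<lambda>t. fst (x t)"] exI[of _ "\<lambda>t. snd (x t)"]) simp
qed

lemma zs_solution_continuous:
  assumes "zs_solution q z a b"
  shows "continuous_on S a" "continuous_on S b"
  using assms unfolding zs_solution_def
  by (auto intro!: continuous_at_imp_continuous_on has_vector_derivative_continuous)

text \<open>As the potential is real, conjugating a row and exchanging its components, with a sign,
  leads from \<open>z\<close> to \<open>cnj z\<close>. This will produce the second row of the frame
  from the first.\<close>

lemma zs_solution_cnj:
  assumes "zs_solution q z a b"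
  shows "zs_solution q (cnj z) (\<lambda>t. - cnj (b t)) (\<lambda>t. cnj (a t))"
  unfolding zs_solution_def
proof (intro allI conjI)
  fix t
  have a: "(a has_vector_derivative (\<i> * z / 2 * a t - of_real (q t) / 2 * b t)) (at t)"
    and b: "(b has_vector_derivative (of_real (q t) / 2 * a t - \<i> * z / 2 * b t)) (at t)"
    using assms by (auto simp: zs_solution_def)
  show "((\<lambda>t. - cnj (b t)) has_vector_derivative \<i> * cnj z / 2 * - cnj (b t) - of_real (q t) / 2 * cnj (a t)) (at t)"
    by (rule back_subst[of "\<lambda>d. (_ has_vector_derivative d) (at t)", OF has_vector_derivative_minus[OF has_vector_derivative_cnj[OF b]]])
      (simp add: field_simps)
  show "((\<lambda>t. cnj (a t)) has_vector_derivative of_real (q t) / 2 * - cnj (b t) - \<i> * cnj z / 2 * cnj (a t)) (at t)"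
    by (rule back_subst[of "\<lambda>d. (_ has_vector_derivative d) (at t)", OF has_vector_derivative_cnj[OF a]])
      (simp add: field_simps)
qed

lemma has_real_derivative_cmod_power2:
  assumes "(f has_vector_derivative D) (at t)"
  shows "((\<lambda>t. (cmod (f t))\<^sup>2) has_real_derivative 2 * Re (cnj (f t) * D)) (at t)"
proof -
  have r: "((\<lambda>t. Re (f t)) has_real_derivative Re D) (at t)" "((\<lambda>t. Im (f t)) has_real_derivative Im D) (at t)"
    using assms by (auto simp: has_vector_derivative_complex_iff)
  show ?thesis unfolding cmod_power2
    using DERIV_add[OF DERIV_power[OF r(1), of 2] DERIV_power[OF r(2), of 2]] by (simp add: algebra_simps)
qed

text \<open>The coefficient matrix is skew-Hermitian at real \<open>z\<close>, so only the imaginary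
  part of \<open>z\<close> can change the length of a row: rows remain unit vectors at real
  \<open>z\<close> and otherwise grow at a rate governed by \<open>Im z\<close>.\<close>

lemma zs_energy_derivative:
  assumes "zs_solution q z a b"
  shows "((\<lambda>t. (cmod (a t))\<^sup>2 + (cmod (b t))\<^sup>2) has_real_derivative Im z * ((cmod (b t))\<^sup>2 - (cmod (a t))\<^sup>2)) (at t)"
proof -
  have a: "(a has_vector_derivative (\<i> * z / 2 * a t - of_real (q t) / 2 * b t)) (at t)"
    and b: "(b has_vector_derivative (of_real (q t) / 2 * a t - \<i> * z / 2 * b t)) (at t)"
    using assms by (auto simp: zs_solution_def)
  from DERIV_add[OF has_real_derivative_cmod_power2[OF a] has_real_derivative_cmod_power2[OF b]]
  show ?thesis
    by (rule back_subst[of "\<lambda>d. (_ has_real_derivative d) (at t)"])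
      (simp only: cmod_power2, simp add: power2_eq_square algebra_simps add_divide_distrib diff_divide_distrib)
qed

lemma zs_energy:
  assumes s: "zs_solution q z a b" and t: "t \<ge> 0"
  shows "(cmod (a t))\<^sup>2 + (cmod (b t))\<^sup>2 \<le> ((cmod (a 0))\<^sup>2 + (cmod (b 0))\<^sup>2) * exp (\<bar>Im z\<bar> * t)"
proof -
  define E where "E t = (cmod (a t))\<^sup>2 + (cmod (b t))\<^sup>2" for t
  define G where "G t = E t * exp (- \<bar>Im z\<bar> * t)" for t
  have dE: "(E has_real_derivative Im z * ((cmod (b t))\<^sup>2 - (cmod (a t))\<^sup>2)) (at t)" for t
    using zs_energy_derivative[OF s] unfolding E_def by blast
  have dG: "(G has_real_derivative (Im z * ((cmod (b t))\<^sup>2 - (cmod (a t))\<^sup>2) - \<bar>Im z\<bar> * E t) * exp (- \<bar>Im z\<bar> * t)) (at t)" for t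
    unfolding G_def by (auto intro!: derivative_eq_intros dE simp: algebra_simps)
  have "G t \<le> G 0"
  proof (rule DERIV_nonpos_imp_nonincreasing[OF t])
    fix s :: real
    have "Im z * ((cmod (b s))\<^sup>2 - (cmod (a s))\<^sup>2) \<le> \<bar>Im z\<bar> * \<bar>(cmod (b s))\<^sup>2 - (cmod (a s))\<^sup>2\<bar>"
      by (metis abs_ge_self abs_mult)
    also have "\<bar>(cmod (b s))\<^sup>2 - (cmod (a s))\<^sup>2\<bar> \<le> E s"
      unfolding E_def using zero_le_power2[of "cmod (a s)"] zero_le_power2[of "cmod (b s)"] by linarith
    then have "\<bar>Im z\<bar> * \<bar>(cmod (b s))\<^sup>2 - (cmod (a s))\<^sup>2\<bar> \<le> \<bar>Im z\<bar> * E s" by (rule mult_left_mono) simp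
    finally show "\<exists>y. (G has_real_derivative y) (at s) \<and> y \<le> 0"
      using dG by (intro exI[of _ "(Im z * ((cmod (b s))\<^sup>2 - (cmod (a s))\<^sup>2) - \<bar>Im z\<bar> * E s) * exp (- \<bar>Im z\<bar> * s)"])
        (auto simp: mult_nonpos_nonneg)
  qed
  then show ?thesis by (simp add: G_def E_def exp_minus field_simps)
qed

lemma zs_energy_real:
  assumes s: "zs_solution q z a b" and z: "Im z = 0"
  shows "(cmod (a t))\<^sup>2 + (cmod (b t))\<^sup>2 = (cmod (a 0))\<^sup>2 + (cmod (b 0))\<^sup>2"
  using DERIV_isconst_all[of "\<lambda>t. (cmod (a t))\<^sup>2 + (cmod (b t))\<^sup>2" t 0] zs_energy_derivative[OF s] z by auto

text \<open>Variation of constants, with the same exponential weight for the forcing as for the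
  solution. An inhomogeneity of size \<open>G\<close> thus costs an error linear in \<open>t\<close>
  and no further exponential.\<close>

lemma duhamel_bound:
  fixes u :: "real \<Rightarrow> complex"
  assumes u: "\<And>s. (u has_vector_derivative k * u s + g s) (at s)" and k: "\<bar>Re k\<bar> \<le> Y"
    and g: "\<And>s. 0 \<le> s \<Longrightarrow> s \<le> t \<Longrightarrow> cmod (g s) \<le> G * exp (Y * s)" and t: "t \<ge> 0"
  shows "cmod (u t) \<le> (cmod (u 0) + G * t) * exp (Y * t)"
proof -
  define \<phi> where "\<phi> s = exp (k * of_real (t - s)) * u s" for s
  have "((\<lambda>s. exp (k * of_real (t - s))) has_vector_derivative - k * exp (k * of_real (t - s))) (at s)" for s
  proof -
    have "((\<lambda>w. exp (k * (of_real t - w))) has_field_derivative - k * exp (k * (of_real t - of_real s))) (at (of_real s))"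
      by (auto intro!: derivative_eq_intros)
    from has_vector_derivative_real_field[OF this] show ?thesis by simp
  qed
  then have d\<phi>: "(\<phi> has_vector_derivative exp (k * of_real (t - s)) * g s) (at s)" for s
    unfolding \<phi>_def by (auto intro!: derivative_eq_intros u simp: algebra_simps)
  have ex: "cmod (exp (k * of_real (t - s))) \<le> exp (Y * (t - s))" if "s \<le> t" for s
    using mult_right_mono[of "Re k" Y "t - s"] k that by simp
  have "cmod (\<phi> t - \<phi> 0) \<le> G * exp (Y * t) * t"
  proof (cases "t = 0")
    case False
    have "norm (\<phi> t - \<phi> 0) \<le> G * exp (Y * t) * t - G * exp (Y * t) * 0"
    proof (rule differentiable_bound_general[where f' = "\<lambda>s. exp (k * of_real (t - s)) * g s" and \<phi>' = "\<lambda>_. G * exp (Y * t)"])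
      show "0 < t" using False t by simp
      show "continuous_on {0..t} \<phi>"
        by (intro continuous_at_imp_continuous_on ballI has_vector_derivative_continuous[OF d\<phi>])
      show "((\<lambda>s. G * exp (Y * t) * s) has_vector_derivative G * exp (Y * t)) (at s)" for s
        unfolding has_real_derivative_iff_has_vector_derivative[symmetric] by (auto intro!: derivative_eq_intros)
      show "norm (exp (k * of_real (t - s)) * g s) \<le> G * exp (Y * t)" if "0 < s" "s < t" for s
      proof -
        have "norm (exp (k * of_real (t - s)) * g s) \<le> exp (Y * (t - s)) * (G * exp (Y * s))"
          unfolding norm_mult by (intro mult_mono ex g) (use that in auto)
        also have "\<dots> = G * exp (Y * t)" by (simp add: exp_add[symmetric] algebra_simps)
        finally show ?thesis .
      qed
      show "(\<phi> has_vector_derivative exp (k * of_real (t - s)) * g s) (at s)" for s by (rule d\<phi>)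
    qed (auto intro!: continuous_intros)
    then show ?thesis by simp
  qed simp
  moreover have "\<phi> t = u t" by (simp add: \<phi>_def)
  moreover have "cmod (\<phi> 0) \<le> exp (Y * t) * cmod (u 0)"
    using ex[of 0] t by (simp only: \<phi>_def norm_mult) (intro mult_right_mono, auto)
  ultimately have "cmod (u t) \<le> G * exp (Y * t) * t + exp (Y * t) * cmod (u 0)"
    using norm_triangle_sub[of "\<phi> t" "\<phi> 0"] by simp
  then show ?thesis by (simp add: algebra_simps)
qed

section \<open>The entries of the frame as entire functions of the spectral parameter\<close>

locale zs_potential =
  fixes q :: "real \<Rightarrow> real" and Q :: real
  assumes q_cont: "continuous_on UNIV q" and q_bound: "\<And>t. \<bar>q t\<bar> \<le> Q"
begin

definition row :: "complex \<Rightarrow> (real \<Rightarrow> complex) \<times> (real \<Rightarrow> complex)" where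
  "row z = (SOME p. zs_solution q z (fst p) (snd p) \<and> fst p 0 = 1 \<and> snd p 0 = 0)"

definition A :: "complex \<Rightarrow> real \<Rightarrow> complex" where "A z = fst (row z)"
definition B :: "complex \<Rightarrow> real \<Rightarrow> complex" where "B z = snd (row z)"
text \<open>The second row is built from the first by the conjugation symmetry instead of being
  chosen again, so that the SU(2) relation between the rows holds by definition.\<close>

definition C :: "complex \<Rightarrow> real \<Rightarrow> complex" where "C z t = - cnj (B (cnj z) t)"
definition D :: "complex \<Rightarrow> real \<Rightarrow> complex" where "D z t = cnj (A (cnj z) t)"

lemma AB: "zs_solution q z (A z) (B z)" and AB0: "A z 0 = 1" "B z 0 = 0"
proof -
  have "\<exists>p. zs_solution q z (fst p) (snd p) \<and> fst p 0 = 1 \<and> snd p 0 = 0"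
    using zs_solution_exists[OF q_cont q_bound, of z 1 0] by auto
  from someI_ex[OF this] show "zs_solution q z (A z) (B z)" "A z 0 = 1" "B z 0 = 0"
    unfolding A_def B_def row_def by auto
qed

lemma CD: "zs_solution q z (C z) (D z)" and CD0: "C z 0 = 0" "D z 0 = 1"
  using zs_solution_cnj[OF AB[of "cnj z"]] AB0[of "cnj z"] by (simp_all add: C_def[abs_def] D_def[abs_def])

lemma derivs:
  "(A z has_vector_derivative (\<i> * z / 2 * A z t - of_real (q t) / 2 * B z t)) (at t)"
  "(B z has_vector_derivative (of_real (q t) / 2 * A z t - \<i> * z / 2 * B z t)) (at t)"
  "(C z has_vector_derivative (\<i> * z / 2 * C z t - of_real (q t) / 2 * D z t)) (at t)"
  "(D z has_vector_derivative (of_real (q t) / 2 * C z t - \<i> * z / 2 * D z t)) (at t)"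
  using AB CD unfolding zs_solution_def by auto

lemma conts: "continuous_on S (A z)" "continuous_on S (B z)" "continuous_on S (C z)" "continuous_on S (D z)"
  using zs_solution_continuous[OF AB] zs_solution_continuous[OF CD] by auto

lemma bounds:
  assumes "t \<ge> 0"
  shows "cmod (A z t) \<le> exp (\<bar>Im z\<bar> / 2 * t)" "cmod (B z t) \<le> exp (\<bar>Im z\<bar> / 2 * t)"
    "cmod (C z t) \<le> exp (\<bar>Im z\<bar> / 2 * t)" "cmod (D z t) \<le> exp (\<bar>Im z\<bar> / 2 * t)"
proof -
  have sq: "exp (\<bar>Im z\<bar> * t) = (exp (\<bar>Im z\<bar> / 2 * t))\<^sup>2" for z
    by (simp add: power2_eq_square exp_add[symmetric])
  have le: "cmod (A z t) \<le> exp (\<bar>Im z\<bar> / 2 * t) \<and> cmod (B z t) \<le> exp (\<bar>Im z\<bar> / 2 * t)" for z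
  proof -
    have "(cmod (A z t))\<^sup>2 + (cmod (B z t))\<^sup>2 \<le> (exp (\<bar>Im z\<bar> / 2 * t))\<^sup>2"
      using zs_energy[OF AB[of z] assms] by (simp add: AB0 sq)
    then have "(cmod (A z t))\<^sup>2 \<le> (exp (\<bar>Im z\<bar> / 2 * t))\<^sup>2" "(cmod (B z t))\<^sup>2 \<le> (exp (\<bar>Im z\<bar> / 2 * t))\<^sup>2"
      using zero_le_power2[of "cmod (A z t)"] zero_le_power2[of "cmod (B z t)"] by linarith+
    then show ?thesis using power2_le_imp_le exp_ge_zero by blast
  qed
  show "cmod (A z t) \<le> exp (\<bar>Im z\<bar> / 2 * t)" "cmod (B z t) \<le> exp (\<bar>Im z\<bar> / 2 * t)"
    "cmod (C z t) \<le> exp (\<bar>Im z\<bar> / 2 * t)" "cmod (D z t) \<le> exp (\<bar>Im z\<bar> / 2 * t)"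
    using le[of z] le[of "cnj z"] by (simp_all add: C_def D_def)
qed

lemma zero_derivative_const:
  assumes "\<And>t. (f has_vector_derivative (0::complex)) (at t)"
  shows "f t = f 0"
  using has_vector_derivative_zero_constant[of UNIV f] assms by (metis UNIV_I convex_UNIV)

lemma det: "A z t * D z t - B z t * C z t = 1"
proof -
  have "((\<lambda>t. A z t * D z t - B z t * C z t) has_vector_derivative 0) (at t)" for t
    by (auto intro!: derivative_eq_intros derivs simp: algebra_simps)
  from zero_derivative_const[OF this, of t] show ?thesis by (simp add: AB0 CD0)
qed

text \<open>In the proof the first row of \<open>F z * inverse (F w)\<close> is obtained by
  integrating its derivative, which carries the factor \<open>z - w\<close>; multiplying back by
  \<open>F w\<close> gives the differences. They have Caratheodory's form, a function continuous at
  \<open>w\<close> times \<open>z - w\<close>, and \<open>holomorphic\<close> reads complex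
  differentiability off them.\<close>

lemma duhamel:
  assumes "T \<ge> 0"
  shows "A z T - A w T = (\<i> / 2 * (integral {0..T} (\<lambda>t. A z t * D w t + B z t * C w t) * A w T
           - integral {0..T} (\<lambda>t. A z t * B w t + B z t * A w t) * C w T)) * (z - w)" (is ?A)
    and "B z T - B w T = (\<i> / 2 * (integral {0..T} (\<lambda>t. A z t * D w t + B z t * C w t) * B w T
           - integral {0..T} (\<lambda>t. A z t * B w t + B z t * A w t) * D w T)) * (z - w)" (is ?B)
proof -
  have "((\<lambda>t. A z t * D w t - B z t * C w t) has_vector_derivative \<i> / 2 * (z - w) * (A z t * D w t + B z t * C w t)) (at t)" for t
    by (auto intro!: derivative_eq_intros derivs simp: field_simps)
  then have "((\<lambda>t. \<i> / 2 * (z - w) * (A z t * D w t + B z t * C w t)) has_integral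
     (A z T * D w T - B z T * C w T) - (A z 0 * D w 0 - B z 0 * C w 0)) {0..T}"
    by (rule integral_of_derivative[OF _ assms])
  note P0 = integral_unique[OF this]
  have e0: "A z 0 * D w 0 - B z 0 * C w 0 = 1" by (simp add: AB0 CD0)
  have P: "A z T * D w T - B z T * C w T - 1 = \<i> / 2 * (z - w) * integral {0..T} (\<lambda>t. A z t * D w t + B z t * C w t)"
    using P0 unfolding integral_mult_right e0 by (rule sym)
  have "((\<lambda>t. B z t * A w t - A z t * B w t) has_vector_derivative - \<i> / 2 * (z - w) * (A z t * B w t + B z t * A w t)) (at t)" for t
    by (auto intro!: derivative_eq_intros derivs simp: field_simps)
  then have "((\<lambda>t. - \<i> / 2 * (z - w) * (A z t * B w t + B z t * A w t)) has_integral
     (B z T * A w T - A z T * B w T) - (B z 0 * A w 0 - A z 0 * B w 0)) {0..T}"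
    by (rule integral_of_derivative[OF _ assms])
  note R0 = integral_unique[OF this]
  have e1: "B z 0 * A w 0 - A z 0 * B w 0 = 0" by (simp add: AB0 CD0)
  have R: "B z T * A w T - A z T * B w T = - \<i> / 2 * (z - w) * integral {0..T} (\<lambda>t. A z t * B w t + B z t * A w t)"
    using R0 unfolding integral_mult_right e1 diff_0_right by (rule sym)
  have "A z T = (A z T * D w T - B z T * C w T) * A w T + (B z T * A w T - A z T * B w T) * C w T"
    using det[of w T] by algebra
  then have "A z T - A w T = (A z T * D w T - B z T * C w T - 1) * A w T + (B z T * A w T - A z T * B w T) * C w T"
    by (simp add: algebra_simps)
  then show ?A unfolding P R by (simp add: algebra_simps)
  have "B z T = (A z T * D w T - B z T * C w T) * B w T + (B z T * A w T - A z T * B w T) * D w T"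
    using det[of w T] by algebra
  then have "B z T - B w T = (A z T * D w T - B z T * C w T - 1) * B w T + (B z T * A w T - A z T * B w T) * D w T"
    by (simp add: algebra_simps)
  then show ?B unfolding P R by (simp add: algebra_simps)
qed

lemma lipschitz:
  assumes "cmod (z - w) \<le> 1" "0 \<le> t" "t \<le> T" and K: "K = exp ((cmod w + 1) / 2 * T)"
  shows "cmod (A z t - A w t) \<le> 2 * K^3 * T * cmod (z - w)" "cmod (B z t - B w t) \<le> 2 * K^3 * T * cmod (z - w)"
proof -
  have K1: "K \<ge> 0" using K by simp
  have bK: "exp (\<bar>Im v\<bar> / 2 * s) \<le> K" if "cmod v \<le> cmod w + 1" "0 \<le> s" "s \<le> T" for v s
  proof -
    have "\<bar>Im v\<bar> \<le> cmod w + 1" using abs_Im_le_cmod[of v] that by linarith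
    then have "\<bar>Im v\<bar> / 2 * s \<le> (cmod w + 1) / 2 * T" using that by (intro mult_mono) auto
    then show ?thesis using K by simp
  qed
  have zw: "cmod z \<le> cmod w + 1" using assms(1) norm_triangle_sub[of z w] by linarith
  have b: "cmod (A z s) \<le> K" "cmod (B z s) \<le> K" "cmod (A w s) \<le> K" "cmod (B w s) \<le> K" "cmod (C w s) \<le> K" "cmod (D w s) \<le> K"
    if "0 \<le> s" "s \<le> T" for s
    using bounds[OF that(1), of z] bounds[OF that(1), of w] bK[OF zw that] bK[of w s] that by (auto intro: order_trans)
  have pr: "cmod (x * y + x' * y') \<le> 2 * K^2" if "cmod x \<le> K" "cmod y \<le> K" "cmod x' \<le> K" "cmod y' \<le> K" for x y x' y'
  proof -
    have "cmod (x * y) \<le> K * K" "cmod (x' * y') \<le> K * K" unfolding norm_mult using that K1 by (auto intro!: mult_mono)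
    then show ?thesis using norm_triangle_ineq[of "x * y" "x' * y'"] by (simp add: power2_eq_square)
  qed
  have T0: "0 \<le> T" using assms by simp
  have int: "cmod (integral {0..t} f) \<le> 2 * K^2 * T" if "continuous_on {0..t} f" "\<And>s. 0 \<le> s \<Longrightarrow> s \<le> t \<Longrightarrow> cmod (f s) \<le> 2 * K^2" for f
  proof -
    have "cmod (integral {0..t} f) \<le> 2 * K^2 * (t - 0)"
      using assms(2) that by (intro integral_bound) auto
    also have "\<dots> \<le> 2 * K^2 * T" using assms by (intro mult_left_mono) auto
    finally show ?thesis .
  qed
  have I: "cmod (integral {0..t} (\<lambda>t. A z t * D w t + B z t * C w t)) \<le> 2 * K^2 * T"
     "cmod (integral {0..t} (\<lambda>t. A z t * B w t + B z t * A w t)) \<le> 2 * K^2 * T"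
    by (intro int continuous_intros conts pr b; use assms in simp)+
  have tT: "0 \<le> t" "t \<le> T" using assms by auto
  have fin: "cmod ((\<i> / 2 * (i1 * x - i2 * y)) * (z - w)) \<le> 2 * K^3 * T * cmod (z - w)"
    if "cmod i1 \<le> 2 * K^2 * T" "cmod i2 \<le> 2 * K^2 * T" "cmod x \<le> K" "cmod y \<le> K" for i1 i2 x y
  proof -
    have "cmod (i1 * x) \<le> 2 * K^2 * T * K" "cmod (i2 * y) \<le> 2 * K^2 * T * K"
      unfolding norm_mult using that K1 T0 by (auto intro!: mult_mono)
    then have "cmod (i1 * x - i2 * y) \<le> 4 * K^3 * T"
      using norm_triangle_ineq4[of "i1 * x" "i2 * y"] by (simp add: power2_eq_square power3_eq_cube mult_ac)
    then have "cmod (\<i> / 2 * (i1 * x - i2 * y)) \<le> 2 * K^3 * T" by (simp add: norm_mult norm_divide)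
    then show ?thesis unfolding norm_mult[of _ "z - w"] by (rule mult_right_mono) simp
  qed
  show "cmod (A z t - A w t) \<le> 2 * K^3 * T * cmod (z - w)" "cmod (B z t - B w t) \<le> 2 * K^3 * T * cmod (z - w)"
    unfolding duhamel[OF tT(1), of z w] by (rule fin[OF I b(3)[OF tT] b(5)[OF tT]], rule fin[OF I b(4)[OF tT] b(6)[OF tT]])
qed

lemma tendsto_integral_AB:
  assumes T: "T \<ge> 0" and fg: "continuous_on {0..T} f" "continuous_on {0..T} g"
  shows "((\<lambda>z. integral {0..T} (\<lambda>t. A z t * f t + B z t * g t)) \<longlongrightarrow> integral {0..T} (\<lambda>t. A w t * f t + B w t * g t)) (at w)"
proof -
  define K where "K = exp ((cmod w + 1) / 2 * T)"
  obtain F where F: "\<And>t. t \<in> {0..T} \<Longrightarrow> cmod (f t) \<le> F" "\<And>t. t \<in> {0..T} \<Longrightarrow> cmod (g t) \<le> F" "F \<ge> 0"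
  proof -
    obtain F1 where F1: "\<And>t. t \<in> {0..T} \<Longrightarrow> cmod (f t) \<le> F1" using continuous_on_compact_bound[OF _ fg(1)] by auto
    obtain F2 where F2: "\<And>t. t \<in> {0..T} \<Longrightarrow> cmod (g t) \<le> F2" using continuous_on_compact_bound[OF _ fg(2)] by auto
    show thesis by (rule that[of "\<bar>F1\<bar> + \<bar>F2\<bar>"]) (use F1 F2 in \<open>force+\<close>)
  qed
  define c where "c = 2 * (2 * K^3 * T * F) * T"
  have "\<forall>\<^sub>F z in at w. norm (integral {0..T} (\<lambda>t. A z t * f t + B z t * g t) - integral {0..T} (\<lambda>t. A w t * f t + B w t * g t)) \<le> c * cmod (z - w)"
    unfolding eventually_at
  proof (intro exI[of _ 1] conjI ballI impI)
    fix z assume z: "z \<noteq> w \<and> dist z w < 1"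
    then have zw: "cmod (z - w) \<le> 1" by (simp add: dist_norm)
    have "integral {0..T} (\<lambda>t. A z t * f t + B z t * g t) - integral {0..T} (\<lambda>t. A w t * f t + B w t * g t)
       = integral {0..T} (\<lambda>t. (A z t * f t + B z t * g t) - (A w t * f t + B w t * g t))"
      by (intro Henstock_Kurzweil_Integration.integral_diff[symmetric] integrable_continuous_real continuous_intros conts fg)
    also have "cmod \<dots> \<le> (2 * (2 * K^3 * T * cmod (z - w) * F)) * (T - 0)"
    proof (rule integral_bound[OF T])
      show "continuous_on {0..T} (\<lambda>t. (A z t * f t + B z t * g t) - (A w t * f t + B w t * g t))"
        by (intro continuous_intros conts fg)
      fix t assume t: "t \<in> {0..T}"
      have "(A z t * f t + B z t * g t) - (A w t * f t + B w t * g t) = (A z t - A w t) * f t + (B z t - B w t) * g t"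
        by (simp add: algebra_simps)
      also have "cmod \<dots> \<le> cmod (A z t - A w t) * cmod (f t) + cmod (B z t - B w t) * cmod (g t)"
        by (metis norm_mult norm_triangle_ineq)
      also have "\<dots> \<le> (2 * K^3 * T * cmod (z - w)) * F + (2 * K^3 * T * cmod (z - w)) * F"
        using lipschitz[OF zw _ _ K_def, of t] t F T by (intro add_mono mult_mono) (auto simp: K_def)
      finally show "cmod ((A z t * f t + B z t * g t) - (A w t * f t + B w t * g t)) \<le> 2 * (2 * K^3 * T * cmod (z - w) * F)"
        by (simp add: mult_ac)
    qed
    finally show "norm (integral {0..T} (\<lambda>t. A z t * f t + B z t * g t) - integral {0..T} (\<lambda>t. A w t * f t + B w t * g t)) \<le> c * cmod (z - w)"
      by (simp add: c_def mult_ac)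
  qed simp
  moreover have "((\<lambda>z. c * cmod (z - w)) \<longlongrightarrow> 0) (at w)"
    by (auto intro!: tendsto_eq_intros)
  ultimately have "((\<lambda>z. integral {0..T} (\<lambda>t. A z t * f t + B z t * g t) - integral {0..T} (\<lambda>t. A w t * f t + B w t * g t)) \<longlongrightarrow> 0) (at w)"
    by (rule Lim_null_comparison)
  then show ?thesis by (simp add: LIM_zero_iff)
qed

lemma holomorphic:
  assumes T: "T \<ge> 0"
  shows "(\<lambda>z. A z T) holomorphic_on S" "(\<lambda>z. B z T) holomorphic_on S"
proof -
  have dA: "(\<lambda>z. A z T) field_differentiable (at w)" for w
    unfolding field_differentiable_def
    by (rule exI, subst CARAT_DERIV, intro exI conjI allI, rule duhamel(1)[OF T])
      (unfold isCont_def, intro tendsto_intros tendsto_integral_AB T conts, rule refl)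
  have dB: "(\<lambda>z. B z T) field_differentiable (at w)" for w
    unfolding field_differentiable_def
    by (rule exI, subst CARAT_DERIV, intro exI conjI allI, rule duhamel(2)[OF T])
      (unfold isCont_def, intro tendsto_intros tendsto_integral_AB T conts, rule refl)
  show "(\<lambda>z. A z T) holomorphic_on S" "(\<lambda>z. B z T) holomorphic_on S"
    unfolding holomorphic_on_def using dA dB field_differentiable_at_within by blast+
qed

end

section \<open>Uniqueness for the integral equation, reflection symmetry and large spectral
  parameter\<close>

context zs_potential begin

text \<open>\<open>monodromy\<close> is defined through an integral equation, so a solution is a
  priori only continuous; it must be identified with the differentiable row.\<close>

lemma row_unique:
  assumes s: "zs_solution q z a' b'"
    and ca: "continuous_on {0..T} a" and cb: "continuous_on {0..T} b"
    and ia: "\<And>t. t \<in> {0..T} \<Longrightarrow> ((\<lambda>s. \<i> * z / 2 * a s - of_real (q s) / 2 * b s) has_integral a t - a' 0) {0..t}"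
    and ib: "\<And>t. t \<in> {0..T} \<Longrightarrow> ((\<lambda>s. of_real (q s) / 2 * a s - \<i> * z / 2 * b s) has_integral b t - b' 0) {0..t}"
    and t: "t \<in> {0..T}"
  shows "a t = a' t \<and> b t = b' t"
proof -
  define u where "u t = cmod (a t - a' t) + cmod (b t - b' t)" for t
  define c where "c = cmod z + \<bar>Q\<bar>"
  have cs: "continuous_on S a'" "continuous_on S b'" for S using zs_solution_continuous[OF s] .
  have da: "(a' has_vector_derivative (\<i> * z / 2 * a' t - of_real (q t) / 2 * b' t)) (at t)"
    and db: "(b' has_vector_derivative (of_real (q t) / 2 * a' t - \<i> * z / 2 * b' t)) (at t)" for t
    using s by (auto simp: zs_solution_def)
  have cu: "continuous_on {0..T} u" unfolding u_def by (intro continuous_intros ca cb cs)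
  have bnd: "cmod (\<i> * z / 2 * x - of_real (q s) / 2 * y) \<le> c / 2 * (cmod x + cmod y)"
            "cmod (of_real (q s) / 2 * y - \<i> * z / 2 * x) \<le> c / 2 * (cmod x + cmod y)" for x y s
  proof -
    have "cmod (\<i> * z / 2 * x) = cmod z / 2 * cmod x" "cmod (of_real (q s) / 2 * y) = \<bar>q s\<bar> / 2 * cmod y"
      by (simp_all add: norm_mult norm_divide)
    moreover have "cmod z / 2 * cmod x \<le> c / 2 * cmod x" by (intro mult_right_mono) (auto simp: c_def)
    moreover
    have "\<bar>q s\<bar> \<le> c" unfolding c_def using q_bound[of s] norm_ge_zero[of z] by linarith
    then have "\<bar>q s\<bar> / 2 * cmod y \<le> c / 2 * cmod y" by (intro mult_right_mono) auto
    ultimately show "cmod (\<i> * z / 2 * x - of_real (q s) / 2 * y) \<le> c / 2 * (cmod x + cmod y)"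
      "cmod (of_real (q s) / 2 * y - \<i> * z / 2 * x) \<le> c / 2 * (cmod x + cmod y)"
      using norm_triangle_ineq4[of "\<i> * z / 2 * x" "of_real (q s) / 2 * y"]
        norm_triangle_ineq4[of "of_real (q s) / 2 * y" "\<i> * z / 2 * x"] unfolding distrib_left by linarith+
  qed
  have "u t \<le> 0 * exp (integral {0..t} (\<lambda>_. c))"
  proof (rule gronwall[OF cu _ _ _ t])
    fix t assume t: "t \<in> {0..T}"
    have t0: "0 \<le> t" using t by simp
    have i: "(\<lambda>s. c / 2 * u s) integrable_on {0..t}"
      by (intro integrable_continuous_real continuous_intros continuous_on_subset[OF cu]) (use t in auto)
    have 1: "((\<lambda>s. (\<i> * z / 2 * a s - of_real (q s) / 2 * b s) - (\<i> * z / 2 * a' s - of_real (q s) / 2 * b' s)) has_integral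
      (a t - a' 0) - (a' t - a' 0)) {0..t}"
      by (intro has_integral_diff ia[OF t] integral_of_derivative[OF da t0])
    have 2: "((\<lambda>s. (of_real (q s) / 2 * a s - \<i> * z / 2 * b s) - (of_real (q s) / 2 * a' s - \<i> * z / 2 * b' s)) has_integral
      (b t - b' 0) - (b' t - b' 0)) {0..t}"
      by (intro has_integral_diff ib[OF t] integral_of_derivative[OF db t0])
    have e1: "(\<i> * z / 2 * a s - of_real (q s) / 2 * b s) - (\<i> * z / 2 * a' s - of_real (q s) / 2 * b' s)
       = \<i> * z / 2 * (a s - a' s) - of_real (q s) / 2 * (b s - b' s)" for s by (simp add: field_simps)
    have e2: "(of_real (q s) / 2 * a s - \<i> * z / 2 * b s) - (of_real (q s) / 2 * a' s - \<i> * z / 2 * b' s)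
       = of_real (q s) / 2 * (a s - a' s) - \<i> * z / 2 * (b s - b' s)" for s by (simp add: field_simps)
    have "cmod (a t - a' t) \<le> integral {0..t} (\<lambda>s. c / 2 * u s)"
      using integral_norm_bound_integral[OF has_integral_integrable[OF 1] i] 1 unfolding e1 u_def
      using bnd(1) by (simp add: integral_unique)
    moreover have "cmod (b t - b' t) \<le> integral {0..t} (\<lambda>s. c / 2 * u s)"
      using integral_norm_bound_integral[OF has_integral_integrable[OF 2] i] 2 unfolding e2 u_def
      using bnd(2) by (simp add: integral_unique add.commute)
    ultimately have "u t \<le> 2 * integral {0..t} (\<lambda>s. c / 2 * u s)" by (simp add: u_def)
    also have "\<dots> = integral {0..t} (\<lambda>s. c * u s)" unfolding integral_mult_right by simp
    finally show "u t \<le> 0 + integral {0..t} (\<lambda>s. c * u s)" by simp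
  qed (auto simp: c_def)
  then have "u t \<le> 0" by simp
  then show ?thesis unfolding u_def by (smt (verit) norm_ge_zero norm_eq_zero right_minus_eq)
qed

lemma zs_unique:
  assumes s: "zs_solution q z a b" and s': "zs_solution q z a' b'" and 0: "a 0 = a' 0" "b 0 = b' 0" and t: "0 \<le> t"
  shows "a t = a' t \<and> b t = b' t"
proof (rule row_unique[OF s' zs_solution_continuous[OF s], of t])
  have da: "(a has_vector_derivative (\<i> * z / 2 * a t - of_real (q t) / 2 * b t)) (at t)"
    and db: "(b has_vector_derivative (of_real (q t) / 2 * a t - \<i> * z / 2 * b t)) (at t)" for t
    using s by (auto simp: zs_solution_def)
  show "((\<lambda>s. \<i> * z / 2 * a s - of_real (q s) / 2 * b s) has_integral a u - a' 0) {0..u}" if "u \<in> {0..t}" for u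
    using integral_of_derivative[OF da, of 0 u] that 0 by simp
  show "((\<lambda>s. of_real (q s) / 2 * a s - \<i> * z / 2 * b s) has_integral b u - b' 0) {0..u}" if "u \<in> {0..t}" for u
    using integral_of_derivative[OF db, of 0 u] that 0 by simp
qed (use t in auto)

text \<open>Conjugation of the equation at a real point \<open>x\<close> gives the equation at
  \<open>- x\<close>. Hence closing the gaps of positive index closes those of negative index as
  well.\<close>

lemma AB_uminus:
  assumes "0 \<le> t"
  shows "A (- of_real x) t = cnj (A (of_real x) t)" "B (- of_real x) t = cnj (B (of_real x) t)"
proof -
  have "zs_solution q (- of_real x) (\<lambda>t. cnj (A (of_real x) t)) (\<lambda>t. cnj (B (of_real x) t))"
    unfolding zs_solution_def
  proof (intro allI conjI)
    fix t
    show "((\<lambda>t. cnj (A (of_real x) t)) has_vector_derivative \<i> * - of_real x / 2 * cnj (A (of_real x) t) - of_real (q t) / 2 * cnj (B (of_real x) t)) (at t)"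
      by (rule back_subst[of "\<lambda>d. (_ has_vector_derivative d) (at t)", OF has_vector_derivative_cnj[OF derivs(1)]]) simp
    show "((\<lambda>t. cnj (B (of_real x) t)) has_vector_derivative of_real (q t) / 2 * cnj (A (of_real x) t) - \<i> * - of_real x / 2 * cnj (B (of_real x) t)) (at t)"
      by (rule back_subst[of "\<lambda>d. (_ has_vector_derivative d) (at t)", OF has_vector_derivative_cnj[OF derivs(2)]]) simp
  qed
  from zs_unique[OF AB[of "- of_real x"] this _ _ assms]
  show "A (- of_real x) t = cnj (A (of_real x) t)" "B (- of_real x) t = cnj (B (of_real x) t)"
    by (simp_all add: AB0)
qed

text \<open>A Riemann-Lebesgue lemma uniform in all complex directions. As \<open>q\<close> is only
  continuous, it is compared with a smooth \<open>p\<close>: the substitution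
  \<open>\<beta> = B - h * A\<close> with \<open>h = p / (2 * \<i> * z)\<close> replaces the forcing
  \<open>q / 2 * A\<close> of \<open>B\<close> by \<open>(q - p) / 2 * A\<close>, of size \<delta>,
  up to terms of order 1/|z|.\<close>

lemma asymptotics:
  assumes T: "T > 0" and per: "q 0 = q T" and e: "e > 0"
  shows "\<exists>R>0. \<forall>z. cmod z \<ge> R \<longrightarrow> cmod (B z T) \<le> e * exp (\<bar>Im z\<bar> / 2 * T) \<and>
     cmod (A z T - exp (\<i> * z / 2 * of_real T)) \<le> e * exp (\<bar>Im z\<bar> / 2 * T)"
proof -
  have Q: "Q \<ge> 0" using q_bound[of 0] by linarith
  \<comment> \<open>Dividing by \<open>1 + Q * T\<close> leaves room for the error in
    \<open>A\<close>, which is driven by \<open>B\<close> and picks up the factor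
    \<open>Q / 2 * T\<close>.\<close>
  define e0 where "e0 = e / (1 + Q * T)"
  have QT: "Q * T \<ge> 0" using Q T by simp
  then have pos: "1 + Q * T > 0" by simp
  then have "e0 * (1 + Q * T) = e" by (simp add: e0_def)
  then have e0e: "e0 + (Q * T) * e0 = e" by (simp add: algebra_simps)
  have "e0 > 0" using e pos by (simp add: e0_def)
  moreover from this have "(Q * T) * e0 \<ge> 0" using QT by simp
  ultimately have e0: "e0 > 0" "e0 \<le> e" "Q / 2 * e0 * T \<le> e" using e0e by (simp_all add: mult_ac)
  define \<delta> where "\<delta> = e0 / T"
  have \<delta>: "\<delta> > 0" using e0 T by (simp add: \<delta>_def)
  obtain p where p: "C2_periodic T p" "\<And>t. t \<in> {0..T} \<Longrightarrow> \<bar>q t - p t\<bar> < \<delta>"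
    using C2_periodic_uniform_approx[OF T continuous_on_subset[OF q_cont] per \<delta>] by auto
  obtain p' p'' where p': "\<And>t. (p has_real_derivative p' t) (at t)" "\<And>t. (p' has_real_derivative p'' t) (at t)"
    using p(1) unfolding C2_periodic_def by auto
  obtain P where P: "\<And>t. t \<in> {0..T} \<Longrightarrow> \<bar>p t\<bar> \<le> P" "P \<ge> 0"
    using continuous_on_compact_bound[OF compact_Icc continuous_on_subset[OF continuous_on_DERIV_UNIV[OF p'(1)]], of 0 T] by auto
  obtain P' where P': "\<And>t. t \<in> {0..T} \<Longrightarrow> \<bar>p' t\<bar> \<le> P'" "P' \<ge> 0"
    using continuous_on_compact_bound[OF compact_Icc continuous_on_subset[OF continuous_on_DERIV_UNIV[OF p'(2)]], of 0 T] by auto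
  define c where "c = P' / 2 + P * Q / 4"
  have c: "c \<ge> 0" using P P' Q by (simp add: c_def)
  define C1 where "C1 = P + c * T"
  have C1: "C1 \<ge> 0" using P c T by (simp add: C1_def)
  have main: "cmod (B z t) \<le> (\<delta> / 2 * T + C1 / cmod z) * exp (\<bar>Im z\<bar> / 2 * t)" if z: "z \<noteq> 0" and t: "t \<in> {0..T}" for z t
  proof -
    define h where "h s = of_real (p s) / (2 * \<i> * z)" for s
    define \<beta> where "\<beta> s = B z s - h s * A z s" for s
    define g where "g s = of_real (q s - p s) / 2 * A z s - of_real (p' s) / (2 * \<i> * z) * A z s + of_real (p s * q s) / (4 * \<i> * z) * B z s" for s
    have dh: "(h has_vector_derivative of_real (p' s) / (2 * \<i> * z)) (at s)" for s
    proof -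
      have "((\<lambda>s. complex_of_real (p s)) has_vector_derivative of_real (p' s)) (at s)"
        using bounded_linear.has_vector_derivative[OF bounded_linear_of_real] p'(1)[of s]
        by (simp add: has_real_derivative_iff_has_vector_derivative)
      from bounded_linear.has_vector_derivative[OF bounded_linear_divide this] show ?thesis unfolding h_def .
    qed
    have d\<beta>: "(\<beta> has_vector_derivative (- (\<i> * z / 2)) * \<beta> s + g s) (at s)" for s
    proof -
      have "(\<beta> has_vector_derivative (of_real (q s) / 2 * A z s - \<i> * z / 2 * B z s) -
         (h s * (\<i> * z / 2 * A z s - of_real (q s) / 2 * B z s) + of_real (p' s) / (2 * \<i> * z) * A z s)) (at s)"
        unfolding \<beta>_def by (intro has_vector_derivative_diff has_vector_derivative_mult dh derivs)
      moreover have "(of_real (q s) / 2 * A z s - \<i> * z / 2 * B z s) -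
         (h s * (\<i> * z / 2 * A z s - of_real (q s) / 2 * B z s) + of_real (p' s) / (2 * \<i> * z) * A z s) = - (\<i> * z / 2) * \<beta> s + g s"
        unfolding \<beta>_def g_def h_def using z by (simp add: field_simps)
      ultimately show ?thesis by simp
    qed
    have h_le: "cmod (h s) \<le> P / (2 * cmod z)" if "s \<in> {0..T}" for s
      using P(1)[OF that] by (simp add: h_def norm_divide norm_mult divide_right_mono)
    have "cmod (\<beta> t) \<le> (cmod (\<beta> 0) + (\<delta> / 2 + c / cmod z) * t) * exp (\<bar>Im z\<bar> / 2 * t)"
    proof (rule duhamel_bound[OF d\<beta>])
      fix s assume s: "0 \<le> s" "s \<le> t"
      have sT: "s \<in> {0..T}" using s t by auto
      define E where "E = exp (\<bar>Im z\<bar> / 2 * s)"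
      have bA: "cmod (A z s) \<le> E" "cmod (B z s) \<le> E" unfolding E_def using bounds[OF s(1)] by auto
      have "cmod (of_real (q s - p s) / 2 * A z s) \<le> \<delta> / 2 * E"
        unfolding norm_mult using bA p(2)[OF sT] \<delta> by (intro mult_mono) (auto simp: norm_divide simp flip: of_real_diff)
      moreover have "cmod (of_real (p' s) / (2 * \<i> * z) * A z s) \<le> P' / (2 * cmod z) * E"
        unfolding norm_mult using bA P'(1)[OF sT] by (intro mult_mono) (auto simp: norm_divide norm_mult divide_right_mono intro: order_trans)
      moreover have "cmod (of_real (p s * q s) / (4 * \<i> * z) * B z s) \<le> P * Q / (4 * cmod z) * E"
      proof -
        have "\<bar>p s\<bar> * \<bar>q s\<bar> \<le> P * Q" using P(1)[OF sT] P(2) q_bound[of s] by (intro mult_mono) auto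
        then have "cmod (of_real (p s * q s) / (4 * \<i> * z)) \<le> P * Q / (4 * cmod z)"
          by (simp add: norm_divide norm_mult abs_mult divide_right_mono)
        then show ?thesis unfolding norm_mult[of _ "B z s"] using bA P(2) Q by (intro mult_mono) auto
      qed
      ultimately have "cmod (g s) \<le> \<delta> / 2 * E + P' / (2 * cmod z) * E + P * Q / (4 * cmod z) * E"
        unfolding g_def by (rule norm_triangle_le[OF add_mono[OF norm_triangle_le_diff[OF add_mono]]])
      also have "\<dots> = (\<delta> / 2 + c / cmod z) * E" unfolding c_def using z by (simp add: field_simps)
      finally show "cmod (g s) \<le> (\<delta> / 2 + c / cmod z) * exp (\<bar>Im z\<bar> / 2 * s)" by (simp add: E_def)
    qed (use t in auto)
    also have "cmod (\<beta> 0) = cmod (h 0)" by (simp add: \<beta>_def AB0)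
    finally have "cmod (\<beta> t) \<le> (cmod (h 0) + (\<delta> / 2 + c / cmod z) * t) * exp (\<bar>Im z\<bar> / 2 * t)" .
    also have "\<dots> \<le> (P / (2 * cmod z) + (\<delta> / 2 + c / cmod z) * T) * exp (\<bar>Im z\<bar> / 2 * t)"
      using h_le[of 0] T t \<delta> c by (intro mult_right_mono add_mono mult_left_mono) auto
    finally have 1: "cmod (\<beta> t) \<le> (P / (2 * cmod z) + (\<delta> / 2 + c / cmod z) * T) * exp (\<bar>Im z\<bar> / 2 * t)" .
    have 2: "cmod (h t * A z t) \<le> P / (2 * cmod z) * exp (\<bar>Im z\<bar> / 2 * t)"
      unfolding norm_mult using h_le[OF t] bounds(1)[of t z] t P by (intro mult_mono) auto
    have "cmod (B z t) \<le> cmod (\<beta> t) + cmod (h t * A z t)"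
      using norm_triangle_ineq[of "\<beta> t" "h t * A z t"] by (simp add: \<beta>_def)
    also have "\<dots> \<le> (P / (2 * cmod z) + (\<delta> / 2 + c / cmod z) * T + P / (2 * cmod z)) * exp (\<bar>Im z\<bar> / 2 * t)"
      using 1 2 by (simp add: distrib_right)
    also have "P / (2 * cmod z) + (\<delta> / 2 + c / cmod z) * T + P / (2 * cmod z) = \<delta> / 2 * T + C1 / cmod z"
      unfolding C1_def using z by (simp add: field_simps)
    finally show ?thesis .
  qed
  define R where "R = 2 * C1 / e0 + 1"
  have R: "R > 0" using C1 e0 by (simp add: R_def add_nonneg_pos)
  show ?thesis
  proof (intro exI[of _ R] conjI R allI impI)
    fix z assume zR: "cmod z \<ge> R"
    have z: "cmod z > 0" "z \<noteq> 0" using zR R by auto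
    have "2 * C1 / e0 \<le> cmod z" using zR by (simp add: R_def)
    then have "C1 / cmod z \<le> e0 / 2" using e0 z by (simp add: field_simps)
    moreover have "\<delta> / 2 * T = e0 / 2" using T by (simp add: \<delta>_def)
    ultimately have le: "\<delta> / 2 * T + C1 / cmod z \<le> e0" by linarith
    have Bt: "cmod (B z t) \<le> e0 * exp (\<bar>Im z\<bar> / 2 * t)" if "t \<in> {0..T}" for t
      using order_trans[OF main[OF z(2) that] mult_right_mono[OF le]] by simp
    show "cmod (B z T) \<le> e * exp (\<bar>Im z\<bar> / 2 * T)"
      using order_trans[OF Bt mult_right_mono[OF e0(2)]] T by simp
    define u where "u t = A z t - exp (\<i> * z / 2 * of_real t)" for t
    have dE: "((\<lambda>t. exp (\<i> * z / 2 * of_real t)) has_vector_derivative \<i> * z / 2 * exp (\<i> * z / 2 * of_real t)) (at t)" for t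
    proof -
      have "((\<lambda>w. exp (\<i> * z / 2 * w)) has_field_derivative \<i> * z / 2 * exp (\<i> * z / 2 * of_real t)) (at (of_real t))"
        by (auto intro!: derivative_eq_intros)
      from has_vector_derivative_real_field[OF this] show ?thesis .
    qed
    have "cmod (u T) \<le> (cmod (u 0) + Q / 2 * e0 * T) * exp (\<bar>Im z\<bar> / 2 * T)"
    proof (rule duhamel_bound[where k = "\<i> * z / 2" and g = "\<lambda>t. - of_real (q t) / 2 * B z t"])
      show "(u has_vector_derivative \<i> * z / 2 * u s + - of_real (q s) / 2 * B z s) (at s)" for s
        by (rule back_subst[of "\<lambda>d. (_ has_vector_derivative d) (at s)"])
          (unfold u_def, rule has_vector_derivative_diff[OF derivs(1) dE], simp add: algebra_simps)
      fix s assume s: "0 \<le> s" "s \<le> T"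
      have "cmod (- of_real (q s) / 2 * B z s) \<le> Q / 2 * (e0 * exp (\<bar>Im z\<bar> / 2 * s))"
        unfolding norm_mult using q_bound[of s] Q Bt[of s] s by (intro mult_mono) (auto simp: norm_divide)
      then show "cmod (- of_real (q s) / 2 * B z s) \<le> Q / 2 * e0 * exp (\<bar>Im z\<bar> / 2 * s)" by (simp add: mult.assoc)
    qed (use T in auto)
    also have "\<dots> \<le> e * exp (\<bar>Im z\<bar> / 2 * T)"
      using e0(3) by (intro mult_right_mono) (auto simp: u_def AB0)
    finally show "cmod (A z T - exp (\<i> * z / 2 * of_real T)) \<le> e * exp (\<bar>Im z\<bar> / 2 * T)" by (simp add: u_def)
  qed
qed

text \<open>The potential \<open>q'\<close> may differ from \<open>q\<close> on a null set, because
  the geodesic curvature of a curve is known only up to null sets.\<close>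

lemma monodromy_eq:
  assumes T: "T \<ge> 0" and N: "negligible N" "\<And>t. t \<in> {0..T} - N \<Longrightarrow> q' t = q t"
  shows "monodromy T (\<lambda>t. complex_of_real (q' t)) z = vector [vector [A z T, B z T], vector [C z T, D z T]]"
proof -
  define E where "E i j c = (\<chi> k l. if k = i \<and> l = j then c else (0::complex))" for i j :: 2 and c
  have E: "bounded_linear (E i j)" for i j
    unfolding linear_conv_bounded_linear[symmetric]
    by (rule linearI) (simp_all add: E_def vec_eq_iff)
  define F where "F t = E 1 1 (A z t) + E 1 2 (B z t) + E 2 1 (C z t) + E 2 2 (D z t)" for t
  have F: "F t = vector [vector [A z t, B z t], vector [C z t, D z t]]" for t
    by (simp add: F_def E_def vec_eq_iff forall_2)
  define al where "al q t = alpha (\<lambda>t. complex_of_real (q t)) z t" for q t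
  have al: "al q t $ 1 $ 1 = \<i> * z / 2" "al q t $ 1 $ 2 = of_real (q t) / 2"
    "al q t $ 2 $ 1 = - of_real (q t) / 2" "al q t $ 2 $ 2 = - \<i> * z / 2" for q t
    by (simp_all add: al_def alpha_def cscale_def eps_def eps_plus_def eps_minus_def)
  have mm: "(X ** al q t) $ i $ 1 = \<i> * z / 2 * X $ i $ 1 - of_real (q t) / 2 * X $ i $ 2"
    "(X ** al q t) $ i $ 2 = of_real (q t) / 2 * X $ i $ 1 - \<i> * z / 2 * X $ i $ 2" for X q t i
    by (simp_all add: matrix_matrix_mult_def sum_2 al mult.commute)
  have dF: "(F has_vector_derivative F t ** al q t) (at t)" for t
  proof -
    have "(F has_vector_derivative E 1 1 (\<i> * z / 2 * A z t - of_real (q t) / 2 * B z t) + E 1 2 (of_real (q t) / 2 * A z t - \<i> * z / 2 * B z t)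
      + E 2 1 (\<i> * z / 2 * C z t - of_real (q t) / 2 * D z t) + E 2 2 (of_real (q t) / 2 * C z t - \<i> * z / 2 * D z t)) (at t)"
      unfolding F_def by (intro has_vector_derivative_add bounded_linear.has_vector_derivative[OF E] derivs)
    moreover have "E 1 1 (\<i> * z / 2 * A z t - of_real (q t) / 2 * B z t) + E 1 2 (of_real (q t) / 2 * A z t - \<i> * z / 2 * B z t)
      + E 2 1 (\<i> * z / 2 * C z t - of_real (q t) / 2 * D z t) + E 2 2 (of_real (q t) / 2 * C z t - \<i> * z / 2 * D z t) = F t ** al q t"
      unfolding vec_eq_iff forall_2 mm by (simp add: E_def F)
    ultimately show ?thesis by simp
  qed
  have ae: "al q' t = al q t" if "t \<in> {0..T} - N" for t using N(2)[OF that] by (simp add: al_def alpha_def)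
  have solF: "solves_frame_eq T (\<lambda>t. complex_of_real (q' t)) z F"
    unfolding solves_frame_eq_def al_def[symmetric]
  proof (intro conjI ballI)
    show "continuous_on {0..T} F"
      by (intro continuous_at_imp_continuous_on ballI has_vector_derivative_continuous[OF dF])
    fix t assume t: "t \<in> {0..T}"
    have "F 0 = mat 1" by (simp add: F AB0 CD0 vec_eq_iff forall_2 mat_def)
    then have "((\<lambda>s. F s ** al q s) has_integral F t - mat 1) {0..t}"
      using integral_of_derivative[OF dF, of 0 t] t by simp
    then show "((\<lambda>s. F s ** al q' s) has_integral F t - mat 1) {0..t}"
      by (rule has_integral_spike[OF N(1), rotated]) (use ae t in auto)
  qed
  have uniq: "G T = F T" if G: "solves_frame_eq T (\<lambda>t. complex_of_real (q' t)) z G" for G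
  proof -
    have cG: "continuous_on {0..T} (\<lambda>t. G t $ i $ j)" for i j
      using G by (auto simp: solves_frame_eq_def intro!: continuous_intros)
    have iG: "((\<lambda>s. (G s ** al q s) $ i $ j) has_integral (G t $ i $ j - mat 1 $ i $ j)) {0..t}" if t: "t \<in> {0..T}" for t i j
    proof -
      have "((\<lambda>s. G s ** al q' s) has_integral (G t - mat 1)) {0..t}"
        using G t unfolding solves_frame_eq_def al_def by blast
      from has_integral_linear[OF this bounded_linear_compose[OF bounded_linear_vec_nth[of j] bounded_linear_vec_nth[of i]]]
      have "((\<lambda>s. (G s ** al q' s) $ i $ j) has_integral (G t $ i $ j - mat 1 $ i $ j)) {0..t}" by (simp add: o_def)
      then show ?thesis by (rule has_integral_spike[OF N(1), rotated]) (use ae t in auto)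
    qed
    have T': "T \<in> {0..T}" using T by simp
    have r1: "G T $ 1 $ 1 = A z T \<and> G T $ 1 $ 2 = B z T"
      by (rule row_unique[OF AB cG cG _ _ T']) (use iG[of _ 1 1] iG[of _ 1 2] in \<open>simp_all add: mm AB0 mat_def\<close>)
    have r2: "G T $ 2 $ 1 = C z T \<and> G T $ 2 $ 2 = D z T"
      by (rule row_unique[OF CD cG cG _ _ T']) (use iG[of _ 2 1] iG[of _ 2 2] in \<open>simp_all add: mm CD0 mat_def\<close>)
    show ?thesis using r1 r2 by (simp add: F vec_eq_iff forall_2)
  qed
  have "monodromy T (\<lambda>t. complex_of_real (q' t)) z = F T"
    unfolding monodromy_def by (rule the_equality) (use solF uniq in blast)+
  then show ?thesis by (simp add: F)
qed

end

section \<open>Double zeros far from the origin\<close>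

text \<open>The quotient \<open>sin w / w\<close>, continued to 0, vanishes only at the nonzero
  multiples of pi; on a closed disc of radius below pi its modulus has a positive minimum.\<close>

lemma sin_quotient_lower_bound:
  fixes \<rho> :: real
  assumes "0 \<le> \<rho>" "\<rho> < pi"
  obtains c where "c > 0" "\<And>w. cmod w \<le> \<rho> \<Longrightarrow> c * cmod w \<le> cmod (sin w)"
proof -
  define \<sigma> where "\<sigma> w = (if w = 0 then deriv sin 0 else (sin w - sin 0) / (w - 0))" for w :: complex
  have hol: "\<sigma> holomorphic_on UNIV" unfolding \<sigma>_def
    by (rule pole_lemma_open) (auto intro: holomorphic_intros)
  have ds: "deriv sin (0::complex) = 1" using DERIV_imp_deriv[OF DERIV_sin[of "0::complex"]] by simp
  have sin: "sin w = w * \<sigma> w" for w by (simp add: \<sigma>_def)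
  have "continuous_on (cball 0 \<rho>) (\<lambda>w. cmod (\<sigma> w))"
    by (intro continuous_intros holomorphic_on_imp_continuous_on holomorphic_on_subset[OF hol]) auto
  then obtain w0 where w0: "w0 \<in> cball 0 \<rho>" "\<And>w. w \<in> cball 0 \<rho> \<Longrightarrow> cmod (\<sigma> w0) \<le> cmod (\<sigma> w)"
    using continuous_attains_inf[of "cball 0 \<rho>" "\<lambda>w. cmod (\<sigma> w)"] assms by auto
  have "\<sigma> w0 \<noteq> 0"
  proof
    assume z: "\<sigma> w0 = 0"
    then have w00: "w0 \<noteq> 0" using ds by (auto simp: \<sigma>_def)
    have "sin w0 = 0" using sin[of w0] z by simp
    then obtain n :: int where n: "w0 = of_real (n * pi)" using Complex_Transcendental.sin_eq_0 by auto
    then have "\<bar>real_of_int n\<bar> * pi \<le> \<rho>" using w0(1) by (simp add: norm_mult abs_mult)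
    moreover have "n \<noteq> 0" using n w00 by auto
    then have "1 \<le> \<bar>real_of_int n\<bar>" by linarith
    then have "1 * pi \<le> \<bar>real_of_int n\<bar> * pi" by (intro mult_right_mono) auto
    ultimately show False using assms by simp
  qed
  then show thesis
    by (intro that[of "cmod (\<sigma> w0)"]) (auto simp: sin norm_mult mult.commute intro!: mult_left_mono w0(2))
qed

lemma entire_factor:
  assumes "p holomorphic_on UNIV" "p l = (0::complex)"
  obtains p1 where "p1 holomorphic_on UNIV" "\<And>z. p z = (z - l) * p1 z"
proof
  show "(\<lambda>z. if z = l then deriv p l else (p z - p l) / (z - l)) holomorphic_on UNIV"
    by (rule pole_lemma_open) (use assms in auto)
  show "p z = (z - l) * (if z = l then deriv p l else (p z - p l) / (z - l))" for z
    using assms(2) by auto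
qed

lemma norm_sin_lower_bound:
  assumes "\<bar>Im w\<bar> \<ge> pi / 4"
  shows "cmod (sin w) \<ge> exp \<bar>Im w\<bar> / 4"
proof -
  define y where "y = \<bar>Im w\<bar>"
  have y: "y \<ge> pi / 4" using assms by (simp add: y_def)
  have "exp (2 * Im w) + inverse (exp (2 * Im w)) = exp (2 * y) + exp (- 2 * y)"
    by (auto simp: y_def abs_if exp_minus[symmetric])
  then have "(cmod (sin w))\<^sup>2 = (exp (2 * y) + exp (- 2 * y) - 2 * cos (2 * Re w)) / 4"
    by (simp add: norm_sin_squared)
  also have "\<dots> \<ge> (exp (2 * y) - 2) / 4"
    using cos_le_one[of "2 * Re w"] exp_ge_zero[of "- 2 * y"] by (intro divide_right_mono) (linarith, simp)
  finally have 1: "(exp (2 * y) - 2) / 4 \<le> (cmod (sin w))\<^sup>2" .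
  \<comment> \<open>From pi > 3 one gets 2 y >= 3/2, and the quadratic Taylor bound then gives exp
    (2 y) >= 3; the final comparison needs 8/3.\<close>
  have "3 < pi" by (rule pi_gt3)
  then have "2 * y \<ge> 3/2" "0 \<le> 2 * y" using y by simp_all
  have "exp (2 * y) \<ge> 1 + 2 * y + (2 * y)\<^sup>2 / 2" by (rule exp_lower_Taylor_quadratic) fact
  moreover have "(2 * y)\<^sup>2 \<ge> (3/2)\<^sup>2" using \<open>2 * y \<ge> 3/2\<close> by (intro power_mono) auto
  ultimately have "exp (2 * y) \<ge> 3" using \<open>2 * y \<ge> 3/2\<close> by (simp add: power2_eq_square)
  then have "(exp y / 4)\<^sup>2 \<le> (exp (2 * y) - 2) / 4"
    by (simp add: power_divide exp_double)
  then have "(exp y / 4)\<^sup>2 \<le> (cmod (sin w))\<^sup>2" using 1 by (rule order_trans)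
  then show ?thesis unfolding y_def by (rule power2_le_imp_le) simp
qed

lemma sin_shift_pi: "sin (w + of_int k * of_real pi) = (-1) powi k * sin (w :: complex)"
proof -
  have n: "sin (w + of_nat m * of_real pi) = (-1) ^ m * sin w" for m and w :: complex
  proof (induction m)
    case (Suc m)
    have "w + of_nat (Suc m) * of_real pi = (w + of_nat m * of_real pi) + of_real pi" by (simp add: algebra_simps)
    moreover have "cos (complex_of_real pi) = -1" "sin (complex_of_real pi) = 0"
      unfolding cos_of_real sin_of_real by simp_all
    ultimately have "sin (w + of_nat (Suc m) * of_real pi) = - sin (w + of_nat m * of_real pi)"
      by (simp only: sin_add) simp
    then show ?case using Suc by simp
  qed simp
  show ?thesis
  proof (cases "k \<ge> 0")
    case True
    then show ?thesis using n[of w "nat k"] by (simp add: power_int_def)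
  next
    case False
    then have "sin w = (-1) ^ nat (- k) * sin (w + of_int k * of_real pi)"
      using n[of "w + of_int k * of_real pi" "nat (- k)"] by (simp add: algebra_simps)
    then have "(-1) ^ nat (- k) * sin w = ((-1) ^ nat (- k) * (-1) ^ nat (- k)) * sin (w + of_int k * of_real pi)" by simp
    also have "((-1) ^ nat (- k) * (-1) ^ nat (- k)) = (1::complex)" by (simp flip: power_mult_distrib)
    finally show ?thesis using False by (simp add: power_int_def inverse_eq_divide power_one_over)
  qed
qed

text \<open>
  Far from the origin the trace-free part of the monodromy is close to that of the vacuum, so near
  every vacuum double point it has exactly one zero. This zero is simple once it is known to exist.
\<close>

lemma far_zeros_are_double:
  fixes p r s :: "complex \<Rightarrow> complex" and l :: "int \<Rightarrow> real"
  assumes T: "T > 0" and hol: "p holomorphic_on UNIV" "r holomorphic_on UNIV" "s holomorphic_on UNIV"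
    and as: "\<And>e. e > 0 \<Longrightarrow> \<exists>R. \<forall>z. cmod z \<ge> R \<longrightarrow> cmod (p z - \<i> * sin (of_real (T / 2) * z)) \<le> e * exp (\<bar>Im z\<bar> / 2 * T) \<and>
       cmod (r z) \<le> e * exp (\<bar>Im z\<bar> / 2 * T) \<and> cmod (s z) \<le> e * exp (\<bar>Im z\<bar> / 2 * T)"
    and zero: "\<And>k. \<bar>k\<bar> > K \<Longrightarrow> p (of_real (l k)) = 0 \<and> r (of_real (l k)) = 0 \<and> s (of_real (l k)) = 0"
    and lim: "\<And>e. e > 0 \<Longrightarrow> \<exists>K. \<forall>k. \<bar>k\<bar> > K \<longrightarrow> \<bar>l k - 2 * pi / T * of_int k\<bar> \<le> e"
  shows "\<exists>R. \<forall>z. cmod z \<ge> R \<longrightarrow> (p z)\<^sup>2 + r z * s z \<noteq> 0 \<or>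
     (\<exists>p1 r1 s1. p1 holomorphic_on UNIV \<and> r1 holomorphic_on UNIV \<and> s1 holomorphic_on UNIV \<and>
        (\<forall>w. p w = (w - z) * p1 w \<and> r w = (w - z) * r1 w \<and> s w = (w - z) * s1 w) \<and>
        p1 z \<noteq> 0 \<and> (p1 z)\<^sup>2 + r1 z * s1 z \<noteq> 0)"
proof -
  define \<omega> where "\<omega> = 2 * pi / T"
  have \<omega>: "\<omega> > 0" "T / 2 * \<omega> = pi" using T by (auto simp: \<omega>_def)
  \<comment> \<open>A point with \<open>\<bar>Im z\<bar> < \<omega> / 4\<close> is within
    \<open>\<omega> / 2 + \<omega> / 4\<close> of some \<open>\<omega> * k\<close>, and
    \<open>l k\<close> is within \<open>\<omega> / 20\<close> of the latter: together 4/5. As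
    \<open>T / 2 * \<rho>\<close> is 4/5 pi < pi, the disc of this radius contains a single zero of
    the recentred sine.\<close>
  define \<rho> where "\<rho> = 4/5 * \<omega>"
  have \<rho>: "\<rho> > 0" using \<omega> by (simp add: \<rho>_def)
  have T\<rho>: "T / 2 * \<rho> = 4/5 * pi" using \<omega>(2) by (simp add: \<rho>_def)
  obtain c0 where c0: "c0 > 0" "\<And>w. cmod w \<le> 4/5 * pi \<Longrightarrow> c0 * cmod w \<le> cmod (sin w)"
    using sin_quotient_lower_bound[of "4/5 * pi"] by auto
  define c where "c = c0 * (T / 2)"
  have c: "c > 0" using c0 T by (simp add: c_def)
  \<comment> \<open>An error \<eta> on the circle of radius \<rho> becomes \<open>c / 4\<close>
    after division by \<open>w - L\<close>. Against a main term of modulus at least \<open>c\<close>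
    this leaves \<open>3/4 * c\<close> for \<open>p1\<close>, whose square dominates
    \<open>r1 * s1\<close>.\<close>
  define \<eta> where "\<eta> = c * \<rho> / 4"
  have \<eta>: "\<eta> > 0" using c \<rho> by (simp add: \<eta>_def)
  define M where "M = T / 2 * (\<rho> + 1)"
  have "uniformly_continuous_on (cball 0 M) (sin :: complex \<Rightarrow> complex)"
    by (intro compact_uniformly_continuous continuous_intros) auto
  then obtain d where d: "d > 0" "\<And>x y. x \<in> cball 0 M \<Longrightarrow> y \<in> cball 0 M \<Longrightarrow> dist y x < d \<Longrightarrow> dist (sin y) (sin x :: complex) < \<eta> / 2"
    using uniformly_continuous_onE[of "cball 0 M" sin "\<eta> / 2"] \<eta> by (metis half_gt_zero)
  define E where "E = exp (\<rho> / 2 * T)"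
  have E: "E > 0" by (simp add: E_def)
  \<comment> \<open>The first entry serves the discs, where the exponential weight is at most
    \<open>E\<close>; the second serves the region away from the real axis, where the sine is at
    least a quarter of the weight.\<close>
  define e where "e = min (\<eta> / (2 * E)) (1/16)"
  have e: "e > 0" "e * E \<le> \<eta> / 2" "e \<le> 1/16"
  proof -
    show "e > 0" "e \<le> 1/16" using \<eta> E by (auto simp: e_def)
    have "e * E \<le> \<eta> / (2 * E) * E" using E by (intro mult_right_mono) (auto simp: e_def)
    then show "e * E \<le> \<eta> / 2" using E by simp
  qed
  obtain R0 where R0: "\<And>z. cmod z \<ge> R0 \<Longrightarrow> cmod (p z - \<i> * sin (of_real (T / 2) * z)) \<le> e * exp (\<bar>Im z\<bar> / 2 * T) \<and>
       cmod (r z) \<le> e * exp (\<bar>Im z\<bar> / 2 * T) \<and> cmod (s z) \<le> e * exp (\<bar>Im z\<bar> / 2 * T)" using as[OF e(1)] by blast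
  define e1 where "e1 = min (min (\<omega> / 20) 1) (d / T)"
  have e1: "e1 > 0" "e1 \<le> \<omega> / 20" "e1 \<le> 1" "T / 2 * e1 < d"
  proof -
    show "e1 > 0" using \<omega> d T by (simp add: e1_def)
    show "e1 \<le> \<omega> / 20" unfolding e1_def by (rule order_trans[OF min.cobounded1 min.cobounded1])
    show "e1 \<le> 1" unfolding e1_def by (rule order_trans[OF min.cobounded1 min.cobounded2])
    have "T / 2 * e1 \<le> T / 2 * (d / T)" using T by (intro mult_left_mono) (auto simp: e1_def)
    then show "T / 2 * e1 < d" using T d by simp
  qed
  obtain K1 where K1: "\<And>k. \<bar>k\<bar> > K1 \<Longrightarrow> \<bar>l k - \<omega> * of_int k\<bar> \<le> e1" using lim[OF e1(1)] unfolding \<omega>_def by blast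
  \<comment> \<open>Points of the circle are within \<open>2 * \<rho> < 2 * \<omega>\<close> of
    \<open>z\<close>, so the first entry keeps the whole circle beyond \<open>R0\<close>. The second
    entry pushes the index \<open>k\<close> past both thresholds.\<close>
  define R where "R = max (R0 + 2 * \<omega>) (\<omega> * (of_int (max \<bar>K\<bar> \<bar>K1\<bar>) + 1))"
  show ?thesis
  proof (intro exI[of _ R] allI impI)
    fix z assume zR: "cmod z \<ge> R"
    then have zR0: "cmod z \<ge> R0 + 2 * \<omega>" by (simp add: R_def)
    show "(p z)\<^sup>2 + r z * s z \<noteq> 0 \<or>
     (\<exists>p1 r1 s1. p1 holomorphic_on UNIV \<and> r1 holomorphic_on UNIV \<and> s1 holomorphic_on UNIV \<and>
        (\<forall>w. p w = (w - z) * p1 w \<and> r w = (w - z) * r1 w \<and> s w = (w - z) * s1 w) \<and>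
        p1 z \<noteq> 0 \<and> (p1 z)\<^sup>2 + r1 z * s1 z \<noteq> 0)"
    proof (cases "\<bar>Im z\<bar> \<ge> \<omega> / 4")
      case True
      define X where "X = exp (\<bar>Im z\<bar> / 2 * T)"
      have X: "X > 0" by (simp add: X_def)
      have im: "\<bar>Im (of_real (T / 2) * z)\<bar> = \<bar>Im z\<bar> / 2 * T" using T by (simp add: abs_mult)
      have "T / 2 * (\<omega> / 4) \<le> T / 2 * \<bar>Im z\<bar>" using True T by (intro mult_left_mono) auto
      then have "\<bar>Im (of_real (T / 2) * z)\<bar> \<ge> pi / 4" unfolding im using \<omega>(2) by (simp add: mult_ac)
      from norm_sin_lower_bound[OF this] have 1: "cmod (sin (of_real (T / 2) * z)) \<ge> X / 4" unfolding im X_def .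
      have z0: "cmod z \<ge> R0" using zR0 \<omega> by simp
      have 2: "cmod (p z - \<i> * sin (of_real (T / 2) * z)) \<le> 1/16 * X" "cmod (r z) \<le> 1/16 * X" "cmod (s z) \<le> 1/16 * X"
        using R0[OF z0] mult_right_mono[OF e(3) less_imp_le[OF X]] unfolding X_def[symmetric] by linarith+
      have "cmod (\<i> * sin (of_real (T / 2) * z)) \<le> cmod (p z) + cmod (p z - \<i> * sin (of_real (T / 2) * z))"
        by (metis norm_minus_commute norm_triangle_sub)
      then have 3: "cmod (p z) \<ge> X / 8" using 1 2(1) X by (simp add: norm_mult)
      have "cmod (r z * s z) \<le> 1/16 * X * (1/16 * X)" unfolding norm_mult using 2 X by (intro mult_mono) auto
      also have "\<dots> < X / 8 * (X / 8)" using X by simp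
      also have "\<dots> \<le> cmod (p z) * cmod (p z)" using 3 X by (intro mult_mono) auto
      finally have "cmod (r z * s z) < cmod ((p z)\<^sup>2)" by (simp only: norm_power power2_eq_square norm_mult)
      then have "(p z)\<^sup>2 + r z * s z \<noteq> 0" by (metis add_eq_0_iff norm_minus_cancel less_irrefl)
      then show ?thesis ..
    next
      case False
      define k where "k = round (Re z / \<omega>)"
      have "\<bar>of_int k - Re z / \<omega>\<bar> \<le> 1/2" unfolding k_def by (rule of_int_round_abs_le)
      then have "\<omega> * \<bar>of_int k - Re z / \<omega>\<bar> \<le> \<omega> * (1/2)" using \<omega> by (intro mult_left_mono) auto
      also have "\<omega> * \<bar>of_int k - Re z / \<omega>\<bar> = \<bar>\<omega> * (of_int k - Re z / \<omega>)\<bar>" using \<omega> by (simp add: abs_mult)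
      also have "\<omega> * (of_int k - Re z / \<omega>) = \<omega> * of_int k - Re z" using \<omega> by (simp add: field_simps)
      finally have k1: "\<bar>Re z - \<omega> * of_int k\<bar> \<le> \<omega> / 2" by linarith
      have zk: "cmod (z - of_real (\<omega> * of_int k)) \<le> 3/4 * \<omega>"
        using cmod_le[of "z - of_real (\<omega> * of_int k)"] k1 False by simp
      have "cmod z \<le> cmod (of_real (\<omega> * of_int k)) + cmod (z - of_real (\<omega> * of_int k))" by (metis norm_triangle_sub)
      also have "cmod (of_real (\<omega> * of_int k)) = \<omega> * \<bar>of_int k\<bar>" unfolding norm_of_real using \<omega> by (simp add: abs_mult)
      finally have "\<omega> * (of_int (max \<bar>K\<bar> \<bar>K1\<bar>) + 1) \<le> \<omega> * \<bar>of_int k\<bar> + 3/4 * \<omega>" using zk zR by (simp add: R_def)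
      then have "\<omega> * of_int (max \<bar>K\<bar> \<bar>K1\<bar>) < \<omega> * \<bar>of_int k\<bar>" using \<omega>(1) unfolding distrib_left by linarith
      then have "real_of_int (max \<bar>K\<bar> \<bar>K1\<bar>) < of_int \<bar>k\<bar>" using \<omega>(1) by simp
      then have k2: "\<bar>k\<bar> > K" "\<bar>k\<bar> > K1" unfolding of_int_less_iff by auto
      define \<mu> where "\<mu> = l k"
      have \<mu>: "\<bar>\<mu> - \<omega> * of_int k\<bar> \<le> e1" using K1[OF k2(2)] by (simp add: \<mu>_def)
      have z\<mu>: "cmod (z - of_real \<mu>) \<le> \<rho>"
      proof -
        have "cmod (z - of_real \<mu>) \<le> cmod (z - of_real (\<omega> * of_int k)) + cmod (of_real (\<omega> * of_int k) - of_real \<mu>)"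
          by (metis diff_add_cancel add_diff_eq norm_triangle_ineq)
        also have "cmod (of_real (\<omega> * of_int k) - of_real \<mu>) \<le> \<omega> / 20"
          unfolding of_real_diff[symmetric] norm_of_real using \<mu> e1(2) by linarith
        finally show ?thesis using zk by (simp add: \<rho>_def)
      qed
      have p0: "p (of_real \<mu>) = 0" "r (of_real \<mu>) = 0" "s (of_real \<mu>) = 0" using zero[OF k2(1)] by (auto simp: \<mu>_def)
      define L where "L = complex_of_real \<mu>"
      obtain p1 where p1: "p1 holomorphic_on UNIV" "\<And>z. p z = (z - L) * p1 z" using entire_factor[OF hol(1) p0(1)] unfolding L_def by blast
      obtain r1 where r1: "r1 holomorphic_on UNIV" "\<And>z. r z = (z - L) * r1 z" using entire_factor[OF hol(2) p0(2)] unfolding L_def by blast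
      obtain s1 where s1: "s1 holomorphic_on UNIV" "\<And>z. s z = (z - L) * s1 z" using entire_factor[OF hol(3) p0(3)] unfolding L_def by blast
      \<comment> \<open>The vacuum entry, recentred at the true double point \<open>L\<close> and
        with the sign that the sine acquires under a shift by \<open>k\<close> times pi.\<close>
      define v where "v z = \<i> * ((-1) powi k * sin (of_real (T / 2) * (z - L)))" for z
      have hv: "v holomorphic_on UNIV" unfolding v_def by (intro holomorphic_intros)
      have "v L = 0" by (simp add: v_def)
      obtain v1 where v1: "v1 holomorphic_on UNIV" "\<And>z. v z = (z - L) * v1 z" using entire_factor[OF hv \<open>v L = 0\<close>] by blast
      have circ: "cmod (p x - v x) \<le> \<eta> \<and> cmod (r x) \<le> \<eta> \<and> cmod (s x) \<le> \<eta>" if x: "cmod (x - L) = \<rho>" for x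
      proof -
        have zL: "cmod (z - L) \<le> \<rho>" using z\<mu> by (simp add: L_def)
        have "cmod (z - x) \<le> cmod (z - L) + cmod (x - L)" by (metis norm_triangle_ineq4 diff_diff_eq2 diff_add_cancel)
        then have "cmod z \<le> cmod x + 2 * \<rho>" using norm_triangle_sub[of z x] zL x by linarith
        then have xR: "cmod x \<ge> R0" using zR0 \<omega> by (simp add: \<rho>_def)
        have "\<bar>Im x\<bar> = \<bar>Im (x - L)\<bar>" by (simp add: L_def)
        also have "\<dots> \<le> \<rho>" using abs_Im_le_cmod[of "x - L"] x by simp
        finally have "\<bar>Im x\<bar> / 2 * T \<le> \<rho> / 2 * T" using T by (intro mult_right_mono) auto
        then have "exp (\<bar>Im x\<bar> / 2 * T) \<le> E" by (simp add: E_def)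
        then have "e * exp (\<bar>Im x\<bar> / 2 * T) \<le> e * E" using e(1) by (intro mult_left_mono) auto
        then have "e * exp (\<bar>Im x\<bar> / 2 * T) \<le> \<eta> / 2" using e(2) by (rule order_trans)
        then have 1: "cmod (p x - \<i> * sin (of_real (T / 2) * x)) \<le> \<eta> / 2" "cmod (r x) \<le> \<eta> / 2" "cmod (s x) \<le> \<eta> / 2"
          using R0[OF xR] by (auto intro: order_trans)
        define u where "u = of_real (T / 2) * (x - of_real (\<omega> * of_int k))"
        define u' where "u' = of_real (T / 2) * (x - L)"
        have "of_real (T / 2) * x = u + of_int k * of_real pi"
          unfolding u_def \<omega>(2)[symmetric] of_real_mult by (simp only: of_real_of_int_eq) (simp add: algebra_simps)
        then have 2: "sin (of_real (T / 2) * x) = (-1) powi k * sin u" by (simp only: sin_shift_pi)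
        have \<mu>': "cmod (L - of_real (\<omega> * of_int k)) \<le> e1" unfolding L_def of_real_diff[symmetric] norm_of_real by (rule \<mu>)
        have nT: "cmod (of_real (T / 2) * y) = T / 2 * cmod y" for y unfolding norm_mult norm_of_real using T by simp
        have "cmod (x - of_real (\<omega> * of_int k)) \<le> \<rho> + e1"
          using norm_triangle_ineq[of "x - L" "L - of_real (\<omega> * of_int k)"] x \<mu>' by simp
        then have "T / 2 * cmod (x - of_real (\<omega> * of_int k)) \<le> M" "T / 2 * cmod (x - L) \<le> M"
          unfolding M_def using x e1(3) T by (intro mult_left_mono; simp)+
        then have uM: "u \<in> cball 0 M" "u' \<in> cball 0 M" unfolding u_def u'_def by (simp_all only: mem_cball_0 nT)
        have "u - u' = of_real (T / 2) * (L - of_real (\<omega> * of_int k))"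
          unfolding u_def u'_def right_diff_distrib[symmetric] by (rule arg_cong[of _ _ "(*) _"]) simp
        then have "dist u u' = T / 2 * cmod (L - of_real (\<omega> * of_int k))" by (simp only: dist_norm nT)
        also have "\<dots> \<le> T / 2 * e1" using \<mu>' T by (intro mult_left_mono) auto
        also have "\<dots> < d" by (rule e1(4))
        finally have 3: "cmod (sin u - sin u') < \<eta> / 2" using d(2)[OF uM(2,1)] by (simp add: dist_norm)
        have "\<i> * sin (of_real (T / 2) * x) - v x = \<i> * (-1) powi k * (sin u - sin u')"
          unfolding 2 v_def u'_def[symmetric] by (simp only: right_diff_distrib mult.assoc)
        then have "cmod (\<i> * sin (of_real (T / 2) * x) - v x) < \<eta> / 2" using 3 by (simp only: norm_mult norm_power_int) simp
        then have "cmod (p x - v x) \<le> \<eta>"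
          using norm_triangle_ineq[of "p x - \<i> * sin (of_real (T / 2) * x)" "\<i> * sin (of_real (T / 2) * x) - v x"] 1(1) by simp
        then show ?thesis using 1 \<eta> by simp
      qed
      \<comment> \<open>Once the common zero \<open>L\<close> is divided out, the maximum principle
        carries the bounds from the circle into the disc, up to \<open>L\<close> itself.\<close>
      have maxmod: "cmod (f y) \<le> c / 4" if f: "f holomorphic_on UNIV" "\<And>x. cmod (x - L) = \<rho> \<Longrightarrow> cmod ((x - L) * f x) \<le> \<eta>"
        and y: "cmod (y - L) \<le> \<rho>" for f y
      proof (rule maximum_modulus_frontier[of f "cball L \<rho>"])
        show "f holomorphic_on interior (cball L \<rho>)" "continuous_on (closure (cball L \<rho>)) f"
          using f(1) holomorphic_on_subset holomorphic_on_imp_continuous_on continuous_on_subset by blast+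
        fix x assume "x \<in> frontier (cball L \<rho>)"
        then have x: "cmod (x - L) = \<rho>" using \<rho> by (simp add: dist_norm norm_minus_commute)
        then have "\<rho> * cmod (f x) \<le> \<rho> * (c / 4)" using f(2)[OF x] x by (simp add: norm_mult \<eta>_def mult_ac)
        then show "cmod (f x) \<le> c / 4" using \<rho> by simp
      qed (use y in \<open>auto simp: dist_norm norm_minus_commute\<close>)
      have b: "cmod (p1 y - v1 y) \<le> c / 4" "cmod (r1 y) \<le> c / 4" "cmod (s1 y) \<le> c / 4" if y: "cmod (y - L) \<le> \<rho>" for y
      proof -
        show "cmod (p1 y - v1 y) \<le> c / 4"
        proof (rule maxmod[OF _ _ y])
          show "(\<lambda>y. p1 y - v1 y) holomorphic_on UNIV" by (intro holomorphic_intros p1 v1)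
          show "cmod ((x - L) * (p1 x - v1 x)) \<le> \<eta>" if "cmod (x - L) = \<rho>" for x
            using circ[OF that] by (simp add: p1(2) v1(2) right_diff_distrib)
        qed
        show "cmod (r1 y) \<le> c / 4" by (rule maxmod[OF r1(1) _ y]) (use circ r1(2) in auto)
        show "cmod (s1 y) \<le> c / 4" by (rule maxmod[OF s1(1) _ y]) (use circ s1(2) in auto)
      qed
      have v1c: "cmod (v1 y) \<ge> c" if y: "cmod (y - L) \<le> \<rho>" "y \<noteq> L" for y
      proof -
        have nT: "cmod (of_real (T / 2) * x) = T / 2 * cmod x" for x unfolding norm_mult norm_of_real using T by simp
        have "T / 2 * cmod (y - L) \<le> 4/5 * pi" unfolding T\<rho>[symmetric] using y T by (intro mult_left_mono) auto
        then have "c0 * (T / 2 * cmod (y - L)) \<le> cmod (sin (of_real (T / 2) * (y - L)))"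
          using c0(2)[of "of_real (T / 2) * (y - L)"] unfolding nT by simp
        also have "\<dots> = cmod (v y)" by (simp add: v_def norm_mult norm_power_int)
        also have "\<dots> = cmod (y - L) * cmod (v1 y)" by (simp add: v1(2) norm_mult)
        finally have "cmod (y - L) * c \<le> cmod (y - L) * cmod (v1 y)" by (simp add: c_def mult_ac)
        then show ?thesis using y(2) by (simp add: mult_le_cancel_left)
      qed
      have v1L: "cmod (v1 L) \<ge> c"
      proof (rule tendsto_lowerbound)
        show "((\<lambda>y. cmod (v1 y)) \<longlongrightarrow> cmod (v1 L)) (at L)"
          using v1(1) holomorphic_on_imp_continuous_on[of v1 UNIV] by (intro tendsto_intros) (auto simp: continuous_on_def)
        show "\<forall>\<^sub>F y in at L. c \<le> cmod (v1 y)"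
          unfolding eventually_at using \<rho> v1c by (intro exI[of _ \<rho>]) (auto simp: dist_norm)
      qed simp
      have v1c': "cmod (v1 y) \<ge> c" if "cmod (y - L) \<le> \<rho>" for y using v1c[OF that] v1L by (cases "y = L") auto
      have nz: "(p1 y)\<^sup>2 + r1 y * s1 y \<noteq> 0 \<and> p1 y \<noteq> 0" if y: "cmod (y - L) \<le> \<rho>" for y
      proof -
        have 1: "cmod (p1 y) \<ge> 3/4 * c" using b(1)[OF y] v1c'[OF y] norm_triangle_sub[of "v1 y" "p1 y"] by (simp add: norm_minus_commute)
        have "cmod (r1 y * s1 y) \<le> c / 4 * (c / 4)" unfolding norm_mult using b[OF y] c by (intro mult_mono) auto
        also have "\<dots> < 3/4 * c * (3/4 * c)" using c by simp
        also have "\<dots> \<le> cmod (p1 y) * cmod (p1 y)" using 1 c by (intro mult_mono) auto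
        finally have "cmod (r1 y * s1 y) < cmod ((p1 y)\<^sup>2)" by (simp only: norm_power power2_eq_square norm_mult)
        then have "(p1 y)\<^sup>2 + r1 y * s1 y \<noteq> 0" by (metis add_eq_0_iff norm_minus_cancel less_irrefl)
        moreover have "p1 y \<noteq> 0" using 1 c by auto
        ultimately show ?thesis by simp
      qed
      have zL: "cmod (z - L) \<le> \<rho>" using z\<mu> by (simp add: L_def)
      show ?thesis
      proof (cases "z = L")
        case True
        then show ?thesis using p1 r1 s1 nz[OF zL] by blast
      next
        case False
        have "(p z)\<^sup>2 + r z * s z = (z - L)\<^sup>2 * ((p1 z)\<^sup>2 + r1 z * s1 z)" by (simp add: p1(2) r1(2) s1(2) power2_eq_square algebra_simps)
        then show ?thesis using nz[OF zL] False by simp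
      qed
    qed
  qed
qed

section \<open>Vanishing orders and a criterion for finite gap\<close>

lemma zorder_entire:
  fixes f :: "complex \<Rightarrow> complex"
  assumes f: "f holomorphic_on UNIV" and nz: "f \<beta> \<noteq> 0"
  shows "zorder f z \<ge> 0" "f z = 0 \<Longrightarrow> zorder f z \<ge> 1"
proof -
  have ev: "\<forall>\<^sub>F w in at z. f w \<noteq> 0"
    using non_zero_neighbour_alt[OF f open_UNIV connected_UNIV, of z \<beta>] nz by simp
  then have fr: "\<exists>\<^sub>F w in at z. f w \<noteq> 0" by (intro eventually_frequently) simp_all
  have an: "f analytic_on {z}" using f by (metis UNIV_I analytic_at open_UNIV)
  show "zorder f z \<ge> 0" by (rule zorder_ge_0[OF an fr])
  show "zorder f z \<ge> 1" if "f z = 0" using zorder_pos_iff'[OF an fr] that by simp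
qed

text \<open>\<open>matrix_order\<close> takes the minimum over the entries that are not identically
  zero, so a lower bound is asked only for those.\<close>

lemma matrix_order_eqI:
  fixes F :: "complex \<Rightarrow> complex^2^2"
  assumes le: "\<And>i j w. F w $ i $ j \<noteq> 0 \<Longrightarrow> m \<le> zorder (\<lambda>w. F w $ i $ j) z"
    and ex: "F w0 $ i0 $ j0 \<noteq> 0" "zorder (\<lambda>w. F w $ i0 $ j0) z = m"
  shows "matrix_order F z = m"
  unfolding matrix_order_def
proof (rule Min_eqI)
  have "{zorder (\<lambda>w. F w $ i $ j) z |i j. \<exists>w. F w $ i $ j \<noteq> 0} \<subseteq> (\<lambda>(i, j). zorder (\<lambda>w. F w $ i $ j) z) ` (UNIV \<times> UNIV)"
    by auto
  then show "finite {zorder (\<lambda>w. F w $ i $ j) z |i j. \<exists>w. F w $ i $ j \<noteq> 0}" by (rule finite_subset) simp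
qed (use le ex in auto)

context zs_potential begin

lemma holomorphic_CD:
  assumes "T \<ge> 0"
  shows "(\<lambda>z. C z T) holomorphic_on UNIV" "(\<lambda>z. D z T) holomorphic_on UNIV"
proof -
  have "cnj \<circ> (\<lambda>z. B z T) \<circ> cnj holomorphic_on UNIV" "cnj \<circ> (\<lambda>z. A z T) \<circ> cnj holomorphic_on UNIV"
    by (rule holomorphic_on_compose_cnj_cnj; simp add: holomorphic[OF assms])+
  then show "(\<lambda>z. C z T) holomorphic_on UNIV" "(\<lambda>z. D z T) holomorphic_on UNIV"
    unfolding C_def D_def by (auto simp: o_def intro!: holomorphic_intros)
qed

text \<open>At a real point with \<open>A\<close> real and \<open>B = 0\<close> the monodromy is a
  multiple of the identity, so its trace-free part vanishes. Beyond a large disc every zero of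
  \<open>4 * F\<close>, which is the discriminant, has order 2 while the trace-free part has order
  1, and the summand is 2 - 2 * 1 = 0; inside the disc there are only finitely many zeros.\<close>

theorem finite_gapI:
  assumes T: "T > 0" and per: "q 0 = q T" and N: "negligible N" "\<And>t. t \<in> {0..T} - N \<Longrightarrow> q' t = q t"
    and lim: "(\<lambda>n. l n - 2 * pi / T * real n) \<longlonglongrightarrow> 0"
    and zero: "\<And>n. n > K \<Longrightarrow> A (of_real (l n)) T \<in> \<real> \<and> B (of_real (l n)) T = 0"
  shows "finite_gap T (\<lambda>t. complex_of_real (q' t))"
proof -
  have T0: "T \<ge> 0" using T by simp
  define p where "p z = (A z T - D z T) / 2" for z
  define r where "r z = B z T" for z
  define s where "s z = C z T" for z
  have hol: "p holomorphic_on UNIV" "r holomorphic_on UNIV" "s holomorphic_on UNIV"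
    unfolding p_def r_def s_def by (intro holomorphic_intros holomorphic[OF T0] holomorphic_CD[OF T0]; simp)+
  \<comment> \<open>Double points of negative index come from the reflection symmetry
    \<open>AB_uminus\<close>.\<close>
  define l' where "l' k = (if k \<ge> 0 then l (nat k) else - l (nat (- k)))" for k :: int
  have as: "\<exists>R. \<forall>z. cmod z \<ge> R \<longrightarrow> cmod (p z - \<i> * sin (of_real (T / 2) * z)) \<le> e * exp (\<bar>Im z\<bar> / 2 * T) \<and>
       cmod (r z) \<le> e * exp (\<bar>Im z\<bar> / 2 * T) \<and> cmod (s z) \<le> e * exp (\<bar>Im z\<bar> / 2 * T)" if e: "e > 0" for e
  proof -
    obtain R where R: "\<And>z. cmod z \<ge> R \<Longrightarrow> cmod (B z T) \<le> e * exp (\<bar>Im z\<bar> / 2 * T)"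
      "\<And>z. cmod z \<ge> R \<Longrightarrow> cmod (A z T - exp (\<i> * z / 2 * of_real T)) \<le> e * exp (\<bar>Im z\<bar> / 2 * T)"
      using asymptotics[OF T per e] by auto
    show ?thesis
    proof (intro exI[of _ R] allI impI conjI)
      fix z assume z: "cmod z \<ge> R"
      then have z': "cmod (cnj z) \<ge> R" by simp
      show "cmod (r z) \<le> e * exp (\<bar>Im z\<bar> / 2 * T)" using R(1)[OF z] by (simp add: r_def)
      show "cmod (s z) \<le> e * exp (\<bar>Im z\<bar> / 2 * T)" using R(1)[OF z'] by (simp add: s_def C_def)
      have "\<i> * sin (of_real (T / 2) * z) = (exp (\<i> * z / 2 * of_real T) - exp (- (\<i> * z / 2 * of_real T))) / 2"
        unfolding sin_exp_eq by (simp add: mult_ac)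
      also have "exp (- (\<i> * z / 2 * of_real T)) = cnj (exp (\<i> * cnj z / 2 * of_real T))"
        unfolding exp_cnj by simp
      finally have e: "\<i> * sin (of_real (T / 2) * z) = (exp (\<i> * z / 2 * of_real T) - cnj (exp (\<i> * cnj z / 2 * of_real T))) / 2" .
      have "p z - \<i> * sin (of_real (T / 2) * z) = ((A z T - exp (\<i> * z / 2 * of_real T)) - cnj (A (cnj z) T - exp (\<i> * cnj z / 2 * of_real T))) / 2"
        unfolding e p_def D_def complex_cnj_diff by (simp add: diff_divide_distrib)
      also have "cmod \<dots> \<le> (cmod (A z T - exp (\<i> * z / 2 * of_real T)) + cmod (A (cnj z) T - exp (\<i> * cnj z / 2 * of_real T))) / 2"
        unfolding norm_divide using norm_triangle_ineq4[of "A z T - exp (\<i> * z / 2 * of_real T)" "cnj (A (cnj z) T - exp (\<i> * cnj z / 2 * of_real T))"]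
        unfolding complex_mod_cnj by simp
      also have "\<dots> \<le> e * exp (\<bar>Im z\<bar> / 2 * T)" using R(2)[OF z] R(2)[OF z'] by simp
      finally show "cmod (p z - \<i> * sin (of_real (T / 2) * z)) \<le> e * exp (\<bar>Im z\<bar> / 2 * T)" .
    qed
  qed
  have zero': "p (of_real (l' k)) = 0 \<and> r (of_real (l' k)) = 0 \<and> s (of_real (l' k)) = 0" if k: "\<bar>k\<bar> > int K" for k
  proof -
    have "A (of_real (l' k)) T \<in> \<real> \<and> B (of_real (l' k)) T = 0"
    proof (cases "k \<ge> 0")
      case True
      then show ?thesis using zero[of "nat k"] k by (simp add: l'_def)
    next
      case False
      then have "nat (- k) > K" using k by simp
      from zero[OF this] show ?thesis using False AB_uminus[OF T0, of "l (nat (- k))"] by (auto simp: l'_def Reals_cnj_iff)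
    qed
    then show ?thesis by (simp add: p_def r_def s_def C_def D_def Reals_cnj_iff)
  qed
  have lim': "\<exists>K. \<forall>k. \<bar>k\<bar> > K \<longrightarrow> \<bar>l' k - 2 * pi / T * of_int k\<bar> \<le> e" if e: "e > 0" for e
  proof -
    obtain n0 where n0: "\<And>n. n \<ge> n0 \<Longrightarrow> \<bar>l n - 2 * pi / T * real n\<bar> < e"
      using LIMSEQ_D[OF lim e] by auto
    show ?thesis
    proof (intro exI[of _ "int n0"] allI impI)
      fix k assume k: "\<bar>k\<bar> > int n0"
      show "\<bar>l' k - 2 * pi / T * of_int k\<bar> \<le> e"
      proof (cases "k \<ge> 0")
        case True
        then show ?thesis using n0[of "nat k"] k by (simp add: l'_def less_imp_le le_nat_iff)
      next
        case False
        then have "l' k - 2 * pi / T * of_int k = - (l (nat (- k)) - 2 * pi / T * real (nat (- k)))" by (simp add: l'_def)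
        moreover have "n0 \<le> nat (- k)" using False k by linarith
        ultimately show ?thesis using n0[of "nat (- k)"] by (simp only: abs_minus_cancel less_imp_le)
      qed
    qed
  qed
  define F where "F z = (p z)\<^sup>2 + r z * s z" for z
  obtain R where R: "\<And>z. cmod z \<ge> R \<Longrightarrow> F z \<noteq> 0 \<or>
     (\<exists>p1 r1 s1. p1 holomorphic_on UNIV \<and> r1 holomorphic_on UNIV \<and> s1 holomorphic_on UNIV \<and>
        (\<forall>w. p w = (w - z) * p1 w \<and> r w = (w - z) * r1 w \<and> s w = (w - z) * s1 w) \<and>
        p1 z \<noteq> 0 \<and> (p1 z)\<^sup>2 + r1 z * s1 z \<noteq> 0)"
    using far_zeros_are_double[OF T hol as zero' lim'] unfolding F_def by blast
  have holF: "F holomorphic_on UNIV" unfolding F_def by (intro holomorphic_intros hol)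
  have anF: "f analytic_on {z}" if "f holomorphic_on UNIV" for f z using that by (metis UNIV_I analytic_at open_UNIV)
  define bad where "bad = {z \<in> cball 0 R. F z = 0}"
  \<comment> \<open>If \<open>F\<close> vanished identically, the second alternative at a far point
    \<open>z\<close> would factor it as \<open>(w - z)^2\<close> times a continuous function that is
    zero off \<open>z\<close> and nonzero at \<open>z\<close>.\<close>
  have nzF: "\<exists>w. F w \<noteq> 0"
  proof (rule ccontr)
    assume "\<nexists>w. F w \<noteq> 0"
    then have F0: "F w = 0" for w by blast
    obtain z where z: "cmod z \<ge> R" by (metis norm_of_real abs_ge_self)
    obtain p1 r1 s1 where h: "p1 holomorphic_on UNIV" "r1 holomorphic_on UNIV" "s1 holomorphic_on UNIV"
      "\<And>w. p w = (w - z) * p1 w" "\<And>w. r w = (w - z) * r1 w" "\<And>w. s w = (w - z) * s1 w" "(p1 z)\<^sup>2 + r1 z * s1 z \<noteq> 0"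
      using R[OF z] F0 by blast
    have "F w = (w - z)\<^sup>2 * ((p1 w)\<^sup>2 + r1 w * s1 w)" for w by (simp add: F_def h(4-6) power2_eq_square algebra_simps)
    then have g0: "(p1 w)\<^sup>2 + r1 w * s1 w = 0" if "w \<noteq> z" for w using F0[of w] that by simp
    have "((\<lambda>w. (p1 w)\<^sup>2 + r1 w * s1 w) \<longlongrightarrow> (p1 z)\<^sup>2 + r1 z * s1 z) (at z)"
      using h(1-3)[THEN holomorphic_on_imp_continuous_on] by (intro tendsto_intros) (auto simp: continuous_on_def)
    moreover have "((\<lambda>w. (p1 w)\<^sup>2 + r1 w * s1 w) \<longlongrightarrow> 0) (at z)"
      by (rule tendsto_eventually) (auto simp: eventually_at_filter g0)
    ultimately show False using h(7) tendsto_unique[of "at z"] by auto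
  qed
  have fin: "finite bad"
  proof (cases "F constant_on UNIV")
    case True
    then have "bad = {}" using nzF by (auto simp: bad_def constant_on_def)
    then show ?thesis by simp
  next
    case False
    then show ?thesis unfolding bad_def
      by (rule holomorphic_compact_finite_zeros[OF holF open_UNIV connected_UNIV compact_cball subset_UNIV])
  qed
  have mono: "monodromy T (\<lambda>t. complex_of_real (q' t)) z = vector [vector [A z T, B z T], vector [C z T, D z T]]" for z
    by (rule monodromy_eq[OF T0 N])
  have Delta: "(Delta T (\<lambda>t. complex_of_real (q' t)) z)\<^sup>2 - 4 = 4 * F z" for z
  proof -
    have "(A z T + D z T)\<^sup>2 - 4 = (A z T + D z T)\<^sup>2 - 4 * (A z T * D z T - B z T * C z T)" by (simp add: det)
    also have "\<dots> = 4 * F z" by (simp add: F_def p_def r_def s_def power2_eq_square field_simps)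
    finally show ?thesis by (simp add: Delta_def mono trace_def sum_2)
  qed
  define G where "G = tracefree_part T (\<lambda>t. complex_of_real (q' t))"
  have G: "G z $ 1 $ 1 = p z" "G z $ 1 $ 2 = r z" "G z $ 2 $ 1 = s z" "G z $ 2 $ 2 = - p z" for z
    by (simp_all add: G_def tracefree_part_def mono Delta_def trace_def sum_2 cscale_def mat_def p_def r_def s_def field_simps)
  have Ghol: "(\<lambda>z. G z $ i $ j) holomorphic_on UNIV" for i j
    using exhaust_2[of i] exhaust_2[of j] hol by (auto simp: G intro!: holomorphic_intros)
  have summand: "zorder (\<lambda>w. (Delta T (\<lambda>t. complex_of_real (q' t)) w)\<^sup>2 - 4) z - 2 * matrix_order G z = 0" if z: "z \<notin> bad" for z
  proof (cases "F z = 0")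
    case False
    have "zorder (\<lambda>w. (Delta T (\<lambda>t. complex_of_real (q' t)) w)\<^sup>2 - 4) z = 0"
      unfolding Delta by (rule zorder_eq_0I[OF anF]) (use False in \<open>auto intro!: holomorphic_intros holF\<close>)
    moreover have "p z \<noteq> 0 \<or> r z \<noteq> 0" using False by (auto simp: F_def)
    then obtain i j where ij: "G z $ i $ j \<noteq> 0" using G(1,2)[of z] by metis
    have "matrix_order G z = 0"
      by (rule matrix_order_eqI[of G 0 z z i j, OF zorder_entire(1)[OF Ghol] ij zorder_eq_0I[OF anF[OF Ghol] ij]])
    ultimately show ?thesis by simp
  next
    case True
    then have "cmod z \<ge> R" using z by (auto simp: bad_def)
    with R True obtain p1 r1 s1 where h: "p1 holomorphic_on UNIV" "r1 holomorphic_on UNIV" "s1 holomorphic_on UNIV"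
      "\<And>w. p w = (w - z) * p1 w" "\<And>w. r w = (w - z) * r1 w" "\<And>w. s w = (w - z) * s1 w" "p1 z \<noteq> 0" "(p1 z)\<^sup>2 + r1 z * s1 z \<noteq> 0"
      by blast
    have "zorder (\<lambda>w. (Delta T (\<lambda>t. complex_of_real (q' t)) w)\<^sup>2 - 4) z = 2"
      unfolding Delta
    proof (rule zorder_eqI[of UNIV])
      show "(\<lambda>w. 4 * ((p1 w)\<^sup>2 + r1 w * s1 w)) holomorphic_on UNIV" by (intro holomorphic_intros h)
      show "4 * F w = 4 * ((p1 w)\<^sup>2 + r1 w * s1 w) * (w - z) powi 2" for w
        by (simp add: F_def h(4-6) power2_eq_square algebra_simps)
      show "4 * ((p1 z)\<^sup>2 + r1 z * s1 z) \<noteq> 0" unfolding mult_eq_0_iff using h(8) by simp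
    qed auto
    moreover have "matrix_order G z = 1"
    proof -
      have zp: "zorder p z = 1"
        by (rule zorder_eqI[of UNIV z p1]) (use h in auto)
      obtain w0 where w0: "p w0 \<noteq> 0"
      proof (atomize_elim, rule ccontr)
        assume "\<nexists>w. p w \<noteq> 0"
        then have "p1 w = 0" if "w \<noteq> z" for w using h(4)[of w] that by auto
        then have "(p1 \<longlongrightarrow> 0) (at z)" by (intro tendsto_eventually) (auto simp: eventually_at_filter)
        moreover have "(p1 \<longlongrightarrow> p1 z) (at z)"
          using h(1)[THEN holomorphic_on_imp_continuous_on] by (auto simp: continuous_on_def)
        ultimately show False using h(7) tendsto_unique[of "at z"] by auto
      qed
      have Gz: "G z $ i $ j = 0" for i j using exhaust_2[of i] exhaust_2[of j] h(4-6)[of z] by (auto simp: G)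
      have "1 \<le> zorder (\<lambda>w. G w $ i $ j) z" if "G w $ i $ j \<noteq> 0" for i j w
        using zorder_entire(2)[OF Ghol that] Gz by simp
      then show ?thesis by (rule matrix_order_eqI[of _ _ _ w0 1 1]) (use w0 zp in \<open>simp_all add: G\<close>)
    qed
    ultimately show ?thesis by simp
  qed
  have "finite {z \<in> UNIV. real_of_int (zorder (\<lambda>w. (Delta T (\<lambda>t. complex_of_real (q' t)) w)\<^sup>2 - 4) z - 2 * matrix_order G z) \<noteq> 0}"
  proof (rule finite_subset[OF _ fin], rule subsetI, rule ccontr)
    fix z assume "z \<in> {z \<in> UNIV. real_of_int (zorder (\<lambda>w. (Delta T (\<lambda>t. complex_of_real (q' t)) w)\<^sup>2 - 4) z - 2 * matrix_order G z) \<noteq> 0}" "z \<notin> bad"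
    then show False using summand[of z] by simp
  qed
  then show ?thesis unfolding finite_gap_def G_def by (rule finite_nonzero_values_imp_summable_on)
qed

end

section \<open>Oscillatory integrals\<close>

lemma mean_value_affine:
  fixes f :: "real \<Rightarrow> complex"
  assumes f: "\<And>t. (f has_vector_derivative f' t) (at t)" and t: "t \<ge> 0"
    and b: "\<And>s. 0 \<le> s \<Longrightarrow> s \<le> t \<Longrightarrow> cmod (f' s - w) \<le> B"
  shows "cmod (f t - f 0 - of_real t * w) \<le> B * t"
proof -
  have "cmod ((\<lambda>t. f t - f 0 - of_real t * w) t) \<le> (cmod ((\<lambda>t. f t - f 0 - of_real t * w) 0) + B * t) * exp (0 * t)"
  proof (rule duhamel_bound[where k = 0 and g = "\<lambda>s. f' s - w"])
    show "((\<lambda>t. f t - f 0 - of_real t * w) has_vector_derivative 0 * (f s - f 0 - of_real s * w) + (f' s - w)) (at s)" for s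
      using f[of s] by (auto intro!: derivative_eq_intros)
  qed (use b t in auto)
  then show ?thesis by simp
qed

text \<open>
  The substitution \<open>v1 = u1 + cnj h u2\<close>, \<open>v2 = u2 - h u1\<close> removes the oscillating part \<open>h'\<close> of
  the coefficient \<open>g = c + h'\<close>; as \<open>h\<close> vanishes at both ends, it does not change the monodromy.
\<close>

lemma gap_estimate:
  fixes u1 u2 g h :: "real \<Rightarrow> complex" and c :: complex and \<mu> T G H e :: real
  assumes T: "T > 0"
    and d1: "\<And>t. (u1 has_vector_derivative (\<i> * of_real \<mu> / 2 * u1 t - cnj (g t) * u2 t)) (at t)"
    and d2: "\<And>t. (u2 has_vector_derivative (g t * u1 t - \<i> * of_real \<mu> / 2 * u2 t)) (at t)"
    and i: "u1 0 = 1" "u2 0 = 0" and n: "\<And>t. cmod (u1 t) \<le> 1" "\<And>t. cmod (u2 t) \<le> 1"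
    and h: "\<And>t. (h has_vector_derivative (g t - c)) (at t)" "h 0 = 0" "h T = 0"
    and hH: "\<And>t. t \<in> {0..T} \<Longrightarrow> cmod (h t) \<le> H" and gG: "\<And>t. t \<in> {0..T} \<Longrightarrow> cmod (g t) \<le> G"
    and e: "cmod c \<le> e" "\<bar>\<mu>\<bar> \<le> e" "H \<le> e" "0 \<le> e" "e \<le> 1"
    and k1: "k1 = T * (2 + G) + 1" and k2: "k2 = k1 * (2 + G) + 1"
  shows "cmod (u2 T - of_real T * c) \<le> T * k2 * e\<^sup>2" "\<bar>Im (u1 T) - \<mu> * T / 2\<bar> \<le> T * (H * G + k2 * e\<^sup>2)"
    "cmod (u1 T - 1) \<le> k1 * e"
proof -
  have G: "G \<ge> 0" using order_trans[OF norm_ge_zero gG[of 0]] T by simp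
  have he: "cmod (h t) \<le> e" if "t \<in> {0..T}" for t using hH[OF that] e(3) by simp
  have H: "H \<ge> 0" using order_trans[OF norm_ge_zero hH[of 0]] T by simp
  have k1p: "k1 \<ge> 0" using k1 T G by simp
  have mu: "cmod (\<i> * of_real \<mu> / 2) = \<bar>\<mu>\<bar> / 2" by (simp add: norm_mult norm_divide)
  have ee: "e * e \<le> e" using e mult_left_mono[of e 1 e] by simp
  define v1 where "v1 t = u1 t + cnj (h t) * u2 t" for t
  define v2 where "v2 t = u2 t - h t * u1 t" for t
  \<comment> \<open>In \<open>w1\<close> the product of \<open>cnj h\<close> and \<open>g\<close>
    meets \<open>u1\<close>, which is near 1, so it is only of first order, \<open>H * G\<close>. In
    \<open>w2\<close> the corresponding product meets \<open>u2\<close>, which is itself small.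
    Hence the term \<open>H * G\<close> in the bound for \<open>Im u1\<close> and the purely
    quadratic bound for \<open>u2\<close>.\<close>
  define w1 where "w1 t = \<i> * of_real \<mu> / 2 * u1 t - cnj c * u2 t + cnj (h t) * (g t * u1 t) - \<i> * of_real \<mu> / 2 * (cnj (h t) * u2 t)" for t
  define w2 where "w2 t = c * u1 t - \<i> * of_real \<mu> / 2 * u2 t - \<i> * of_real \<mu> / 2 * (h t * u1 t) + h t * (cnj (g t) * u2 t)" for t
  have dv1: "(v1 has_vector_derivative w1 t) (at t)" for t
  proof -
    have "(v1 has_vector_derivative (\<i> * of_real \<mu> / 2 * u1 t - cnj (g t) * u2 t) +
       (cnj (h t) * (g t * u1 t - \<i> * of_real \<mu> / 2 * u2 t) + cnj (g t - c) * u2 t)) (at t)"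
      unfolding v1_def by (intro has_vector_derivative_add has_vector_derivative_mult has_vector_derivative_cnj d1 d2 h)
    then show ?thesis by (rule back_subst[of "\<lambda>d. (_ has_vector_derivative d) (at t)"]) (simp add: w1_def algebra_simps)
  qed
  have dv2: "(v2 has_vector_derivative w2 t) (at t)" for t
  proof -
    have "(v2 has_vector_derivative (g t * u1 t - \<i> * of_real \<mu> / 2 * u2 t) -
       (h t * (\<i> * of_real \<mu> / 2 * u1 t - cnj (g t) * u2 t) + (g t - c) * u1 t)) (at t)"
      unfolding v2_def by (intro has_vector_derivative_diff has_vector_derivative_mult d1 d2 h)
    then show ?thesis by (rule back_subst[of "\<lambda>d. (_ has_vector_derivative d) (at t)"]) (simp add: w2_def algebra_simps)
  qed
  have four: "cmod (p + q + r + s) \<le> cmod p + cmod q + cmod r + cmod s" "cmod (p - q + r - s) \<le> cmod p + cmod q + cmod r + cmod s"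
     "cmod (p - q - r + s) \<le> cmod p + cmod q + cmod r + cmod s" for p q r s :: complex
    by (meson norm_triangle_ineq norm_triangle_ineq4 norm_triangle_le norm_triangle_le_diff add_mono order_refl order_trans)+
  have pr: "cmod (x * y) \<le> X * Y" if "cmod x \<le> X" "cmod y \<le> Y" for x y X Y
    unfolding norm_mult using that by (intro mult_mono) (auto intro: order_trans[OF norm_ge_zero])
  have mu': "cmod (\<i> * of_real \<mu> / 2) \<le> e / 2" using mu e by simp
  have v0: "v1 0 = 1" "v2 0 = 0" "v1 T = u1 T" "v2 T = u2 T" using i h by (auto simp: v1_def v2_def)
  \<comment> \<open>The estimate is made in two passes. The first bounds the derivatives, and
    thereby \<open>u2\<close> and \<open>u1 - 1\<close>, by multiples of \<open>e\<close>, with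
    constant \<open>k1\<close>; the second feeds this back into the equations and leaves quadratic
    errors, with constant \<open>k2\<close>.\<close>
  have first: "cmod (w1 t) \<le> (2 + G) * e \<and> cmod (w2 t) \<le> (2 + G) * e" if t: "t \<in> {0..T}" for t
  proof -
    note b = he[OF t] gG[OF t] n[of t]
    have "cmod (\<i> * of_real \<mu> / 2 * u1 t) \<le> e / 2 * 1" "cmod (\<i> * of_real \<mu> / 2 * u2 t) \<le> e / 2 * 1" "cmod (c * u1 t) \<le> e * 1" "cmod (cnj c * u2 t) \<le> e * 1"
       "cmod (cnj (h t) * (g t * u1 t)) \<le> e * (G * 1)" "cmod (h t * (cnj (g t) * u2 t)) \<le> e * (G * 1)"
       "cmod (\<i> * of_real \<mu> / 2 * (cnj (h t) * u2 t)) \<le> e / 2 * (e * 1)" "cmod (\<i> * of_real \<mu> / 2 * (h t * u1 t)) \<le> e / 2 * (e * 1)"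
      by (intro pr mu'; use b e in simp)+
    then have "cmod (w1 t) \<le> e / 2 + e + e * G + e / 2 * e" "cmod (w2 t) \<le> e + e / 2 + e / 2 * e + e * G"
      unfolding w1_def w2_def by (smt (verit) four mult_1_right)+
    then show ?thesis using ee by (auto simp: algebra_simps)
  qed
  have v2t: "cmod (v2 t) \<le> (2 + G) * e * T" and v1t: "cmod (v1 t - 1) \<le> (2 + G) * e * T" if t: "t \<in> {0..T}" for t
  proof -
    have tT: "(2 + G) * e * t \<le> (2 + G) * e * T" using t G e by (intro mult_left_mono) auto
    have "cmod (v2 t - v2 0 - of_real t * 0) \<le> (2 + G) * e * t"
      by (rule mean_value_affine[OF dv2]) (use first t in auto)
    then show "cmod (v2 t) \<le> (2 + G) * e * T" using tT v0 by simp
    have "cmod (v1 t - v1 0 - of_real t * 0) \<le> (2 + G) * e * t"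
      by (rule mean_value_affine[OF dv1]) (use first t in auto)
    then show "cmod (v1 t - 1) \<le> (2 + G) * e * T" using tT v0 by simp
  qed
  have u2t: "cmod (u2 t) \<le> k1 * e" and u1t: "cmod (u1 t - 1) \<le> k1 * e" if t: "t \<in> {0..T}" for t
  proof -
    have "cmod (h t * u1 t) \<le> e * 1" "cmod (cnj (h t) * u2 t) \<le> e * 1" by (intro pr; use he[OF t] n in simp)+
    then show "cmod (u2 t) \<le> k1 * e" "cmod (u1 t - 1) \<le> k1 * e"
      using v2t[OF t] v1t[OF t] norm_triangle_ineq[of "v2 t" "h t * u1 t"] norm_triangle_ineq4[of "v1 t - 1" "cnj (h t) * u2 t"]
      unfolding k1 v1_def v2_def by (simp_all add: algebra_simps)
  qed
  have k: "k1 * (e * e) \<ge> 0" "G * (k1 * (e * e)) \<ge> 0" "e * e \<ge> 0" using k1p G by auto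
  have ks: "e * (k1 * e) = k1 * (e * e)" "e / 2 * (k1 * e) = k1 * (e * e) / 2" "e / 2 * (e * 1) = e * e / 2"
     "e * (G * (k1 * e)) = G * (k1 * (e * e))" "k2 * e\<^sup>2 = 2 * (k1 * (e * e)) + G * (k1 * (e * e)) + e * e"
    by (simp_all add: k2 power2_eq_square algebra_simps)
  have second: "cmod (w2 t - c) \<le> k2 * e\<^sup>2 \<and> cmod (w1 t - \<i> * of_real \<mu> / 2) \<le> H * G + k2 * e\<^sup>2" if t: "t \<in> {0..T}" for t
  proof -
    note b = he[OF t] gG[OF t] n[of t] u1t[OF t] u2t[OF t] hH[OF t]
    have "cmod (c * (u1 t - 1)) \<le> e * (k1 * e)" "cmod (\<i> * of_real \<mu> / 2 * u2 t) \<le> e / 2 * (k1 * e)"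
       "cmod (\<i> * of_real \<mu> / 2 * (h t * u1 t)) \<le> e / 2 * (e * 1)" "cmod (h t * (cnj (g t) * u2 t)) \<le> e * (G * (k1 * e))"
      by (intro pr mu'; use b e in simp)+
    then have 1: "cmod (c * (u1 t - 1) - \<i> * of_real \<mu> / 2 * u2 t - \<i> * of_real \<mu> / 2 * (h t * u1 t) + h t * (cnj (g t) * u2 t))
       \<le> e * (k1 * e) + e / 2 * (k1 * e) + e / 2 * (e * 1) + e * (G * (k1 * e))"
      using four(3) by (rule order_trans[rotated, OF add_mono[OF add_mono[OF add_mono]]])
    have "w2 t - c = c * (u1 t - 1) - \<i> * of_real \<mu> / 2 * u2 t - \<i> * of_real \<mu> / 2 * (h t * u1 t) + h t * (cnj (g t) * u2 t)"
      by (simp add: w2_def algebra_simps)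
    moreover have "e * (k1 * e) + e / 2 * (k1 * e) + e / 2 * (e * 1) + e * (G * (k1 * e)) \<le> k2 * e\<^sup>2"
      using k unfolding ks by linarith
    ultimately have A: "cmod (w2 t - c) \<le> k2 * e\<^sup>2" using 1 by simp
    have "cmod (\<i> * of_real \<mu> / 2 * (u1 t - 1)) \<le> e / 2 * (k1 * e)" "cmod (cnj c * u2 t) \<le> e * (k1 * e)"
       "cmod (cnj (h t) * (g t * u1 t)) \<le> H * (G * 1)" "cmod (\<i> * of_real \<mu> / 2 * (cnj (h t) * u2 t)) \<le> e / 2 * (e * 1)"
      by (intro pr mu'; use b e in simp)+
    then have 2: "cmod (\<i> * of_real \<mu> / 2 * (u1 t - 1) - cnj c * u2 t + cnj (h t) * (g t * u1 t) - \<i> * of_real \<mu> / 2 * (cnj (h t) * u2 t))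
       \<le> e / 2 * (k1 * e) + e * (k1 * e) + H * (G * 1) + e / 2 * (e * 1)"
      using four(2) by (rule order_trans[rotated, OF add_mono[OF add_mono[OF add_mono]]])
    have "w1 t - \<i> * of_real \<mu> / 2 = \<i> * of_real \<mu> / 2 * (u1 t - 1) - cnj c * u2 t + cnj (h t) * (g t * u1 t) - \<i> * of_real \<mu> / 2 * (cnj (h t) * u2 t)"
      by (simp add: w1_def algebra_simps diff_divide_distrib)
    moreover have "e / 2 * (k1 * e) + e * (k1 * e) + H * (G * 1) + e / 2 * (e * 1) \<le> H * G + k2 * e\<^sup>2"
      using k unfolding ks by linarith
    ultimately show ?thesis using A 2 by simp
  qed
  have "cmod (v2 T - v2 0 - of_real T * c) \<le> k2 * e\<^sup>2 * T"
    by (rule mean_value_affine[OF dv2]) (use second T in auto)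
  then show "cmod (u2 T - of_real T * c) \<le> T * k2 * e\<^sup>2" using v0 by (simp add: mult_ac)
  have "cmod (v1 T - v1 0 - of_real T * (\<i> * of_real \<mu> / 2)) \<le> (H * G + k2 * e\<^sup>2) * T"
    by (rule mean_value_affine[OF dv1]) (use second T in auto)
  moreover have "\<bar>Im (u1 T) - \<mu> * T / 2\<bar> = \<bar>Im (v1 T - v1 0 - of_real T * (\<i> * of_real \<mu> / 2))\<bar>"
    using v0 by (simp add: mult_ac)
  ultimately show "\<bar>Im (u1 T) - \<mu> * T / 2\<bar> \<le> T * (H * G + k2 * e\<^sup>2)"
    using abs_Im_le_cmod[of "v1 T - v1 0 - of_real T * (\<i> * of_real \<mu> / 2)"] by (simp add: mult.commute)
  show "cmod (u1 T - 1) \<le> k1 * e" using u1t[of T] T by simp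
qed

section \<open>Partial Fourier integrals\<close>

lemma has_vector_derivative_cis_mult:
  "((\<lambda>s. cis (a * s)) has_vector_derivative \<i> * of_real a * cis (a * s)) (at s)"
proof -
  have "((\<lambda>w. exp (\<i> * of_real a * w)) has_field_derivative \<i> * of_real a * exp (\<i> * of_real a * of_real s)) (at (of_real s))"
    by (auto intro!: derivative_eq_intros)
  from has_vector_derivative_real_field[OF this] show ?thesis by (simp add: cis_conv_exp mult_ac)
qed

lemma continuous_on_cis_mult [continuous_intros]: "continuous_on S (\<lambda>s. cis (a * s))"
  by (intro continuous_at_imp_continuous_on ballI has_vector_derivative_continuous[OF has_vector_derivative_cis_mult])

lemma integral_cis:
  assumes "a \<noteq> 0" "0 \<le> t"
  shows "integral {0..t} (\<lambda>s. cis (a * s)) = (cis (a * t) - 1) / (\<i> * of_real a)"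
proof -
  have "((\<lambda>s. cis (a * s) / (\<i> * of_real a)) has_vector_derivative cis (a * s)) (at s)" for s
    using bounded_linear.has_vector_derivative[OF bounded_linear_divide[of "\<i> * of_real a"] has_vector_derivative_cis_mult[of a s]] assms by simp
  from integral_of_derivative[OF this assms(2)] show ?thesis by (simp add: integral_unique diff_divide_distrib)
qed

lemma norm_integral_cis_le:
  assumes "a \<noteq> 0" "0 \<le> t"
  shows "cmod (integral {0..t} (\<lambda>s. cis (a * s))) \<le> 2 / \<bar>a\<bar>"
proof -
  have "cmod (cis (a * t) - 1) \<le> 2" using norm_triangle_ineq4[of "cis (a * t)" 1] by simp
  then show ?thesis unfolding integral_cis[OF assms] by (simp add: norm_divide norm_mult divide_right_mono)
qed

text \<open>Besides the Fourier coefficient at \<open>t = T\<close> the unfinished integrals matter: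
  up to a factor 1/2 and a linear function of \<open>t\<close> they are the substitution
  \<open>h\<close> of \<open>gap_estimate\<close>.\<close>

definition osc :: "real \<Rightarrow> (real \<Rightarrow> real) \<Rightarrow> nat \<Rightarrow> real \<Rightarrow> complex" where
  "osc T q n t = integral {0..t} (\<lambda>s. of_real (q s) * cis (2 * pi / T * real n * s))"

lemma osc_integrable:
  "continuous_on UNIV q \<Longrightarrow> (\<lambda>s. of_real (q s) * cis (2 * pi / T * real n * s)) integrable_on {a..b}"
  by (intro integrable_continuous_real continuous_intros) (auto intro: continuous_on_subset)

lemma osc_add:
  assumes "continuous_on UNIV p" "continuous_on UNIV q"
  shows "osc T (\<lambda>s. p s + q s) n t = osc T p n t + osc T q n t"
  unfolding osc_def using osc_integrable[OF assms(1)] osc_integrable[OF assms(2)]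
  by (subst Henstock_Kurzweil_Integration.integral_add[symmetric]) (auto simp: algebra_simps)

text \<open>One integration by parts leaves boundary terms, hence the rate 1/n for general
  \<open>t\<close>. Over a full period the boundary terms cancel, and a second integration by parts
  gives 1/n^2.\<close>

lemma osc_C2_periodic:
  assumes T: "T > 0" and p: "C2_periodic T p"
  shows "\<exists>P\<ge>0. \<forall>n\<ge>1. (\<forall>t\<in>{0..T}. cmod (osc T p n t) \<le> P / real n) \<and> cmod (osc T p n T) \<le> P / (real n)\<^sup>2"
proof -
  obtain p1 p2 where d: "\<And>t. (p has_real_derivative p1 t) (at t)" "\<And>t. (p1 has_real_derivative p2 t) (at t)"
    "continuous_on UNIV p2" "\<And>t. p (t + T) = p t" "\<And>t. p1 (t + T) = p1 t"
    using p unfolding C2_periodic_def by auto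
  have c: "continuous_on UNIV p" "continuous_on UNIV p1" using d(1,2) continuous_on_DERIV_UNIV by blast+
  have "\<exists>P\<ge>0. \<forall>t\<in>{0..T}. \<bar>f t\<bar> \<le> P" if "continuous_on UNIV f" for f :: "real \<Rightarrow> real"
    using continuous_on_compact_bound[OF compact_Icc continuous_on_subset[OF that], of 0 T] by (metis subset_UNIV real_norm_def)
  from this[OF c(1)] this[OF c(2)] this[OF d(3)] obtain P0 P1 P2 where
    P: "P0 \<ge> 0" "P1 \<ge> 0" "P2 \<ge> 0" "\<And>t. t \<in> {0..T} \<Longrightarrow> \<bar>p t\<bar> \<le> P0" "\<And>t. t \<in> {0..T} \<Longrightarrow> \<bar>p1 t\<bar> \<le> P1" "\<And>t. t \<in> {0..T} \<Longrightarrow> \<bar>p2 t\<bar> \<le> P2"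
    by metis
  define \<omega> where "\<omega> = 2 * pi / T"
  have \<omega>: "\<omega> > 0" using T by (simp add: \<omega>_def)
  have ibp: "\<i> * of_real (\<omega> * real n) * osc T f n t = of_real (f t) * cis (\<omega> * real n * t) - of_real (f 0) - osc T f' n t"
    if f: "\<And>t. (f has_real_derivative f' t) (at t)" and f': "continuous_on UNIV f'" and t: "0 \<le> t" for f f' n t
  proof -
    have df: "((\<lambda>s. complex_of_real (f s)) has_vector_derivative of_real (f' s)) (at s)" for s
      using bounded_linear.has_vector_derivative[OF bounded_linear_of_real] f[of s]
      by (simp add: has_real_derivative_iff_has_vector_derivative)
    have "((\<lambda>s. of_real (f s) * cis (\<omega> * real n * s)) has_vector_derivative
       of_real (f s) * (\<i> * of_real (\<omega> * real n) * cis (\<omega> * real n * s)) + of_real (f' s) * cis (\<omega> * real n * s)) (at s)" for s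
      by (intro has_vector_derivative_mult df has_vector_derivative_cis_mult)
    note integral_unique[OF integral_of_derivative[OF this t]]
    moreover have "integral {0..t} (\<lambda>s. of_real (f s) * (\<i> * of_real (\<omega> * real n) * cis (\<omega> * real n * s)) + of_real (f' s) * cis (\<omega> * real n * s))
       = \<i> * of_real (\<omega> * real n) * osc T f n t + osc T f' n t"
    proof -
      have "integral {0..t} (\<lambda>s. \<i> * of_real (\<omega> * real n) * (of_real (f s) * cis (\<omega> * real n * s)) + of_real (f' s) * cis (\<omega> * real n * s))
       = \<i> * of_real (\<omega> * real n) * osc T f n t + osc T f' n t"
        unfolding osc_def \<omega>_def[symmetric]
        using integrable_on_mult_right[OF osc_integrable[OF continuous_on_DERIV_UNIV[OF f], of T n, folded \<omega>_def]] osc_integrable[OF f', of T n, folded \<omega>_def]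
        by (subst Henstock_Kurzweil_Integration.integral_add) (assumption | simp only: integral_mult_right)+
      then show ?thesis by (simp add: mult_ac)
    qed
    ultimately show ?thesis by (simp add: algebra_simps)
  qed
  have oscb: "cmod (osc T f n t) \<le> P * T" if "continuous_on UNIV f" "\<And>t. t \<in> {0..T} \<Longrightarrow> \<bar>f t\<bar> \<le> P" "t \<in> {0..T}" "P \<ge> 0" for f n t P
  proof -
    have "cmod (osc T f n t) \<le> P * (t - 0)" unfolding osc_def
      by (rule integral_bound) (use that T in \<open>auto intro!: continuous_intros intro: continuous_on_subset simp: norm_mult\<close>)
    also have "\<dots> \<le> P * T" using that by (intro mult_left_mono) auto
    finally show ?thesis .
  qed
  have perT: "p T = p 0" "p1 T = p1 0" using d(4)[of 0] d(5)[of 0] by auto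
  have cisT: "cis (\<omega> * real n * T) = 1" for n
  proof -
    have eq: "\<omega> * real n * T = 2 * pi * real n" using T by (simp add: \<omega>_def)
    show ?thesis unfolding eq by (rule cis_multiple_2pi) simp
  qed
  define P where "P = (2 * P0 + P1 * T) / \<omega> + P2 * T / \<omega>\<^sup>2"
  show ?thesis
  proof (intro exI[of _ P] conjI allI impI ballI)
    show "P \<ge> 0" using P \<omega> T by (simp add: P_def)
    fix n :: nat assume n: "n \<ge> 1"
    have \<omega>n: "\<omega> * real n > 0" using \<omega> n by simp
    have no: "cmod (\<i> * of_real (\<omega> * real n) * x) = \<omega> * real n * cmod x" for x
      by (simp only: norm_mult norm_of_real norm_ii abs_of_pos[OF \<omega>n] mult_1)
    show "cmod (osc T p n t) \<le> P / real n" if t: "t \<in> {0..T}" for t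
    proof -
      have "\<omega> * real n * cmod (osc T p n t) = cmod (of_real (p t) * cis (\<omega> * real n * t) - of_real (p 0) - osc T p1 n t)"
        unfolding no[symmetric] using ibp[OF d(1) c(2), of t n] t by simp
      also have "\<dots> \<le> cmod (of_real (p t) * cis (\<omega> * real n * t)) + cmod (complex_of_real (p 0)) + cmod (osc T p1 n t)"
        by (meson norm_triangle_ineq4 norm_triangle_le_diff add_mono order_refl order_trans)
      also have "\<dots> \<le> P0 + P0 + P1 * T"
        using P(4)[OF t] P(4)[of 0] T oscb[OF c(2) P(5) t P(2)] by (intro add_mono) (auto simp: norm_mult)
      finally have "cmod (osc T p n t) \<le> (2 * P0 + P1 * T) / \<omega> / real n" using \<omega> n by (simp add: field_simps)
      also have "\<dots> \<le> P / real n" using P T \<omega> by (intro divide_right_mono) (auto simp: P_def)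
      finally show ?thesis .
    qed
    have "\<omega> * real n * cmod (osc T p n T) = cmod (osc T p1 n T)"
      unfolding no[symmetric] using ibp[OF d(1) c(2), of T n] T by (simp add: cisT perT)
    moreover have "\<omega> * real n * cmod (osc T p1 n T) = cmod (osc T p2 n T)"
      unfolding no[symmetric] using ibp[OF d(2) d(3), of T n] T by (simp add: cisT perT)
    moreover have "cmod (osc T p2 n T) \<le> P2 * T" by (rule oscb[OF d(3) P(6)]) (use T P in auto)
    ultimately have "(\<omega> * real n) * ((\<omega> * real n) * cmod (osc T p n T)) \<le> P2 * T" by simp
    then have "cmod (osc T p n T) \<le> P2 * T / \<omega>\<^sup>2 / (real n)\<^sup>2" using \<omega> n by (simp add: field_simps power2_eq_square)
    also have "\<dots> \<le> P / (real n)\<^sup>2" using P T \<omega> by (intro divide_right_mono) (auto simp: P_def)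
    finally show "cmod (osc T p n T) \<le> P / (real n)\<^sup>2" .
  qed
qed

section \<open>Fourier series of the perturbation\<close>

definition pert :: "real \<Rightarrow> (nat \<Rightarrow> complex) \<Rightarrow> real \<Rightarrow> real" where
  "pert T g t = (\<Sum>m. 2 * Re (cnj (g m) * cis (2 * pi / T * real m * t)))"

lemma pert_term_le: "\<bar>2 * Re (cnj (g m) * cis x)\<bar> \<le> 2 * cmod (g m)"
  using abs_Re_le_cmod[of "cnj (g m) * cis x"] by (simp add: norm_mult)

lemma pert_summable:
  assumes "summable (\<lambda>m. cmod (g m))"
  shows "summable (\<lambda>m. 2 * Re (cnj (g m) * cis (2 * pi / T * real m * t)))"
  by (rule summable_comparison_test'[OF summable_mult[OF assms, of 2], of 0]) (use pert_term_le in simp)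

lemma pert_uniform:
  assumes "summable (\<lambda>m. cmod (g m))"
  shows "uniform_limit UNIV (\<lambda>n t. \<Sum>m<n. 2 * Re (cnj (g m) * cis (2 * pi / T * real m * t))) (pert T g) sequentially"
  unfolding pert_def by (rule Weierstrass_m_test[OF _ summable_mult[OF assms, of 2]]) (use pert_term_le in simp)

lemma pert_continuous:
  assumes "summable (\<lambda>m. cmod (g m))"
  shows "continuous_on UNIV (pert T g)"
  by (rule uniform_limit_theorem[OF _ pert_uniform[OF assms]]) (intro always_eventually allI continuous_intros, simp)

lemma pert_periodic:
  assumes "T > 0"
  shows "pert T g (t + T) = pert T g t"
proof -
  have "cis (2 * pi / T * real m * (t + T)) = cis (2 * pi / T * real m * t)" for m
  proof -
    have eq: "2 * pi / T * real m * (t + T) = 2 * pi / T * real m * t + 2 * pi * real m" using assms by (simp add: field_simps)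
    have "cis (2 * pi * real m) = 1" by (rule cis_multiple_2pi) simp
    then show ?thesis unfolding eq cis_mult[symmetric] by simp
  qed
  then show ?thesis by (simp only: pert_def)
qed

lemma pert_bound:
  assumes "summable (\<lambda>m. cmod (g m))"
  shows "\<bar>pert T g t\<bar> \<le> 2 * (\<Sum>m. cmod (g m))"
proof -
  have s: "summable (\<lambda>m. 2 * cmod (g m))" by (rule summable_mult[OF assms])
  have "\<bar>pert T g t\<bar> \<le> (\<Sum>m. \<bar>2 * Re (cnj (g m) * cis (2 * pi / T * real m * t))\<bar>)"
    unfolding pert_def by (rule summable_rabs, rule summable_comparison_test'[OF s, of 0]) (use pert_term_le in simp)
  also have "\<dots> \<le> (\<Sum>m. 2 * cmod (g m))"
  proof (rule suminf_le[OF _ _ s])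
    show "\<bar>2 * Re (cnj (g m) * cis (2 * pi / T * real m * t))\<bar> \<le> 2 * cmod (g m)" for m by (rule pert_term_le)
    show "summable (\<lambda>m. \<bar>2 * Re (cnj (g m) * cis (2 * pi / T * real m * t))\<bar>)"
      by (rule summable_comparison_test'[OF s, of 0]) (use pert_term_le in simp)
  qed
  also have "\<dots> = 2 * (\<Sum>m. cmod (g m))" by (rule suminf_mult[OF assms])
  finally show ?thesis .
qed

lemma pert_diff:
  assumes "summable (\<lambda>m. cmod (g m))" "summable (\<lambda>m. cmod (g' m))"
  shows "\<bar>pert T g t - pert T g' t\<bar> \<le> 2 * (\<Sum>m. cmod (g m - g' m))"
proof -
  have s: "summable (\<lambda>m. cmod (g m - g' m))"
    by (rule summable_comparison_test'[OF summable_add[OF assms], of 0]) (simp add: norm_triangle_ineq4)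
  have "pert T g t - pert T g' t = pert T (\<lambda>m. g m - g' m) t"
    unfolding pert_def suminf_diff[OF pert_summable[OF assms(1)] pert_summable[OF assms(2)]]
    by (rule suminf_cong) (simp add: algebra_simps)
  then show ?thesis using pert_bound[OF s] by simp
qed

text \<open>Each real mode \<open>m\<close> multiplied by the mode \<open>n\<close> splits into the
  frequencies \<open>n + m\<close> and \<open>n - m\<close>; only the second with
  \<open>m = n\<close> fails to oscillate. Uniform convergence allows integration term by
  term.\<close>

lemma osc_pert_terms:
  fixes g :: "nat \<Rightarrow> complex"
  assumes s: "summable (\<lambda>m. cmod (g m))" and T: "T > 0"
  shows "(\<lambda>m. integral {0..t} (\<lambda>s. cnj (g m) * cis (2 * pi / T * (real n + real m) * s) + g m * cis (2 * pi / T * (real n - real m) * s)))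
     sums osc T (pert T g) n t"
proof -
  define f where "f m s = cnj (g m) * cis (2 * pi / T * (real n + real m) * s) + g m * cis (2 * pi / T * (real n - real m) * s)" for m s
  have cf: "continuous_on S (f m)" for m S unfolding f_def by (intro continuous_intros)
  have f: "f m s = of_real (2 * Re (cnj (g m) * cis (2 * pi / T * real m * s))) * cis (2 * pi / T * real n * s)" for m s
  proof -
    define x y where "x = 2 * pi / T * real m * s" and "y = 2 * pi / T * real n * s"
    have e: "2 * pi / T * (real n + real m) * s = x + y" "2 * pi / T * (real n - real m) * s = - x + y"
      by (simp_all add: x_def y_def algebra_simps diff_divide_distrib add_divide_distrib)
    have "complex_of_real (2 * Re (cnj (g m) * cis x)) = cnj (g m) * cis x + cnj (cnj (g m) * cis x)"
      using complex_add_cnj[of "cnj (g m) * cis x"] by simp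
    then show ?thesis unfolding f_def e x_def[symmetric] y_def[symmetric] cis_mult[symmetric]
      by (simp add: algebra_simps flip: cis_cnj)
  qed
  have ul: "uniform_limit {0..t} (\<lambda>n s. \<Sum>m<n. f m s) (\<lambda>s. \<Sum>m. f m s) sequentially"
  proof (rule Weierstrass_m_test[OF _ summable_mult[OF s, of 2]])
    show "norm (f m s) \<le> 2 * cmod (g m)" for m s
      unfolding f using pert_term_le[of g m] by (simp only: norm_mult norm_of_real norm_cis mult_1_right)
  qed
  have sum_f: "(\<Sum>m. f m s) = of_real (pert T g s) * cis (2 * pi / T * real n * s)" for s
  proof -
    have "(\<lambda>m. f m s) sums (of_real (pert T g s) * cis (2 * pi / T * real n * s))"
      unfolding f pert_def by (intro sums_mult2 sums_of_real summable_sums pert_summable assms)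
    then show ?thesis by (rule sums_unique[symmetric])
  qed
  have c: "\<And>n. continuous_on {0..t} (\<lambda>s. \<Sum>m<n. f m s)" by (intro continuous_on_sum cf)
  obtain I J where IJ: "\<And>n. ((\<lambda>s. \<Sum>m<n. f m s) has_integral I n) {0..t}" "((\<lambda>s. \<Sum>m. f m s) has_integral J) {0..t}" "(I \<longlongrightarrow> J) sequentially"
    by (rule uniform_limit_integral[OF ul c sequentially_bot]) (rule that)
  have "I n = (\<Sum>m<n. integral {0..t} (f m))" for n
    using integral_unique[OF IJ(1), of n] by (subst (asm) Henstock_Kurzweil_Integration.integral_sum) (auto intro!: integrable_continuous_real cf)
  then have I: "I = (\<lambda>n. \<Sum>m<n. integral {0..t} (f m))" by (rule ext)
  have J: "J = osc T (pert T g) n t" using integral_unique[OF IJ(2)] unfolding sum_f osc_def by simp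
  have "(\<lambda>m. integral {0..t} (f m)) sums osc T (pert T g) n t" using IJ(3) unfolding I J sums_def .
  then show ?thesis unfolding f_def .
qed

text \<open>The term \<open>m = n\<close> is \<open>1 / 0 = 0\<close>, so the sum runs over the
  positive distances from \<open>n\<close>; the factor 2 accounts for the two sides.\<close>

lemma sum_inverse_square_shift:
  "(\<Sum>m. 1 / (real n - real m)\<^sup>2) \<le> 2 * (\<Sum>j. 1 / (real j)\<^sup>2)" "summable (\<lambda>m. 1 / (real n - real m)\<^sup>2)"
proof -
  have s: "summable (\<lambda>j. 1 / (real j)\<^sup>2)" using inverse_power_summable[of 2, where 'a = real] by (simp add: inverse_eq_divide)
  have e: "(\<lambda>m. 1 / (real n - real (m + n))\<^sup>2) = (\<lambda>j. 1 / (real j)\<^sup>2)" by (simp add: fun_eq_iff)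
  show s': "summable (\<lambda>m. 1 / (real n - real m)\<^sup>2)"
    using s summable_iff_shift[of "\<lambda>m. 1 / (real n - real m)\<^sup>2" n] unfolding e by simp
  have "(\<Sum>m<n. 1 / (real n - real m)\<^sup>2) = (\<Sum>m<n. 1 / (real (Suc (n - Suc m)))\<^sup>2)"
    by (rule sum.cong) (auto simp: of_nat_diff Suc_diff_Suc)
  also have "\<dots> = (\<Sum>j<n. 1 / (real (Suc j))\<^sup>2)" by (rule sum.nat_diff_reindex)
  also have "\<dots> \<le> (\<Sum>j. 1 / (real (Suc j))\<^sup>2)"
    by (rule sum_le_suminf) (use s summable_Suc_iff[of "\<lambda>j. 1 / (real j)\<^sup>2"] in auto)
  also have "\<dots> = (\<Sum>j. 1 / (real j)\<^sup>2)" using suminf_split_head[OF s] by simp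
  finally have "(\<Sum>m<n. 1 / (real n - real m)\<^sup>2) \<le> (\<Sum>j. 1 / (real j)\<^sup>2)" .
  then show "(\<Sum>m. 1 / (real n - real m)\<^sup>2) \<le> 2 * (\<Sum>j. 1 / (real j)\<^sup>2)"
    using suminf_split_initial_segment[OF s', of n] unfolding e by simp
qed

text \<open>The exponent has to lie strictly between 3/2 and 2. Above 3/2 the squares of
  \<open>m * decay m\<close> are summable, as \<open>osc_pert\<close> demands; below 2
  \<open>decay\<close> eventually exceeds every multiple of 1/n^2, the size of the errors in the gap
  equations. At 0 the power is 0.\<close>

definition decay :: "nat \<Rightarrow> real" where "decay m = real m powr (-7/4)"

lemma decay: "decay m \<ge> 0" "decay 0 = 0" "summable decay"
  unfolding decay_def by (simp_all add: summable_real_powr_iff)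


lemma decay_sq_summable: "summable (\<lambda>m. (real m * decay m)\<^sup>2)"
proof -
  have "(real m * decay m)\<^sup>2 = real m powr (-3/2)" for m
  proof (cases "m = 0")
    case False
    then have "real m * decay m = real m powr (1 + -7/4)" unfolding decay_def powr_add by simp
    then show ?thesis by (simp add: power2_eq_square powr_add[symmetric])
  qed simp
  then show ?thesis by (simp add: summable_real_powr_iff)
qed

text \<open>The constant \<open>H\<close> serves the whole box of coefficients at once. For
  \<open>m \<noteq> n\<close> the denominator |n - m| has to be traded for \<open>n\<close>: from n
  <= |n - m| + m the term splits into \<open>decay m\<close> and the product of
  \<open>m * decay m\<close> with 1/|n - m|, and the inequality of means bounds the product by two
  summable squares.\<close>

lemma osc_pert:
  assumes T: "T > 0"
  shows "\<exists>H\<ge>0. \<forall>g. (\<forall>m. cmod (g m) \<le> 2 * decay m) \<longrightarrow> (\<forall>n\<ge>1. osc T (pert T g) n T = of_real T * g n \<and>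
     (\<forall>t\<in>{0..T}. cmod (osc T (pert T g) n t - of_real t * g n) \<le> H / real n))"
proof -
  define \<omega> where "\<omega> = 2 * pi / T"
  have \<omega>: "\<omega> > 0" using T by (simp add: \<omega>_def)
  define S where "S = 2 * (\<Sum>m. decay m) + (\<Sum>m. (real m * decay m)\<^sup>2) / 2 + (\<Sum>j. 1 / (real j)\<^sup>2)"
  define H where "H = 4 / \<omega> * S"
  have s2: "summable (\<lambda>j. 1 / (real j)\<^sup>2)" using inverse_power_summable[of 2, where 'a = real] by (simp add: inverse_eq_divide)
  have S: "S \<ge> 0" unfolding S_def
    by (intro add_nonneg_nonneg mult_nonneg_nonneg divide_nonneg_nonneg suminf_nonneg decay decay_sq_summable s2) (auto simp: decay)
  show ?thesis
  proof (intro exI[of _ H] conjI allI impI)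
    show "H \<ge> 0" using S \<omega> by (simp add: H_def)
    fix g :: "nat \<Rightarrow> complex" and n :: nat
    assume g: "\<forall>m. cmod (g m) \<le> 2 * decay m" and n: "n \<ge> 1"
    have sg: "summable (\<lambda>m. cmod (g m))"
      by (rule summable_comparison_test'[OF summable_mult[OF decay(3), of 2], of 0]) (use g in simp)
    define a where "a m t = integral {0..t} (\<lambda>s. cnj (g m) * cis (\<omega> * (real n + real m) * s) + g m * cis (\<omega> * (real n - real m) * s))" for m t
    have a_sums: "(\<lambda>m. a m t) sums osc T (pert T g) n t" for t unfolding a_def \<omega>_def by (rule osc_pert_terms[OF sg T])
    have a: "a m t = cnj (g m) * integral {0..t} (\<lambda>s. cis (\<omega> * (real n + real m) * s)) + g m * integral {0..t} (\<lambda>s. cis (\<omega> * (real n - real m) * s))" for m t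
    proof -
      have i: "(\<lambda>s. c * cis (x * s)) integrable_on {0..t}" for c x by (intro integrable_continuous_real continuous_intros)
      show ?thesis unfolding a_def by (simp add: Henstock_Kurzweil_Integration.integral_add[OF i i])
    qed
    have diag: "integral {0..t} (\<lambda>s. cis (\<omega> * (real n - real n) * s)) = of_real t" if "t \<ge> 0" for t using that by (simp add: scaleR_conv_of_real)
    have perT: "integral {0..T} (\<lambda>s. cis (\<omega> * k * s)) = 0" if "k \<noteq> 0" "k \<in> \<int>" for k
    proof -
      have eq: "\<omega> * k * T = 2 * pi * k" using T by (simp add: \<omega>_def)
      have "cis (\<omega> * k * T) = 1" unfolding eq by (rule cis_multiple_2pi) (use that in auto)
      then show ?thesis using integral_cis[of "\<omega> * k" T] that \<omega> T by simp
    qed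
    have "(\<lambda>m. a m T) = (\<lambda>m. if m = n then of_real T * g n else 0)"
    proof
      fix m
      have "integral {0..T} (\<lambda>s. cis (\<omega> * (real n + real m) * s)) = 0" by (rule perT) (use n in auto)
      moreover have "integral {0..T} (\<lambda>s. cis (\<omega> * (real n - real m) * s)) = (if m = n then of_real T else 0)"
      proof (cases "m = n")
        case True
        then show ?thesis using diag[of T] T by simp
      next
        case False
        then show ?thesis using perT[of "real n - real m"] by simp
      qed
      ultimately show "a m T = (if m = n then of_real T * g n else 0)" by (simp add: a)
    qed
    then have "(\<lambda>m. if m = n then of_real T * g n else 0) sums osc T (pert T g) n T" using a_sums[of T] by simp
    then show "osc T (pert T g) n T = of_real T * g n"
      using sums_single[of n "\<lambda>_. of_real T * g n"] sums_unique2 by fastforce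
    show "\<forall>t\<in>{0..T}. cmod (osc T (pert T g) n t - of_real t * g n) \<le> H / real n"
    proof
      fix t assume t: "t \<in> {0..T}"
      define b where "b m = 4 / \<omega> / real n * (2 * decay m + (real m * decay m)\<^sup>2 / 2 + 1 / (real n - real m)\<^sup>2 / 2)" for m
      have sb: "summable b" unfolding b_def
        by (intro summable_mult summable_add summable_divide decay decay_sq_summable sum_inverse_square_shift)
      have ab: "cmod (a m t - (if m = n then of_real t * g n else 0)) \<le> b m" for m
      proof (cases "m = 0")
        case True
        then have "g m = 0" using g decay(2) by (metis mult_zero_right norm_le_zero_iff)
        moreover have "b m \<ge> 0" using \<omega> by (simp add: b_def decay)
        ultimately show ?thesis using True n by (simp add: a)
      next
        case False
        have nm: "real n + real m > 0" "real n + real m \<ge> real n" using n by auto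
        have t0: "0 \<le> t" using t by simp
        have i1: "cmod (integral {0..t} (\<lambda>s. cis (\<omega> * (real n + real m) * s))) \<le> 2 / (\<omega> * real n)"
        proof -
          have "cmod (integral {0..t} (\<lambda>s. cis (\<omega> * (real n + real m) * s))) \<le> 2 / \<bar>\<omega> * (real n + real m)\<bar>"
            by (rule norm_integral_cis_le[OF _ t0]) (use \<omega> nm in auto)
          also have "\<dots> \<le> 2 / (\<omega> * real n)" using \<omega> nm n by (intro divide_left_mono) (auto simp: abs_mult)
          finally show ?thesis .
        qed
        have gi1: "cmod (cnj (g m) * integral {0..t} (\<lambda>s. cis (\<omega> * (real n + real m) * s))) \<le> 2 * decay m * (2 / (\<omega> * real n))"
          unfolding norm_mult complex_mod_cnj using g i1 decay(1) by (intro mult_mono) auto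
        have base: "2 * decay m * (2 / (\<omega> * real n)) = 4 / \<omega> / real n * decay m" using \<omega> n by (simp add: field_simps)
        show ?thesis
        proof (cases "m = n")
          case True
          have "a m t - (if m = n then of_real t * g n else 0) = cnj (g m) * integral {0..t} (\<lambda>s. cis (\<omega> * (real n + real m) * s))"
            using diag[OF t0] True by (simp add: a)
          also have "cmod \<dots> \<le> 4 / \<omega> / real n * decay m" using gi1 base by simp
          also have "\<dots> \<le> b m" unfolding b_def using \<omega> decay(1)[of m] by (intro mult_left_mono) auto
          finally show ?thesis .
        next
          case mn: False
          define x where "x = \<bar>real n - real m\<bar>"
          have x: "x > 0" "x\<^sup>2 = (real n - real m)\<^sup>2" using mn by (auto simp: x_def)
          have i2: "cmod (integral {0..t} (\<lambda>s. cis (\<omega> * (real n - real m) * s))) \<le> 2 / (\<omega> * x)"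
            using norm_integral_cis_le[of "\<omega> * (real n - real m)" t] \<omega> mn t0 by (simp add: abs_mult x_def)
          have "cmod (g m * integral {0..t} (\<lambda>s. cis (\<omega> * (real n - real m) * s))) \<le> 2 * decay m * (2 / (\<omega> * x))"
            unfolding norm_mult using g i2 decay(1) by (intro mult_mono) auto
          also have "\<dots> = 4 / \<omega> / real n * (real n * decay m / x)" using \<omega> n by (simp add: field_simps)
          also have "real n * decay m / x \<le> decay m + (real m * decay m)\<^sup>2 / 2 + 1 / (real n - real m)\<^sup>2 / 2"
          proof -
            have "real n \<le> x + real m" unfolding x_def by linarith
            then have "real n * (decay m / x) \<le> (x + real m) * (decay m / x)" using decay(1)[of m] x(1) by (intro mult_right_mono) auto
            also have "\<dots> = decay m + (real m * decay m) * (1 / x)" using x(1) by (simp add: field_simps)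
            also have "(real m * decay m) * (1 / x) \<le> (real m * decay m)\<^sup>2 / 2 + (1 / x)\<^sup>2 / 2"
              using sum_squares_bound[of "real m * decay m" "1 / x"] by simp
            finally show ?thesis using x(2) by (simp add: power_divide)
          qed
          finally have gi2: "cmod (g m * integral {0..t} (\<lambda>s. cis (\<omega> * (real n - real m) * s)))
             \<le> 4 / \<omega> / real n * (decay m + (real m * decay m)\<^sup>2 / 2 + 1 / (real n - real m)\<^sup>2 / 2)"
            using \<omega> by (simp add: mult_left_mono divide_right_mono)
          have "cmod (a m t) \<le> 4 / \<omega> / real n * decay m + 4 / \<omega> / real n * (decay m + (real m * decay m)\<^sup>2 / 2 + 1 / (real n - real m)\<^sup>2 / 2)"
            unfolding a using gi1 gi2 base by (intro norm_triangle_le add_mono) auto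
          also have "\<dots> = b m" by (simp add: b_def algebra_simps)
          finally show ?thesis using mn by simp
        qed
      qed
      have "(\<lambda>m. a m t - (if m = n then of_real t * g n else 0)) sums (osc T (pert T g) n t - of_real t * g n)"
        by (intro sums_diff a_sums sums_single)
      then have "cmod (osc T (pert T g) n t - of_real t * g n) \<le> (\<Sum>m. b m)"
        using norm_suminf_le[OF ab sb] by (simp add: sums_iff)
      also have "\<dots> = 4 / \<omega> / real n * (2 * (\<Sum>m. decay m) + (\<Sum>m. (real m * decay m)\<^sup>2) / 2 + (\<Sum>m. 1 / (real n - real m)\<^sup>2) / 2)"
        unfolding b_def
        by (subst suminf_mult suminf_add[symmetric] suminf_divide;
            (intro summable_mult summable_add summable_divide decay decay_sq_summable sum_inverse_square_shift)?)+ simp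
      also have "\<dots> \<le> 4 / \<omega> / real n * S"
        unfolding S_def using \<omega> sum_inverse_square_shift(1)[of n] by (intro mult_left_mono) auto
      finally show "cmod (osc T (pert T g) n t - of_real t * g n) \<le> H / real n" by (simp add: H_def)
    qed
  qed
qed

text \<open>At real spectral parameters both rows are unit vectors, so their squared distance is
  \<open>2 - 2 * Re (p t)\<close> with \<open>p\<close> their Hermitian product. The derivative of
  \<open>p\<close> contains only the differences of the data, hence a bound free of exponentials. It
  is a square-root modulus of continuity, which is enough for \<open>zs_tendsto\<close>.\<close>

lemma zs_row_diff:
  assumes s: "zs_solution q (of_real x) a b" and s': "zs_solution q' (of_real x') a' b'"
    and i: "a 0 = 1" "b 0 = 0" "a' 0 = 1" "b' 0 = 0" and t: "t \<ge> 0"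
    and d: "\<And>s. 0 \<le> s \<Longrightarrow> s \<le> t \<Longrightarrow> \<bar>q s - q' s\<bar> \<le> e" "\<bar>x - x'\<bar> \<le> e"
  shows "(cmod (a t - a' t))\<^sup>2 \<le> 4 * e * t" "(cmod (b t - b' t))\<^sup>2 \<le> 4 * e * t"
proof -
  have d1: "(a has_vector_derivative (\<i> * of_real x / 2 * a t - of_real (q t) / 2 * b t)) (at t)"
    "(b has_vector_derivative (of_real (q t) / 2 * a t - \<i> * of_real x / 2 * b t)) (at t)"
    "(a' has_vector_derivative (\<i> * of_real x' / 2 * a' t - of_real (q' t) / 2 * b' t)) (at t)"
    "(b' has_vector_derivative (of_real (q' t) / 2 * a' t - \<i> * of_real x' / 2 * b' t)) (at t)" for t
    using s s' by (auto simp: zs_solution_def)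
  have n: "(cmod (a t))\<^sup>2 + (cmod (b t))\<^sup>2 = 1" "(cmod (a' t))\<^sup>2 + (cmod (b' t))\<^sup>2 = 1" for t
    using zs_energy_real[OF s, of t] zs_energy_real[OF s', of t] i by auto
  then have n1: "cmod (a t) \<le> 1" "cmod (b t) \<le> 1" "cmod (a' t) \<le> 1" "cmod (b' t) \<le> 1" for t
    by (metis add_decreasing2 le_add_same_cancel1 le_add_same_cancel2 one_power2 power2_le_imp_le zero_le_one zero_le_power2 order_refl norm_ge_zero)+
  define p where "p t = a t * cnj (a' t) + b t * cnj (b' t)" for t
  define w where "w t = \<i> * of_real ((x - x') / 2) * (a t * cnj (a' t)) - \<i> * of_real ((x - x') / 2) * (b t * cnj (b' t))
     + of_real ((q t - q' t) / 2) * (a t * cnj (b' t)) - of_real ((q t - q' t) / 2) * (b t * cnj (a' t))" for t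
  have dp: "(p has_vector_derivative w t) (at t)" for t
  proof -
    have "(p has_vector_derivative (a t * cnj (\<i> * of_real x' / 2 * a' t - of_real (q' t) / 2 * b' t) + (\<i> * of_real x / 2 * a t - of_real (q t) / 2 * b t) * cnj (a' t)) +
      (b t * cnj (of_real (q' t) / 2 * a' t - \<i> * of_real x' / 2 * b' t) + (of_real (q t) / 2 * a t - \<i> * of_real x / 2 * b t) * cnj (b' t))) (at t)"
      unfolding p_def by (intro has_vector_derivative_add has_vector_derivative_mult has_vector_derivative_cnj d1)
    then show ?thesis by (rule back_subst[of "\<lambda>d. (_ has_vector_derivative d) (at t)"]) (simp add: w_def field_simps)
  qed
  have "cmod (p t - p 0 - of_real t * 0) \<le> 2 * e * t"
  proof (rule mean_value_affine[OF dp t])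
    fix s assume s: "0 \<le> s" "s \<le> t"
    have pr: "cmod (y * z) \<le> 1" if "cmod y \<le> 1" "cmod z \<le> 1" for y z unfolding norm_mult using that by (simp add: mult_le_one)
    have pr2: "cmod (c * y) \<le> e / 2" if "cmod c \<le> e / 2" "cmod y \<le> 1" for c y
      unfolding norm_mult using mult_mono[OF that(1) that(2)] that(1) order_trans[OF norm_ge_zero that(1)] by simp
    have b1: "cmod (\<i> * of_real ((x - x') / 2)) \<le> e / 2" "cmod (of_real ((q s - q' s) / 2)) \<le> e / 2"
      unfolding norm_mult norm_of_real using d(1)[OF s] d(2) by auto
    have "cmod (w s) \<le> e / 2 + e / 2 + e / 2 + e / 2"
      unfolding w_def by (intro norm_triangle_le_diff add_mono norm_triangle_le pr2 pr b1; simp add: n1)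
    then show "cmod (w s - 0) \<le> 2 * e" by simp
  qed
  then have 1: "cmod (p t - 1) \<le> 2 * e * t" by (simp add: p_def i)
  have "(cmod (a t - a' t))\<^sup>2 + (cmod (b t - b' t))\<^sup>2 = 2 - 2 * Re (p t)"
    using n[of t] unfolding p_def cmod_power2 by (simp add: power2_eq_square algebra_simps)
  also have "\<dots> \<le> 4 * e * t" using 1 abs_Re_le_cmod[of "p t - 1"] by simp
  finally have *: "(cmod (a t - a' t))\<^sup>2 + (cmod (b t - b' t))\<^sup>2 \<le> 4 * e * t" .
  then show "(cmod (a t - a' t))\<^sup>2 \<le> 4 * e * t" "(cmod (b t - b' t))\<^sup>2 \<le> 4 * e * t"
    using zero_le_power2[of "cmod (a t - a' t)"] zero_le_power2[of "cmod (b t - b' t)"] by linarith+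
qed

section \<open>The frame equation\<close>

type_synonym triple = "real \<times> real \<times> real"

text \<open>For \<open>m = 1\<close> and \<open>k = K\<close> these are the Frenet equations:
  position, velocity and normal have as derivatives the velocity, \<open>c\<close> times the normal
  minus \<open>K\<close> times the position, and \<open>- c\<close> times the velocity. For
  \<open>m = K\<close> and \<open>k = 1\<close> the matrix is minus the transpose of this one, which
  gives the dual flow.\<close>

definition gen :: "real \<Rightarrow> real \<Rightarrow> real \<Rightarrow> triple \<Rightarrow> triple" where
  "gen m k c v = (m * fst (snd v), c * snd (snd v) - k * fst v, - c * fst (snd v))"

text \<open>The derivative of \<open>gen m k c\<close> with respect to the curvature
  \<open>c\<close>.\<close>

definition rot23 :: "triple \<Rightarrow> triple" where
  "rot23 v = (0, snd (snd v), - fst (snd v))"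

definition admissible :: "(real \<Rightarrow> real) \<Rightarrow> bool" where
  "admissible q \<longleftrightarrow> continuous_on UNIV q \<and> (\<exists>Q. \<forall>t. \<bar>q t\<bar> \<le> Q)"

definition flow :: "real \<Rightarrow> real \<Rightarrow> (real \<Rightarrow> real) \<Rightarrow> triple \<Rightarrow> real \<Rightarrow> triple" where
  "flow m k q v = (SOME x. x 0 = v \<and> (\<forall>t. (x has_vector_derivative gen m k (q t) (x t)) (at t)))"

lemma triple_comp_le: "\<bar>fst v\<bar> \<le> norm v" "\<bar>fst (snd v)\<bar> \<le> norm v" "\<bar>snd (snd v)\<bar> \<le> norm (v :: triple)"
proof -
  have "norm (fst v) \<le> norm v" "norm (snd v) \<le> norm v" "norm (fst (snd v)) \<le> norm (snd v)" "norm (snd (snd v)) \<le> norm (snd v)"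
    by (metis norm_fst_le norm_snd_le prod.collapse)+
  then show "\<bar>fst v\<bar> \<le> norm v" "\<bar>fst (snd v)\<bar> \<le> norm v" "\<bar>snd (snd v)\<bar> \<le> norm v" by auto
qed

lemma triple_norm_le: "norm (v :: triple) \<le> \<bar>fst v\<bar> + \<bar>fst (snd v)\<bar> + \<bar>snd (snd v)\<bar>"
proof -
  have "norm v \<le> norm (fst v) + norm (snd v)" "norm (snd v) \<le> norm (fst (snd v)) + norm (snd (snd v))"
    by (metis norm_Pair_le prod.collapse)+
  then show ?thesis by simp
qed

lemma triple_inner: "(v :: triple) \<bullet> w = fst v * fst w + fst (snd v) * fst (snd w) + snd (snd v) * snd (snd w)"
  by (simp add: inner_prod_def)

lemma gen_linear: "linear (gen m k c)"
  by (rule linearI) (simp_all add: gen_def algebra_simps)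

lemma gen_norm: "norm (gen m k c v) \<le> (\<bar>m\<bar> + \<bar>k\<bar> + 2 * \<bar>c\<bar>) * norm v"
proof -
  have "norm (gen m k c v) \<le> \<bar>m\<bar> * \<bar>fst (snd v)\<bar> + (\<bar>c\<bar> * \<bar>snd (snd v)\<bar> + \<bar>k\<bar> * \<bar>fst v\<bar>) + \<bar>c\<bar> * \<bar>fst (snd v)\<bar>"
    using triple_norm_le[of "gen m k c v"] abs_triangle_ineq4[of "c * snd (snd v)" "k * fst v"] by (simp add: gen_def abs_mult)
  also have "\<dots> \<le> \<bar>m\<bar> * norm v + (\<bar>c\<bar> * norm v + \<bar>k\<bar> * norm v) + \<bar>c\<bar> * norm v"
    by (intro add_mono mult_left_mono triple_comp_le) auto
  finally show ?thesis by (simp add: algebra_simps)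
qed

lemma gen_diff: "gen m k c v - gen m k c' w = gen m k c (v - w) + (c - c') *\<^sub>R rot23 w"
  by (simp add: gen_def rot23_def algebra_simps prod_eq_iff)

lemma rot23_norm: "norm (rot23 v) \<le> 2 * norm v"
  using triple_norm_le[of "rot23 v"] triple_comp_le[of v] by (simp add: rot23_def)

lemma gen_continuous:
  assumes "continuous_on S q" "continuous_on S y"
  shows "continuous_on S (\<lambda>t. gen m k (q t) (y t))"
  unfolding gen_def by (intro continuous_intros assms)

lemma flow:
  assumes "admissible q"
  shows flow_0: "flow m k q v 0 = v"
    and flow_deriv: "(flow m k q v has_vector_derivative gen m k (q t) (flow m k q v t)) (at t)"
proof -
  obtain Q where Q: "\<And>t. \<bar>q t\<bar> \<le> Q" and c: "continuous_on UNIV q" using assms by (auto simp: admissible_def)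
  have "\<exists>x. x 0 = v \<and> (\<forall>t. (x has_vector_derivative gen m k (q t) (x t)) (at t))"
  proof (rule linear_ode_exists[where C = "\<bar>m\<bar> + \<bar>k\<bar> + 2 * \<bar>Q\<bar>"])
    show "norm (gen m k (q t) x) \<le> (\<bar>m\<bar> + \<bar>k\<bar> + 2 * \<bar>Q\<bar>) * norm x" for t x
    proof -
      have "\<bar>q t\<bar> \<le> \<bar>Q\<bar>" using Q[of t] by linarith
      then have "(\<bar>m\<bar> + \<bar>k\<bar> + 2 * \<bar>q t\<bar>) * norm x \<le> (\<bar>m\<bar> + \<bar>k\<bar> + 2 * \<bar>Q\<bar>) * norm x" by (intro mult_right_mono) auto
      then show ?thesis using gen_norm order_trans by blast
    qed
  qed (auto intro: gen_linear gen_continuous c)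
  from someI_ex[OF this] show "flow m k q v 0 = v" "(flow m k q v has_vector_derivative gen m k (q t) (flow m k q v t)) (at t)"
    unfolding flow_def by auto
qed

lemma flow_continuous: "admissible q \<Longrightarrow> continuous_on S (flow m k q v)"
  by (intro continuous_at_imp_continuous_on ballI has_vector_derivative_continuous[OF flow_deriv])

lemma flow_unique:
  assumes q: "admissible q" and x: "\<And>t. (x has_vector_derivative gen m k (q t) (x t)) (at t)"
  shows "x t = flow m k q (x 0) t"
proof -
  obtain Q where Q: "\<And>t. \<bar>q t\<bar> \<le> Q" using q by (auto simp: admissible_def)
  have "x t - flow m k q (x 0) t = 0"
  proof (rule linear_ode_unique[where C = "\<bar>m\<bar> + \<bar>k\<bar> + 2 * \<bar>Q\<bar>" and d = "\<lambda>t. gen m k (q t) (x t - flow m k q (x 0) t)"])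
    show "((\<lambda>t. x t - flow m k q (x 0) t) has_vector_derivative gen m k (q t) (x t - flow m k q (x 0) t)) (at t)" for t
      unfolding linear_diff[OF gen_linear] by (rule has_vector_derivative_diff[OF x flow_deriv[OF q]])
    show "norm (gen m k (q t) (x t - flow m k q (x 0) t)) \<le> (\<bar>m\<bar> + \<bar>k\<bar> + 2 * \<bar>Q\<bar>) * norm (x t - flow m k q (x 0) t)" for t
    proof -
      have "\<bar>q t\<bar> \<le> \<bar>Q\<bar>" using Q[of t] by linarith
      then have "(\<bar>m\<bar> + \<bar>k\<bar> + 2 * \<bar>q t\<bar>) * norm w \<le> (\<bar>m\<bar> + \<bar>k\<bar> + 2 * \<bar>Q\<bar>) * norm w" for w :: triple by (intro mult_right_mono) auto
      then show ?thesis using gen_norm order_trans by blast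
    qed
  qed (use flow_0[OF q] in auto)
  then show ?thesis by simp
qed

lemma flow_scaleR: "admissible q \<Longrightarrow> flow m k q (c *\<^sub>R v) t = c *\<^sub>R flow m k q v t"
  using flow_unique[of q "\<lambda>t. c *\<^sub>R flow m k q v t" m k t]
    bounded_linear.has_vector_derivative[OF bounded_linear_scaleR_right flow_deriv[of q m k v]]
  by (simp add: flow_0 linear_scale[OF gen_linear])

lemma flow_periodic:
  assumes q: "admissible q" "\<And>t. q (t + T) = q t" and T: "flow m k q v T = v"
  shows "flow m k q v (t + T) = flow m k q v t"
proof -
  have sh: "((\<lambda>t. t + T) has_vector_derivative 1) (at t)" for t by (auto intro!: derivative_eq_intros)
  have "((\<lambda>t. flow m k q v (t + T)) has_vector_derivative gen m k (q t) (flow m k q v (t + T))) (at t)" for t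
    using vector_diff_chain_at[OF sh flow_deriv[OF q(1)]] by (simp add: o_def q(2))
  from flow_unique[OF q(1) this, of t] show ?thesis using T by simp
qed

text \<open>Gronwall's inequality with the L1 distance of the curvatures as forcing.
  \<open>R\<close> satisfies just the integral equation, so it may be the frame of a W22 curve. The
  exponent involves \<open>p\<close> only through its L1 norm, which later allows constants that are
  fixed before the approximant.\<close>

lemma flow_compare:
  assumes p: "admissible p" and \<kappa>: "L2_loc \<kappa>" and R: "continuous_on {0..T} R" "\<And>t. t \<in> {0..T} \<Longrightarrow> norm (R t) \<le> B"
    and iR: "\<And>t. t \<in> {0..T} \<Longrightarrow> ((\<lambda>s. gen m k (\<kappa> s) (R s)) has_integral R t - R 0) {0..t}" and t: "t \<in> {0..T}"
    and P: "integral {0..T} (\<lambda>s. \<bar>p s\<bar>) \<le> P" and d: "integral {0..T} (\<lambda>s. \<bar>p s - \<kappa> s\<bar>) \<le> d"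
  shows "norm (flow m k p (R 0) t - R t) \<le> 2 * B * d * exp ((\<bar>m\<bar> + \<bar>k\<bar>) * T + 2 * P)"
proof -
  have cp: "continuous_on S p" for S using p by (auto simp: admissible_def intro: continuous_on_subset)
  define F where "F = flow m k p (R 0)"
  have cF: "continuous_on S F" for S unfolding F_def by (rule flow_continuous[OF p])
  define D where "D t = F t - R t" for t
  have cD: "continuous_on {0..T} D" unfolding D_def by (intro continuous_intros cF R)
  define w where "w t = \<bar>m\<bar> + \<bar>k\<bar> + 2 * \<bar>p t\<bar>" for t
  have cw: "continuous_on S w" for S unfolding w_def by (intro continuous_intros cp)
  have T: "0 \<le> T" and B: "B \<ge> 0" using t order_trans[OF norm_ge_zero R(2)[OF t]] by auto
  have ipk: "(\<lambda>s. \<bar>p s - \<kappa> s\<bar>) integrable_on {a..b}" for a b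
    using L2_loc_norm_integrable[OF L2_loc_add[OF L2_loc_continuous[OF cp] L2_loc_linear[OF bounded_linear_minus[OF bounded_linear_ident] \<kappa>]]] by simp
  have "norm (D t) \<le> 2 * B * d * exp (integral {0..t} w)"
  proof (rule gronwall[OF continuous_on_norm[OF cD] cw _ _ t])
    fix t assume t: "t \<in> {0..T}"
    have t0: "0 \<le> t" using t by simp
    have "((\<lambda>s. gen m k (p s) (F s) - gen m k (\<kappa> s) (R s)) has_integral (F t - F 0) - (R t - R 0)) {0..t}"
      unfolding F_def by (intro has_integral_diff iR[OF t] integral_of_derivative[OF flow_deriv[OF p] t0])
    then have i1: "((\<lambda>s. gen m k (p s) (F s) - gen m k (\<kappa> s) (R s)) has_integral D t) {0..t}"
      by (simp add: D_def F_def flow_0[OF p])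
    have i2: "(\<lambda>s. w s * norm (D s)) integrable_on {0..t}"
      using t by (intro integrable_continuous_real continuous_intros cw continuous_on_subset[OF cD]) auto
    have i3: "(\<lambda>s. 2 * B * \<bar>p s - \<kappa> s\<bar>) integrable_on {0..t}" for t by (intro integrable_on_mult_right ipk)
    have "norm (D t) \<le> integral {0..t} (\<lambda>s. w s * norm (D s) + 2 * B * \<bar>p s - \<kappa> s\<bar>)"
      unfolding integral_unique[OF i1, symmetric]
    proof (rule integral_norm_bound_integral[OF has_integral_integrable[OF i1] integrable_add[OF i2 i3]])
      fix s assume s: "s \<in> {0..t}"
      have "norm (gen m k (p s) (F s) - gen m k (\<kappa> s) (R s)) \<le> norm (gen m k (p s) (D s)) + norm ((p s - \<kappa> s) *\<^sub>R rot23 (R s))"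
        unfolding gen_diff D_def by (rule norm_triangle_ineq)
      moreover have "norm (gen m k (p s) (D s)) \<le> w s * norm (D s)" unfolding w_def by (rule gen_norm)
      moreover have "norm ((p s - \<kappa> s) *\<^sub>R rot23 (R s)) \<le> \<bar>p s - \<kappa> s\<bar> * (2 * B)"
      proof -
        have "norm (rot23 (R s)) \<le> 2 * B" using rot23_norm[of "R s"] R(2)[of s] s t by auto
        then show ?thesis by (simp add: mult_left_mono)
      qed
      ultimately show "norm (gen m k (p s) (F s) - gen m k (\<kappa> s) (R s)) \<le> w s * norm (D s) + 2 * B * \<bar>p s - \<kappa> s\<bar>"
        by (simp add: mult_ac)
    qed
    also have "\<dots> = integral {0..t} (\<lambda>s. w s * norm (D s)) + 2 * B * integral {0..t} (\<lambda>s. \<bar>p s - \<kappa> s\<bar>)"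
      by (subst Henstock_Kurzweil_Integration.integral_add[OF i2 i3]) simp
    also have "2 * B * integral {0..t} (\<lambda>s. \<bar>p s - \<kappa> s\<bar>) \<le> 2 * B * d"
    proof (rule mult_left_mono)
      have "integral {0..t} (\<lambda>s. \<bar>p s - \<kappa> s\<bar>) \<le> integral {0..T} (\<lambda>s. \<bar>p s - \<kappa> s\<bar>)"
        by (rule integral_subset_le) (use t ipk in auto)
      then show "integral {0..t} (\<lambda>s. \<bar>p s - \<kappa> s\<bar>) \<le> d" using d by simp
    qed (use B in simp)
    finally show "norm (D t) \<le> 2 * B * d + integral {0..t} (\<lambda>s. w s * norm (D s))" by simp
  qed (auto simp: w_def)
  also have "integral {0..t} w \<le> (\<bar>m\<bar> + \<bar>k\<bar>) * T + 2 * P"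
  proof -
    have "integral {0..t} w \<le> integral {0..T} w"
      by (rule integral_subset_le) (use t cw in \<open>auto intro!: integrable_continuous_real simp: w_def\<close>)
    also have "\<dots> = (\<bar>m\<bar> + \<bar>k\<bar>) * T + 2 * integral {0..T} (\<lambda>s. \<bar>p s\<bar>)"
    proof -
      have i: "(\<lambda>s. 2 * \<bar>p s\<bar>) integrable_on {0..T}" by (intro integrable_continuous_real continuous_intros cp)
      show ?thesis unfolding w_def using T by (subst Henstock_Kurzweil_Integration.integral_add[OF _ i]) auto
    qed
    finally show ?thesis using P by simp
  qed
  then have "2 * B * d * exp (integral {0..t} w) \<le> 2 * B * d * exp ((\<bar>m\<bar> + \<bar>k\<bar>) * T + 2 * P)"
  proof (intro mult_left_mono)
    have "0 \<le> d" using d integral_nonneg[OF ipk, of 0 T] by simp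
    then show "0 \<le> 2 * B * d" using B by simp
  qed simp
  finally show ?thesis by (simp add: D_def F_def)
qed

lemma flow_bound:
  assumes p: "admissible p" and t: "t \<in> {0..T}" and P: "integral {0..T} (\<lambda>s. \<bar>p s\<bar>) \<le> P"
  shows "norm (flow m k p v t) \<le> norm v * exp ((\<bar>m\<bar> + \<bar>k\<bar>) * T + 2 * P)"
proof -
  have cp: "continuous_on S p" for S using p by (auto simp: admissible_def intro: continuous_on_subset)
  define F where "F = flow m k p v"
  have cF: "continuous_on S F" for S unfolding F_def by (rule flow_continuous[OF p])
  define w where "w t = \<bar>m\<bar> + \<bar>k\<bar> + 2 * \<bar>p t\<bar>" for t
  have cw: "continuous_on S w" for S unfolding w_def by (intro continuous_intros cp)
  have T: "0 \<le> T" using t by auto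
  have "norm (F t) \<le> norm v * exp (integral {0..t} w)"
  proof (rule gronwall[OF continuous_on_norm[OF cF] cw _ _ t])
    fix t assume t: "t \<in> {0..T}"
    have t0: "0 \<le> t" using t by simp
    have i1: "((\<lambda>s. gen m k (p s) (F s)) has_integral (F t - F 0)) {0..t}"
      unfolding F_def by (rule integral_of_derivative[OF flow_deriv[OF p] t0])
    have "norm (F t - F 0) \<le> integral {0..t} (\<lambda>s. w s * norm (F s))"
      unfolding integral_unique[OF i1, symmetric]
      by (rule integral_norm_bound_integral[OF has_integral_integrable[OF i1]])
        (auto simp: w_def intro!: gen_norm integrable_continuous_real continuous_intros cp cF)
    then show "norm (F t) \<le> norm v + integral {0..t} (\<lambda>s. w s * norm (F s))"
      using norm_triangle_sub[of "F t" "F 0"] by (simp add: F_def flow_0[OF p])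
  qed (auto simp: w_def)
  also have "integral {0..t} w \<le> (\<bar>m\<bar> + \<bar>k\<bar>) * T + 2 * P"
  proof -
    have "integral {0..t} w \<le> integral {0..T} w"
      by (rule integral_subset_le) (use t cw in \<open>auto intro!: integrable_continuous_real simp: w_def\<close>)
    also have "\<dots> = (\<bar>m\<bar> + \<bar>k\<bar>) * T + 2 * integral {0..T} (\<lambda>s. \<bar>p s\<bar>)"
    proof -
      have i: "(\<lambda>s. 2 * \<bar>p s\<bar>) integrable_on {0..T}" by (intro integrable_continuous_real continuous_intros cp)
      show ?thesis unfolding w_def using T by (subst Henstock_Kurzweil_Integration.integral_add[OF _ i]) auto
    qed
    finally show ?thesis using P by simp
  qed
  then have "norm v * exp (integral {0..t} w) \<le> norm v * exp ((\<bar>m\<bar> + \<bar>k\<bar>) * T + 2 * P)" by (intro mult_left_mono) auto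
  finally show ?thesis by (simp add: F_def)
qed

section \<open>The frame flow, its dual and the linearised closing condition\<close>

abbreviation row_flow :: "real \<Rightarrow> (real \<Rightarrow> real) \<Rightarrow> triple \<Rightarrow> real \<Rightarrow> triple" where
  "row_flow K \<equiv> flow 1 K"

abbreviation col_flow :: "real \<Rightarrow> (real \<Rightarrow> real) \<Rightarrow> triple \<Rightarrow> real \<Rightarrow> triple" where
  "col_flow K \<equiv> flow K 1"

text \<open>The two flows are dual for equal potentials, so their pairing changes only through
  \<open>q - p\<close>. This is the variation formula of the frame.\<close>

lemma row_col_derivative:
  assumes q: "admissible q" and p: "admissible p"
  shows "((\<lambda>t. row_flow K q v t \<bullet> col_flow K p w t) has_vector_derivative (q t - p t) * (rot23 (row_flow K q v t) \<bullet> col_flow K p w t)) (at t)"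
proof -
  have "((\<lambda>t. row_flow K q v t \<bullet> col_flow K p w t) has_vector_derivative
     row_flow K q v t \<bullet> gen K 1 (p t) (col_flow K p w t) + gen 1 K (q t) (row_flow K q v t) \<bullet> col_flow K p w t) (at t)"
    by (rule bounded_bilinear.has_vector_derivative[OF bounded_bilinear_inner flow_deriv[OF q] flow_deriv[OF p]])
  then show ?thesis
    by (rule back_subst[of "\<lambda>d. (_ has_vector_derivative d) (at t)"]) (simp add: triple_inner gen_def rot23_def algebra_simps)
qed

lemma row_col_const:
  assumes "admissible q"
  shows "row_flow K q v t \<bullet> col_flow K q w t = v \<bullet> w"
proof -
  have "((\<lambda>t. row_flow K q v t \<bullet> col_flow K q w t) has_real_derivative 0) (at t)" for t
    using row_col_derivative[OF assms assms, of K v w t] by (simp add: has_real_derivative_iff_has_vector_derivative)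
  then have "row_flow K q v t \<bullet> col_flow K q w t = row_flow K q v 0 \<bullet> col_flow K q w 0" by (intro DERIV_isconst_all) blast
  then show ?thesis by (simp add: flow_0[OF assms])
qed

text \<open>The invariant form diag(K, 1, 1) of the frame equations as a map from row solutions to
  column solutions. It is degenerate for the plane.\<close>

definition metric :: "real \<Rightarrow> triple \<Rightarrow> triple" where
  "metric K v = (K * fst v, snd v)"

lemma col_flow_metric:
  assumes "admissible q"
  shows "col_flow K q (metric K v) t = metric K (row_flow K q v t)"
proof -
  have bl: "bounded_linear (metric K)"
    unfolding linear_conv_bounded_linear[symmetric] metric_def by (rule linearI) (auto simp: algebra_simps)
  have "((\<lambda>t. metric K (row_flow K q v t)) has_vector_derivative gen K 1 (q t) (metric K (row_flow K q v t))) (at t)" for t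
    by (rule back_subst[of "\<lambda>d. (_ has_vector_derivative d) (at t)", OF bounded_linear.has_vector_derivative[OF bl flow_deriv[OF assms]]])
      (simp add: metric_def gen_def)
  from flow_unique[OF assms this, of t] show ?thesis by (simp add: flow_0[OF assms])
qed

lemma row_flow_orthogonal:
  assumes "admissible q"
  shows "row_flow K q v t \<bullet> metric K (row_flow K q w t) = v \<bullet> metric K w"
  unfolding col_flow_metric[OF assms, symmetric] by (rule row_col_const[OF assms])

text \<open>A cross product of a row with a column solution, arranged so that it is equivariant for
  every \<open>K\<close>, also for 0. Its first component is the pairing with \<open>rot23\<close>;
  through it \<open>rot_row_col\<close> expresses the variation of the closing entries by the
  coordinates of the curve itself.\<close>

lemma row_flow_cross:
  fixes K :: real
  assumes q: "admissible q"
  defines "cr \<equiv> \<lambda>v w :: triple. (snd (snd v) * fst (snd w) - fst (snd v) * snd (snd w),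
      K * fst v * snd (snd w) - snd (snd v) * fst w, fst (snd v) * fst w - K * fst v * fst (snd w))"
  shows "cr (row_flow K q v t) (col_flow K q w t) = row_flow K q (cr v w) t"
proof -
  have comp: "((\<lambda>t. fst (flow m k q v t)) has_vector_derivative m * fst (snd (flow m k q v t))) (at t)"
     "((\<lambda>t. fst (snd (flow m k q v t))) has_vector_derivative q t * snd (snd (flow m k q v t)) - k * fst (flow m k q v t)) (at t)"
     "((\<lambda>t. snd (snd (flow m k q v t))) has_vector_derivative - q t * fst (snd (flow m k q v t))) (at t)" for m k v t
    using bounded_linear.has_vector_derivative[OF bounded_linear_fst flow_deriv[OF q, of m k v t]]
      bounded_linear.has_vector_derivative[OF bounded_linear_fst_comp[OF bounded_linear_snd] flow_deriv[OF q, of m k v t]]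
      bounded_linear.has_vector_derivative[OF bounded_linear_snd_comp[OF bounded_linear_snd] flow_deriv[OF q, of m k v t]]
    by (simp_all add: gen_def)
  have pair: "((\<lambda>t. (f t, g t)) has_vector_derivative (f', g')) (at t)"
    if "(f has_vector_derivative f') (at t)" "(g has_vector_derivative g') (at t)" for f :: "real \<Rightarrow> 'x::real_normed_vector" and g :: "real \<Rightarrow> 'y::real_normed_vector" and f' g' t
    using that unfolding has_vector_derivative_def by (auto intro!: derivative_eq_intros)
  have "((\<lambda>t. cr (row_flow K q v t) (col_flow K q w t)) has_vector_derivative gen 1 K (q t) (cr (row_flow K q v t) (col_flow K q w t))) (at t)" for t
    unfolding gen_def cr_def fst_conv snd_conv
    by (intro pair; (rule derivative_eq_intros comp refl | simp add: algebra_simps)+)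
  from flow_unique[OF q this, of t] show ?thesis by (simp add: flow_0[OF q])
qed

definition e1 :: triple where "e1 = (1, 0, 0)"
definition e2 :: triple where "e2 = (0, 1, 0)"
definition e3 :: triple where "e3 = (0, 0, 1)"

lemma rot_row_col:
  assumes q: "admissible q"
  shows "rot23 (row_flow K q e2 t) \<bullet> col_flow K q e1 t = fst (row_flow K q e3 t)"
    "rot23 (row_flow K q e3 t) \<bullet> col_flow K q e1 t = - fst (row_flow K q e2 t)"
    "rot23 (row_flow K q e3 t) \<bullet> col_flow K q e2 t = fst (row_flow K q e1 t)"
  using row_flow_cross[OF q, of K e2 t e1] row_flow_cross[OF q, of K e3 t e1] row_flow_cross[OF q, of K e3 t e2]
    flow_scaleR[OF q, of 1 K "-1" e2 t]
  by (simp_all add: e1_def e2_def e3_def triple_inner rot23_def prod_eq_iff)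

text \<open>The variation formula gives the first-order change of the three entries below the
  diagonal of the frame at time \<open>T\<close>; the remainder is quadratic in the distance
  \<open>d\<close> and linear in the defect \<open>e\<close> of the frame of \<open>p\<close>. The
  constant depends on \<open>P\<close>, a bound for the L1 norm of \<open>p\<close>, and not on
  \<open>p\<close>, which is chosen after it.\<close>

lemma closing_estimate:
  assumes T: "T > 0"
  shows "\<exists>C\<ge>0. \<forall>p q e d. admissible p \<longrightarrow> admissible q \<longrightarrow> integral {0..T} (\<lambda>s. \<bar>p s\<bar>) \<le> P \<longrightarrow>
     (\<forall>t\<in>{0..T}. \<bar>q t - p t\<bar> \<le> d) \<longrightarrow> d \<le> 1 \<longrightarrow>
     norm (row_flow K p e1 T - e1) \<le> e \<longrightarrow> norm (row_flow K p e2 T - e2) \<le> e \<longrightarrow> norm (row_flow K p e3 T - e3) \<le> e \<longrightarrow>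
     \<bar>fst (row_flow K q e2 T) - integral {0..T} (\<lambda>t. (q t - p t) * fst (row_flow K p e3 t))\<bar> \<le> C * (e + d\<^sup>2) \<and>
     \<bar>fst (row_flow K q e3 T) + integral {0..T} (\<lambda>t. (q t - p t) * fst (row_flow K p e2 t))\<bar> \<le> C * (e + d\<^sup>2) \<and>
     \<bar>fst (snd (row_flow K q e3 T)) - integral {0..T} (\<lambda>t. (q t - p t) * fst (row_flow K p e1 t))\<bar> \<le> C * (e + d\<^sup>2)"
proof -
  define M where "M = exp ((1 + \<bar>K\<bar>) * T + 2 * (\<bar>P\<bar> + T))"
  have M: "M \<ge> 1" unfolding M_def using T by simp
  \<comment> \<open>The first summand pays for replacing \<open>col_flow K p w T\<close> by
    \<open>w\<close>, the second for replacing the row flow of \<open>q\<close> by that of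
    \<open>p\<close> under the integral.\<close>
  define C where "C = 3 * M\<^sup>2 + 4 * M^3 * T\<^sup>2"
  show ?thesis
  proof (intro exI[of _ C] conjI allI impI)
    show "C \<ge> 0" using M T by (simp add: C_def)
    fix p q e d
    assume p: "admissible p" and q: "admissible q" and P: "integral {0..T} (\<lambda>s. \<bar>p s\<bar>) \<le> P"
      and d: "\<forall>t\<in>{0..T}. \<bar>q t - p t\<bar> \<le> d" "d \<le> 1"
      and e: "norm (row_flow K p e1 T - e1) \<le> e" "norm (row_flow K p e2 T - e2) \<le> e" "norm (row_flow K p e3 T - e3) \<le> e"
    have cp: "continuous_on S p" "continuous_on S q" for S using p q by (auto simp: admissible_def intro: continuous_on_subset)
    have "\<bar>q 0 - p 0\<bar> \<le> d" using d(1) T by simp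
    then have d0: "d \<ge> 0" by linarith
    have e0: "e \<ge> 0" using e(1) norm_ge_zero order_trans by blast
    have nE: "norm e1 \<le> 1" "norm e2 \<le> 1" "norm e3 \<le> 1" by (simp_all add: e1_def e2_def e3_def norm_Pair)
    have Q: "integral {0..T} (\<lambda>s. \<bar>q s\<bar>) \<le> \<bar>P\<bar> + T"
    proof -
      have "integral {0..T} (\<lambda>s. \<bar>q s\<bar>) \<le> integral {0..T} (\<lambda>s. \<bar>p s\<bar> + 1)"
        using d by (intro integral_le integrable_continuous_real continuous_intros cp) force
      also have "\<dots> = integral {0..T} (\<lambda>s. \<bar>p s\<bar>) + T"
        using T by (subst Henstock_Kurzweil_Integration.integral_add) (auto intro!: integrable_continuous_real continuous_intros cp)
      finally show ?thesis using P by simp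
    qed
    have P': "integral {0..T} (\<lambda>s. \<bar>p s\<bar>) \<le> \<bar>P\<bar> + T" using P T by simp
    have bM: "norm (flow m k f v t) \<le> M" if "admissible f" "integral {0..T} (\<lambda>s. \<bar>f s\<bar>) \<le> \<bar>P\<bar> + T" "norm v \<le> 1" "t \<in> {0..T}" "\<bar>m\<bar> + \<bar>k\<bar> = 1 + \<bar>K\<bar>" for m k f v t
    proof -
      have "norm (flow m k f v t) \<le> norm v * M"
        using flow_bound[OF that(1,4,2), of m k v] unfolding that(5) M_def .
      also have "\<dots> \<le> 1 * M" using M that(3) by (intro mult_right_mono) auto
      finally show ?thesis by simp
    qed
    have dif: "norm (row_flow K q v t - row_flow K p v t) \<le> 2 * M\<^sup>2 * T * d" if v: "norm v \<le> 1" and t: "t \<in> {0..T}" for v t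
    proof -
      have "norm (row_flow K q (row_flow K p v 0) t - row_flow K p v t) \<le> 2 * M * (d * T) * exp ((\<bar>1\<bar> + \<bar>K\<bar>) * T + 2 * (\<bar>P\<bar> + T))"
      proof (rule flow_compare[OF q L2_loc_continuous[OF cp(1)] flow_continuous[OF p] _ _ t Q])
        show "norm (row_flow K p v s) \<le> M" if "s \<in> {0..T}" for s by (rule bM[OF p P' v that]) simp
        show "((\<lambda>s. gen 1 K (p s) (row_flow K p v s)) has_integral row_flow K p v s - row_flow K p v 0) {0..s}" if "s \<in> {0..T}" for s
          by (rule integral_of_derivative[OF flow_deriv[OF p]]) (use that in auto)
        have "norm (integral {0..T} (\<lambda>s. \<bar>q s - p s\<bar>)) \<le> d * (T - 0)"
          using d(1) T by (intro integral_bound continuous_intros cp) auto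
        then show "integral {0..T} (\<lambda>s. \<bar>q s - p s\<bar>) \<le> d * T" by simp
      qed
      then have "norm (row_flow K q v t - row_flow K p v t) \<le> 2 * M * (d * T) * M" by (simp only: flow_0[OF p] abs_one M_def)
      then show ?thesis by (simp add: power2_eq_square mult_ac)
    qed
    \<comment> \<open>Pairing with \<open>e1\<close>, \<open>e2\<close>, \<open>e3\<close> and
      invariance of the pairing transfer the defect of the frame to the dual frame.\<close>
    have th: "norm (col_flow K p w T - w) \<le> 3 * M * e" if w: "norm w \<le> 1" for w
    proof -
      have c: "\<bar>v \<bullet> (col_flow K p w T - w)\<bar> \<le> M * e" if v: "norm (row_flow K p v T - v) \<le> e" for v
      proof -
        have "v \<bullet> (col_flow K p w T - w) = - ((row_flow K p v T - v) \<bullet> col_flow K p w T)"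
          using row_col_const[OF p, of K v T w] by (simp add: inner_diff_left inner_diff_right)
        also have "\<bar>\<dots>\<bar> \<le> norm (row_flow K p v T - v) * norm (col_flow K p w T)" by (simp add: Cauchy_Schwarz_ineq2)
        also have "\<dots> \<le> e * M" using v e0 bM[OF p P' w, of T K 1] T by (intro mult_mono) auto
        finally show ?thesis by (simp add: mult.commute)
      qed
      show ?thesis
        using triple_norm_le[of "col_flow K p w T - w"] c[OF e(1)] c[OF e(2)] c[OF e(3)]
        by (simp add: triple_inner e1_def e2_def e3_def)
    qed
    have key: "\<bar>row_flow K q v T \<bullet> w - integral {0..T} (\<lambda>t. (q t - p t) * (rot23 (row_flow K p v t) \<bullet> col_flow K p w t))\<bar> \<le> C * (e + d\<^sup>2)"
      if v: "norm v \<le> 1" and w: "norm w \<le> 1" and vw: "v \<bullet> w = 0" for v w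
    proof -
      define f where "f g t = (q t - p t) * (rot23 (row_flow K g v t) \<bullet> col_flow K p w t)" for g t
      have cf: "continuous_on {0..T} (f g)" if "admissible g" for g
        unfolding f_def rot23_def by (intro continuous_intros cp flow_continuous that p)
      have "integral {0..T} (f q) = row_flow K q v T \<bullet> col_flow K p w T"
        using integral_unique[OF integral_of_derivative[OF row_col_derivative[OF q p, of K v w], of 0 T]] T vw
        by (simp add: f_def[abs_def] flow_0[OF p] flow_0[OF q])
      moreover have "\<bar>row_flow K q v T \<bullet> col_flow K p w T - row_flow K q v T \<bullet> w\<bar> \<le> M * (3 * M * e)"
      proof -
        have "\<bar>row_flow K q v T \<bullet> (col_flow K p w T - w)\<bar> \<le> norm (row_flow K q v T) * norm (col_flow K p w T - w)" by (rule Cauchy_Schwarz_ineq2)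
        also have "\<dots> \<le> M * (3 * M * e)" using bM[OF q Q v, of T 1 K] th[OF w] T M by (intro mult_mono) auto
        finally show ?thesis by (simp add: inner_diff_right)
      qed
      moreover have "\<bar>integral {0..T} (f q) - integral {0..T} (f p)\<bar> \<le> 4 * M^3 * T\<^sup>2 * d\<^sup>2"
      proof -
        have "norm (integral {0..T} (\<lambda>t. f q t - f p t)) \<le> d * (2 * (2 * M\<^sup>2 * T * d) * M) * (T - 0)"
        proof (rule integral_bound)
          show "continuous_on {0..T} (\<lambda>t. f q t - f p t)" by (intro continuous_intros cf p q)
          fix t assume t: "t \<in> {0..T}"
          have "rot23 (row_flow K q v t) - rot23 (row_flow K p v t) = rot23 (row_flow K q v t - row_flow K p v t)"
            by (simp add: rot23_def)
          then have "f q t - f p t = (q t - p t) * (rot23 (row_flow K q v t - row_flow K p v t) \<bullet> col_flow K p w t)"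
            unfolding f_def right_diff_distrib[symmetric] inner_diff_left[symmetric] by simp
          also have "norm \<dots> \<le> d * (2 * (2 * M\<^sup>2 * T * d) * M)"
            unfolding norm_mult
          proof (rule mult_mono)
            have "norm (rot23 (row_flow K q v t - row_flow K p v t) \<bullet> col_flow K p w t) \<le> norm (rot23 (row_flow K q v t - row_flow K p v t)) * norm (col_flow K p w t)"
              by (simp add: Cauchy_Schwarz_ineq2)
            also have "\<dots> \<le> (2 * (2 * M\<^sup>2 * T * d)) * M"
              using rot23_norm[of "row_flow K q v t - row_flow K p v t"] dif[OF v t] bM[OF p P' w t, of K 1] M T d0 by (intro mult_mono) auto
            finally show "norm (rot23 (row_flow K q v t - row_flow K p v t) \<bullet> col_flow K p w t) \<le> 2 * (2 * M\<^sup>2 * T * d) * M" .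
          qed (use d(1) t d0 in auto)
          finally show "norm (f q t - f p t) \<le> d * (2 * (2 * M\<^sup>2 * T * d) * M)" .
        qed (use T in simp)
        moreover have "integral {0..T} (\<lambda>t. f q t - f p t) = integral {0..T} (f q) - integral {0..T} (f p)"
          by (intro Henstock_Kurzweil_Integration.integral_diff integrable_continuous_real cf p q)
        ultimately show ?thesis by (simp add: power2_eq_square power3_eq_cube mult_ac)
      qed
      ultimately have "\<bar>row_flow K q v T \<bullet> w - integral {0..T} (f p)\<bar> \<le> M * (3 * M * e) + 4 * M^3 * T\<^sup>2 * d\<^sup>2" by linarith
      also have "\<dots> \<le> C * (e + d\<^sup>2)"
      proof -
        have "4 * M^3 * T\<^sup>2 * e \<ge> 0" "3 * M\<^sup>2 * d\<^sup>2 \<ge> 0" using M T e0 by auto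
        then show ?thesis unfolding C_def by (simp add: algebra_simps power2_eq_square)
      qed
      finally show ?thesis unfolding f_def .
    qed
    show "\<bar>fst (row_flow K q e2 T) - integral {0..T} (\<lambda>t. (q t - p t) * fst (row_flow K p e3 t))\<bar> \<le> C * (e + d\<^sup>2)"
      using key[OF nE(2,1)] unfolding rot_row_col[OF p] by (simp add: triple_inner e1_def e2_def)
    show "\<bar>fst (row_flow K q e3 T) + integral {0..T} (\<lambda>t. (q t - p t) * fst (row_flow K p e2 t))\<bar> \<le> C * (e + d\<^sup>2)"
      using key[OF nE(3,1)] unfolding rot_row_col[OF p] by (simp add: triple_inner e1_def e3_def)
    show "\<bar>fst (snd (row_flow K q e3 T)) - integral {0..T} (\<lambda>t. (q t - p t) * fst (row_flow K p e1 t))\<bar> \<le> C * (e + d\<^sup>2)"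
      using key[OF nE(3,2)] unfolding rot_row_col[OF p] by (simp add: triple_inner e2_def e3_def)
  qed
qed

text \<open>The symmetry group has dimension three: a frame near the identity that vanishes below
  the diagonal and preserves \<open>metric K\<close> is the identity. For \<open>K = 0\<close> the
  form does not see the first coordinate, but there \<open>e1\<close> is a constant
  solution.\<close>

lemma closing_conditions:
  assumes q: "admissible q" and z: "fst (row_flow K q e2 T) = 0" "fst (row_flow K q e3 T) = 0" "fst (snd (row_flow K q e3 T)) = 0"
    and near: "norm (row_flow K q e1 T - e1) < 1" "norm (row_flow K q e2 T - e2) < 1" "norm (row_flow K q e3 T - e3) < 1"
  shows "row_flow K q e1 T = e1 \<and> row_flow K q e2 T = e2 \<and> row_flow K q e3 T = e3"
proof -
  obtain x1 y1 z1 where r1: "row_flow K q e1 T = (x1, y1, z1)" by (metis prod.collapse)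
  obtain y2 z2 where r2: "row_flow K q e2 T = (0, y2, z2)" using z(1) by (metis prod.collapse)
  obtain z3 where r3: "row_flow K q e3 T = (0, 0, z3)" using z(2,3) by (metis prod.collapse)
  have pos: "x1 > 0" "y2 > 0" "z3 > 0"
    using le_less_trans[OF triple_comp_le(1) near(1)] le_less_trans[OF triple_comp_le(2) near(2)] le_less_trans[OF triple_comp_le(3) near(3)]
    unfolding r1 r2 r3 by (auto simp: e1_def e2_def e3_def)
  note o = row_flow_orthogonal[OF q, of K _ T]
  have "z3 * z3 = 1" using o[of e3 e3] unfolding r3 by (simp add: r3 e3_def metric_def triple_inner)
  then have z3: "z3 = 1" using pos by (simp add: square_eq_1_iff)
  have z2: "z2 = 0" using o[of e2 e3] unfolding r2 r3 by (simp add: r2 r3 z3 e2_def e3_def metric_def triple_inner)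
  have "y2 * y2 = 1" using o[of e2 e2] unfolding r2 by (simp add: r2 z2 e2_def metric_def triple_inner)
  then have y2: "y2 = 1" using pos by (simp add: square_eq_1_iff)
  have z1: "z1 = 0" using o[of e1 e3] unfolding r1 r3 by (simp add: r1 r3 z3 e1_def e3_def metric_def triple_inner)
  have y1: "y1 = 0" using o[of e1 e2] unfolding r1 r2 by (simp add: r1 r2 z2 y2 e1_def e2_def metric_def triple_inner)
  have "x1 = 1"
  proof (cases "K = 0")
    case True
    have "(\<lambda>_. e1) t = flow 1 K q ((\<lambda>_. e1) 0) t" for t
    proof (rule flow_unique[OF q])
      have "gen 1 K (q t) e1 = 0" for t by (simp add: gen_def e1_def True zero_prod_def)
      then show "((\<lambda>_. e1) has_vector_derivative gen 1 K (q t) e1) (at t)" for t by simp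
    qed
    from this[of T] show ?thesis unfolding r1 by (simp add: e1_def)
  next
    case False
    have "K * (x1 * x1) = K" using o[of e1 e1] unfolding r1 by (simp add: r1 y1 z1 e1_def metric_def triple_inner)
    then show ?thesis using False pos by (simp add: square_eq_1_iff)
  qed
  then show ?thesis unfolding r1 r2 r3 by (simp add: y1 z1 y2 z2 z3 e1_def e2_def e3_def)
qed

section \<open>Continuous dependence on the potential, and nondegeneracy of curves that are not
  geodesics\<close>

lemma admissible_periodic:
  assumes "continuous_on UNIV q" "\<And>t. q (t + T) = q t" "T > 0"
  shows "admissible q"
proof -
  obtain Q where Q: "\<And>t. t \<in> {0..T} \<Longrightarrow> \<bar>q t\<bar> \<le> Q"
    using continuous_on_compact_bound[OF compact_Icc continuous_on_subset[OF assms(1)], of 0 T] by (metis subset_UNIV real_norm_def)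
  have n: "q (t + real n * T) = q t" for t n
  proof (induction n)
    case (Suc n)
    have "q (t + real (Suc n) * T) = q ((t + real n * T) + T)" by (simp add: algebra_simps)
    then show ?case using Suc assms(2) by simp
  qed simp
  have z: "q (t + of_int k * T) = q t" for t k
  proof (cases "k \<ge> 0")
    case True
    then show ?thesis using n[of t "nat k"] by simp
  next
    case False
    then show ?thesis using n[of "t + of_int k * T" "nat (- k)"] by (simp add: algebra_simps)
  qed
  have "\<bar>q t\<bar> \<le> Q" for t
  proof -
    define k where "k = \<lfloor>t / T\<rfloor>"
    have "of_int k \<le> t / T" "t / T < of_int k + 1" unfolding k_def by linarith+
    then have "of_int k * T \<le> t" "t < (of_int k + 1) * T" using assms(3) by (simp_all add: field_simps)
    then have "t - of_int k * T \<in> {0..T}" by (auto simp: algebra_simps)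
    then show ?thesis using Q z[of "t - of_int k * T" k] by force
  qed
  then show ?thesis using assms(1) by (auto simp: admissible_def)
qed

lemma C2_periodic_admissible: "C2_periodic T w \<Longrightarrow> T > 0 \<Longrightarrow> admissible w"
  by (rule admissible_periodic[OF C2_periodic_continuous]) (auto simp: C2_periodic_def)

lemma flow_tendsto:
  assumes q: "admissible q" "\<And>n. admissible (qs n)" and T: "T \<ge> 0"
    and le: "\<And>n t. t \<in> {0..T} \<Longrightarrow> \<bar>qs n t - q t\<bar> \<le> E n" and E: "E \<longlonglongrightarrow> 0"
  shows "(\<lambda>n. flow m k (qs n) v T) \<longlonglongrightarrow> flow m k q v T"
proof -
  have cq: "continuous_on S q" "\<And>n. continuous_on S (qs n)" for S using q by (auto simp: admissible_def intro: continuous_on_subset)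
  obtain B where B: "\<And>t. t \<in> {0..T} \<Longrightarrow> norm (flow m k q v t) \<le> B"
    using continuous_on_compact_bound[OF compact_Icc flow_continuous[OF q(1)], of 0 T m k v] by metis
  define P where "P = integral {0..T} (\<lambda>s. \<bar>q s\<bar>) + T"
  define c where "c = 2 * B * T * exp ((\<bar>m\<bar> + \<bar>k\<bar>) * T + 2 * P)"
  have "\<forall>\<^sub>F n in sequentially. norm (flow m k (qs n) v T - flow m k q v T) \<le> c * E n"
  proof -
    have "\<forall>\<^sub>F n in sequentially. E n < 1" using E by (rule order_tendstoD) simp
    then show ?thesis
    proof eventually_elim
      case (elim n)
      have "norm (flow m k (qs n) (flow m k q v 0) T - flow m k q v T) \<le> 2 * B * (E n * T) * exp ((\<bar>m\<bar> + \<bar>k\<bar>) * T + 2 * P)"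
      proof (rule flow_compare[OF q(2) L2_loc_continuous[OF cq(1)] flow_continuous[OF q(1)] B])
        show "((\<lambda>s. gen m k (q s) (flow m k q v s)) has_integral flow m k q v s - flow m k q v 0) {0..s}" if "s \<in> {0..T}" for s
          by (rule integral_of_derivative[OF flow_deriv[OF q(1)]]) (use that in auto)
        have "norm (integral {0..T} (\<lambda>s. \<bar>qs n s - q s\<bar>)) \<le> E n * (T - 0)"
          using le T by (intro integral_bound continuous_intros cq) auto
        then show "integral {0..T} (\<lambda>s. \<bar>qs n s - q s\<bar>) \<le> E n * T" by simp
        have "integral {0..T} (\<lambda>s. \<bar>qs n s\<bar>) \<le> integral {0..T} (\<lambda>s. \<bar>q s\<bar> + 1)"
        proof (intro integral_le integrable_continuous_real continuous_intros cq)
          show "\<bar>qs n s\<bar> \<le> \<bar>q s\<bar> + 1" if "s \<in> {0..T}" for s using le[OF that, of n] elim by linarith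
        qed
        also have "\<dots> = P" unfolding P_def
          using T by (subst Henstock_Kurzweil_Integration.integral_add) (auto intro!: integrable_continuous_real continuous_intros cq)
        finally show "integral {0..T} (\<lambda>s. \<bar>qs n s\<bar>) \<le> P" .
      qed (use T in auto)
      then show ?case by (simp add: flow_0[OF q(1)] c_def mult_ac)
    qed
  qed
  moreover have "(\<lambda>n. c * E n) \<longlonglongrightarrow> 0" using tendsto_mult_right_zero[OF E] .
  ultimately have "(\<lambda>n. flow m k (qs n) v T - flow m k q v T) \<longlonglongrightarrow> 0" by (rule Lim_null_comparison)
  then show ?thesis by (simp add: LIM_zero_iff)
qed

abbreviation zsA :: "(real \<Rightarrow> real) \<Rightarrow> complex \<Rightarrow> real \<Rightarrow> complex" where "zsA \<equiv> zs_potential.A"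
abbreviation zsB :: "(real \<Rightarrow> real) \<Rightarrow> complex \<Rightarrow> real \<Rightarrow> complex" where "zsB \<equiv> zs_potential.B"

lemma admissible_zs: "admissible q \<Longrightarrow> \<exists>Q. zs_potential q Q"
  unfolding admissible_def zs_potential_def by auto

lemma zs_tendsto:
  assumes q: "admissible q" "\<And>n. admissible (qs n)" and T: "T \<ge> 0"
    and le: "\<And>n t. t \<in> {0..T} \<Longrightarrow> \<bar>qs n t - q t\<bar> \<le> E n" and E: "E \<longlonglongrightarrow> 0" and l: "l \<longlonglongrightarrow> l0"
  shows "(\<lambda>n. zsA (qs n) (of_real (l n)) T) \<longlonglongrightarrow> zsA q (of_real l0) T"
    "(\<lambda>n. zsB (qs n) (of_real (l n)) T) \<longlonglongrightarrow> zsB q (of_real l0) T"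
proof -
  define e where "e n = \<bar>E n\<bar> + \<bar>l n - l0\<bar>" for n
  have e: "(\<lambda>n. sqrt (4 * e n * T)) \<longlonglongrightarrow> 0"
  proof -
    have "(\<lambda>n. sqrt (4 * (\<bar>E n\<bar> + \<bar>l n - l0\<bar>) * T)) \<longlonglongrightarrow> sqrt (4 * (\<bar>0\<bar> + \<bar>l0 - l0\<bar>) * T)" by (intro tendsto_intros E l)
    then show ?thesis by (simp add: e_def)
  qed
  obtain Q where Q: "zs_potential q Q" using admissible_zs[OF q(1)] by blast
  have b: "(cmod (zsA (qs n) (of_real (l n)) T - zsA q (of_real l0) T))\<^sup>2 \<le> 4 * e n * T \<and>
     (cmod (zsB (qs n) (of_real (l n)) T - zsB q (of_real l0) T))\<^sup>2 \<le> 4 * e n * T" for n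
  proof -
    obtain Q' where Q': "zs_potential (qs n) Q'" using admissible_zs[OF q(2)] by blast
    have "\<bar>qs n s - q s\<bar> \<le> e n" if "0 \<le> s" "s \<le> T" for s using le[of s n] that by (auto simp: e_def)
    moreover have "\<bar>l n - l0\<bar> \<le> e n" by (simp add: e_def)
    ultimately show ?thesis
      using zs_row_diff[OF zs_potential.AB[OF Q', of "of_real (l n)"] zs_potential.AB[OF Q, of "of_real l0"]
         zs_potential.AB0[OF Q'] zs_potential.AB0[OF Q] T, of "e n"] by blast
  qed
  have "(\<lambda>n. zsA (qs n) (of_real (l n)) T - zsA q (of_real l0) T) \<longlonglongrightarrow> 0"
    by (rule Lim_null_comparison[OF _ e], rule always_eventually) (use b in \<open>auto intro!: real_le_rsqrt\<close>)
  then show "(\<lambda>n. zsA (qs n) (of_real (l n)) T) \<longlonglongrightarrow> zsA q (of_real l0) T" by (simp add: LIM_zero_iff)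
  have "(\<lambda>n. zsB (qs n) (of_real (l n)) T - zsB q (of_real l0) T) \<longlonglongrightarrow> 0"
    by (rule Lim_null_comparison[OF _ e], rule always_eventually) (use b in \<open>auto intro!: real_le_rsqrt\<close>)
  then show "(\<lambda>n. zsB (qs n) (of_real (l n)) T) \<longlonglongrightarrow> zsB q (of_real l0) T" by (simp add: LIM_zero_iff)
qed

text \<open>In the vacuum every gap is closed, with double points exactly at the multiples of
  \<open>2 * pi / T\<close>.\<close>

lemma finite_gap_zero_potential:
  assumes T: "T > 0" and N: "negligible N" "\<And>t. t \<in> {0..T} - N \<Longrightarrow> q t = 0"
  shows "finite_gap T (\<lambda>t. complex_of_real (q t))"
proof -
  interpret zs_potential "\<lambda>_. 0" 0 by unfold_locales auto
  have d: "((\<lambda>t. cis (x / 2 * t)) has_vector_derivative \<i> * of_real x / 2 * cis (x / 2 * t)) (at t)" for x t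
    using has_vector_derivative_cis_mult[of "x / 2" t] by simp
  have "zs_solution (\<lambda>_. 0) (of_real x) (\<lambda>t. cis (x / 2 * t)) (\<lambda>_. 0)" for x
    unfolding zs_solution_def using d[of x] by auto
  from zs_unique[OF AB this _ _ less_imp_le[OF T]] have AB: "A (of_real x) T = cis (x / 2 * T)" "B (of_real x) T = 0" for x
    by (simp_all add: AB0)
  show ?thesis
  proof (rule finite_gapI[OF T _ N(1), where l = "\<lambda>n. 2 * pi / T * real n" and K = 0])
    show "A (of_real (2 * pi / T * real n)) T \<in> \<real> \<and> B (of_real (2 * pi / T * real n)) T = 0" for n
    proof -
      have "2 * pi / T * real n / 2 * T = pi * real n" using T by simp
      moreover have "cis (pi * real n) \<in> \<real>" by (auto simp: complex_is_Real_iff sin_times_pi_eq_0)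
      ultimately show ?thesis by (simp only: AB)
    qed
  qed (use N in auto)
qed

text \<open>A curve contained in a plane through the origin of the frame space is a geodesic.\<close>

lemma planar_imp_geodesic:
  assumes T: "T > 0" and \<kappa>: "L2_loc \<kappa>"
    and S: "continuous_on UNIV S" "\<And>t. t \<in> {0..T} \<Longrightarrow> ((\<lambda>s. gen 1 K (\<kappa> s) (S s)) has_integral S t - S 0) {0..t}"
    and S0: "S 0 \<noteq> 0" and planar: "\<And>t. t \<in> {0..T} \<Longrightarrow> fst (S t) = 0"
  shows "\<exists>N. negligible N \<and> (\<forall>t\<in>{0..T} - N. \<kappa> t = 0)"
proof -
  define y where "y t = fst (snd (S t))" for t
  define z where "z t = snd (snd (S t))" for t
  have cy: "continuous_on A y" and cz: "continuous_on A z" for A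
    unfolding y_def z_def by (intro continuous_intros continuous_on_subset[OF S(1)]; simp)+
  have bl: "bounded_linear (\<lambda>v :: triple. fst (snd v))" "bounded_linear (\<lambda>v :: triple. snd (snd v))"
    by (intro bounded_linear_fst_comp bounded_linear_snd_comp bounded_linear_snd)+
  have i: "(y has_integral 0) {0..t}" "((\<lambda>s. \<kappa> s * z s - K * fst (S s)) has_integral y t - y 0) {0..t}"
    "((\<lambda>s. - \<kappa> s * y s) has_integral z t - z 0) {0..t}" if t: "t \<in> {0..T}" for t
    using has_integral_linear[OF S(2)[OF t] bounded_linear_fst] has_integral_linear[OF S(2)[OF t] bl(1)]
      has_integral_linear[OF S(2)[OF t] bl(2)] planar[OF t] planar[of 0] T
    by (simp_all add: o_def gen_def y_def[abs_def] z_def[abs_def])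
  \<comment> \<open>The first component of the equation makes all integrals of \<open>y\<close> over
    \<open>{0..t}\<close> vanish, hence \<open>y\<close> itself. Then \<open>z\<close> is constant
    and not 0, and the second component reduces to \<open>z 0\<close> times the integral of
    \<kappa>.\<close>
  have y0: "y t = 0" if t: "t \<in> {0..T}" for t
  proof -
    have "((\<lambda>u. integral {0..u} y) has_vector_derivative y t) (at t within {0..T})"
      by (rule integral_has_vector_derivative[OF cy t])
    moreover have "((\<lambda>u. integral {0..u} y) has_vector_derivative 0) (at t within {0..T})"
      by (rule has_vector_derivative_transform[OF t _ has_vector_derivative_const[of 0]]) (use i(1) in \<open>simp add: integral_unique\<close>)
    ultimately show ?thesis using vector_derivative_unique_within_closed_interval[of 0 T t] T t by auto
  qed
  have z: "z t = z 0" if t: "t \<in> {0..T}" for t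
  proof -
    have "((\<lambda>s. - \<kappa> s * y s) has_integral 0) {0..t}" by (rule has_integral_is_0) (use y0 t in auto)
    from has_integral_unique[OF i(3)[OF t] this] show ?thesis by simp
  qed
  have z0: "z 0 \<noteq> 0"
  proof
    assume "z 0 = 0"
    then have "S 0 = 0" using planar[of 0] y0[of 0] T by (simp add: prod_eq_iff y_def z_def)
    then show False using S0 by simp
  qed
  have ik: "\<kappa> integrable_on {a..b}" for a b by (rule L2_loc_integrable[OF \<kappa>])
  have k0: "integral {0..t} \<kappa> = 0" if t: "t \<in> {0..T}" for t
  proof -
    have "((\<lambda>s. z 0 * \<kappa> s) has_integral y t - y 0) {0..t}"
    proof (rule has_integral_eq[OF _ i(2)[OF t]])
      fix s assume "s \<in> {0..t}"
      then have "s \<in> {0..T}" using t by auto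
      from z[OF this] planar[OF this] show "\<kappa> s * z s - K * fst (S s) = z 0 * \<kappa> s" by simp
    qed
    from integral_unique[OF this] have "z 0 * integral {0..t} \<kappa> = y t - y 0" by simp
    then show ?thesis using y0[OF t] y0[of 0] T z0 by auto
  qed
  have km: "integral {a..b} \<kappa> = 0" if "0 \<le> a" "a \<le> b" "b \<le> T" for a b
    using Henstock_Kurzweil_Integration.integral_combine[OF that(1,2) ik] k0[of a] k0[of b] that by auto
  obtain N where "negligible N" "\<And>t. t \<in> {0..T} - N \<Longrightarrow> \<kappa> t = 0"
    by (rule zero_integrals_imp_zero_AE[of \<kappa> 0 T, OF ik km]) (assumption+, rule that)
  then show ?thesis by blast
qed

text \<open>The attainable integrals form a subspace. If it were proper, some
  \<open>n \<noteq> 0\<close> would be orthogonal to it, and \<open>n \<bullet> x\<close> would be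
  orthogonal to all periodic C2 functions; as these are dense in L2, it would vanish on the period,
  against \<open>nd\<close>.\<close>

lemma dual_functions:
  fixes x :: "real \<Rightarrow> triple"
  assumes T: "T > 0" and x: "continuous_on UNIV x"
    and nd: "\<And>n. n \<noteq> 0 \<Longrightarrow> \<exists>t\<in>{0..T}. n \<bullet> x t \<noteq> 0"
  shows "\<exists>w. C2_periodic T w \<and> integral {0..T} (\<lambda>t. w t *\<^sub>R x t) = v"
proof -
  define V where "V = {integral {0..T} (\<lambda>t. w t *\<^sub>R x t) | w. C2_periodic T w}"
  have int: "(\<lambda>t. w t *\<^sub>R x t) integrable_on {0..T}" if "C2_periodic T w" for w
    by (intro integrable_continuous_real continuous_intros continuous_on_subset[OF x] continuous_on_subset[OF C2_periodic_continuous[OF that]]) auto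
  have VI: "integral {0..T} (\<lambda>t. w t *\<^sub>R x t) \<in> V" if "C2_periodic T w" for w using that by (auto simp: V_def)
  have sub: "subspace V"
  proof (rule subspaceI)
    show "0 \<in> V" using VI[OF C2_periodic_const[of T 0]] by simp
    fix a b assume "a \<in> V" "b \<in> V"
    then obtain u w where uw: "C2_periodic T u" "a = integral {0..T} (\<lambda>t. u t *\<^sub>R x t)" "C2_periodic T w" "b = integral {0..T} (\<lambda>t. w t *\<^sub>R x t)"
      unfolding V_def by blast
    have "a + b = integral {0..T} (\<lambda>t. (u t + w t) *\<^sub>R x t)"
      unfolding uw scaleR_add_left by (rule Henstock_Kurzweil_Integration.integral_add[symmetric]) (intro int uw)+
    then show "a + b \<in> V" using VI[OF C2_periodic_add[OF uw(1,3)]] by simp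
  next
    fix c a assume "a \<in> V"
    then obtain u where u: "C2_periodic T u" "a = integral {0..T} (\<lambda>t. u t *\<^sub>R x t)" unfolding V_def by blast
    have "c *\<^sub>R a = integral {0..T} (\<lambda>t. (c * u t) *\<^sub>R x t)"
      unfolding u scaleR_scaleR[symmetric] by (rule integral_cmul[symmetric])
    then show "c *\<^sub>R a \<in> V" using VI[OF C2_periodic_mult[OF C2_periodic_const u(1), of c]] by simp
  qed
  have "V = UNIV"
  proof (rule ccontr)
    assume "V \<noteq> UNIV"
    then have "span V \<noteq> UNIV" using sub by (metis span_eq_iff)
    then obtain n where n: "n \<noteq> 0" "\<And>v. v \<in> span V \<Longrightarrow> n \<bullet> v = 0" using span_not_UNIV_orthogonal by blast
    define f where "f t = n \<bullet> x t" for t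
    have cf: "continuous_on S f" for S unfolding f_def by (intro continuous_intros continuous_on_subset[OF x]) auto
    have orth: "integral {0..T} (\<lambda>t. w t * f t) = 0" if w: "C2_periodic T w" for w
    proof -
      have "n \<bullet> integral {0..T} (\<lambda>t. w t *\<^sub>R x t) = 0" by (rule n(2), rule span_base) (use w in \<open>auto simp: V_def\<close>)
      moreover have "integral {0..T} (\<lambda>t. n \<bullet> (w t *\<^sub>R x t)) = n \<bullet> integral {0..T} (\<lambda>t. w t *\<^sub>R x t)"
        using integral_linear[OF int[OF w] bounded_linear_inner_right[of n]] by (simp add: o_def)
      ultimately show ?thesis by (simp add: f_def)
    qed
    have "integral {0..T} (\<lambda>t. (f t)\<^sup>2) \<le> 0 + e" if e: "e > 0" for e
    proof -
      obtain w where w: "C2_periodic T w" "integral {0..T} (\<lambda>t. (f t - w t)\<^sup>2) < e"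
        using C2_periodic_L2_approx[OF L2_loc_continuous[OF cf] T e] by blast
      have cw: "continuous_on S w" for S using C2_periodic_continuous[OF w(1)] continuous_on_subset by blast
      have "integral {0..T} (\<lambda>t. (f t)\<^sup>2) + integral {0..T} (\<lambda>t. (w t)\<^sup>2) - 2 * integral {0..T} (\<lambda>t. w t * f t) = integral {0..T} (\<lambda>t. (f t - w t)\<^sup>2)"
      proof -
        have "((\<lambda>t. (f t)\<^sup>2 + (w t)\<^sup>2 - 2 * (w t * f t)) has_integral integral {0..T} (\<lambda>t. (f t)\<^sup>2) + integral {0..T} (\<lambda>t. (w t)\<^sup>2) - 2 * integral {0..T} (\<lambda>t. w t * f t)) {0..T}"
          by (intro has_integral_diff has_integral_add has_integral_mult_right integrable_integral integrable_continuous_real continuous_intros cf cw)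
        from integral_unique[OF this] show ?thesis by (simp add: power2_diff algebra_simps)
      qed
      moreover have "integral {0..T} (\<lambda>t. (w t)\<^sup>2) \<ge> 0"
        by (rule integral_nonneg) (auto intro!: integrable_continuous_real continuous_intros cw)
      ultimately show ?thesis using w(2) orth[OF w(1)] by simp
    qed
    then have "integral {0..T} (\<lambda>t. (f t)\<^sup>2) \<le> 0" by (rule field_le_epsilon)
    moreover have "integral {0..T} (\<lambda>t. (f t)\<^sup>2) \<ge> 0"
      by (rule integral_nonneg) (auto intro!: integrable_continuous_real continuous_intros cf)
    ultimately have "integral {0..T} (\<lambda>t. (f t)\<^sup>2) = 0" by simp
    moreover have cf2: "continuous_on {0..T} (\<lambda>t. (f t)\<^sup>2)" by (intro continuous_intros cf)
    ultimately have "\<forall>t\<in>{0..T}. (f t)\<^sup>2 = 0"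
      using integral_eq_0_iff[OF cf2 T] by simp
    then show False using nd[OF n(1)] by (auto simp: f_def)
  qed
  then have "v \<in> V" by simp
  then show ?thesis by (auto simp: V_def)
qed

section \<open>Closing the gaps and the frame\<close>

lemma osc_cmult: "osc T (\<lambda>s. c * q s) n t = of_real c * osc T q n t"
  unfolding osc_def by (simp add: mult.assoc flip: integral_mult_right)

lemma osc_sum:
  assumes "finite I" "\<And>i. i \<in> I \<Longrightarrow> continuous_on UNIV (q i)"
  shows "osc T (\<lambda>s. \<Sum>i\<in>I. q i s) n t = (\<Sum>i\<in>I. osc T (q i) n t)"
  using assms
proof (induction I rule: finite_induct)
  case (insert i I)
  then show ?case by (simp add: osc_add continuous_on_sum)
qed (simp add: osc_def)

text \<open>\<eta> is the radius for the closing parameters, \<open>A\<^sub>\<mu>\<close> the scale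
  of the shifts of double points, and gaps of index at most \<open>N\<close> are left alone.
  \<open>N \<ge> 1\<close> keeps the coordinates of the gaps beyond \<open>N\<close> apart from the
  coordinates 0, 1, 2.\<close>

locale deformation =
  fixes T K \<eta> A\<^sub>\<mu> :: real and p :: "real \<Rightarrow> real" and w :: "nat \<Rightarrow> real \<Rightarrow> real" and N :: nat
  assumes T: "T > 0" and p: "C2_periodic T p" and w: "\<And>i. C2_periodic T (w i)"
    and \<eta>: "0 \<le> \<eta>" "\<eta> \<le> 1" and N: "N \<ge> 1" and A\<^sub>\<mu>: "A\<^sub>\<mu> \<ge> 0"
begin

text \<open>
  Coordinates \<open>0, 1, 2\<close> of the cube are the parameters of the closing condition; coordinates
  \<open>3 n, 3 n + 1, 3 n + 2\<close> are the Fourier coefficient and the double point belonging to the gap \<open>n\<close>.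
\<close>

definition coef :: "(nat \<Rightarrow> real) \<Rightarrow> nat \<Rightarrow> complex" where
  "coef x n = (if n > N then Complex (x (3 * n)) (x (3 * n + 1)) else 0)"

definition base :: "(nat \<Rightarrow> real) \<Rightarrow> real \<Rightarrow> real" where
  "base x t = p t + (\<Sum>i<3. x i * w i t)"

definition pot :: "(nat \<Rightarrow> real) \<Rightarrow> real \<Rightarrow> real" where
  "pot x t = base x t + pert T (coef x) t"

definition freq :: "(nat \<Rightarrow> real) \<Rightarrow> nat \<Rightarrow> real" where
  "freq x n = 2 * pi / T * real n + x (3 * n + 2)"

text \<open>The radii for the shifts decrease only like 1/n, because the term \<open>H * G\<close>
  in \<open>gap_estimate\<close> does not shrink with the box. Coordinates of the untouched gaps
  have radius 0.\<close>

definition rad :: "nat \<Rightarrow> real" where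
  "rad i = (if i < 3 then \<eta> else if i div 3 > N then (if i mod 3 = 2 then A\<^sub>\<mu> / real (i div 3) else decay (i div 3)) else 0)"

text \<open>\<open>cis (- (pi * real n))\<close> is a sign. It makes the vacuum value at frequency
  \<open>2 * pi / T * n\<close> equal to 1 for every \<open>n\<close>.\<close>

definition u1 :: "(nat \<Rightarrow> real) \<Rightarrow> nat \<Rightarrow> complex" where
  "u1 x n = cis (- (pi * real n)) * zsA (pot x) (of_real (freq x n)) T"

definition u2 :: "(nat \<Rightarrow> real) \<Rightarrow> nat \<Rightarrow> complex" where
  "u2 x n = cis (pi * real n) * zsB (pot x) (of_real (freq x n)) T"

definition clos :: "(nat \<Rightarrow> real) \<Rightarrow> nat \<Rightarrow> real" where
  "clos x i = (if i = 0 then fst (row_flow K (pot x) e2 T) else if i = 1 then fst (row_flow K (pot x) e3 T)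
     else fst (snd (row_flow K (pot x) e3 T)))"

text \<open>A Newton step with the Jacobian replaced by its leading part: \<open>u2\<close> is about
  \<open>T / 2\<close> times the coefficient and \<open>Im u1\<close> about \<open>T / 2\<close>
  times the shift, whence the factors \<open>2 / T\<close>; by duality of the \<open>w i\<close> the
  closing functions are about the parameters themselves. Untouched coordinates are left
  fixed.\<close>

definition res :: "(nat \<Rightarrow> real) \<Rightarrow> nat \<Rightarrow> real" where
  "res x i = (if i < 3 then x i - clos x i else if i div 3 > N then
      (if i mod 3 = 0 then x i - 2 / T * Re (u2 x (i div 3))
       else if i mod 3 = 1 then x i - 2 / T * Im (u2 x (i div 3)) else x i - 2 / T * Im (u1 x (i div 3))) else x i)"

definition inbox :: "(nat \<Rightarrow> real) \<Rightarrow> bool" where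
  "inbox x \<longleftrightarrow> (\<forall>j. \<bar>x j\<bar> \<le> rad j)"

lemma rad_nonneg: "rad i \<ge> 0"
  using \<eta> A\<^sub>\<mu> by (simp add: rad_def decay)

lemma inboxD:
  assumes "inbox x"
  shows "i < 3 \<Longrightarrow> \<bar>x i\<bar> \<le> \<eta>" "n > N \<Longrightarrow> \<bar>x (3 * n)\<bar> \<le> decay n" "n > N \<Longrightarrow> \<bar>x (3 * n + 1)\<bar> \<le> decay n"
    "n > N \<Longrightarrow> \<bar>x (3 * n + 2)\<bar> \<le> A\<^sub>\<mu> / real n"
proof -
  have r: "\<bar>x j\<bar> \<le> rad j" for j using assms by (simp add: inbox_def)
  show "i < 3 \<Longrightarrow> \<bar>x i\<bar> \<le> \<eta>" using r[of i] by (simp add: rad_def)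
  have d: "(3 * n + 1) div 3 = n" "(3 * n + 2) div 3 = n" "(3 * n + 1) mod 3 = 1" "(3 * n + 2) mod 3 = 2" for n :: nat by presburger+
  show "n > N \<Longrightarrow> \<bar>x (3 * n)\<bar> \<le> decay n" using r[of "3 * n"] N by (simp add: rad_def)
  show "n > N \<Longrightarrow> \<bar>x (3 * n + 1)\<bar> \<le> decay n" using r[of "3 * n + 1"] N unfolding rad_def d by simp
  show "n > N \<Longrightarrow> \<bar>x (3 * n + 2)\<bar> \<le> A\<^sub>\<mu> / real n" using r[of "3 * n + 2"] N unfolding rad_def d by simp
qed

lemma coef_le:
  assumes "inbox x"
  shows "cmod (coef x n) \<le> 2 * (if n > N then decay n else 0)"
proof (cases "n > N")
  case True
  then have "cmod (coef x n) \<le> \<bar>x (3 * n)\<bar> + \<bar>x (3 * n + 1)\<bar>" using cmod_le[of "coef x n"] by (simp add: coef_def)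
  then show ?thesis using inboxD(2,3)[OF assms True] True by simp
qed (simp add: coef_def)

lemma coef_le_decay: "inbox x \<Longrightarrow> cmod (coef x n) \<le> 2 * decay n"
  using coef_le[of x n] decay(1)[of n] by (auto split: if_splits)

lemma coef_summable: "inbox x \<Longrightarrow> summable (\<lambda>n. cmod (coef x n))"
  by (rule summable_comparison_test'[OF summable_mult[OF decay(3), of 2], of 0]) (use coef_le_decay in simp)

lemma base_C2: "C2_periodic T (base x)"
  unfolding base_def by (intro C2_periodic_add C2_periodic_sum C2_periodic_mult C2_periodic_const p w) simp

lemma pot_continuous: "inbox x \<Longrightarrow> continuous_on UNIV (pot x)"
  unfolding pot_def by (intro continuous_intros C2_periodic_continuous[OF base_C2] pert_continuous coef_summable)

lemma pot_periodic: "pot x (t + T) = pot x t"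
  using base_C2[of x] by (simp add: pot_def pert_periodic[OF T] C2_periodic_def) metis

lemma pot_admissible: "inbox x \<Longrightarrow> admissible (pot x)"
  by (rule admissible_periodic[OF pot_continuous pot_periodic T])

lemma inbox_limit:
  assumes "\<And>k. inbox (X k)" "\<And>j. (\<lambda>k. X k j) \<longlonglongrightarrow> x j"
  shows "inbox x"
  unfolding inbox_def
proof
  fix j
  show "\<bar>x j\<bar> \<le> rad j"
    by (rule LIMSEQ_le_const2[OF tendsto_rabs[OF assms(2)]]) (use assms(1) in \<open>auto simp: inbox_def\<close>)
qed

text \<open>On the box, convergence of each coordinate already gives uniform convergence of the
  potentials, by Tannery's theorem with the majorant \<open>4 * decay n\<close>.\<close>

lemma pot_converges:
  assumes X: "\<And>k. inbox (X k)" "\<And>j. (\<lambda>k. X k j) \<longlonglongrightarrow> x j"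
  shows "\<exists>E. E \<longlonglongrightarrow> 0 \<and> (\<forall>k. \<forall>t\<in>{0..T}. \<bar>pot (X k) t - pot x t\<bar> \<le> E k)"
proof -
  have x: "inbox x" by (rule inbox_limit[OF X])
  have "\<exists>W. \<forall>t\<in>{0..T}. \<bar>w i t\<bar> \<le> W" for i
    using continuous_on_compact_bound[OF compact_Icc continuous_on_subset[OF C2_periodic_continuous[OF w]], of 0 T i] by (metis subset_UNIV real_norm_def)
  then obtain W where W: "\<And>i t. t \<in> {0..T} \<Longrightarrow> \<bar>w i t\<bar> \<le> W i" by metis
  define E1 where "E1 k = (\<Sum>i<3. \<bar>X k i - x i\<bar> * W i)" for k
  define E2 where "E2 k = (\<Sum>n. cmod (coef (X k) n - coef x n))" for k
  have "E1 \<longlonglongrightarrow> (\<Sum>i<3. \<bar>x i - x i\<bar> * W i)" unfolding E1_def by (intro tendsto_intros X)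
  then have E1: "E1 \<longlonglongrightarrow> 0" by simp
  have "E2 \<longlonglongrightarrow> (\<Sum>n. 0)"
    unfolding E2_def
  proof (rule conjunct2[OF conjunct2[OF tannerys_theorem[where M = "\<lambda>n. 4 * decay n"]]])
    show "(\<lambda>k. cmod (coef (X k) n - coef x n)) \<longlonglongrightarrow> 0" for n
    proof -
      have "(\<lambda>k. coef (X k) n) \<longlonglongrightarrow> coef x n"
        unfolding coef_def using X(2) by (auto intro!: tendsto_Complex)
      then have "(\<lambda>k. cmod (coef (X k) n - coef x n)) \<longlonglongrightarrow> cmod (coef x n - coef x n)" by (intro tendsto_intros)
      then show ?thesis by simp
    qed
    have "norm (cmod (coef (X k) n - coef x n)) \<le> 4 * decay n" for k n
      using norm_triangle_ineq4[of "coef (X k) n" "coef x n"] coef_le_decay[OF X(1), of k n] coef_le_decay[OF x, of n] by simp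
    then show "\<forall>\<^sub>F (n, k) in sequentially \<times>\<^sub>F sequentially. norm (cmod (coef (X k) n - coef x n)) \<le> 4 * decay n"
      by (intro always_eventually) auto
    show "summable (\<lambda>n. 4 * decay n)" by (intro summable_mult decay)
  qed simp
  then have E2: "E2 \<longlonglongrightarrow> 0" by simp
  show ?thesis
  proof (intro exI[of _ "\<lambda>k. E1 k + 2 * E2 k"] conjI allI ballI)
    show "(\<lambda>k. E1 k + 2 * E2 k) \<longlonglongrightarrow> 0" using tendsto_add[OF E1 tendsto_mult_right_zero[OF E2, of 2]] by simp
    fix k t assume t: "t \<in> {0..T}"
    have "pot (X k) t - pot x t = (\<Sum>i<3. (X k i - x i) * w i t) + (pert T (coef (X k)) t - pert T (coef x) t)"
      by (simp add: pot_def base_def left_diff_distrib sum_subtractf)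
    also have "\<bar>\<dots>\<bar> \<le> \<bar>\<Sum>i<3. (X k i - x i) * w i t\<bar> + \<bar>pert T (coef (X k)) t - pert T (coef x) t\<bar>" by (rule abs_triangle_ineq)
    also have "\<bar>\<Sum>i<3. (X k i - x i) * w i t\<bar> \<le> E1 k"
      unfolding E1_def by (rule order_trans[OF sum_abs sum_mono]) (auto simp: abs_mult intro!: mult_left_mono W t)
    also have "\<bar>pert T (coef (X k)) t - pert T (coef x) t\<bar> \<le> 2 * E2 k"
      unfolding E2_def by (rule pert_diff[OF coef_summable[OF X(1)] coef_summable[OF x]])
    finally show "\<bar>pot (X k) t - pot x t\<bar> \<le> E1 k + 2 * E2 k" by simp
  qed
qed

lemma res_continuous:
  assumes X: "\<And>k. inbox (X k)" "\<And>j. (\<lambda>k. X k j) \<longlonglongrightarrow> x j"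
  shows "(\<lambda>k. res (X k) i) \<longlonglongrightarrow> res x i"
proof -
  have x: "inbox x" by (rule inbox_limit[OF X])
  obtain E where E: "E \<longlonglongrightarrow> 0" "\<And>k t. t \<in> {0..T} \<Longrightarrow> \<bar>pot (X k) t - pot x t\<bar> \<le> E k" using pot_converges[OF X] by blast
  have T0: "T \<ge> 0" using T by simp
  have fl: "(\<lambda>k. row_flow K (pot (X k)) v T) \<longlonglongrightarrow> row_flow K (pot x) v T" for v
    by (rule flow_tendsto[OF pot_admissible[OF x] pot_admissible[OF X(1)] T0 E(2,1)])
  have fr: "(\<lambda>k. freq (X k) n) \<longlonglongrightarrow> freq x n" for n unfolding freq_def by (intro tendsto_intros X)
  have zs: "(\<lambda>k. u1 (X k) n) \<longlonglongrightarrow> u1 x n" "(\<lambda>k. u2 (X k) n) \<longlonglongrightarrow> u2 x n" for n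
    unfolding u1_def u2_def
    by (rule tendsto_mult[OF tendsto_const zs_tendsto(1)[OF pot_admissible[OF x] pot_admissible[OF X(1)] T0 E(2,1) fr]],
        assumption, rule tendsto_mult[OF tendsto_const zs_tendsto(2)[OF pot_admissible[OF x] pot_admissible[OF X(1)] T0 E(2,1) fr]], assumption)
  have cl: "(\<lambda>k. clos (X k) i) \<longlonglongrightarrow> clos x i" for i
    unfolding clos_def by (auto intro!: tendsto_intros fl)
  show ?thesis unfolding res_def using T by (auto intro!: tendsto_intros X cl zs)
qed

lemma fixed_point:
  assumes into: "\<And>x i. inbox x \<Longrightarrow> \<bar>res x i\<bar> \<le> rad i"
  obtains x where "inbox x" "\<And>i. i < 3 \<Longrightarrow> clos x i = 0" "\<And>n. n > N \<Longrightarrow> u2 x n = 0 \<and> Im (u1 x n) = 0"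
proof -
  obtain x where x: "\<And>j. \<bar>x j\<bar> \<le> rad j" "\<And>i. res x i = x i"
  proof (rule hilbert_cube_fixed_point[of rad res])
    show "rad i \<ge> 0" for i by (rule rad_nonneg)
    show "\<bar>res x i\<bar> \<le> rad i" if "\<And>j. \<bar>x j\<bar> \<le> rad j" for x i using into that by (simp add: inbox_def)
    show "(\<lambda>k. res (X k) i) \<longlonglongrightarrow> res x i" if "\<And>k j. \<bar>X k j\<bar> \<le> rad j" "\<And>j. (\<lambda>k. X k j) \<longlonglongrightarrow> x j" for X x i
      by (rule res_continuous) (use that in \<open>auto simp: inbox_def\<close>)
  qed blast
  have d: "(3 * n + 1) div 3 = n" "(3 * n + 2) div 3 = n" "(3 * n + 1) mod 3 = 1" "(3 * n + 2) mod 3 = 2" for n :: nat by presburger+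
  show thesis
  proof (rule that[of x])
    show "inbox x" using x(1) by (simp add: inbox_def)
    show "clos x i = 0" if "i < 3" for i using x(2)[of i] that by (simp add: res_def)
    show "u2 x n = 0 \<and> Im (u1 x n) = 0" if n: "n > N" for n
    proof -
      have n3: "\<not> 3 * n < 3" "\<not> 3 * n + 1 < 3" "\<not> 3 * n + 2 < 3" using n N by auto
      have "Re (u2 x n) = 0" using x(2)[of "3 * n"] n n3 T by (simp add: res_def)
      moreover have "Im (u2 x n) = 0" using x(2)[of "3 * n + 1"] n n3 T unfolding res_def d by simp
      moreover have "Im (u1 x n) = 0" using x(2)[of "3 * n + 2"] n n3 T unfolding res_def d by simp
      ultimately show ?thesis by (simp add: complex_eq_iff)
    qed
  qed
qed

lemma osc_base:
  assumes x: "inbox x" and P: "P \<ge> 0" "cmod (osc T p n t) \<le> P" "\<And>i. i < 3 \<Longrightarrow> cmod (osc T (w i) n t) \<le> P"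
  shows "cmod (osc T (base x) n t) \<le> 4 * P"
proof -
  have c: "continuous_on UNIV p" "continuous_on UNIV (\<lambda>t. x i * w i t)" for i
    using C2_periodic_continuous[OF p] C2_periodic_continuous[OF w] by (auto intro!: continuous_intros)
  have "osc T (base x) n t = osc T p n t + (\<Sum>i<3. of_real (x i) * osc T (w i) n t)"
    unfolding base_def by (subst osc_add) (auto intro!: c continuous_on_sum simp: osc_sum[OF _ c(2)] osc_cmult)
  also have "cmod \<dots> \<le> P + (\<Sum>i<(3::nat). P)"
  proof (rule norm_triangle_mono[OF P(2) order_trans[OF norm_sum sum_mono]])
    fix i assume i: "i \<in> {..<3::nat}"
    have "cmod (of_real (x i) * osc T (w i) n t) \<le> 1 * P"
      unfolding norm_mult norm_of_real using inboxD(1)[OF x, of i] \<eta> P i by (intro mult_mono) auto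
    then show "cmod (of_real (x i) * osc T (w i) n t) \<le> P" by simp
  qed
  finally show ?thesis by simp
qed

text \<open>\<open>A\<^sub>\<mu> / n\<close> dominates all first-order quantities: \<open>Hh\<close>
  accounts for the oscillating primitive, \<open>2 * P / T + 1\<close> for the mean
  \<open>c\<close>, and \<open>2 * Hh * G + 2\<close> for the new shift. The hypothesis
  \<open>big\<close> then makes the quadratic errors fit; in \<open>deformation_exists\<close> the
  constants in it are independent of \<open>N\<close>.\<close>

lemma gap_into:
  assumes P: "P \<ge> 0" "\<And>n t. n \<ge> 1 \<Longrightarrow> t \<in> {0..T} \<Longrightarrow> cmod (osc T p n t) \<le> P / real n" "\<And>n. n \<ge> 1 \<Longrightarrow> cmod (osc T p n T) \<le> P / (real n)\<^sup>2"
      "\<And>i n t. i < 3 \<Longrightarrow> n \<ge> 1 \<Longrightarrow> t \<in> {0..T} \<Longrightarrow> cmod (osc T (w i) n t) \<le> P / real n" "\<And>i n. i < 3 \<Longrightarrow> n \<ge> 1 \<Longrightarrow> cmod (osc T (w i) n T) \<le> P / (real n)\<^sup>2"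
    and H: "H \<ge> 0" "\<And>g n. (\<And>m. cmod (g m) \<le> 2 * decay m) \<Longrightarrow> n \<ge> 1 \<Longrightarrow> osc T (pert T g) n T = of_real T * g n"
      "\<And>g n t. (\<And>m. cmod (g m) \<le> 2 * decay m) \<Longrightarrow> n \<ge> 1 \<Longrightarrow> t \<in> {0..T} \<Longrightarrow> cmod (osc T (pert T g) n t - of_real t * g n) \<le> H / real n"
    and G: "\<And>x t. inbox x \<Longrightarrow> t \<in> {0..T} \<Longrightarrow> \<bar>pot x t\<bar> \<le> 2 * G" "G \<ge> 0"
    and k1: "k1 = T * (2 + G) + 1" and k2: "k2 = k1 * (2 + G) + 1" and Hh: "Hh = 4 * P + H"
    and A: "A\<^sub>\<mu> = 2 * Hh * G + Hh + 2 * P / T + 3"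
    and big: "\<And>n. n > N \<Longrightarrow> A\<^sub>\<mu> / real n \<le> 1 \<and> k2 * A\<^sub>\<mu>\<^sup>2 / real n \<le> 1 \<and> (4 * P / T + 2 * k2 * A\<^sub>\<mu>\<^sup>2) / (real n)\<^sup>2 \<le> decay n \<and> decay n \<le> 1 / real n"
    and x: "inbox x" and i: "i \<ge> 3"
  shows "\<bar>res x i\<bar> \<le> rad i"
proof (cases "i div 3 > N")
  case False
  then show ?thesis using x i by (simp add: res_def inbox_def)
next
  case n: True
  define n where "n = i div 3"
  have nN: "n > N" and n1: "n \<ge> 1" using n N by (auto simp: n_def)
  have rn: "real n > 0" using n1 by simp
  define q where "q = pot x"
  define \<mu> where "\<mu> = x (3 * n + 2)"
  define lr where "lr = freq x n"
  define \<omega> where "\<omega> = 2 * pi / T"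
  have adm: "admissible q" unfolding q_def by (rule pot_admissible[OF x])
  have cq: "continuous_on S q" for S using pot_continuous[OF x] continuous_on_subset unfolding q_def by blast
  obtain Q where Q: "zs_potential q Q" using admissible_zs[OF adm] by blast
  define a where "a = zsA q (of_real lr)"
  define b where "b = zsB q (of_real lr)"
  have da: "(a has_vector_derivative (\<i> * of_real lr / 2 * a t - of_real (q t) / 2 * b t)) (at t)"
    and db: "(b has_vector_derivative (of_real (q t) / 2 * a t - \<i> * of_real lr / 2 * b t)) (at t)" for t
    using zs_potential.derivs(1,2)[OF Q] unfolding a_def b_def by auto
  have ab0: "a 0 = 1" "b 0 = 0" using zs_potential.AB0[OF Q] by (auto simp: a_def b_def)
  have "(cmod (a t))\<^sup>2 + (cmod (b t))\<^sup>2 = 1" for t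
    using zs_energy_real[OF zs_potential.AB[OF Q], of "of_real lr" t] ab0 by (simp add: a_def b_def)
  then have ab1: "cmod (a t) \<le> 1" "cmod (b t) \<le> 1" for t
    by (metis le_add_same_cancel1 le_add_same_cancel2 one_power2 power2_le_imp_le zero_le_one zero_le_power2)+
  \<comment> \<open>In coordinates rotating with frequency \<open>\<omega> * n / 2\<close> the fast
    phase moves from the spectral parameter to the coefficient \<open>g\<close>, and the small \<mu>
    is all that remains of the former: the system of \<open>gap_estimate\<close>.\<close>
  define v1 where "v1 t = cis (- (\<omega> * real n / 2) * t) * a t" for t
  define v2 where "v2 t = cis (\<omega> * real n / 2 * t) * b t" for t
  define g where "g t = of_real (q t) / 2 * cis (\<omega> * real n * t)" for t
  have cg: "continuous_on S g" for S unfolding g_def by (intro continuous_intros cq) auto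
  have l_eq: "lr = \<omega> * real n + \<mu>" by (simp add: lr_def freq_def \<omega>_def \<mu>_def)
  have cc: "cis (- (\<omega> * real n / 2) * t) = cis (- (\<omega> * real n * t)) * cis (\<omega> * real n / 2 * t)"
    "cis (\<omega> * real n / 2 * t) = cis (\<omega> * real n * t) * cis (- (\<omega> * real n / 2) * t)" for t
    unfolding cis_mult by (rule arg_cong[of _ _ cis], simp add: field_simps)+
  have dv1: "(v1 has_vector_derivative (\<i> * of_real \<mu> / 2 * v1 t - cnj (g t) * v2 t)) (at t)" for t
  proof -
    have "(v1 has_vector_derivative (cis (- (\<omega> * real n / 2) * t) * (\<i> * of_real lr / 2 * a t - of_real (q t) / 2 * b t) +
       \<i> * of_real (- (\<omega> * real n / 2)) * cis (- (\<omega> * real n / 2) * t) * a t)) (at t)"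
      unfolding v1_def by (intro has_vector_derivative_mult has_vector_derivative_cis_mult da)
    moreover have "cis (- (\<omega> * real n / 2) * t) * (\<i> * of_real lr / 2 * a t - of_real (q t) / 2 * b t) +
       \<i> * of_real (- (\<omega> * real n / 2)) * cis (- (\<omega> * real n / 2) * t) * a t =
       \<i> * of_real \<mu> / 2 * v1 t - of_real (q t) / 2 * (cis (- (\<omega> * real n / 2) * t) * b t)"
      unfolding v1_def l_eq by (simp add: field_simps)
    moreover have "of_real (q t) / 2 * (cis (- (\<omega> * real n / 2) * t) * b t) = cnj (g t) * v2 t"
      unfolding cc(1) g_def v2_def by (simp add: cis_cnj)
    ultimately show ?thesis by simp
  qed
  have dv2: "(v2 has_vector_derivative (g t * v1 t - \<i> * of_real \<mu> / 2 * v2 t)) (at t)" for t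
  proof -
    have "(v2 has_vector_derivative (cis (\<omega> * real n / 2 * t) * (of_real (q t) / 2 * a t - \<i> * of_real lr / 2 * b t) +
       \<i> * of_real (\<omega> * real n / 2) * cis (\<omega> * real n / 2 * t) * b t)) (at t)"
      unfolding v2_def by (intro has_vector_derivative_mult has_vector_derivative_cis_mult db)
    moreover have "cis (\<omega> * real n / 2 * t) * (of_real (q t) / 2 * a t - \<i> * of_real lr / 2 * b t) +
       \<i> * of_real (\<omega> * real n / 2) * cis (\<omega> * real n / 2 * t) * b t =
       of_real (q t) / 2 * (cis (\<omega> * real n / 2 * t) * a t) - \<i> * of_real \<mu> / 2 * v2 t"
      unfolding v2_def l_eq by (simp add: field_simps)
    moreover have "of_real (q t) / 2 * (cis (\<omega> * real n / 2 * t) * a t) = g t * v1 t"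
      unfolding cc(2) g_def v1_def by simp
    ultimately show ?thesis by simp
  qed
  obtain J where J: "J 0 = 0" "\<And>t. (J has_vector_derivative g t) (at t)" using primitive_exists[OF cg] by blast
  have Josc: "J t = osc T q n t / 2" if t: "t \<in> {0..T}" for t
  proof -
    have "integral {0..t} g = J t" using integral_unique[OF integral_of_derivative[OF J(2), of 0 t]] J(1) t by simp
    moreover have "integral {0..t} g = integral {0..t} (\<lambda>s. (1/2) * (of_real (q s) * cis (2 * pi / T * real n * s)))"
      by (rule arg_cong[of _ _ "integral _"]) (simp add: g_def \<omega>_def fun_eq_iff)
    ultimately show ?thesis unfolding osc_def by simp
  qed
  \<comment> \<open>The mean of \<open>g\<close> over the period, so that the primitive
    \<open>h\<close> of \<open>g - c\<close> vanishes at both ends.\<close>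
  define c where "c = osc T q n T / (2 * of_real T)"
  define h where "h t = J t - of_real t * c" for t
  have dh: "(h has_vector_derivative g t - c) (at t)" for t
    unfolding h_def by (auto intro!: derivative_eq_intros J)
  have h0: "h 0 = 0" "h T = 0" using J(1) Josc[of T] T by (auto simp: h_def c_def)
  define \<gamma> where "\<gamma> = coef x n"
  have osc_q: "osc T q n t = osc T (base x) n t + osc T (pert T (coef x)) n t" for t
    unfolding q_def pot_def by (rule osc_add[OF C2_periodic_continuous[OF base_C2] pert_continuous[OF coef_summable[OF x]]])
  have oscT: "osc T q n T = osc T (base x) n T + of_real T * \<gamma>"
    unfolding osc_q \<gamma>_def using H(2)[OF coef_le_decay[OF x] n1] by simp
  have b1: "cmod (osc T (base x) n t) \<le> 4 * (P / real n)" if "t \<in> {0..T}" for t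
    by (rule osc_base[OF x]) (use P n1 that in auto)
  have b2: "cmod (osc T (base x) n T) \<le> 4 * (P / (real n)\<^sup>2)"
    by (rule osc_base[OF x]) (use P n1 in auto)
  have \<gamma>le: "cmod \<gamma> \<le> 2 * decay n" unfolding \<gamma>_def by (rule coef_le_decay[OF x])
  have hH: "cmod (h t) \<le> Hh / real n" if t: "t \<in> {0..T}" for t
  proof -
    have T0: "complex_of_real T \<noteq> 0" using T by simp
    have "h t = (osc T (base x) n t + (osc T (pert T (coef x)) n t - of_real t * \<gamma>) - of_real (t / T) * osc T (base x) n T) / 2"
      using T0 unfolding h_def Josc[OF t] c_def oscT osc_q[of t] by (simp add: field_simps)
    also have "cmod \<dots> \<le> (4 * (P / real n) + H / real n + 1 * (4 * (P / real n))) / 2"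
    proof -
      have "cmod (of_real (t / T) * osc T (base x) n T) \<le> 1 * (4 * (P / real n))"
        unfolding norm_mult norm_of_real using b1[of T] T t P(1) by (intro mult_mono) auto
      moreover have "cmod (osc T (pert T (coef x)) n t - of_real t * \<gamma>) \<le> H / real n"
        unfolding \<gamma>_def by (rule H(3)[OF coef_le_decay[OF x] n1 t])
      ultimately show ?thesis unfolding norm_divide using b1[OF t]
        by (simp only: norm_numeral) (rule divide_right_mono[OF order_trans[OF norm_triangle_ineq4 add_mono[OF order_trans[OF norm_triangle_ineq add_mono]]]], auto)
    qed
    also have "\<dots> \<le> Hh / real n" unfolding Hh using P(1) H(1) rn by (simp add: field_simps)
    finally show ?thesis .
  qed
  have Hh0: "Hh \<ge> 0" using Hh P H by simp
  define e where "e = A\<^sub>\<mu> / real n"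
  note bign = big[OF nN]
  have c_eq: "c = osc T (base x) n T / (2 * of_real T) + \<gamma> / 2"
    using T unfolding c_def oscT by (simp add: field_simps)
  have "(real n)\<^sup>2 \<ge> real n" using n1 by (simp add: power2_eq_square)
  then have Pn: "P / (real n)\<^sup>2 \<le> P / real n" using P(1) rn by (intro divide_left_mono) auto
  have ce: "cmod c \<le> e"
  proof -
    have "cmod c \<le> 4 * (P / real n) / (2 * T) + 1 / real n"
      unfolding c_eq
    proof (rule norm_triangle_mono)
      have "cmod (osc T (base x) n T / (2 * of_real T)) = cmod (osc T (base x) n T) / (2 * T)" using T by (simp add: norm_divide norm_mult)
      also have "\<dots> \<le> 4 * (P / real n) / (2 * T)" using b2 Pn T by (intro divide_right_mono) auto
      finally show "cmod (osc T (base x) n T / (2 * of_real T)) \<le> 4 * (P / real n) / (2 * T)" .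
      show "cmod (\<gamma> / 2) \<le> 1 / real n" using \<gamma>le bign by (simp add: norm_divide)
    qed
    also have "\<dots> = (2 * P / T + 1) / real n" using T rn by (simp add: field_simps)
    also have "\<dots> \<le> e" unfolding e_def A using Hh0 G(2) rn T P(1) by (intro divide_right_mono) auto
    finally show ?thesis .
  qed
  have \<mu>e: "\<bar>\<mu>\<bar> \<le> e" unfolding \<mu>_def e_def by (rule inboxD(4)[OF x nN])
  have He: "Hh / real n \<le> e" unfolding e_def A using Hh0 G(2) rn T P(1) by (intro divide_right_mono) auto
  have gG: "cmod (g t) \<le> G" if "t \<in> {0..T}" for t
    using G(1)[OF x that] by (simp add: g_def q_def norm_mult norm_divide)
  have nv: "cmod (v1 t) \<le> 1" "cmod (v2 t) \<le> 1" for t using ab1 by (simp_all add: v1_def v2_def norm_mult)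
  have i0: "v1 0 = 1" "v2 0 = 0" using ab0 by (simp_all add: v1_def v2_def)
  have e0: "0 \<le> e" "e \<le> 1" using A\<^sub>\<mu> rn bign by (auto simp: e_def)
  note est = gap_estimate[OF T dv1 dv2 i0 nv dh h0 hH gG ce \<mu>e He e0 k1 k2]
  have angle: "\<omega> * real n / 2 * T = pi * real n" "- (\<omega> * real n / 2) * T = - (pi * real n)" using T by (simp_all add: \<omega>_def)
  have v: "v1 T = u1 x n" "v2 T = u2 x n"
    unfolding v1_def v2_def angle u1_def u2_def a_def b_def q_def lr_def by simp_all
  have k2p: "k2 \<ge> 0" using k2 k1 G(2) T by simp
  have e2: "e\<^sup>2 = A\<^sub>\<mu>\<^sup>2 / (real n)\<^sup>2" by (simp add: e_def power_divide)
  \<comment> \<open>In the Newton step \<gamma> cancels. What remains is the Fourier coefficient of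
    the smooth part, of order 1/n^2 as it is taken over the full period, and the quadratic
    error.\<close>
  have gnew: "cmod (\<gamma> - of_real (2 / T) * u2 x n) \<le> decay n"
  proof -
    have "\<gamma> - of_real (2 / T) * u2 x n = - (osc T (base x) n T / of_real T) - of_real (2 / T) * (v2 T - of_real T * c)"
      using T unfolding v(2) c_eq by (simp add: field_simps)
    also have "cmod \<dots> \<le> 4 * (P / (real n)\<^sup>2) / T + 2 / T * (T * k2 * e\<^sup>2)"
    proof (rule order_trans[OF norm_triangle_ineq4 add_mono])
      show "cmod (- (osc T (base x) n T / of_real T)) \<le> 4 * (P / (real n)\<^sup>2) / T"
        unfolding norm_minus_cancel norm_divide norm_of_real using divide_right_mono[OF b2, of T] T by simp
      show "cmod (of_real (2 / T) * (v2 T - of_real T * c)) \<le> 2 / T * (T * k2 * e\<^sup>2)"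
        unfolding norm_mult norm_of_real using est(1) T by (intro mult_mono) auto
    qed
    also have "\<dots> = (4 * P / T + 2 * k2 * A\<^sub>\<mu>\<^sup>2) / (real n)\<^sup>2" unfolding e2 using T rn by (simp add: field_simps)
    also have "\<dots> \<le> decay n" using bign by simp
    finally show ?thesis .
  qed
  have munew: "\<bar>\<mu> - 2 / T * Im (u1 x n)\<bar> \<le> A\<^sub>\<mu> / real n"
  proof -
    have "\<mu> - 2 / T * Im (u1 x n) = - (2 / T) * (Im (v1 T) - \<mu> * T / 2)" using T unfolding v by (simp add: field_simps)
    also have "\<bar>\<dots>\<bar> = 2 / T * \<bar>Im (v1 T) - \<mu> * T / 2\<bar>" unfolding abs_mult using T by simp
    also have "\<dots> \<le> 2 / T * (T * (Hh / real n * G + k2 * e\<^sup>2))" using est(2) T by (intro mult_left_mono) auto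
    also have "\<dots> = (2 * Hh * G + 2 * (k2 * A\<^sub>\<mu>\<^sup>2 / real n)) / real n" unfolding e2 using T rn by (simp add: field_simps power2_eq_square)
    also have "\<dots> \<le> (2 * Hh * G + 2 * 1) / real n" using bign rn by (intro divide_right_mono add_left_mono mult_left_mono) auto
    also have "\<dots> \<le> A\<^sub>\<mu> / real n" unfolding A using Hh0 T P(1) rn by (intro divide_right_mono) auto
    finally show ?thesis .
  qed
  have i3: "i = 3 * n + i mod 3" by (simp add: n_def)
  have \<gamma>c: "Re \<gamma> = x (3 * n)" "Im \<gamma> = x (3 * n + 1)" using nN by (simp_all add: \<gamma>_def coef_def)
  consider "i mod 3 = 0" | "i mod 3 = 1" | "i mod 3 = 2" by linarith
  then show ?thesis
  proof cases
    case 1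
    then have ix: "i = 3 * n" using i3 by simp
    have "\<bar>Re (\<gamma> - of_real (2 / T) * u2 x n)\<bar> \<le> decay n" using abs_Re_le_cmod gnew order_trans by blast
    then show ?thesis using 1 i n \<gamma>c ix by (simp add: res_def rad_def n_def[symmetric])
  next
    case 2
    then have ix: "i = 3 * n + 1" using i3 by simp
    have "\<bar>Im (\<gamma> - of_real (2 / T) * u2 x n)\<bar> \<le> decay n" using abs_Im_le_cmod gnew order_trans by blast
    then show ?thesis using 2 i n \<gamma>c unfolding res_def rad_def n_def[symmetric] by (simp add: ix)
  next
    case 3
    then have ix: "x i = \<mu>" using i3 by (simp add: \<mu>_def)
    then show ?thesis using 3 i n munew unfolding res_def rad_def n_def[symmetric] by simp
  qed
qed

end

text \<open>The condition on \<open>C\<close> amounts to \<open>C \<le> real n powr (1/4)\<close>,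
  where 1/4 is the margin between the exponents 2 and 7/4. The tail of \<open>decay\<close> bounds
  the whole perturbation uniformly.\<close>

lemma gap_index_bounds:
  assumes "\<rho> > 0"
  obtains N where "N \<ge> 1" "\<And>n. n > N \<Longrightarrow> A / real n \<le> 1 \<and> B / real n \<le> 1 \<and> C / (real n)\<^sup>2 \<le> decay n \<and> decay n \<le> 1 / real n"
    "4 * (\<Sum>m. if m > N then decay m else 0) \<le> \<rho>"
proof -
  have "(\<lambda>n. c / real n) \<longlonglongrightarrow> 0" for c :: real by real_asymp
  then have e1: "\<forall>\<^sub>F n in sequentially. c / real n < 1" for c :: real by (rule order_tendstoD) simp
  have "filterlim (\<lambda>n. real n powr (1/4)) at_top sequentially" by real_asymp
  then have e2: "\<forall>\<^sub>F n in sequentially. C \<le> real n powr (1/4)" by (simp add: filterlim_at_top)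
  from eventually_conj[OF e1[of A] eventually_conj[OF e1[of B] e2]]
  obtain N1 where N1: "\<And>n. n \<ge> N1 \<Longrightarrow> A / real n < 1 \<and> B / real n < 1 \<and> C \<le> real n powr (1/4)" unfolding eventually_sequentially by blast
  obtain N2 where N2: "\<And>n. n \<ge> N2 \<Longrightarrow> norm (\<Sum>i. decay (i + n)) < \<rho> / 4"
    using suminf_exist_split[OF _ decay(3), of "\<rho> / 4"] assms by auto
  define N where "N = N1 + N2 + 1"
  show thesis
  proof (rule that[of N])
    show "A / real n \<le> 1 \<and> B / real n \<le> 1 \<and> C / (real n)\<^sup>2 \<le> decay n \<and> decay n \<le> 1 / real n" if n: "n > N" for n
    proof (intro conjI)
      have n0: "real n \<ge> 1" using n by (simp add: N_def)
      show "A / real n \<le> 1" "B / real n \<le> 1" using N1[of n] n by (auto simp: N_def)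
      have "C / (real n)\<^sup>2 \<le> real n powr (1/4) / (real n)\<^sup>2" using N1[of n] n by (intro divide_right_mono) (auto simp: N_def)
      also have "\<dots> = decay n" using n0 unfolding decay_def by (simp flip: powr_numeral powr_diff)
      finally show "C / (real n)\<^sup>2 \<le> decay n" .
      have "decay n \<le> real n powr (-1)" unfolding decay_def using n0 by (intro powr_mono) auto
      then show "decay n \<le> 1 / real n" using n0 by (simp add: powr_minus_divide)
    qed
    let ?f = "\<lambda>m. if m > N then decay m else 0"
    have s: "summable ?f" by (rule summable_comparison_test'[OF decay(3), of 0]) (simp add: decay)
    have "suminf ?f = (\<Sum>i. decay (i + (N + 1)))" using suminf_split_initial_segment[OF s, of "N + 1"] by simp
    then show "4 * suminf ?f \<le> \<rho>" using N2[of "N + 1"] by (simp add: N_def)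
  qed (simp add: N_def)
qed

text \<open>\<open>est\<close> is the self-map property for the three closing coordinates. It is
  asked of every \<open>q\<close> near \<open>p\<close> plus the sum of the
  \<open>s i * w i\<close>, because the gap coefficients enter it only through the sup norm \<rho>
  of their series.\<close>

lemma deformation_exists:
  assumes T: "T > 0" and p: "C2_periodic T p" and w: "\<And>i. C2_periodic T (w i)" and \<eta>: "0 \<le> \<eta>" "\<eta> \<le> 1" and \<rho>: "\<rho> > 0"
    and est: "\<And>q s. admissible q \<Longrightarrow> (\<And>i. i < 3 \<Longrightarrow> \<bar>s i\<bar> \<le> \<eta>) \<Longrightarrow> (\<And>t. t \<in> {0..T} \<Longrightarrow> \<bar>q t - p t - (\<Sum>i<3. s i * w i t)\<bar> \<le> \<rho>) \<Longrightarrow>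
      \<bar>s (0::nat) - fst (row_flow K q e2 T)\<bar> \<le> \<eta> \<and> \<bar>s 1 - fst (row_flow K q e3 T)\<bar> \<le> \<eta> \<and> \<bar>s 2 - fst (snd (row_flow K q e3 T))\<bar> \<le> \<eta>"
  obtains q s where "admissible q" "\<And>t. q (t + T) = q t" "\<And>i. i < (3::nat) \<Longrightarrow> \<bar>s i\<bar> \<le> \<eta>"
    "\<And>t. t \<in> {0..T} \<Longrightarrow> \<bar>q t - p t - (\<Sum>i<3. s i * w i t)\<bar> \<le> \<rho>"
    "fst (row_flow K q e2 T) = 0" "fst (row_flow K q e3 T) = 0" "fst (snd (row_flow K q e3 T)) = 0"
    "\<And>q' N. negligible N \<Longrightarrow> (\<And>t. t \<in> {0..T} - N \<Longrightarrow> q' t = q t) \<Longrightarrow> finite_gap T (\<lambda>t. complex_of_real (q' t))"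
proof -
  have cb: "\<exists>M\<ge>0. \<forall>t\<in>{0..T}. \<bar>f t\<bar> \<le> M" if "C2_periodic T f" for f
    using continuous_on_compact_bound[OF compact_Icc continuous_on_subset[OF C2_periodic_continuous[OF that]], of 0 T] by (metis subset_UNIV real_norm_def)
  obtain Mp where Mp: "Mp \<ge> 0" "\<And>t. t \<in> {0..T} \<Longrightarrow> \<bar>p t\<bar> \<le> Mp" using cb[OF p] by blast
  have "\<forall>i. \<exists>M\<ge>0. \<forall>t\<in>{0..T}. \<bar>w i t\<bar> \<le> M" using cb[OF w] by blast
  then obtain W where W: "\<And>i. W i \<ge> 0" "\<And>i t. t \<in> {0..T} \<Longrightarrow> \<bar>w i t\<bar> \<le> W i" by metis
  define Ws where "Ws = (\<Sum>i<(3::nat). W i)"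
  \<comment> \<open>\<open>decay\<close> is summed over all indices and not just beyond
    \<open>N\<close>: every constant up to \<open>A\<close> has to be available before
    \<open>N\<close> is chosen.\<close>
  define G where "G = (Mp + Ws + 4 * suminf decay) / 2"
  obtain Pp where Pp: "Pp \<ge> 0" "\<And>n t. n \<ge> 1 \<Longrightarrow> t \<in> {0..T} \<Longrightarrow> cmod (osc T p n t) \<le> Pp / real n" "\<And>n. n \<ge> 1 \<Longrightarrow> cmod (osc T p n T) \<le> Pp / (real n)\<^sup>2"
    using osc_C2_periodic[OF T p] by blast
  have "\<forall>i. \<exists>P\<ge>0. \<forall>n\<ge>1. (\<forall>t\<in>{0..T}. cmod (osc T (w i) n t) \<le> P / real n) \<and> cmod (osc T (w i) n T) \<le> P / (real n)\<^sup>2"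
    using osc_C2_periodic[OF T w] by blast
  then obtain Pw where Pw: "\<And>i. Pw i \<ge> 0" "\<And>i n t. n \<ge> 1 \<Longrightarrow> t \<in> {0..T} \<Longrightarrow> cmod (osc T (w i) n t) \<le> Pw i / real n" "\<And>i n. n \<ge> 1 \<Longrightarrow> cmod (osc T (w i) n T) \<le> Pw i / (real n)\<^sup>2"
    by metis
  define P where "P = Pp + (\<Sum>i<(3::nat). Pw i)"
  have P0: "P \<ge> 0" unfolding P_def using Pp(1) Pw(1) by (intro add_nonneg_nonneg sum_nonneg) auto
  have PpP: "Pp \<le> P" unfolding P_def using Pw(1) sum_nonneg[of "{..<3}" Pw] by simp
  have PwP: "Pw i \<le> P" if "i < 3" for i
    unfolding P_def using member_le_sum[of i "{..<3}" Pw] Pw(1) Pp(1) that by simp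
  obtain H where H: "H \<ge> 0" "\<And>g n. (\<And>m. cmod (g m) \<le> 2 * decay m) \<Longrightarrow> n \<ge> 1 \<Longrightarrow> osc T (pert T g) n T = of_real T * g n"
      "\<And>g n t. (\<And>m. cmod (g m) \<le> 2 * decay m) \<Longrightarrow> n \<ge> 1 \<Longrightarrow> t \<in> {0..T} \<Longrightarrow> cmod (osc T (pert T g) n t - of_real t * g n) \<le> H / real n"
    using osc_pert[OF T] by blast
  define k1 where "k1 = T * (2 + G) + 1"
  define k2 where "k2 = k1 * (2 + G) + 1"
  define Hh where "Hh = 4 * P + H"
  define A where "A = 2 * Hh * G + Hh + 2 * P / T + 3"
  have G0: "G \<ge> 0" unfolding G_def Ws_def using Mp(1) W(1) sum_nonneg[of "{..<3}" W] suminf_nonneg[OF decay(3,1)] by simp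
  have A0: "A \<ge> 0" unfolding A_def Hh_def using G0 P0 H(1) T by simp
  obtain N where N: "N \<ge> 1" and big: "\<And>n. n > N \<Longrightarrow> A / real n \<le> 1 \<and> k2 * A\<^sup>2 / real n \<le> 1 \<and> (4 * P / T + 2 * k2 * A\<^sup>2) / (real n)\<^sup>2 \<le> decay n \<and> decay n \<le> 1 / real n"
    and tail: "4 * (\<Sum>m. if m > N then decay m else 0) \<le> \<rho>"
    by (rule gap_index_bounds[OF \<rho>, of A "k2 * A\<^sup>2" "4 * P / T + 2 * k2 * A\<^sup>2"], rule that) blast+
  interpret deformation T K \<eta> A p w N
    by unfold_locales (use T p w \<eta> N A0 in auto)
  have sd: "summable (\<lambda>m. if m > N then decay m else 0)" by (rule summable_comparison_test'[OF decay(3), of 0]) (simp add: decay)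
  have near: "\<bar>pot x t - p t - (\<Sum>i<3. x i * w i t)\<bar> \<le> \<rho>" if x: "inbox x" for x t
  proof -
    have "\<bar>pot x t - p t - (\<Sum>i<3. x i * w i t)\<bar> = \<bar>pert T (coef x) t\<bar>" by (simp add: pot_def base_def)
    also have "\<dots> \<le> 2 * (\<Sum>n. cmod (coef x n))" by (rule pert_bound[OF coef_summable[OF x]])
    also have "\<dots> \<le> 2 * (\<Sum>n. 2 * (if n > N then decay n else 0))"
      by (intro mult_left_mono suminf_le coef_le coef_summable x summable_mult sd) simp
    also have "\<dots> = 4 * (\<Sum>m. if m > N then decay m else 0)" by (subst suminf_mult[OF sd]) simp
    finally show ?thesis using tail by simp
  qed
  have potG: "\<bar>pot x t\<bar> \<le> 2 * G" if x: "inbox x" and t: "t \<in> {0..T}" for x t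
  proof -
    have "\<bar>pert T (coef x) t\<bar> \<le> 2 * (\<Sum>n. cmod (coef x n))" by (rule pert_bound[OF coef_summable[OF x]])
    also have "\<dots> \<le> 2 * (\<Sum>n. 2 * decay n)"
      by (intro mult_left_mono suminf_le coef_le_decay coef_summable x summable_mult decay) simp
    also have "\<dots> = 4 * suminf decay" by (subst suminf_mult[OF decay(3)]) simp
    finally have 1: "\<bar>pert T (coef x) t\<bar> \<le> 4 * suminf decay" .
    have "\<bar>\<Sum>i<3. x i * w i t\<bar> \<le> Ws"
      unfolding Ws_def
    proof (rule order_trans[OF sum_abs sum_mono])
      fix i assume "i \<in> {..<3::nat}"
      then have "\<bar>x i * w i t\<bar> \<le> 1 * W i" unfolding abs_mult using inboxD(1)[OF x, of i] \<eta> W t by (intro mult_mono) auto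
      then show "\<bar>x i * w i t\<bar> \<le> W i" by simp
    qed
    moreover define \<sigma> where "\<sigma> = (\<Sum>i<3. x i * w i t)"
    ultimately have "\<bar>\<sigma>\<bar> \<le> Ws" by simp
    then have "norm (p t + \<sigma> + pert T (coef x) t) \<le> Mp + Ws + 4 * suminf decay"
      using 1 Mp(2)[OF t] by (intro norm_triangle_mono) simp_all
    then show ?thesis unfolding pot_def base_def G_def \<sigma>_def[symmetric] by simp
  qed
  have into: "\<bar>res x i\<bar> \<le> rad i" if x: "inbox x" for x i
  proof (cases "i < 3")
    case True
    have "\<bar>x i - clos x i\<bar> \<le> \<eta>"
      using est[OF pot_admissible[OF x] inboxD(1)[OF x] near[OF x]] True unfolding clos_def
      by (auto simp: numeral_3_eq_3 less_Suc_eq numeral_2_eq_2)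
    then show ?thesis using True by (simp add: res_def rad_def)
  next
    case False
    show ?thesis
    proof (rule gap_into[of P H G k1 k2 Hh])
      show "cmod (osc T p n t) \<le> P / real n" if "n \<ge> 1" "t \<in> {0..T}" for n t
        by (rule order_trans[OF Pp(2)[OF that] divide_right_mono[OF PpP]]) simp
      show "cmod (osc T p n T) \<le> P / (real n)\<^sup>2" if "n \<ge> 1" for n
        by (rule order_trans[OF Pp(3)[OF that] divide_right_mono[OF PpP]]) simp
      show "cmod (osc T (w i) n t) \<le> P / real n" if "i < 3" "n \<ge> 1" "t \<in> {0..T}" for i n t
        by (rule order_trans[OF Pw(2)[OF that(2,3)] divide_right_mono[OF PwP[OF that(1)]]]) simp
      show "cmod (osc T (w i) n T) \<le> P / (real n)\<^sup>2" if "i < 3" "n \<ge> 1" for i n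
        by (rule order_trans[OF Pw(3)[OF that(2)] divide_right_mono[OF PwP[OF that(1)]]]) simp
    qed (use P0 H potG G0 k1_def k2_def Hh_def A_def big x False in auto)
  qed
  obtain x where x: "inbox x" and cl: "\<And>i. i < 3 \<Longrightarrow> clos x i = 0" and u: "\<And>n. n > N \<Longrightarrow> u2 x n = 0 \<and> Im (u1 x n) = 0"
    by (rule fixed_point, erule into, rule that) blast+
  show thesis
  proof (rule that[of "pot x" x])
    show "admissible (pot x)" by (rule pot_admissible[OF x])
    show "pot x (t + T) = pot x t" for t by (rule pot_periodic)
    show "\<bar>x i\<bar> \<le> \<eta>" if "i < 3" for i by (rule inboxD(1)[OF x that])
    show "\<bar>pot x t - p t - (\<Sum>i<3. x i * w i t)\<bar> \<le> \<rho>" for t by (rule near[OF x])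
    show "fst (row_flow K (pot x) e2 T) = 0" "fst (row_flow K (pot x) e3 T) = 0" "fst (snd (row_flow K (pot x) e3 T)) = 0"
      using cl[of 0] cl[of 1] cl[of 2] by (simp_all add: clos_def)
    fix q' M assume M: "negligible M" "\<And>t. t \<in> {0..T} - M \<Longrightarrow> q' t = pot x t"
    obtain Q where Q: "zs_potential (pot x) Q" using admissible_zs[OF pot_admissible[OF x]] by blast
    show "finite_gap T (\<lambda>t. complex_of_real (q' t))"
    proof (rule zs_potential.finite_gapI[OF Q T _ M, where l = "freq x" and K = N])
      show "pot x 0 = pot x T" using pot_periodic[of x 0] by simp
      show "(\<lambda>n. freq x n - 2 * pi / T * real n) \<longlonglongrightarrow> 0"
      proof (rule Lim_null_comparison)
        show "\<forall>\<^sub>F n in sequentially. norm (freq x n - 2 * pi / T * real n) \<le> A / real n"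
          using eventually_gt_at_top[of N] by eventually_elim (use inboxD(4)[OF x] in \<open>simp add: freq_def\<close>)
        show "(\<lambda>n. A / real n) \<longlonglongrightarrow> 0" by real_asymp
      qed
      fix n assume n: "n > N"
      have 1: "zsA (pot x) (of_real (freq x n)) T = cis (pi * real n) * u1 x n" unfolding u1_def by (simp add: cis_mult flip: mult.assoc)
      have "sin (pi * real n) = 0" by (rule sin_npi2)
      then have "Im (zsA (pot x) (of_real (freq x n)) T) = 0" unfolding 1 using u[OF n] by simp
      moreover have "zsB (pot x) (of_real (freq x n)) T = 0" using u[OF n] by (simp add: u2_def)
      ultimately show "zsA (pot x) (of_real (freq x n)) T \<in> \<real> \<and> zsB (pot x) (of_real (freq x n)) T = 0"
        by (simp add: complex_is_Real_iff)
    qed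
  qed
qed

section \<open>Choice of constants and approximation of a closed frame\<close>

lemma small_multiples:
  assumes "\<And>a b. (a, b) \<in> set L \<Longrightarrow> b > 0"
  obtains x :: real where "x > 0" "\<And>a b. (a, b) \<in> set L \<Longrightarrow> a * x \<le> b"
proof -
  have "\<forall>\<^sub>F x in at_right (0::real). fst c * x \<le> snd c" if "c \<in> set L" for c
  proof -
    have "((\<lambda>x. fst c * x) \<longlongrightarrow> fst c * 0) (at_right 0)" by (intro tendsto_intros)
    then have "\<forall>\<^sub>F x in at_right 0. fst c * x < snd c" by (rule order_tendstoD) (use assms that in \<open>cases c, auto\<close>)
    then show ?thesis by eventually_elim simp
  qed
  then have "\<forall>\<^sub>F x in at_right (0::real). \<forall>c\<in>set L. fst c * x \<le> snd c" by (intro eventually_ball_finite) auto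
  from eventually_happens'[OF _ eventually_conj[OF this eventually_at_right_less]]
  show thesis using that by (metis fst_conv snd_conv trivial_limit_at_right_real)
qed

lemma integral_product_diff:
  fixes f g X Y :: "real \<Rightarrow> real"
  assumes T: "T \<ge> 0" and c: "continuous_on {0..T} f" "continuous_on {0..T} g" "continuous_on {0..T} X" "continuous_on {0..T} Y"
    and b: "\<And>t. t \<in> {0..T} \<Longrightarrow> \<bar>f t - g t\<bar> \<le> \<rho>" "\<And>t. t \<in> {0..T} \<Longrightarrow> \<bar>g t\<bar> \<le> S"
      "\<And>t. t \<in> {0..T} \<Longrightarrow> \<bar>X t\<bar> \<le> B" "\<And>t. t \<in> {0..T} \<Longrightarrow> \<bar>X t - Y t\<bar> \<le> \<epsilon>"
  shows "\<bar>integral {0..T} (\<lambda>t. f t * X t) - integral {0..T} (\<lambda>t. g t * Y t)\<bar> \<le> (\<rho> * B + S * \<epsilon>) * T"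
proof -
  have "integral {0..T} (\<lambda>t. f t * X t) - integral {0..T} (\<lambda>t. g t * Y t) = integral {0..T} (\<lambda>t. f t * X t - g t * Y t)"
    by (intro Henstock_Kurzweil_Integration.integral_diff[symmetric] integrable_continuous_interval continuous_intros c)
  also have "norm \<dots> \<le> (\<rho> * B + S * \<epsilon>) * (T - 0)"
  proof (rule integral_bound[OF T])
    show "continuous_on {0..T} (\<lambda>t. f t * X t - g t * Y t)" by (intro continuous_intros c)
    fix t assume t: "t \<in> {0..T}"
    have "f t * X t - g t * Y t = (f t - g t) * X t + g t * (X t - Y t)" by (simp add: algebra_simps)
    also have "norm \<dots> \<le> \<rho> * B + S * \<epsilon>"
      by (rule norm_triangle_mono; unfold real_norm_def abs_mult; rule mult_mono)
        (use b[OF t] abs_ge_zero[of "f t - g t"] abs_ge_zero[of "g t"] in \<open>linarith | auto\<close>)+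
    finally show "norm (f t * X t - g t * Y t) \<le> \<rho> * B + S * \<epsilon>" .
  qed
  finally show ?thesis by simp
qed

text \<open>The pointwise inequality |f| <= \<theta> + f^2 / \<theta> is integrated.\<close>

lemma L1_le_of_L2_le:
  assumes T: "T > 0" and f: "L2_loc f" and \<theta>: "\<theta> > 0" and i: "integral {0..T} (\<lambda>t. (f t)\<^sup>2) \<le> \<theta>\<^sup>2"
  shows "integral {0..T} (\<lambda>t. \<bar>f t :: real\<bar>) \<le> \<theta> * (T + 1)"
proof -
  have si: "(\<lambda>t. (f t)\<^sup>2) integrable_on {0..T}" using f by (simp add: L2_loc_def)
  have "integral {0..T} (\<lambda>t. \<bar>f t\<bar>) \<le> integral {0..T} (\<lambda>t. \<theta> + (f t)\<^sup>2 / \<theta>)"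
  proof (rule integral_le)
    show "(\<lambda>t. \<bar>f t\<bar>) integrable_on {0..T}" using L2_loc_norm_integrable[OF f] by simp
    show "(\<lambda>t. \<theta> + (f t)\<^sup>2 / \<theta>) integrable_on {0..T}" by (intro integrable_add integrable_const_ivl integrable_on_divide si)
    fix t
    have "0 \<le> \<bar>f t\<bar> * \<theta>" using \<theta> by simp
    then have "\<bar>f t\<bar> * \<theta> \<le> \<theta> * \<theta> + (f t)\<^sup>2"
      using sum_squares_bound[of "\<bar>f t\<bar>" \<theta>] unfolding power2_abs power2_eq_square[of \<theta>] by linarith
    then show "\<bar>f t\<bar> \<le> \<theta> + (f t)\<^sup>2 / \<theta>" using \<theta> by (simp add: field_simps)
  qed
  also have "\<dots> = \<theta> * T + integral {0..T} (\<lambda>t. (f t)\<^sup>2) / \<theta>"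
    using T by (subst Henstock_Kurzweil_Integration.integral_add) (auto intro!: integrable_on_divide si)
  also have "\<dots> \<le> \<theta> * T + \<theta>\<^sup>2 / \<theta>" using i \<theta> by (intro add_left_mono divide_right_mono) auto
  finally show ?thesis using \<theta> by (simp add: field_simps power2_eq_square)
qed

lemma finite_gap_frame_approximation:
  fixes \<kappa> :: "real \<Rightarrow> real" and K T e :: real and R :: "triple \<Rightarrow> real \<Rightarrow> triple"
  assumes T: "T > 0" and e: "e > 0" and \<kappa>: "L2_loc \<kappa>"
    and Rc: "\<And>v. v \<in> {e1, e2, e3} \<Longrightarrow> continuous_on UNIV (R v)"
    and Ri: "\<And>v t. v \<in> {e1, e2, e3} \<Longrightarrow> t \<in> {0..T} \<Longrightarrow> ((\<lambda>s. gen 1 K (\<kappa> s) (R v s)) has_integral R v t - R v 0) {0..t}"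
    and R0: "\<And>v. v \<in> {e1, e2, e3} \<Longrightarrow> R v 0 = v" and RT: "\<And>v. v \<in> {e1, e2, e3} \<Longrightarrow> R v T = v"
    and nz: "\<not> (\<exists>N. negligible N \<and> (\<forall>t\<in>{0..T} - N. \<kappa> t = 0))"
  obtains q where "admissible q" "\<And>t. q (t + T) = q t" "\<And>v. v \<in> {e1, e2, e3} \<Longrightarrow> row_flow K q v T = v"
    "integral {0..T} (\<lambda>t. (\<kappa> t - q t)\<^sup>2) \<le> e"
    "\<And>v t. v \<in> {e1, e2, e3} \<Longrightarrow> t \<in> {0..T} \<Longrightarrow> norm (row_flow K q v t - R v t) \<le> e"
    "\<And>q' N. negligible N \<Longrightarrow> (\<And>t. t \<in> {0..T} - N \<Longrightarrow> q' t = q t) \<Longrightarrow> finite_gap T (\<lambda>t. complex_of_real (q' t))"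
proof -
  let ?E = "{e1, e2, e3}"
  define x where "x t = (fst (R e1 t), fst (R e2 t), fst (R e3 t))" for t
  have xc: "continuous_on UNIV x" unfolding x_def by (intro continuous_intros Rc) auto
  have nd: "\<exists>t\<in>{0..T}. n \<bullet> x t \<noteq> 0" if n: "n \<noteq> 0" for n
  proof (rule ccontr)
    assume pl: "\<not> (\<exists>t\<in>{0..T}. n \<bullet> x t \<noteq> 0)"
    define S where "S t = fst n *\<^sub>R R e1 t + fst (snd n) *\<^sub>R R e2 t + snd (snd n) *\<^sub>R R e3 t" for t
    have Sc: "continuous_on UNIV S" unfolding S_def by (intro continuous_intros Rc) auto
    have gl: "gen 1 K c (S t) = fst n *\<^sub>R gen 1 K c (R e1 t) + fst (snd n) *\<^sub>R gen 1 K c (R e2 t) + snd (snd n) *\<^sub>R gen 1 K c (R e3 t)" for c t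
      unfolding S_def by (simp add: linear_add[OF gen_linear] linear_scale[OF gen_linear])
    have Si: "((\<lambda>s. gen 1 K (\<kappa> s) (S s)) has_integral S t - S 0) {0..t}" if t: "t \<in> {0..T}" for t
    proof -
      have "S t - S 0 = fst n *\<^sub>R (R e1 t - R e1 0) + fst (snd n) *\<^sub>R (R e2 t - R e2 0) + snd (snd n) *\<^sub>R (R e3 t - R e3 0)"
        by (simp add: S_def algebra_simps)
      then show ?thesis unfolding gl using t by (auto intro!: has_integral_add has_integral_cmul Ri)
    qed
    have "S 0 = n" unfolding S_def by (cases n) (simp add: R0 e1_def e2_def e3_def)
    then have S0: "S 0 \<noteq> 0" using n by simp
    have "fst (S t) = n \<bullet> x t" for t by (simp add: S_def x_def triple_inner)
    then have "\<And>t. t \<in> {0..T} \<Longrightarrow> fst (S t) = 0" using pl by auto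
    from planar_imp_geodesic[OF T \<kappa> Sc Si S0 this] nz show False by blast
  qed
  have dual: "\<exists>w. C2_periodic T w \<and> integral {0..T} (\<lambda>t. w t *\<^sub>R x t) = v" for v
    by (rule dual_functions[OF T xc nd])
  \<comment> \<open>Order and signs are those of the three integrals in
    \<open>closing_estimate\<close>, so that the linearised closing functions become exactly
    \<open>s 0\<close>, \<open>s 1\<close> and \<open>s 2\<close>, as recorded in
    \<open>sums\<close>.\<close>
  define target :: "nat \<Rightarrow> triple" where "target i = (if i = 0 then e3 else if i = 1 then - e2 else e1)" for i
  define w where "w i = (SOME w. C2_periodic T w \<and> integral {0..T} (\<lambda>t. w t *\<^sub>R x t) = target i)" for i
  have w: "C2_periodic T (w i)" "integral {0..T} (\<lambda>t. w i t *\<^sub>R x t) = target i" for i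
    unfolding w_def using someI_ex[OF dual[of "target i"]] by blast+
  have wc: "continuous_on S (w i)" for i S using C2_periodic_continuous[OF w(1)] continuous_on_subset by blast
  have xcS: "continuous_on S x" for S using xc continuous_on_subset by blast
  have wx: "integral {0..T} (\<lambda>t. w i t * fst (R e1 t)) = fst (target i)"
    "integral {0..T} (\<lambda>t. w i t * fst (R e2 t)) = fst (snd (target i))"
    "integral {0..T} (\<lambda>t. w i t * fst (R e3 t)) = snd (snd (target i))" for i
  proof -
    have int: "(\<lambda>t. w i t *\<^sub>R x t) integrable_on {0..T}" by (intro integrable_continuous_interval continuous_intros wc xcS)
    have "integral {0..T} (h \<circ> (\<lambda>t. w i t *\<^sub>R x t)) = h (target i)" if "bounded_linear h" for h :: "triple \<Rightarrow> real"
      using integral_linear[OF int that] w(2) by simp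
    from this[of fst] this[of "\<lambda>v. fst (snd v)"] this[of "\<lambda>v. snd (snd v)"]
    show "integral {0..T} (\<lambda>t. w i t * fst (R e1 t)) = fst (target i)"
      "integral {0..T} (\<lambda>t. w i t * fst (R e2 t)) = fst (snd (target i))"
      "integral {0..T} (\<lambda>t. w i t * fst (R e3 t)) = snd (snd (target i))"
      by (simp_all add: o_def x_def bounded_linear_fst bounded_linear_snd bounded_linear_compose[OF bounded_linear_fst bounded_linear_snd]
        bounded_linear_compose[OF bounded_linear_snd bounded_linear_snd])
  qed
  have "\<exists>W. \<forall>t\<in>{0..T}. \<bar>w i t\<bar> \<le> W" for i
    using continuous_on_compact_bound[OF compact_Icc wc, of 0 T i] by (metis real_norm_def)
  then obtain Wi where Wi: "\<And>i t. t \<in> {0..T} \<Longrightarrow> \<bar>w i t\<bar> \<le> Wi i" by metis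
  define W where "W = 1 + \<bar>Wi 0\<bar> + \<bar>Wi 1\<bar> + \<bar>Wi 2\<bar>"
  have W1: "W \<ge> 1" by (simp add: W_def)
  have W: "\<bar>w i t\<bar> \<le> W" if "t \<in> {0..T}" "i < 3" for i t
    using Wi[OF that(1), of i] that(2) unfolding W_def by (auto simp: numeral_3_eq_3 less_Suc_eq numeral_2_eq_2)
  have "\<exists>B. \<forall>t\<in>{0..T}. norm (R v t) \<le> B" if "v \<in> ?E" for v
    using continuous_on_compact_bound[OF compact_Icc continuous_on_subset[OF Rc[OF that]], of 0 T] by (metis subset_UNIV)
  then obtain Bv where Bv: "\<And>v t. v \<in> ?E \<Longrightarrow> t \<in> {0..T} \<Longrightarrow> norm (R v t) \<le> Bv v" by metis
  define B where "B = 1 + \<bar>Bv e1\<bar> + \<bar>Bv e2\<bar> + \<bar>Bv e3\<bar>"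
  have B1: "B \<ge> 1" by (simp add: B_def)
  have B: "norm (R v t) \<le> B" if "v \<in> ?E" "t \<in> {0..T}" for v t
    using Bv[OF that] that(1) unfolding B_def by auto
  \<comment> \<open>Room for the L1 norms of both \<open>p\<close> and \<open>q\<close>, whose L1
    distance from \<kappa> will be at most \<open>T + 1\<close>. Thus \<open>P\<close>,
    \<open>C\<close> and \<Lambda> are fixed before \<open>p\<close> and \<open>q\<close>
    exist.\<close>
  define P where "P = integral {0..T} (\<lambda>s. \<bar>\<kappa> s\<bar>) + T + 1"
  obtain C where C: "C \<ge> 0" and Cest: "\<And>p q \<epsilon> d. admissible p \<Longrightarrow> admissible q \<Longrightarrow> integral {0..T} (\<lambda>s. \<bar>p s\<bar>) \<le> P \<Longrightarrow>
     (\<And>t. t \<in> {0..T} \<Longrightarrow> \<bar>q t - p t\<bar> \<le> d) \<Longrightarrow> d \<le> 1 \<Longrightarrow>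
     norm (row_flow K p e1 T - e1) \<le> \<epsilon> \<Longrightarrow> norm (row_flow K p e2 T - e2) \<le> \<epsilon> \<Longrightarrow> norm (row_flow K p e3 T - e3) \<le> \<epsilon> \<Longrightarrow>
     \<bar>fst (row_flow K q e2 T) - integral {0..T} (\<lambda>t. (q t - p t) * fst (row_flow K p e3 t))\<bar> \<le> C * (\<epsilon> + d\<^sup>2) \<and>
     \<bar>fst (row_flow K q e3 T) + integral {0..T} (\<lambda>t. (q t - p t) * fst (row_flow K p e2 t))\<bar> \<le> C * (\<epsilon> + d\<^sup>2) \<and>
     \<bar>fst (snd (row_flow K q e3 T)) - integral {0..T} (\<lambda>t. (q t - p t) * fst (row_flow K p e1 t))\<bar> \<le> C * (\<epsilon> + d\<^sup>2)"
    using closing_estimate[OF T, of P K] by (elim exE conjE) (rule that, assumption, blast)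
  define \<Lambda> where "\<Lambda> = 2 * B * exp ((1 + \<bar>K\<bar>) * T + 2 * P)"
  have \<Lambda>: "\<Lambda> > 0" unfolding \<Lambda>_def using B1 by simp
  \<comment> \<open>The allowed distance of the frames is kept below 1, so that
    \<open>closing_conditions\<close> applies to the frame of \<open>q\<close>.\<close>
  define m where "m = min e (1/2)"
  have m: "m > 0" "m \<le> e" "m < 1" using e by (auto simp: m_def)
  \<comment> \<open>In the order of the list: \<eta> is at most 1; the sup distance
    \<open>4 * W * \<eta>\<close> of \<open>q\<close> from \<open>p\<close> is at most 1; the
    quadratic closing error is at most \<open>\<eta> / 4\<close>; the deformation uses half of the
    frame error \<open>m\<close>; and it uses half of the L2 error \<open>e\<close>.\<close>
  obtain \<eta> where \<eta>: "\<eta> > 0" and \<eta>L: "\<And>a b. (a, b) \<in> set [(1, 1), (4 * W, 1), (64 * C * W\<^sup>2, 1), (8 * \<Lambda> * W * T, m), (64 * T * W\<^sup>2, e)] \<Longrightarrow> a * \<eta> \<le> b"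
    by (rule small_multiples[of "[(1, 1), (4 * W, 1), (64 * C * W\<^sup>2, 1), (8 * \<Lambda> * W * T, m), (64 * T * W\<^sup>2, e)]"]) (use e m in auto)
  have \<eta>s: "\<eta> \<le> 1" "4 * W * \<eta> \<le> 1" "64 * C * W\<^sup>2 * \<eta> \<le> 1" "8 * \<Lambda> * W * T * \<eta> \<le> m" "64 * T * W\<^sup>2 * \<eta> \<le> e"
    using \<eta>L[of 1 1] \<eta>L[of "4 * W" 1] \<eta>L[of "64 * C * W\<^sup>2" 1] \<eta>L[of "8 * \<Lambda> * W * T" m] \<eta>L[of "64 * T * W\<^sup>2" e] by auto
  \<comment> \<open>The allowance \<eta> of a Newton step is split into quarters: one for the
    quadratic error, one for the tail \<rho>, and two for the distance \<epsilon> between the frames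
    of \<open>p\<close> and of the given curve, once as closing defect (\<open>\<epsilon>C\<close>)
    and once inside the integrals (\<open>\<epsilon>W\<close>). Only then does \<theta> determine
    \<open>p\<close>.\<close>
  define \<rho> where "\<rho> = min \<eta> (\<eta> / (8 * B * T))"
  have \<rho>: "\<rho> > 0" "\<rho> \<le> \<eta>" "2 * B * T * \<rho> \<le> \<eta> / 4"
  proof -
    show "\<rho> > 0" "\<rho> \<le> \<eta>" unfolding \<rho>_def using \<eta> B1 T by auto
    have "\<rho> \<le> \<eta> / (8 * B * T)" unfolding \<rho>_def by simp
    then show "2 * B * T * \<rho> \<le> \<eta> / 4" using B1 T by (simp add: field_simps)
  qed
  define \<epsilon> where "\<epsilon> = min (min (\<eta> / (4 * C + 4)) (1 / (12 * W * T))) (min 1 (m / 2))"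
  have \<epsilon>: "\<epsilon> > 0" "\<epsilon> \<le> 1" unfolding \<epsilon>_def using \<eta> C W1 T m by auto
  have \<epsilon>m: "\<epsilon> \<le> m / 2" unfolding \<epsilon>_def by (intro min.coboundedI2 order_refl)
  have \<epsilon>C: "C * \<epsilon> \<le> \<eta> / 4"
  proof -
    have "\<epsilon> \<le> \<eta> / (4 * C + 4)" unfolding \<epsilon>_def by simp
    then have "\<epsilon> * (4 * C + 4) \<le> \<eta>" using C by (simp add: field_simps)
    then have "4 * (C * \<epsilon>) + 4 * \<epsilon> \<le> \<eta>" by (simp add: algebra_simps)
    then show ?thesis using \<epsilon>(1) by linarith
  qed
  have \<epsilon>W: "3 * W * \<eta> * \<epsilon> * T \<le> \<eta> / 4"
  proof -
    have "\<epsilon> \<le> 1 / (12 * W * T)" unfolding \<epsilon>_def by simp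
    then have "12 * W * T * \<epsilon> \<le> 1" using W1 T by (simp add: field_simps)
    from mult_right_mono[OF this, of \<eta>] \<eta> show ?thesis by (simp add: algebra_simps)
  qed
  obtain \<theta> where \<theta>: "\<theta> > 0" and \<theta>L: "\<And>a b. (a, b) \<in> set [(1, 1), (4, e), (T + 1, 1), (\<Lambda> * (T + 1), \<epsilon>)] \<Longrightarrow> a * \<theta> \<le> b"
    by (rule small_multiples[of "[(1, 1), (4, e), (T + 1, 1), (\<Lambda> * (T + 1), \<epsilon>)]"]) (use e \<epsilon> in auto)
  have \<theta>s: "\<theta> \<le> 1" "4 * \<theta> \<le> e" "\<theta> * (T + 1) \<le> 1" "\<Lambda> * (\<theta> * (T + 1)) \<le> \<epsilon>"
    using \<theta>L[of 1 1] \<theta>L[of 4 e] \<theta>L[of "T + 1" 1] \<theta>L[of "\<Lambda> * (T + 1)" \<epsilon>] by (auto simp: algebra_simps)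
  have "\<theta>\<^sup>2 > 0" using \<theta> by simp
  then obtain p where p: "C2_periodic T p" "integral {0..T} (\<lambda>t. (\<kappa> t - p t)\<^sup>2) < \<theta>\<^sup>2" using C2_periodic_L2_approx[OF \<kappa> T] by blast
  have padm: "admissible p" by (rule C2_periodic_admissible[OF p(1) T])
  have pcU: "continuous_on UNIV p" by (rule C2_periodic_continuous[OF p(1)])
  have pc: "continuous_on S p" for S using pcU continuous_on_subset by blast
  have L2d: "L2_loc (\<lambda>t. \<kappa> t - q t)" if "continuous_on UNIV q" for q
    using L2_loc_add[OF \<kappa> L2_loc_continuous[of "\<lambda>t. - q t"]] that by (simp add: continuous_on_minus)
  have absi: "(\<lambda>t. \<bar>f t\<bar>) integrable_on {0..T}" if "L2_loc f" for f :: "real \<Rightarrow> real"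
    using L2_loc_norm_integrable[OF that] by simp
  have sqi: "(\<lambda>t. (f t)\<^sup>2) integrable_on {0..T}" if "L2_loc f" for f :: "real \<Rightarrow> real"
    using that by (simp add: L2_loc_def)
  have pk: "integral {0..T} (\<lambda>t. \<bar>p t - \<kappa> t\<bar>) \<le> \<theta> * (T + 1)"
    using L1_le_of_L2_le[OF T L2d[OF pcU] \<theta>] p(2) by (simp add: abs_minus_commute)
  have L1: "integral {0..T} (\<lambda>t. \<bar>q t\<bar>) \<le> P" if q: "continuous_on UNIV q" and d: "integral {0..T} (\<lambda>t. \<bar>q t - \<kappa> t\<bar>) \<le> T + 1" for q
  proof -
    have "integral {0..T} (\<lambda>t. \<bar>q t\<bar>) \<le> integral {0..T} (\<lambda>t. \<bar>\<kappa> t\<bar> + \<bar>q t - \<kappa> t\<bar>)"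
      using absi[OF \<kappa>] absi[OF L2d[OF q]] absi[OF L2_loc_continuous[OF q]]
      by (intro integral_le integrable_add) (auto simp: abs_minus_commute)
    also have "\<dots> = integral {0..T} (\<lambda>t. \<bar>\<kappa> t\<bar>) + integral {0..T} (\<lambda>t. \<bar>q t - \<kappa> t\<bar>)"
      using absi[OF \<kappa>] absi[OF L2d[OF q]] by (intro Henstock_Kurzweil_Integration.integral_add) (auto simp: abs_minus_commute)
    finally show ?thesis using d unfolding P_def by simp
  qed
  have cmp: "norm (row_flow K q v t - R v t) \<le> \<Lambda> * d"
    if q: "admissible q" and d: "integral {0..T} (\<lambda>t. \<bar>q t - \<kappa> t\<bar>) \<le> d" "d \<le> T + 1" and v: "v \<in> ?E" and t: "t \<in> {0..T}" for q v t d
  proof -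
    have qc: "continuous_on UNIV q" using q by (simp add: admissible_def)
    have "norm (flow 1 K q (R v 0) t - R v t) \<le> 2 * B * d * exp ((\<bar>1\<bar> + \<bar>K\<bar>) * T + 2 * P)"
      by (rule flow_compare[OF q \<kappa> continuous_on_subset[OF Rc[OF v]] B[OF v] Ri[OF v] t L1[OF qc order_trans[OF d]] d(1)]) auto
    then show ?thesis using R0[OF v] unfolding \<Lambda>_def by (simp add: mult_ac)
  qed
  have pflow: "norm (row_flow K p v t - R v t) \<le> \<epsilon>" if "v \<in> ?E" "t \<in> {0..T}" for v t
    using cmp[OF padm pk _ that] \<theta>s(3,4) T by linarith
  have pT: "norm (row_flow K p v T - v) \<le> \<epsilon>" if "v \<in> ?E" for v using pflow[OF that, of T] RT[OF that] T by simp
  have sumW: "\<bar>\<Sum>i<3. s i * w i t\<bar> \<le> 3 * W * \<eta>" if s: "\<And>i. i < 3 \<Longrightarrow> \<bar>s i\<bar> \<le> \<eta>" and t: "t \<in> {0..T}" for s :: "nat \<Rightarrow> real" and t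
  proof -
    have "\<bar>\<Sum>i<3. s i * w i t\<bar> \<le> (\<Sum>i<(3::nat). \<eta> * W)"
      by (rule order_trans[OF sum_abs sum_mono], unfold abs_mult, rule mult_mono) (use s W[OF t] \<eta> in auto)
    then show ?thesis by (simp add: mult.commute mult.left_commute)
  qed
  have qp: "\<bar>q t - p t\<bar> \<le> 4 * W * \<eta>" if s: "\<And>i. i < 3 \<Longrightarrow> \<bar>s i\<bar> \<le> \<eta>" and t: "t \<in> {0..T}"
    and q: "\<bar>q t - p t - (\<Sum>i<3. s i * w i t)\<bar> \<le> \<rho>" for q :: "real \<Rightarrow> real" and s :: "nat \<Rightarrow> real" and t
  proof -
    have "\<eta> \<le> W * \<eta>" using W1 \<eta> by simp
    then show ?thesis using q sumW[of s t, OF s t] \<rho>(2) by linarith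
  qed
  have est: "\<bar>s (0::nat) - fst (row_flow K q e2 T)\<bar> \<le> \<eta> \<and> \<bar>s 1 - fst (row_flow K q e3 T)\<bar> \<le> \<eta> \<and> \<bar>s 2 - fst (snd (row_flow K q e3 T))\<bar> \<le> \<eta>"
    if q: "admissible q" and s: "\<And>i. i < 3 \<Longrightarrow> \<bar>s i\<bar> \<le> \<eta>" and near: "\<And>t. t \<in> {0..T} \<Longrightarrow> \<bar>q t - p t - (\<Sum>i<3. s i * w i t)\<bar> \<le> \<rho>" for q s
  proof -
    have qc: "continuous_on S q" for S using q continuous_on_subset unfolding admissible_def by blast
    have dC: "C * (4 * W * \<eta>)\<^sup>2 \<le> \<eta> / 4"
      using mult_right_mono[OF \<eta>s(3), of \<eta>] \<eta> by (simp add: power2_eq_square algebra_simps)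
    have lin: "\<bar>integral {0..T} (\<lambda>t. (q t - p t) * fst (row_flow K p v t)) - (\<Sum>i<3. s i * integral {0..T} (\<lambda>t. w i t * fst (R v t)))\<bar> \<le> \<eta> / 4 + \<eta> / 4"
      if v: "v \<in> ?E" for v
    proof -
      have rc: "continuous_on S (\<lambda>t. fst (row_flow K p v t))" for S by (intro continuous_intros flow_continuous padm)
      have Rcv: "continuous_on S (\<lambda>t. fst (R v t))" for S by (intro continuous_intros continuous_on_subset[OF Rc[OF v]]) auto
      have "(\<Sum>i<3. s i * integral {0..T} (\<lambda>t. w i t * fst (R v t))) = integral {0..T} (\<lambda>t. \<Sum>i<3. s i * (w i t * fst (R v t)))"
        by (subst integral_sum) (auto intro!: integrable_continuous_interval continuous_intros wc Rcv)
      also have "\<dots> = integral {0..T} (\<lambda>t. (\<Sum>i<3. s i * w i t) * fst (R v t))" by (simp add: sum_distrib_right mult.assoc)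
      finally have 1: "(\<Sum>i<3. s i * integral {0..T} (\<lambda>t. w i t * fst (R v t))) = integral {0..T} (\<lambda>t. (\<Sum>i<3. s i * w i t) * fst (R v t))" .
      have "\<bar>integral {0..T} (\<lambda>t. (q t - p t) * fst (row_flow K p v t)) - integral {0..T} (\<lambda>t. (\<Sum>i<3. s i * w i t) * fst (R v t))\<bar>
        \<le> (\<rho> * (2 * B) + (3 * W * \<eta>) * \<epsilon>) * T"
      proof (rule integral_product_diff)
        fix t assume t: "t \<in> {0..T}"
        have d: "\<bar>fst (row_flow K p v t - R v t)\<bar> \<le> \<epsilon>" using triple_comp_le(1)[of "row_flow K p v t - R v t"] pflow[OF v t] by linarith
        then show "\<bar>fst (row_flow K p v t) - fst (R v t)\<bar> \<le> \<epsilon>" by simp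
        then show "\<bar>fst (row_flow K p v t)\<bar> \<le> 2 * B" using triple_comp_le(1)[of "R v t"] B[OF v t] \<epsilon>(2) B1 by linarith
        show "\<bar>\<Sum>i<3. s i * w i t\<bar> \<le> 3 * W * \<eta>" by (rule sumW[OF s t])
      qed (use T near in \<open>auto intro!: continuous_intros qc pc wc rc Rcv\<close>)
      also have "\<dots> = 2 * B * T * \<rho> + 3 * W * \<eta> * \<epsilon> * T" by (simp add: algebra_simps)
      finally show ?thesis unfolding 1 using \<rho>(3) \<epsilon>W by linarith
    qed
    have sums: "(\<Sum>i<3. s i * integral {0..T} (\<lambda>t. w i t * fst (R e3 t))) = s 0"
      "(\<Sum>i<3. s i * integral {0..T} (\<lambda>t. w i t * fst (R e2 t))) = - s 1"
      "(\<Sum>i<3. s i * integral {0..T} (\<lambda>t. w i t * fst (R e1 t))) = s 2"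
      unfolding wx by (simp_all add: numeral_3_eq_3 target_def e1_def e2_def e3_def numeral_2_eq_2)
    have qp': "\<And>t. t \<in> {0..T} \<Longrightarrow> \<bar>q t - p t\<bar> \<le> 4 * W * \<eta>" by (rule qp[where s = s and q = q, OF s _ near])
    have L1p: "integral {0..T} (\<lambda>s. \<bar>p s\<bar>) \<le> P" by (rule L1[OF pcU]) (use pk \<theta>s(3) T in linarith)
    have c: "C * (\<epsilon> + (4 * W * \<eta>)\<^sup>2) \<le> \<eta> / 4 + \<eta> / 4" using \<epsilon>C dC by (simp add: distrib_left)
    note E = Cest[OF padm q L1p qp' \<eta>s(2) pT pT pT, OF _ insertI1 insertI2[OF insertI1] insertI2[OF insertI2[OF insertI1]]]
    show ?thesis
    proof (intro conjI)
      show "\<bar>s 0 - fst (row_flow K q e2 T)\<bar> \<le> \<eta>"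
        using conjunct1[OF E] lin[OF insertI2[OF insertI2[OF insertI1]], unfolded sums] c by linarith
      show "\<bar>s 1 - fst (row_flow K q e3 T)\<bar> \<le> \<eta>"
        using conjunct1[OF conjunct2[OF E]] lin[OF insertI2[OF insertI1], unfolded sums] c by linarith
      show "\<bar>s 2 - fst (snd (row_flow K q e3 T))\<bar> \<le> \<eta>"
        using conjunct2[OF conjunct2[OF E]] lin[OF insertI1, unfolded sums] c by linarith
    qed
  qed
  obtain q s where q: "admissible q" "\<And>t. q (t + T) = q t" and s: "\<And>i. i < (3::nat) \<Longrightarrow> \<bar>s i\<bar> \<le> \<eta>"
    and near: "\<And>t. t \<in> {0..T} \<Longrightarrow> \<bar>q t - p t - (\<Sum>i<3. s i * w i t)\<bar> \<le> \<rho>"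
    and cl: "fst (row_flow K q e2 T) = 0" "fst (row_flow K q e3 T) = 0" "fst (snd (row_flow K q e3 T)) = 0"
    and fg: "\<And>q' N. negligible N \<Longrightarrow> (\<And>t. t \<in> {0..T} - N \<Longrightarrow> q' t = q t) \<Longrightarrow> finite_gap T (\<lambda>t. complex_of_real (q' t))"
  proof (rule deformation_exists[OF T p(1) w(1) less_imp_le[OF \<eta>] \<eta>s(1) \<rho>(1), where K = K])
    fix q and s :: "nat \<Rightarrow> real"
    assume "admissible q" "\<And>i. i < 3 \<Longrightarrow> \<bar>s i\<bar> \<le> \<eta>" "\<And>t. t \<in> {0..T} \<Longrightarrow> \<bar>q t - p t - (\<Sum>i<3. s i * w i t)\<bar> \<le> \<rho>"
    then show "\<bar>s 0 - fst (row_flow K q e2 T)\<bar> \<le> \<eta> \<and> \<bar>s 1 - fst (row_flow K q e3 T)\<bar> \<le> \<eta> \<and> \<bar>s 2 - fst (snd (row_flow K q e3 T))\<bar> \<le> \<eta>"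
      by (intro est) blast+
  qed (rule that, blast+)
  have qcU: "continuous_on UNIV q" using q by (simp add: admissible_def)
  have qc: "continuous_on S q" for S using qcU continuous_on_subset by blast
  have qp': "\<bar>q t - p t\<bar> \<le> 4 * W * \<eta>" if "t \<in> {0..T}" for t by (rule qp[where s = s and q = q, OF s that near[OF that]])
  have qk: "integral {0..T} (\<lambda>t. \<bar>q t - \<kappa> t\<bar>) \<le> 4 * W * \<eta> * T + \<theta> * (T + 1)"
  proof -
    have "integral {0..T} (\<lambda>t. \<bar>q t - \<kappa> t\<bar>) \<le> integral {0..T} (\<lambda>t. 4 * W * \<eta> + \<bar>p t - \<kappa> t\<bar>)"
    proof (rule integral_le)
      show "(\<lambda>t. \<bar>q t - \<kappa> t\<bar>) integrable_on {0..T}" using absi[OF L2d[OF qcU]] by (simp add: abs_minus_commute)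
      show "(\<lambda>t. 4 * W * \<eta> + \<bar>p t - \<kappa> t\<bar>) integrable_on {0..T}"
        using absi[OF L2d[OF pcU]] by (intro integrable_add integrable_const_ivl) (simp add: abs_minus_commute)
      show "\<bar>q t - \<kappa> t\<bar> \<le> 4 * W * \<eta> + \<bar>p t - \<kappa> t\<bar>" if "t \<in> {0..T}" for t using qp'[OF that] by linarith
    qed
    also have "\<dots> = 4 * W * \<eta> * T + integral {0..T} (\<lambda>t. \<bar>p t - \<kappa> t\<bar>)"
      using T absi[OF L2d[OF pcU]] by (subst Henstock_Kurzweil_Integration.integral_add) (auto simp: abs_minus_commute)
    finally show ?thesis using pk by simp
  qed
  have qflow: "norm (row_flow K q v t - R v t) \<le> m" if "v \<in> ?E" "t \<in> {0..T}" for v t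
  proof -
    have "4 * W * \<eta> * T \<le> 1 * T" using \<eta>s(2) T by (intro mult_right_mono) auto
    then have "norm (row_flow K q v t - R v t) \<le> \<Lambda> * (4 * W * \<eta> * T + \<theta> * (T + 1))"
      using cmp[OF q(1) qk _ that] \<theta>s(3) by simp
    also have "\<dots> = 8 * \<Lambda> * W * T * \<eta> / 2 + \<Lambda> * (\<theta> * (T + 1))" by (simp add: algebra_simps)
    also have "\<dots> \<le> m / 2 + m / 2" using \<eta>s(4) \<theta>s(4) \<epsilon>m by (intro add_mono) linarith+
    finally show ?thesis by simp
  qed
  show thesis
  proof (rule that[of q])
    have "norm (row_flow K q v T - v) < 1" if "v \<in> ?E" for v using qflow[OF that, of T] RT[OF that] T m by simp
    then show "row_flow K q v T = v" if "v \<in> ?E" for v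
      using closing_conditions[OF q(1) cl] that by auto
    have "integral {0..T} (\<lambda>t. (\<kappa> t - q t)\<^sup>2) \<le> integral {0..T} (\<lambda>t. 2 * (\<kappa> t - p t)\<^sup>2 + 2 * (16 * W\<^sup>2 * \<eta>))"
    proof (rule integral_le)
      show "(\<lambda>t. 2 * (\<kappa> t - p t)\<^sup>2 + 2 * (16 * W\<^sup>2 * \<eta>)) integrable_on {0..T}"
        by (intro integrable_add integrable_const_ivl integrable_on_mult_right sqi L2d pcU)
      show "(\<kappa> t - q t)\<^sup>2 \<le> 2 * (\<kappa> t - p t)\<^sup>2 + 2 * (16 * W\<^sup>2 * \<eta>)" if t: "t \<in> {0..T}" for t
      proof -
        have "(q t - p t)\<^sup>2 \<le> (4 * W * \<eta>)\<^sup>2" using qp'[OF t] abs_le_square_iff[of "q t - p t" "4 * W * \<eta>"] W1 \<eta> by simp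
        also have "\<dots> = 16 * W\<^sup>2 * (\<eta> * \<eta>)" by (simp add: power2_eq_square)
        also have "\<dots> \<le> 16 * W\<^sup>2 * \<eta>" using \<eta> \<eta>s(1) by (intro mult_left_mono) auto
        moreover have "(\<kappa> t - q t)\<^sup>2 \<le> 2 * (\<kappa> t - p t)\<^sup>2 + 2 * (q t - p t)\<^sup>2"
          using zero_le_power2[of "(\<kappa> t - p t) + (q t - p t)"] by (simp add: power2_eq_square algebra_simps)
        ultimately show ?thesis by linarith
      qed
    qed (intro sqi L2d qcU)
    also have "\<dots> = 2 * integral {0..T} (\<lambda>t. (\<kappa> t - p t)\<^sup>2) + 64 * T * W\<^sup>2 * \<eta> / 2"
      using T sqi[OF L2d[OF pcU]] by (subst Henstock_Kurzweil_Integration.integral_add) (auto intro: integrable_on_mult_right)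
    also have "\<dots> \<le> 2 * \<theta>\<^sup>2 + e / 2" using p(2) \<eta>s(5) by linarith
    also have "\<dots> \<le> e"
    proof -
      have "\<theta>\<^sup>2 \<le> \<theta>" using \<theta> \<theta>s(1) by (simp add: power2_eq_square)
      then show ?thesis using \<theta>s(2) by linarith
    qed
    finally show "integral {0..T} (\<lambda>t. (\<kappa> t - q t)\<^sup>2) \<le> e" .
    show "norm (row_flow K q v t - R v t) \<le> e" if "v \<in> ?E" "t \<in> {0..T}" for v t using qflow[OF that] m(2) by simp
  qed (use q fg in auto)
qed

section \<open>Curves on surfaces of constant curvature\<close>

lemma linear_ode_unique_affine:
  fixes x :: "real \<Rightarrow> 'a::banach"
  assumes d: "\<And>t. (x has_vector_derivative (L (x t) + q t *\<^sub>R M (x t))) (at t)" and L: "bounded_linear L" and M: "bounded_linear M"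
    and q: "\<And>t. \<bar>q t\<bar> \<le> Q" and x0: "x 0 = 0"
  shows "x t = 0"
proof -
  obtain b where b: "b \<ge> 0" "\<And>v. norm (L v) \<le> norm v * b" using bounded_linear.nonneg_bounded[OF L] by blast
  obtain c where c: "c \<ge> 0" "\<And>v. norm (M v) \<le> norm v * c" using bounded_linear.nonneg_bounded[OF M] by blast
  have Q: "Q \<ge> 0" using q[of 0] by linarith
  show ?thesis
  proof (rule linear_ode_unique[OF d _ x0, of "b + Q * c"])
    fix t
    have "norm (q t *\<^sub>R M (x t)) \<le> Q * (norm (x t) * c)" unfolding norm_scaleR using q c(2) Q by (intro mult_mono) auto
    then show "norm (L (x t) + q t *\<^sub>R M (x t)) \<le> (b + Q * c) * norm (x t)"
      using norm_triangle_ineq[of "L (x t)" "q t *\<^sub>R M (x t)"] b(2)[of "x t"] by (simp add: algebra_simps)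
  qed (use b c Q in simp)
qed

text \<open>Expansion of both arguments in the standard bases reduces this to the scalar product
  rule.\<close>

lemma absolutely_continuous_bilinear:
  fixes f f' :: "real \<Rightarrow> 'a::euclidean_space" and g g' :: "real \<Rightarrow> 'b::euclidean_space" and h :: "'a \<Rightarrow> 'b \<Rightarrow> 'c::euclidean_space"
  assumes h: "bounded_bilinear h" and f': "has_L2_derivative f f'" and g': "has_L2_derivative g g'"
    and cf: "continuous_on UNIV f" and cg: "continuous_on UNIV g" and ab: "a \<le> b"
  shows "((\<lambda>t. h (f' t) (g t) + h (f t) (g' t)) has_integral h (f b) (g b) - h (f a) (g a)) {a..b}"
proof -
  interpret bounded_bilinear h by (rule h)
  have expand: "h x y = (\<Sum>i\<in>Basis. \<Sum>j\<in>Basis. ((x \<bullet> i) * (y \<bullet> j)) *\<^sub>R h i j)" for x y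
  proof -
    have "h x y = h (\<Sum>i\<in>Basis. (x \<bullet> i) *\<^sub>R i) (\<Sum>j\<in>Basis. (y \<bullet> j) *\<^sub>R j)" by (simp add: euclidean_representation)
    also have "\<dots> = (\<Sum>i\<in>Basis. \<Sum>j\<in>Basis. ((x \<bullet> i) * (y \<bullet> j)) *\<^sub>R h i j)"
      unfolding sum_left unfolding sum_right by (simp add: scaleR_left scaleR_right mult.commute)
    finally show ?thesis .
  qed
  have sc: "((\<lambda>t. (f' t \<bullet> i) * (g t \<bullet> j) + (f t \<bullet> i) * (g' t \<bullet> j)) has_integral (f b \<bullet> i) * (g b \<bullet> j) - (f a \<bullet> i) * (g a \<bullet> j)) {a..b}" for i j
  proof (rule absolutely_continuous_product[OF _ _ _ _ _ _ ab])
    show "L2_loc (\<lambda>t. f' t \<bullet> i)" "L2_loc (\<lambda>t. g' t \<bullet> j)"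
      using f' g' by (auto simp: has_L2_derivative_def intro!: L2_loc_linear[OF bounded_linear_inner_left])
    show "((\<lambda>t. f' t \<bullet> i) has_integral f t \<bullet> i - f s \<bullet> i) {s..t}" if "s \<le> t" for s t
      using has_integral_linear[OF _ bounded_linear_inner_left[of i], of f' "f t - f s"] f' that
      by (simp add: has_L2_derivative_def o_def inner_diff_left)
    show "((\<lambda>t. g' t \<bullet> j) has_integral g t \<bullet> j - g s \<bullet> j) {s..t}" if "s \<le> t" for s t
      using has_integral_linear[OF _ bounded_linear_inner_left[of j], of g' "g t - g s"] g' that
      by (simp add: has_L2_derivative_def o_def inner_diff_left)
  qed (intro continuous_intros cf cg)+
  have "((\<lambda>t. \<Sum>i\<in>Basis. \<Sum>j\<in>Basis. ((f' t \<bullet> i) * (g t \<bullet> j) + (f t \<bullet> i) * (g' t \<bullet> j)) *\<^sub>R h i j) has_integral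
      (\<Sum>i\<in>Basis. \<Sum>j\<in>Basis. ((f b \<bullet> i) * (g b \<bullet> j) - (f a \<bullet> i) * (g a \<bullet> j)) *\<^sub>R h i j)) {a..b}"
    by (intro has_integral_sum finite_Basis has_integral_scaleR_left sc)
  then show ?thesis
    unfolding expand[of "f' _"] expand[of "f _"] by (simp add: scaleR_add_left scaleR_diff_left sum.distrib sum_subtractf)
qed

lemma has_L2_derivative_of_derivative:
  fixes f :: "real \<Rightarrow> 'a::euclidean_space"
  assumes "\<And>t. (f has_vector_derivative f' t) (at t)" "continuous_on UNIV f'"
  shows "has_L2_derivative f f'"
  unfolding has_L2_derivative_def using L2_loc_continuous[OF assms(2)] integral_of_derivative[OF assms(1)] by blast

lemma has_L2_derivative_integral:
  "has_L2_derivative f g \<Longrightarrow> a \<le> b \<Longrightarrow> integral {a..b} g = f b - f a"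
  by (simp add: has_L2_derivative_def integral_unique)

lemma has_L2_derivative_unique_AE:
  fixes f :: "real \<Rightarrow> 'a::euclidean_space"
  assumes "has_L2_derivative f g" "has_L2_derivative f h"
  obtains N where "negligible N" "\<And>t. t \<in> {a..b} - N \<Longrightarrow> g t = h t"
proof -
  have i: "g integrable_on {s..t}" "h integrable_on {s..t}" for s t
    using assms L2_loc_integrable unfolding has_L2_derivative_def by blast+
  obtain N where N: "negligible N" "\<And>t. t \<in> {a..b} - N \<Longrightarrow> g t - h t = 0"
  proof (rule zero_integrals_imp_zero_AE[of "\<lambda>t. g t - h t" a b])
    show "(\<lambda>t. g t - h t) integrable_on {s..t}" for s t by (intro integrable_diff i)
    show "integral {s..t} (\<lambda>t. g t - h t) = 0" if "s \<le> t" for s t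
      by (subst Henstock_Kurzweil_Integration.integral_diff[OF i])
        (simp add: has_L2_derivative_integral[OF assms(1) that] has_L2_derivative_integral[OF assms(2) that])
  qed blast
  then show thesis using that by auto
qed

lemma has_L2_derivative_continuous:
  fixes f :: "real \<Rightarrow> 'a::euclidean_space"
  assumes "has_L2_derivative f g"
  shows "continuous_on UNIV f"
proof -
  have "isCont f t" for t
  proof -
    have gi: "g integrable_on {t - 1..t + 1}" using assms L2_loc_integrable unfolding has_L2_derivative_def by blast
    have "continuous_on {t - 1..t + 1} (\<lambda>x. f (t - 1) + integral {t - 1..x} g)"
      by (intro continuous_intros indefinite_integral_continuous_1 gi)
    then have "continuous_on {t - 1..t + 1} f"
      by (rule continuous_on_eq) (simp add: has_L2_derivative_integral[OF assms])
    then show ?thesis by (rule continuous_on_interior) simp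
  qed
  then show ?thesis by (simp add: continuous_at_imp_continuous_on)
qed

text \<open>A function that is not integrable has integral 0 by convention, and \<open>g0\<close>
  covers this case. In this way \<open>W22_dist\<close> can be estimated from an upper bound for its
  integrand alone.\<close>

lemma integral_le_of_AE_le:
  fixes f g :: "real \<Rightarrow> real"
  assumes N: "negligible N" and le: "\<And>t. t \<in> S - N \<Longrightarrow> f t \<le> g t" and g: "g integrable_on S" and g0: "integral S g \<ge> 0"
  shows "integral S f \<le> integral S g"
proof (cases "f integrable_on S")
  case True
  let ?f = "\<lambda>t. if t \<in> N then g t else f t"
  have "?f integrable_on S" by (rule integrable_spike[OF True N]) auto
  then have "integral S ?f \<le> integral S g" by (intro integral_le g) (use le in auto)
  moreover have "integral S ?f = integral S f" by (rule integral_spike[OF N]) auto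
  ultimately show ?thesis by simp
qed (use g0 in \<open>simp add: not_integrable_integral\<close>)

lemma has_integral_Pair:
  fixes f :: "real \<Rightarrow> 'a::euclidean_space" and g :: "real \<Rightarrow> 'b::euclidean_space"
  assumes "(f has_integral x) S" "(g has_integral y) S"
  shows "((\<lambda>t. (f t, g t)) has_integral (x, y)) S"
proof -
  have l: "bounded_linear (\<lambda>v::'a. (v, 0::'b))" "bounded_linear (\<lambda>v::'b. (0::'a, v))"
    by (auto intro: bounded_linear_Pair bounded_linear_ident bounded_linear_zero)
  from has_integral_add[OF has_integral_linear[OF assms(1) l(1)] has_integral_linear[OF assms(2) l(2)]]
  show ?thesis by (simp add: o_def)
qed

text \<open>A common description of the three surfaces with curvature \<open>K\<close>, where
  \<open>K3\<close> says that \<open>K\<close> is -1, 0 or 1. The rotation is split into a part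
  \<open>rho\<close> bilinear in point and vector, a cross product for the quadrics, and a part
  \<open>J\<close> independent of the point, the quarter turn of the plane. The factors
  \<open>K\<close> make the conditions on the position vector empty for the plane. The axiom
  \<open>path\<close> keeps a curve on its sheet of the hyperboloid.\<close>

locale surface_geometry =
  fixes S :: "'a::euclidean_space surface" and K :: real and rho :: "'a \<Rightarrow> 'a \<Rightarrow> 'a" and J :: "'a \<Rightarrow> 'a"
  assumes form: "bounded_bilinear (form S)" and form_sym: "form S v w = form S w v"
    and rho: "bounded_bilinear rho" and rho_self: "rho v v = 0" and J: "bounded_linear J"
    and rot: "rot S p v = rho p v + J v" and KJ: "K *\<^sub>R J v = 0" and K3: "K * K * K = K"
    and points: "p \<in> points S \<Longrightarrow> K * form S p p = K * K"
    and frame: "p \<in> points S \<Longrightarrow> form S u u = 1 \<Longrightarrow> K * form S p u = 0 \<Longrightarrow> n = rot S p u \<Longrightarrow>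
      form S n n = 1 \<and> form S u n = 0 \<and> K * form S p n = 0 \<and> rot S p n = - u \<and> rho u n = K *\<^sub>R p \<and>
      (\<forall>a. a = (K * form S a p) *\<^sub>R p + form S a u *\<^sub>R u + form S a n *\<^sub>R n)"
    and path: "continuous_on UNIV \<delta> \<Longrightarrow> (\<And>t. K * form S (\<delta> t) (\<delta> t) = K * K) \<Longrightarrow> \<delta> 0 \<in> points S \<Longrightarrow> \<delta> (t::real) \<in> points S"
begin

interpretation F: bounded_bilinear "form S" by (rule form)
interpretation rho: bounded_bilinear rho by (rule rho)
interpretation J: bounded_linear J by (rule J)

lemma rot_add: "rot S p (v + w) = rot S p v + rot S p w" and rot_scaleR: "rot S p (c *\<^sub>R v) = c *\<^sub>R rot S p v"
  by (simp_all add: rot rho.add_right rho.scaleR_right J.add J.scaleR scaleR_add_right)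

lemma rot_self: "K *\<^sub>R rot S p p = 0"
  by (simp add: rot rho_self KJ)

lemma rot_continuous: "continuous_on A p \<Longrightarrow> continuous_on A v \<Longrightarrow> continuous_on A (\<lambda>t. rot S (p t) (v t))"
  unfolding rot by (intro continuous_on_add rho.continuous_on J.continuous_on)

lemma closed_curveD:
  assumes \<gamma>: "\<gamma> \<in> closed_curves S T"
  shows "\<gamma> t \<in> points S" "form S (velocity \<gamma> t) (velocity \<gamma> t) = 1" "\<gamma> (t + T) = \<gamma> t"
    "(\<gamma> has_vector_derivative velocity \<gamma> t) (at t)" "has_L2_derivative (velocity \<gamma>) (acceleration \<gamma>)"
    "continuous_on UNIV \<gamma>" "continuous_on UNIV (velocity \<gamma>)" "has_L2_derivative \<gamma> (velocity \<gamma>)"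
    "velocity \<gamma> (t + T) = velocity \<gamma> t" "K * form S (\<gamma> t) (velocity \<gamma> t) = 0"
proof -
  show pt: "\<gamma> t \<in> points S" "form S (velocity \<gamma> t) (velocity \<gamma> t) = 1" "\<gamma> (t + T) = \<gamma> t" for t
    using \<gamma> by (auto simp: closed_curves_def)
  have W: "W22_loc \<gamma>" using \<gamma> by (simp add: closed_curves_def)
  show d: "(\<gamma> has_vector_derivative velocity \<gamma> t) (at t)" for t
    using W by (auto simp: W22_loc_def velocity_def differentiable_on_def vector_derivative_works)
  show a: "has_L2_derivative (velocity \<gamma>) (acceleration \<gamma>)"
    unfolding acceleration_def by (rule someI_ex[of "has_L2_derivative (velocity \<gamma>)"]) (use W in \<open>simp add: W22_loc_def\<close>)
  show c: "continuous_on UNIV (velocity \<gamma>)" by (rule has_L2_derivative_continuous[OF a])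
  show l: "has_L2_derivative \<gamma> (velocity \<gamma>)" by (rule has_L2_derivative_of_derivative[OF d c])
  show "continuous_on UNIV \<gamma>" by (rule has_L2_derivative_continuous[OF l])
  have "((\<gamma> \<circ> (\<lambda>s. s + T)) has_vector_derivative 1 *\<^sub>R velocity \<gamma> (t + T)) (at t)"
    by (rule vector_diff_chain_at) (auto intro!: derivative_eq_intros d)
  then have "(\<gamma> has_vector_derivative velocity \<gamma> (t + T)) (at t)" by (simp add: o_def pt)
  then show "velocity \<gamma> (t + T) = velocity \<gamma> t" using vector_derivative_unique_at[OF _ d] by blast
  have "((\<lambda>s. form S (\<gamma> s) (\<gamma> s)) has_vector_derivative form S (\<gamma> t) (velocity \<gamma> t) + form S (velocity \<gamma> t) (\<gamma> t)) (at t)"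
    by (rule F.has_vector_derivative[OF d d])
  then have "((\<lambda>s. K * form S (\<gamma> s) (\<gamma> s)) has_vector_derivative K * (form S (\<gamma> t) (velocity \<gamma> t) + form S (velocity \<gamma> t) (\<gamma> t))) (at t)"
    by (rule has_vector_derivative_mult_right)
  moreover have "(\<lambda>s. K * form S (\<gamma> s) (\<gamma> s)) = (\<lambda>s. K * K)" using points[OF pt(1)] by auto
  ultimately have "K * (form S (\<gamma> t) (velocity \<gamma> t) + form S (velocity \<gamma> t) (\<gamma> t)) = 0"
    using vector_derivative_unique_at[OF _ has_vector_derivative_const] by metis
  then show "K * form S (\<gamma> t) (velocity \<gamma> t) = 0" by (simp add: form_sym[of "velocity \<gamma> t"])
qed

text \<open>The product rule for absolutely continuous functions is applied to the constants
  \<open>form S v v\<close> and \<open>K * form S v \<gamma>\<close>. It yields, for almost every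
  \<open>t\<close>, the components of the acceleration along velocity and position; the remaining
  component is the curvature.\<close>

lemma frenet_AE:
  assumes \<gamma>: "\<gamma> \<in> closed_curves S T"
  obtains N where "negligible N"
    "\<And>t. t \<in> {0..T} - N \<Longrightarrow> acceleration \<gamma> t = geodesic_curvature S \<gamma> t *\<^sub>R rot S (\<gamma> t) (velocity \<gamma> t) - K *\<^sub>R \<gamma> t"
proof -
  note D = closed_curveD[OF \<gamma>]
  let ?v = "velocity \<gamma>" and ?a = "acceleration \<gamma>"
  have 1: "((\<lambda>t. form S (?a t) (?v t) + form S (?v t) (?a t)) has_integral 0) {a..b}" if "a \<le> b" for a b
    using absolutely_continuous_bilinear[OF form D(5,5,7,7) that] by (simp add: D(2))
  have D10: "K * form S (?v t) (\<gamma> t) = 0" for t using D(10)[of t] form_sym[of "\<gamma> t"] by simp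
  have 2: "((\<lambda>t. K * (form S (?a t) (\<gamma> t) + form S (?v t) (?v t))) has_integral 0) {a..b}" if "a \<le> b" for a b
    using has_integral_mult_right[OF absolutely_continuous_bilinear[OF form D(5,8,7,6) that], of K]
    by (simp add: right_diff_distrib D10)
  have int: "f integrable_on {a..b}" if "\<And>a b. a \<le> b \<Longrightarrow> (f has_integral 0) {a..b}" for f :: "real \<Rightarrow> real" and a b :: real
    using that[of a b] by (cases "a \<le> b") auto
  obtain N1 where N1: "negligible N1" "\<And>t. t \<in> {0..T} - N1 \<Longrightarrow> form S (?a t) (?v t) + form S (?v t) (?a t) = 0"
    using zero_integrals_imp_zero_AE[OF int[OF 1] integral_unique[OF 1], of 0 T] by blast
  obtain N2 where N2: "negligible N2" "\<And>t. t \<in> {0..T} - N2 \<Longrightarrow> K * (form S (?a t) (\<gamma> t) + form S (?v t) (?v t)) = 0"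
    using zero_integrals_imp_zero_AE[OF int[OF 2] integral_unique[OF 2], of 0 T] by blast
  show thesis
  proof (rule that)
    show "negligible (N1 \<union> N2)" using N1 N2 by (intro negligible_Un)
    fix t assume t: "t \<in> {0..T} - (N1 \<union> N2)"
    have "form S (?a t) (?v t) = 0" using N1(2)[of t] t by (simp add: form_sym[of "?v t"])
    moreover have "K * form S (?a t) (\<gamma> t) = - K" using N2(2)[of t] t by (simp add: D(2) distrib_left)
    moreover have "?a t = (K * form S (?a t) (\<gamma> t)) *\<^sub>R \<gamma> t + form S (?a t) (?v t) *\<^sub>R ?v t +
        form S (?a t) (rot S (\<gamma> t) (?v t)) *\<^sub>R rot S (\<gamma> t) (?v t)"
      using frame[OF D(1,2,10) refl, of t] by blast
    ultimately show "?a t = geodesic_curvature S \<gamma> t *\<^sub>R rot S (\<gamma> t) (?v t) - K *\<^sub>R \<gamma> t"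
      by (simp add: geodesic_curvature_def)
  qed
qed

text \<open>The normal is bounded because it is continuous and periodic; having unit length for
  \<open>form S\<close> does not bound its Euclidean norm on the hyperboloid.\<close>

lemma curvature_L2:
  assumes \<gamma>: "\<gamma> \<in> closed_curves S T" and T: "T > 0"
  shows "L2_loc (geodesic_curvature S \<gamma>)"
proof -
  note D = closed_curveD[OF \<gamma>]
  let ?N = "\<lambda>t. rot S (\<gamma> t) (velocity \<gamma> t)"
  have c: "continuous_on UNIV ?N" by (intro rot_continuous D)
  have per: "?N (t + T) = ?N t" for t by (simp add: D(3,9))
  obtain B where B: "\<And>t. t \<in> {0..T} \<Longrightarrow> norm (?N t) \<le> B"
    using continuous_on_compact_bound[OF compact_Icc continuous_on_subset[OF c], of 0 T] by (metis subset_UNIV)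
  have "norm (?N t) \<le> B" for t
  proof -
    have shift: "?N (s + of_int k * T) = ?N s" for s k
    proof (induction k arbitrary: s rule: int_induct[where k = 0])
      case (step1 i)
      have "?N (s + of_int (i + 1) * T) = ?N ((s + of_int i * T) + T)" by (simp add: algebra_simps)
      then show ?case using per[of "s + of_int i * T"] step1 by simp
    next
      case (step2 i)
      have "?N (s + of_int i * T) = ?N ((s + of_int (i - 1) * T) + T)" by (simp add: algebra_simps)
      then show ?case using per[of "s + of_int (i - 1) * T"] step2 by simp
    qed simp
    define s where "s = t - of_int \<lfloor>t / T\<rfloor> * T"
    have "s \<in> {0..T}" unfolding s_def using T floor_divide_lower[OF T, of t] floor_divide_upper[OF T, of t] by (auto simp: algebra_simps)
    moreover have "?N t = ?N s" using shift[of s "\<lfloor>t / T\<rfloor>"] by (simp add: s_def)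
    ultimately show ?thesis using B by metis
  qed
  then have "L2_loc (\<lambda>t. form S (acceleration \<gamma> t) (?N t))"
    using L2_loc_bilinear[OF bounded_bilinear.flip[OF form] c, of B "acceleration \<gamma>"] D(5) by (simp add: has_L2_derivative_def)
  then show ?thesis unfolding geodesic_curvature_def .
qed

text \<open>The normal is bilinear in curve and velocity up to the linear part \<open>J\<close>, so
  the product rule applies; \<open>rho_self\<close> kills the velocity-velocity term and
  \<open>rot_self\<close> the position part of the acceleration.\<close>

lemma normal_integral:
  assumes \<gamma>: "\<gamma> \<in> closed_curves S T" and ab: "0 \<le> a" "a \<le> b" "b \<le> T"
  shows "((\<lambda>t. - geodesic_curvature S \<gamma> t *\<^sub>R velocity \<gamma> t) has_integral
     rot S (\<gamma> b) (velocity \<gamma> b) - rot S (\<gamma> a) (velocity \<gamma> a)) {a..b}"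
proof -
  note D = closed_curveD[OF \<gamma>]
  let ?v = "velocity \<gamma>" and ?a = "acceleration \<gamma>"
  obtain N where N: "negligible N" "\<And>t. t \<in> {0..T} - N \<Longrightarrow> ?a t = geodesic_curvature S \<gamma> t *\<^sub>R rot S (\<gamma> t) (?v t) - K *\<^sub>R \<gamma> t"
    using frenet_AE[OF \<gamma>] by blast
  have i1: "((\<lambda>t. rho (?v t) (?v t) + rho (\<gamma> t) (?a t)) has_integral rho (\<gamma> b) (?v b) - rho (\<gamma> a) (?v a)) {a..b}"
    by (rule absolutely_continuous_bilinear[OF rho D(8,5,6,7) ab(2)])
  have i2: "((\<lambda>t. J (?a t)) has_integral J (?v b) - J (?v a)) {a..b}"
    using has_integral_linear[OF _ J, of ?a "?v b - ?v a"] D(5) ab(2) by (simp add: has_L2_derivative_def o_def J.diff)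
  have "((\<lambda>t. rot S (\<gamma> t) (?a t)) has_integral rot S (\<gamma> b) (?v b) - rot S (\<gamma> a) (?v a)) {a..b}"
    using has_integral_add[OF i1 i2] unfolding rot add_diff_add by (simp add: rho_self)
  then show ?thesis
  proof (rule has_integral_spike[OF N(1), rotated])
    fix t assume t: "t \<in> {a..b} - N"
    have f: "rot S (\<gamma> t) (rot S (\<gamma> t) (?v t)) = - ?v t" using frame[OF D(1,2,10) refl, of t] by blast
    have "?a t = geodesic_curvature S \<gamma> t *\<^sub>R rot S (\<gamma> t) (?v t) + (- K) *\<^sub>R \<gamma> t" using N(2)[of t] t ab by simp
    then have "rot S (\<gamma> t) (?a t) = geodesic_curvature S \<gamma> t *\<^sub>R rot S (\<gamma> t) (rot S (\<gamma> t) (?v t)) + (- K) *\<^sub>R rot S (\<gamma> t) (\<gamma> t)"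
      by (simp only: rot_add rot_scaleR)
    then show "- geodesic_curvature S \<gamma> t *\<^sub>R ?v t = rot S (\<gamma> t) (?a t)" using f rot_self by simp
  qed
qed

text \<open>Each row solution is the moving frame of the curve tested with a fixed functional. The
  three of them with initial values \<open>e1\<close>, \<open>e2\<close>, \<open>e3\<close> are the
  coordinates of the moving frame in the initial frame.\<close>

lemma curve_frame:
  assumes \<gamma>: "\<gamma> \<in> closed_curves S T" and T: "T > 0"
  obtains f1 f2 f3 R where "f1 \<in> points S" "form S f2 f2 = 1" "K * form S f1 f2 = 0" "f3 = rot S f1 f2"
    "\<And>w. continuous_on UNIV (R w)" "\<And>w. R w 0 = w" "\<And>w. R w T = w"
    "\<And>w t. t \<in> {0..T} \<Longrightarrow> ((\<lambda>s. gen 1 K (geodesic_curvature S \<gamma> s) (R w s)) has_integral R w t - R w 0) {0..t}"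
    "\<And>t. \<gamma> t = fst (R e1 t) *\<^sub>R f1 + fst (R e2 t) *\<^sub>R f2 + fst (R e3 t) *\<^sub>R f3"
    "\<And>t. velocity \<gamma> t = fst (snd (R e1 t)) *\<^sub>R f1 + fst (snd (R e2 t)) *\<^sub>R f2 + fst (snd (R e3 t)) *\<^sub>R f3"
    "\<And>t. rot S (\<gamma> t) (velocity \<gamma> t) = snd (snd (R e1 t)) *\<^sub>R f1 + snd (snd (R e2 t)) *\<^sub>R f2 + snd (snd (R e3 t)) *\<^sub>R f3"
proof -
  note D = closed_curveD[OF \<gamma>]
  let ?v = "velocity \<gamma>" and ?a = "acceleration \<gamma>" and ?N = "\<lambda>t. rot S (\<gamma> t) (velocity \<gamma> t)" and ?k = "geodesic_curvature S \<gamma>"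
  obtain M where M: "negligible M" "\<And>t. t \<in> {0..T} - M \<Longrightarrow> ?a t = ?k t *\<^sub>R ?N t - K *\<^sub>R \<gamma> t"
    using frenet_AE[OF \<gamma>] by blast
  define f1 f2 f3 where f: "f1 = \<gamma> 0" "f2 = ?v 0" "f3 = ?N 0"
  have fr: "form S f3 f3 = 1" "form S f2 f3 = 0" "K * form S f1 f3 = 0" "\<And>a. a = (K * form S a f1) *\<^sub>R f1 + form S a f2 *\<^sub>R f2 + form S a f3 *\<^sub>R f3"
    using frame[OF D(1,2,10) refl, of 0] unfolding f by blast+
  define \<xi> where "\<xi> w a = fst w * (K * form S a f1) + fst (snd w) * form S a f2 + snd (snd w) * form S a f3" for w :: triple and a
  have lin: "bounded_linear (\<xi> w)" for w
    unfolding \<xi>_def by (intro bounded_linear_add bounded_linear_const_mult F.bounded_linear_left)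
  interpret X: bounded_linear "\<xi> w" for w by (rule lin)
  \<comment> \<open>For \<open>K = 0\<close> the functional \<open>\<xi> w\<close> has no term for
    the base point. Measuring the displacement from \<open>\<gamma> 0\<close> and adding
    \<open>fst w\<close> gives the initial value \<open>w\<close> for every
    \<open>K\<close>.\<close>
  define R where "R w t = (fst w + \<xi> w (\<gamma> t - \<gamma> 0), \<xi> w (?v t), \<xi> w (?N t))" for w t
  have expand: "\<xi> e1 a *\<^sub>R f1 + \<xi> e2 a *\<^sub>R f2 + \<xi> e3 a *\<^sub>R f3 = a" for a
    using fr(4)[of a] by (simp add: \<xi>_def e1_def e2_def e3_def)
  have R0: "R w 0 = w" for w
  proof -
    have "\<xi> w f2 = fst (snd w)" "\<xi> w f3 = snd (snd w)"
      using fr(1-3) D(2,10)[of 0] unfolding \<xi>_def f(1,2)[symmetric] by (simp_all add: form_sym[of f2 f1] form_sym[of f3 f1] form_sym[of f3 f2])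
    then show ?thesis unfolding R_def unfolding f(3)[symmetric] unfolding f(2)[symmetric] by (simp add: X.zero)
  qed
  have K\<xi>: "K * \<xi> w (\<gamma> 0) = K * fst w" for w
  proof -
    have "K * \<xi> w (\<gamma> 0) = fst w * (K * (K * form S f1 f1)) + fst (snd w) * (K * form S f1 f2) + snd (snd w) * (K * form S f1 f3)"
      by (simp add: \<xi>_def f algebra_simps)
    also have "\<dots> = fst w * (K * (K * K))"
    proof -
      have "K * form S f1 f1 = K * K" "K * form S f1 f2 = 0" using points[OF D(1), of 0] D(10)[of 0] by (simp_all only: f)
      then show ?thesis using fr(3) by (simp only: mult_zero_right add_0_right)
    qed
    also have "K * (K * K) = K" using K3 by (simp only: mult.assoc)
    finally show ?thesis by (simp only: mult.commute)
  qed
  show thesis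
  proof (rule that[of f1 f2 f3 R])
    show "f1 \<in> points S" "form S f2 f2 = 1" "K * form S f1 f2 = 0" "f3 = rot S f1 f2" using D(1,2,10) by (simp_all add: f)
    show "continuous_on UNIV (R w)" for w
      unfolding R_def by (intro continuous_intros X.continuous_on rot_continuous D)
    show "R w 0 = w" for w by (rule R0)
    have "R w T = R w 0" for w using D(3,9)[of 0] by (simp add: R_def)
    then show "R w T = w" for w using R0 by simp
    show "((\<lambda>s. gen 1 K (?k s) (R w s)) has_integral R w t - R w 0) {0..t}" if t: "t \<in> {0..T}" for w t
    proof -
      have i: "((\<lambda>s. \<xi> w (?v s)) has_integral \<xi> w (\<gamma> t) - \<xi> w (\<gamma> 0)) {0..t}"
        "((\<lambda>s. \<xi> w (?a s)) has_integral \<xi> w (?v t) - \<xi> w (?v 0)) {0..t}"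
        "((\<lambda>s. \<xi> w (- ?k s *\<^sub>R ?v s)) has_integral \<xi> w (?N t) - \<xi> w (?N 0)) {0..t}"
        using has_integral_linear[OF _ lin[of w], of ?v "\<gamma> t - \<gamma> 0" "{0..t}"] has_integral_linear[OF _ lin[of w], of ?a "?v t - ?v 0" "{0..t}"]
          has_integral_linear[OF normal_integral[OF \<gamma>, of 0 t] lin[of w]] D(5,8) t
        by (auto simp: has_L2_derivative_def o_def X.diff)
      have "((\<lambda>s. (\<xi> w (?v s), \<xi> w (?a s), \<xi> w (- ?k s *\<^sub>R ?v s))) has_integral R w t - R w 0) {0..t}"
        using has_integral_Pair[OF i(1) has_integral_Pair[OF i(2,3)]] by (simp add: R_def X.diff)
      then show ?thesis
      proof (rule has_integral_spike[OF M(1), rotated])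
        fix s assume s: "s \<in> {0..t} - M"
        have "\<xi> w (?a s) = ?k s * \<xi> w (?N s) - K * \<xi> w (\<gamma> s)" using M(2)[of s] s t by (simp add: X.diff X.scaleR)
        also have "K * \<xi> w (\<gamma> s) = K * (fst w + \<xi> w (\<gamma> s - \<gamma> 0))" using K\<xi>[of w] by (simp add: X.diff algebra_simps)
        finally show "gen 1 K (?k s) (R w s) = (\<xi> w (?v s), \<xi> w (?a s), \<xi> w (- ?k s *\<^sub>R ?v s))"
          by (simp add: gen_def R_def X.scaleR X.neg)
      qed
    qed
    show "\<gamma> t = fst (R e1 t) *\<^sub>R f1 + fst (R e2 t) *\<^sub>R f2 + fst (R e3 t) *\<^sub>R f3" for t
    proof -
      have "\<gamma> t = f1 + (\<xi> e1 (\<gamma> t - \<gamma> 0) *\<^sub>R f1 + \<xi> e2 (\<gamma> t - \<gamma> 0) *\<^sub>R f2 + \<xi> e3 (\<gamma> t - \<gamma> 0) *\<^sub>R f3)"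
        unfolding expand by (simp add: f(1))
      moreover have "fst e1 = 1" "fst e2 = 0" "fst e3 = 0" by (simp_all add: e1_def e2_def e3_def)
      ultimately show ?thesis unfolding R_def by (simp add: scaleR_add_left add.assoc)
    qed
    show "?v t = fst (snd (R e1 t)) *\<^sub>R f1 + fst (snd (R e2 t)) *\<^sub>R f2 + fst (snd (R e3 t)) *\<^sub>R f3" for t
      using expand[of "?v t"] by (simp add: R_def)
    show "?N t = snd (snd (R e1 t)) *\<^sub>R f1 + snd (snd (R e2 t)) *\<^sub>R f2 + snd (snd (R e3 t)) *\<^sub>R f3" for t
      using expand[of "?N t"] by (simp add: R_def)
  qed
qed

section \<open>From closed frames back to closed curves\<close>

definition scalars :: "'a \<Rightarrow> 'a \<Rightarrow> 'a \<Rightarrow> real \<times> real \<times> real \<times> real \<times> real \<times> real" where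
  "scalars p u n = (form S u u - 1, form S n n - 1, form S u n, K * form S p u, K * form S p n, K * form S p p - K * K)"

text \<open>
  The moving frame stays adapted to the surface because its deviation from an adapted frame solves a
  homogeneous linear equation, first for the scalar products and then for the rotation.
\<close>

lemma frame_flow_scalars:
  assumes q: "admissible q" and d: "\<And>t. (p has_vector_derivative u t) (at t)" "\<And>t. (u has_vector_derivative (q t *\<^sub>R n t - K *\<^sub>R p t)) (at t)"
      "\<And>t. (n has_vector_derivative (- q t *\<^sub>R u t)) (at t)"
    and i: "scalars (p 0) (u 0) (n 0) = 0"
  shows "scalars (p t) (u t) (n t) = 0"
proof -
  obtain Q where Q: "\<And>t. \<bar>q t\<bar> \<le> Q" using q by (auto simp: admissible_def)
  define L :: "real \<times> real \<times> real \<times> real \<times> real \<times> real \<Rightarrow> real \<times> real \<times> real \<times> real \<times> real \<times> real"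
    where "L = (\<lambda>(a, b, c, d, g, h). (- 2 * d, 0, - g, K * a - K * h, K * c, 2 * d))"
  define M :: "real \<times> real \<times> real \<times> real \<times> real \<times> real \<Rightarrow> real \<times> real \<times> real \<times> real \<times> real \<times> real"
    where "M = (\<lambda>(a, b, c, d, g, h). (2 * c, - 2 * c, b - a, g, - d, 0))"
  have lin: "bounded_linear L" "bounded_linear M"
    unfolding linear_conv_bounded_linear[symmetric] L_def M_def
    by (rule linearI; clarsimp simp: algebra_simps)+
  show ?thesis
  proof (rule linear_ode_unique_affine[where x = "\<lambda>t. scalars (p t) (u t) (n t)" and L = L and M = M and q = q, OF _ lin Q i])
    fix t
    have K1: "K * (K * K) = K" using K3 by (simp add: mult.assoc)
    have "((\<lambda>t. scalars (p t) (u t) (n t)) has_vector_derivative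
       (form S (u t) (q t *\<^sub>R n t - K *\<^sub>R p t) + form S (q t *\<^sub>R n t - K *\<^sub>R p t) (u t) - 0,
        form S (n t) (- q t *\<^sub>R u t) + form S (- q t *\<^sub>R u t) (n t) - 0,
        form S (u t) (- q t *\<^sub>R u t) + form S (q t *\<^sub>R n t - K *\<^sub>R p t) (n t),
        K * (form S (p t) (q t *\<^sub>R n t - K *\<^sub>R p t) + form S (u t) (u t)),
        K * (form S (p t) (- q t *\<^sub>R u t) + form S (u t) (n t)),
        K * (form S (p t) (u t) + form S (u t) (p t)) - 0)) (at t)"
      unfolding scalars_def
      by (intro has_vector_derivative_Pair has_vector_derivative_diff has_vector_derivative_const has_vector_derivative_mult_right F.has_vector_derivative d)
    also have "(form S (u t) (q t *\<^sub>R n t - K *\<^sub>R p t) + form S (q t *\<^sub>R n t - K *\<^sub>R p t) (u t) - 0,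
        form S (n t) (- q t *\<^sub>R u t) + form S (- q t *\<^sub>R u t) (n t) - 0,
        form S (u t) (- q t *\<^sub>R u t) + form S (q t *\<^sub>R n t - K *\<^sub>R p t) (n t),
        K * (form S (p t) (q t *\<^sub>R n t - K *\<^sub>R p t) + form S (u t) (u t)),
        K * (form S (p t) (- q t *\<^sub>R u t) + form S (u t) (n t)),
        K * (form S (p t) (u t) + form S (u t) (p t)) - 0) = L (scalars (p t) (u t) (n t)) + q t *\<^sub>R M (scalars (p t) (u t) (n t))"
      using K1 unfolding scalars_def L_def M_def
      by (simp add: F.diff_left F.diff_right F.minus_left F.minus_right F.scaleR_left F.scaleR_right form_sym[of "u t" "p t"] form_sym[of "n t" "p t"] form_sym[of "n t" "u t"] algebra_simps)
    finally show "((\<lambda>t. scalars (p t) (u t) (n t)) has_vector_derivative L (scalars (p t) (u t) (n t)) + q t *\<^sub>R M (scalars (p t) (u t) (n t))) (at t)" .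
  qed
qed

lemma frame_flow_rot:
  assumes q: "admissible q" and d: "\<And>t. (p has_vector_derivative u t) (at t)" "\<And>t. (u has_vector_derivative (q t *\<^sub>R n t - K *\<^sub>R p t)) (at t)"
      "\<And>t. (n has_vector_derivative (- q t *\<^sub>R u t)) (at t)"
    and i: "rot S (p 0) (u 0) = n 0" "rot S (p 0) (n 0) = - u 0" "rho (u 0) (n 0) = K *\<^sub>R p 0"
  shows "rot S (p t) (u t) = n t"
proof -
  obtain Q where Q: "\<And>t. \<bar>q t\<bar> \<le> Q" using q by (auto simp: admissible_def)
  define L :: "'a \<times> 'a \<times> 'a \<Rightarrow> 'a \<times> 'a \<times> 'a" where "L = (\<lambda>(a, b, c). (0, c, - K *\<^sub>R b))"
  define M :: "'a \<times> 'a \<times> 'a \<Rightarrow> 'a \<times> 'a \<times> 'a" where "M = (\<lambda>(a, b, c). (b, - a, 0))"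
  have lin: "bounded_linear L" "bounded_linear M"
    unfolding linear_conv_bounded_linear[symmetric] L_def M_def
    by (rule linearI; clarsimp simp: algebra_simps)+
  \<comment> \<open>The third entry closes the system: differentiating the second one along the
    curve produces \<open>rho u n\<close>.\<close>
  define W where "W t = (rho (p t) (u t) + J (u t) - n t, rho (p t) (n t) + J (n t) + u t, rho (u t) (n t) - K *\<^sub>R p t)" for t
  have "W t = 0"
  proof (rule linear_ode_unique_affine[where x = W and L = L and M = M and q = q, OF _ lin Q])
    show "W 0 = 0" using i by (simp add: W_def rot zero_prod_def)
    fix t
    have KJ': "K *\<^sub>R J v = 0" "J (K *\<^sub>R v) = 0" for v using KJ by (simp_all add: J.scaleR)
    have "(W has_vector_derivative
       (rho (p t) (q t *\<^sub>R n t - K *\<^sub>R p t) + rho (u t) (u t) + J (q t *\<^sub>R n t - K *\<^sub>R p t) - (- q t *\<^sub>R u t),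
        rho (p t) (- q t *\<^sub>R u t) + rho (u t) (n t) + J (- q t *\<^sub>R u t) + (q t *\<^sub>R n t - K *\<^sub>R p t),
        rho (u t) (- q t *\<^sub>R u t) + rho (q t *\<^sub>R n t - K *\<^sub>R p t) (n t) - K *\<^sub>R u t)) (at t)"
      unfolding W_def
      by (intro has_vector_derivative_Pair has_vector_derivative_diff has_vector_derivative_add rho.has_vector_derivative J.has_vector_derivative
        bounded_linear.has_vector_derivative[OF bounded_linear_scaleR_right] d)
    also have "(rho (p t) (q t *\<^sub>R n t - K *\<^sub>R p t) + rho (u t) (u t) + J (q t *\<^sub>R n t - K *\<^sub>R p t) - (- q t *\<^sub>R u t),
        rho (p t) (- q t *\<^sub>R u t) + rho (u t) (n t) + J (- q t *\<^sub>R u t) + (q t *\<^sub>R n t - K *\<^sub>R p t),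
        rho (u t) (- q t *\<^sub>R u t) + rho (q t *\<^sub>R n t - K *\<^sub>R p t) (n t) - K *\<^sub>R u t) = L (W t) + q t *\<^sub>R M (W t)"
      unfolding W_def L_def M_def
      by (simp add: rho.diff_left rho.diff_right rho.minus_left rho.minus_right rho.scaleR_left rho.scaleR_right rho_self J.diff J.neg J.scaleR KJ KJ' scaleR_diff_right scaleR_add_right)
    finally show "(W has_vector_derivative L (W t) + q t *\<^sub>R M (W t)) (at t)" .
  qed
  then show ?thesis by (simp add: W_def rot prod_eq_iff)
qed

text \<open>The converse of \<open>curve_frame\<close>: an adapted initial frame and a potential
  with closed frame determine a closed curve whose curvature is that potential almost
  everywhere.\<close>

lemma frame_curve:
  fixes q :: "real \<Rightarrow> real" and f1 f2 f3 :: 'a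
  defines "C \<equiv> \<lambda>pr t. pr (row_flow K q e1 t) *\<^sub>R f1 + pr (row_flow K q e2 t) *\<^sub>R f2 + pr (row_flow K q e3 t) *\<^sub>R f3"
  defines "\<delta> \<equiv> C fst"
  assumes f: "f1 \<in> points S" "form S f2 f2 = 1" "K * form S f1 f2 = 0" "f3 = rot S f1 f2"
    and q: "admissible q" "\<And>t. q (t + T) = q t" and cl: "\<And>v. v \<in> {e1, e2, e3} \<Longrightarrow> row_flow K q v T = v"
  shows "\<delta> \<in> closed_curves S T" "velocity \<delta> t = C (\<lambda>v. fst (snd v)) t" "rot S (\<delta> t) (velocity \<delta> t) = C (\<lambda>v. snd (snd v)) t"
    "\<exists>N. negligible N \<and> (\<forall>t\<in>{0..T} - N. acceleration \<delta> t = q t *\<^sub>R rot S (\<delta> t) (velocity \<delta> t) - K *\<^sub>R \<delta> t \<and> geodesic_curvature S \<delta> t = q t)"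
proof -
  define u where "u = C (\<lambda>v. fst (snd v))"
  define n where "n = C (\<lambda>v. snd (snd v))"
  have dC: "(C pr has_vector_derivative pr (gen 1 K (q t) (row_flow K q e1 t)) *\<^sub>R f1 + pr (gen 1 K (q t) (row_flow K q e2 t)) *\<^sub>R f2
      + pr (gen 1 K (q t) (row_flow K q e3 t)) *\<^sub>R f3) (at t)" if "bounded_linear pr" for pr t
    unfolding C_def
    by (intro has_vector_derivative_add bounded_linear.has_vector_derivative[OF bounded_linear_compose[OF bounded_linear_scaleR_left that]] flow_deriv q)
  have bl: "bounded_linear (\<lambda>v :: triple. fst v)" "bounded_linear (\<lambda>v :: triple. fst (snd v))" "bounded_linear (\<lambda>v :: triple. snd (snd v))"
    by (auto intro!: bounded_linear_fst bounded_linear_snd bounded_linear_compose[OF bounded_linear_fst bounded_linear_snd]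
        bounded_linear_compose[OF bounded_linear_snd bounded_linear_snd])
  have d: "(\<delta> has_vector_derivative u t) (at t)" "(u has_vector_derivative (q t *\<^sub>R n t - K *\<^sub>R \<delta> t)) (at t)" "(n has_vector_derivative (- q t *\<^sub>R u t)) (at t)" for t
    using dC[OF bl(1), of t] dC[OF bl(2), of t] dC[OF bl(3), of t]
    unfolding \<delta>_def u_def n_def by (simp_all add: gen_def C_def algebra_simps)
  have i: "\<delta> 0 = f1" "u 0 = f2" "n 0 = f3"
    by (simp_all add: \<delta>_def u_def n_def C_def flow_0[OF q(1)] e1_def e2_def e3_def)
  have fr: "form S f3 f3 = 1" "form S f2 f3 = 0" "K * form S f1 f3 = 0" "rot S f1 f3 = - f2" "rho f2 f3 = K *\<^sub>R f1"
    using frame[OF f] by blast+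
  have sc: "scalars (\<delta> t) (u t) (n t) = 0" for t
    by (rule frame_flow_scalars[OF q(1) d]) (use f fr points[OF f(1)] in \<open>simp add: scalars_def i zero_prod_def\<close>)
  then have sc: "form S (u t) (u t) = 1" "form S (n t) (n t) = 1" "form S (u t) (n t) = 0" "K * form S (\<delta> t) (u t) = 0" "K * form S (\<delta> t) (n t) = 0"
      "K * form S (\<delta> t) (\<delta> t) = K * K" for t
    unfolding scalars_def by (simp_all add: prod_eq_iff)
  have rt: "rot S (\<delta> t) (u t) = n t" for t
    by (rule frame_flow_rot[OF q(1) d]) (use f fr in \<open>simp_all add: i\<close>)
  have cc: "continuous_on UNIV \<delta>" "continuous_on UNIV u" "continuous_on UNIV n"
    using d by (auto intro!: has_vector_derivative_continuous continuous_at_imp_continuous_on)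
  have qc: "continuous_on UNIV q" using q by (simp add: admissible_def)
  have v: "velocity \<delta> t = u t" for t unfolding velocity_def by (rule vector_derivative_at[OF d(1)])
  then have v': "velocity \<delta> = u" by auto
  have L2: "has_L2_derivative (velocity \<delta>) (\<lambda>t. q t *\<^sub>R n t - K *\<^sub>R \<delta> t)"
    unfolding v' by (rule has_L2_derivative_of_derivative[OF d(2)]) (intro continuous_intros qc cc)
  show cd: "\<delta> \<in> closed_curves S T"
    unfolding closed_curves_def
  proof (intro CollectI conjI allI)
    show "\<delta> t \<in> points S" for t by (rule path[OF cc(1) sc(6)]) (simp add: i f)
    have "\<delta> differentiable_on UNIV"
      unfolding differentiable_on_def using d(1) differentiableI_vector by blast
    then show "W22_loc \<delta>" using L2 by (auto simp: W22_loc_def)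
    show "form S (velocity \<delta> t) (velocity \<delta> t) = 1" for t by (simp add: v sc)
    show "\<delta> (t + T) = \<delta> t" for t
      unfolding \<delta>_def C_def using flow_periodic[OF q cl] by simp
  qed
  show "velocity \<delta> t = C (\<lambda>v. fst (snd v)) t" by (simp add: v u_def)
  show "rot S (\<delta> t) (velocity \<delta> t) = C (\<lambda>v. snd (snd v)) t" using rt by (simp add: v n_def)
  obtain N where N: "negligible N" "\<And>t. t \<in> {0..T} - N \<Longrightarrow> acceleration \<delta> t = q t *\<^sub>R n t - K *\<^sub>R \<delta> t"
    using has_L2_derivative_unique_AE[OF closed_curveD(5)[OF cd] L2] by blast
  show "\<exists>N. negligible N \<and> (\<forall>t\<in>{0..T} - N. acceleration \<delta> t = q t *\<^sub>R rot S (\<delta> t) (velocity \<delta> t) - K *\<^sub>R \<delta> t \<and> geodesic_curvature S \<delta> t = q t)"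
  proof (intro exI[of _ N] conjI ballI)
    show "negligible N" by (rule N(1))
    fix t assume t: "t \<in> {0..T} - N"
    show "acceleration \<delta> t = q t *\<^sub>R rot S (\<delta> t) (velocity \<delta> t) - K *\<^sub>R \<delta> t" using N(2)[OF t] by (simp add: v rt)
    show "geodesic_curvature S \<delta> t = q t"
      unfolding geodesic_curvature_def N(2)[OF t] v rt by (simp add: F.diff_left F.scaleR_left sc)
  qed
qed

lemma triple_comb_norm:
  assumes "\<bar>a1\<bar> \<le> e" "\<bar>a2\<bar> \<le> e" "\<bar>a3\<bar> \<le> e"
  shows "norm (a1 *\<^sub>R f1 + a2 *\<^sub>R f2 + a3 *\<^sub>R f3 :: 'a) \<le> e * (norm f1 + norm f2 + norm f3)"
proof -
  have "norm (a1 *\<^sub>R f1 + a2 *\<^sub>R f2 + a3 *\<^sub>R f3) \<le> e * norm f1 + e * norm f2 + e * norm f3"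
    by (intro norm_triangle_mono) (use assms in \<open>simp_all add: mult_right_mono\<close>)
  then show ?thesis by (simp add: algebra_simps)
qed

text \<open>Both curves are combinations of the same vectors \<open>f1\<close>, \<open>f2\<close>,
  \<open>f3\<close> with coordinates from row solutions. Closeness of these solutions gives
  closeness of position, velocity and normal, and L2 closeness of the curvatures then gives that of
  the accelerations.\<close>

theorem finite_gap_dense:
  assumes T: "T > 0"
  shows "W22_dense_in T (finite_gap_curves S T) (closed_curves S T)"
  unfolding W22_dense_in_def
proof (intro conjI ballI allI impI)
  show "finite_gap_curves S T \<subseteq> closed_curves S T" by (auto simp: finite_gap_curves_def)
  fix \<gamma> and e :: real assume \<gamma>: "\<gamma> \<in> closed_curves S T" and e: "e > 0"
  define \<kappa> where "\<kappa> = geodesic_curvature S \<gamma>"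
  have \<kappa>: "L2_loc \<kappa>" unfolding \<kappa>_def by (rule curvature_L2[OF \<gamma> T])
  show "\<exists>\<delta>\<in>finite_gap_curves S T. W22_dist T \<gamma> \<delta> < e"
  proof (cases "\<exists>N. negligible N \<and> (\<forall>t\<in>{0..T} - N. \<kappa> t = 0)")
    \<comment> \<open>A closed geodesic serves as its own approximation.\<close>
    case True
    then have "finite_gap T (\<lambda>t. complex_of_real (\<kappa> t))" using finite_gap_zero_potential[OF T] by blast
    then show ?thesis using \<gamma> e by (intro bexI[of _ \<gamma>]) (auto simp: finite_gap_curves_def \<kappa>_def W22_dist_def)
  next
    case nz: False
    show ?thesis
    proof (rule curve_frame[OF \<gamma> T, folded \<kappa>_def])
      fix f1 f2 f3 R
      assume f: "f1 \<in> points S" "form S f2 f2 = 1" "K * form S f1 f2 = 0" "f3 = rot S f1 f2"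
        and R: "\<And>w. continuous_on UNIV (R w)" "\<And>w. R w 0 = w" "\<And>w. R w T = w"
          "\<And>w t. t \<in> {0..T} \<Longrightarrow> ((\<lambda>s. gen 1 K (\<kappa> s) (R w s)) has_integral R w t - R w 0) {0..t}"
        and g: "\<And>t. \<gamma> t = fst (R e1 t) *\<^sub>R f1 + fst (R e2 t) *\<^sub>R f2 + fst (R e3 t) *\<^sub>R f3"
          "\<And>t. velocity \<gamma> t = fst (snd (R e1 t)) *\<^sub>R f1 + fst (snd (R e2 t)) *\<^sub>R f2 + fst (snd (R e3 t)) *\<^sub>R f3"
          "\<And>t. rot S (\<gamma> t) (velocity \<gamma> t) = snd (snd (R e1 t)) *\<^sub>R f1 + snd (snd (R e2 t)) *\<^sub>R f2 + snd (snd (R e3 t)) *\<^sub>R f3"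
      define F where "F = norm f1 + norm f2 + norm f3"
      have F0: "F \<ge> 0" by (simp add: F_def)
      let ?N = "\<lambda>t. rot S (\<gamma> t) (velocity \<gamma> t)"
      have Nc: "continuous_on {0..T} ?N" by (intro rot_continuous continuous_on_subset[OF closed_curveD(6)[OF \<gamma>]] continuous_on_subset[OF closed_curveD(7)[OF \<gamma>]]) auto
      obtain B where B: "B \<ge> 0" "\<And>t. t \<in> {0..T} \<Longrightarrow> norm (?N t) \<le> B"
        using continuous_on_compact_bound[OF compact_Icc Nc] by metis
      have \<kappa>i: "(\<lambda>t. (\<kappa> t)\<^sup>2) integrable_on {0..T}" using \<kappa> by (simp add: L2_loc_def)
      define I where "I = integral {0..T} (\<lambda>t. (\<kappa> t)\<^sup>2)"
      have I0: "I \<ge> 0" unfolding I_def by (rule Henstock_Kurzweil_Integration.integral_nonneg[OF \<kappa>i]) simp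
      define c where "c = 2 * F\<^sup>2 + 3 * (K\<^sup>2 * F\<^sup>2)"
      \<comment> \<open>\<open>c\<close> collects the contributions bounded pointwise by multiples
        of \<open>\<epsilon> * F\<^sup>2\<close>. The next two terms belong to the L2 distance of
        the curvatures, with \<open>B + F\<close> bounding the new normal, and to the difference of
        the normals weighted with the square of \<kappa>.\<close>
      define A where "A = c * T + 3 * (B + F)\<^sup>2 + 3 * F\<^sup>2 * I + 1"
      have c0: "c \<ge> 0" by (simp add: c_def)
      have A0: "A > 0" unfolding A_def using c0 T I0 by (intro add_nonneg_pos add_nonneg_nonneg mult_nonneg_nonneg) auto
      define \<epsilon> where "\<epsilon> = min 1 (e\<^sup>2 / (2 * A))"
      have \<epsilon>: "\<epsilon> > 0" "\<epsilon> \<le> 1" "A * \<epsilon> < e\<^sup>2"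
      proof -
        show "\<epsilon> > 0" "\<epsilon> \<le> 1" using A0 e by (auto simp: \<epsilon>_def)
        have "A * \<epsilon> \<le> A * (e\<^sup>2 / (2 * A))" using A0 by (intro mult_left_mono) (auto simp: \<epsilon>_def)
        also have "\<dots> = e\<^sup>2 / 2" using A0 by simp
        also have "\<dots> < e\<^sup>2" using e by simp
        finally show "A * \<epsilon> < e\<^sup>2" .
      qed
      show ?thesis
      proof (rule finite_gap_frame_approximation[OF T \<epsilon>(1) \<kappa> R(1) _ R(2) R(3) nz])
        show "((\<lambda>s. gen 1 K (\<kappa> s) (R v s)) has_integral R v t - R v 0) {0..t}" if "t \<in> {0..T}" for v t by (rule R(4)[OF that])
        fix q
        assume q: "admissible q" "\<And>t. q (t + T) = q t" "\<And>v. v \<in> {e1, e2, e3} \<Longrightarrow> row_flow K q v T = v"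
          and q2: "integral {0..T} (\<lambda>t. (\<kappa> t - q t)\<^sup>2) \<le> \<epsilon>"
          and near: "\<And>v t. v \<in> {e1, e2, e3} \<Longrightarrow> t \<in> {0..T} \<Longrightarrow> norm (row_flow K q v t - R v t) \<le> \<epsilon>"
          and fg: "\<And>q' N. negligible N \<Longrightarrow> (\<And>t. t \<in> {0..T} - N \<Longrightarrow> q' t = q t) \<Longrightarrow> finite_gap T (\<lambda>t. complex_of_real (q' t))"
        define \<delta> where "\<delta> = (\<lambda>t. fst (row_flow K q e1 t) *\<^sub>R f1 + fst (row_flow K q e2 t) *\<^sub>R f2 + fst (row_flow K q e3 t) *\<^sub>R f3)"
        have \<delta>: "\<delta> \<in> closed_curves S T" unfolding \<delta>_def by (rule frame_curve(1)[OF f q])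
        have \<delta>v: "velocity \<delta> t = fst (snd (row_flow K q e1 t)) *\<^sub>R f1 + fst (snd (row_flow K q e2 t)) *\<^sub>R f2 + fst (snd (row_flow K q e3 t)) *\<^sub>R f3" for t
          unfolding \<delta>_def by (rule frame_curve(2)[OF f q])
        have \<delta>n: "rot S (\<delta> t) (velocity \<delta> t) = snd (snd (row_flow K q e1 t)) *\<^sub>R f1 + snd (snd (row_flow K q e2 t)) *\<^sub>R f2 + snd (snd (row_flow K q e3 t)) *\<^sub>R f3" for t
          unfolding \<delta>_def by (rule frame_curve(3)[OF f q])
        have \<delta>a: "\<exists>N. negligible N \<and> (\<forall>t\<in>{0..T} - N. acceleration \<delta> t = q t *\<^sub>R rot S (\<delta> t) (velocity \<delta> t) - K *\<^sub>R \<delta> t \<and> geodesic_curvature S \<delta> t = q t)"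
          unfolding \<delta>_def by (rule frame_curve(4)[OF f q])
        obtain N where N: "negligible N" "\<And>t. t \<in> {0..T} - N \<Longrightarrow> acceleration \<delta> t = q t *\<^sub>R rot S (\<delta> t) (velocity \<delta> t) - K *\<^sub>R \<delta> t"
          "\<And>t. t \<in> {0..T} - N \<Longrightarrow> geodesic_curvature S \<delta> t = q t" using \<delta>a by blast
        have \<delta>fg: "\<delta> \<in> finite_gap_curves S T" unfolding finite_gap_curves_def using \<delta> fg[OF N(1,3)] by simp
        obtain N' where N': "negligible N'" "\<And>t. t \<in> {0..T} - N' \<Longrightarrow> acceleration \<gamma> t = \<kappa> t *\<^sub>R ?N t - K *\<^sub>R \<gamma> t"
          using frenet_AE[OF \<gamma>] unfolding \<kappa>_def by blast
        let ?M = "\<lambda>t. rot S (\<delta> t) (velocity \<delta> t)"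
        have comp: "\<bar>fst (R v t) - fst (row_flow K q v t)\<bar> \<le> \<epsilon> \<and> \<bar>fst (snd (R v t)) - fst (snd (row_flow K q v t))\<bar> \<le> \<epsilon> \<and>
            \<bar>snd (snd (R v t)) - snd (snd (row_flow K q v t))\<bar> \<le> \<epsilon>" if "v \<in> {e1, e2, e3}" "t \<in> {0..T}" for v t
          using triple_comp_le[of "row_flow K q v t - R v t"] near[OF that] by (auto simp: abs_minus_commute)
        have close: "norm (\<gamma> t - \<delta> t) \<le> \<epsilon> * F" "norm (velocity \<gamma> t - velocity \<delta> t) \<le> \<epsilon> * F" "norm (?N t - ?M t) \<le> \<epsilon> * F" if t: "t \<in> {0..T}" for t
        proof -
          have lin: "a1 *\<^sub>R f1 + a2 *\<^sub>R f2 + a3 *\<^sub>R f3 - (b1 *\<^sub>R f1 + b2 *\<^sub>R f2 + b3 *\<^sub>R f3) =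
            (a1 - b1) *\<^sub>R f1 + (a2 - b2) *\<^sub>R f2 + (a3 - b3) *\<^sub>R f3" for a1 a2 a3 b1 b2 b3 by (simp add: algebra_simps)
          show "norm (\<gamma> t - \<delta> t) \<le> \<epsilon> * F" unfolding g(1)[of t] \<delta>_def lin F_def
            by (rule triple_comb_norm) (use comp t in auto)
          show "norm (velocity \<gamma> t - velocity \<delta> t) \<le> \<epsilon> * F" unfolding g(2)[of t] \<delta>v lin F_def
            by (rule triple_comb_norm) (use comp t in auto)
          show "norm (?N t - ?M t) \<le> \<epsilon> * F" unfolding g(3)[of t] \<delta>n lin F_def
            by (rule triple_comb_norm) (use comp t in auto)
        qed
        have sq: "x\<^sup>2 \<le> \<epsilon> * F\<^sup>2" if "0 \<le> x" "x \<le> \<epsilon> * F" for x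
        proof -
          have "x\<^sup>2 \<le> (\<epsilon> * F)\<^sup>2" using that by (intro power_mono) auto
          also have "\<dots> = \<epsilon> * (\<epsilon> * F\<^sup>2)" by (simp add: power2_eq_square)
          also have "\<dots> \<le> 1 * (\<epsilon> * F\<^sup>2)" using \<epsilon> by (intro mult_right_mono) auto
          finally show ?thesis by simp
        qed
        let ?g = "\<lambda>t. \<epsilon> * c + 3 * (B + F)\<^sup>2 * (\<kappa> t - q t)\<^sup>2 + 3 * (\<epsilon> * F\<^sup>2) * (\<kappa> t)\<^sup>2"
        have qL: "L2_loc (\<lambda>t. \<kappa> t - q t)"
          using L2_loc_add[OF \<kappa> L2_loc_continuous[of "\<lambda>t. - q t"]] q(1) by (simp add: continuous_on_minus admissible_def)
        then have qi: "(\<lambda>t. (\<kappa> t - q t)\<^sup>2) integrable_on {0..T}" by (simp add: L2_loc_def)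
        have gi: "((\<lambda>t. ?g t) has_integral (\<epsilon> * c * T + 3 * (B + F)\<^sup>2 * integral {0..T} (\<lambda>t. (\<kappa> t - q t)\<^sup>2) + 3 * (\<epsilon> * F\<^sup>2) * I)) {0..T}"
          unfolding I_def using has_integral_const_real[of "\<epsilon> * c" 0 T] T
          by (intro has_integral_add has_integral_mult_right integrable_integral qi \<kappa>i) (simp add: mult.commute)
        have "integral {0..T} (\<lambda>t. (norm (\<gamma> t - \<delta> t))\<^sup>2 + (norm (velocity \<gamma> t - velocity \<delta> t))\<^sup>2 + (norm (acceleration \<gamma> t - acceleration \<delta> t))\<^sup>2)
          \<le> integral {0..T} ?g"
        proof (rule integral_le_of_AE_le[of "N \<union> N'"])
          show "negligible (N \<union> N')" using N N' by (intro negligible_Un)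
          show "?g integrable_on {0..T}" using gi by blast
          show "integral {0..T} ?g \<ge> 0"
            by (rule Henstock_Kurzweil_Integration.integral_nonneg) (use gi \<epsilon> c0 in auto)
          fix t assume t: "t \<in> {0..T} - (N \<union> N')"
          then have t0: "t \<in> {0..T}" by simp
          have acc: "acceleration \<gamma> t - acceleration \<delta> t = (\<kappa> t - q t) *\<^sub>R ?M t + \<kappa> t *\<^sub>R (?N t - ?M t) - K *\<^sub>R (\<gamma> t - \<delta> t)"
          proof -
            have "t \<in> {0..T} - N" "t \<in> {0..T} - N'" using t by auto
            from this(1) this(2) show ?thesis
              unfolding N(2)[OF \<open>t \<in> {0..T} - N\<close>] N'(2)[OF \<open>t \<in> {0..T} - N'\<close>] by (simp add: algebra_simps)
          qed
          have "norm (acceleration \<gamma> t - acceleration \<delta> t) \<le> norm ((\<kappa> t - q t) *\<^sub>R ?M t) + norm (\<kappa> t *\<^sub>R (?N t - ?M t)) + norm (K *\<^sub>R (\<gamma> t - \<delta> t))"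
            unfolding acc using norm_triangle_ineq4[of "(\<kappa> t - q t) *\<^sub>R ?M t + \<kappa> t *\<^sub>R (?N t - ?M t)" "K *\<^sub>R (\<gamma> t - \<delta> t)"]
              norm_triangle_ineq[of "(\<kappa> t - q t) *\<^sub>R ?M t" "\<kappa> t *\<^sub>R (?N t - ?M t)"] by linarith
          then have "(norm (acceleration \<gamma> t - acceleration \<delta> t))\<^sup>2 \<le> (norm ((\<kappa> t - q t) *\<^sub>R ?M t) + norm (\<kappa> t *\<^sub>R (?N t - ?M t)) + norm (K *\<^sub>R (\<gamma> t - \<delta> t)))\<^sup>2"
            by (intro power_mono) auto
          also have "\<dots> \<le> 3 * ((norm ((\<kappa> t - q t) *\<^sub>R ?M t))\<^sup>2 + (norm (\<kappa> t *\<^sub>R (?N t - ?M t)))\<^sup>2 + (norm (K *\<^sub>R (\<gamma> t - \<delta> t)))\<^sup>2)"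
          proof -
            have "(x + y + z)\<^sup>2 \<le> 3 * (x\<^sup>2 + y\<^sup>2 + z\<^sup>2)" for x y z :: real
              using zero_le_power2[of "x - y"] zero_le_power2[of "x - z"] zero_le_power2[of "y - z"] by (simp add: power2_eq_square algebra_simps)
            then show ?thesis .
          qed
          also have "(norm ((\<kappa> t - q t) *\<^sub>R ?M t))\<^sup>2 \<le> (B + F)\<^sup>2 * (\<kappa> t - q t)\<^sup>2"
          proof -
            have "norm (?M t) \<le> norm (?N t) + norm (?N t - ?M t)" by norm
            also have "\<dots> \<le> B + 1 * F" using B(2)[OF t0] close(3)[OF t0] mult_right_mono[OF \<epsilon>(2) F0] by linarith
            finally have "(norm (?M t))\<^sup>2 \<le> (B + F)\<^sup>2" by (intro power_mono) auto
            from mult_right_mono[OF this, of "(\<kappa> t - q t)\<^sup>2"] show ?thesis by (simp add: power_mult_distrib mult.commute)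
          qed
          also have "(norm (\<kappa> t *\<^sub>R (?N t - ?M t)))\<^sup>2 \<le> (\<epsilon> * F\<^sup>2) * (\<kappa> t)\<^sup>2"
            using mult_right_mono[OF sq[OF norm_ge_zero close(3)[OF t0]], of "(\<kappa> t)\<^sup>2"] by (simp add: power_mult_distrib mult.commute)
          also have "(norm (K *\<^sub>R (\<gamma> t - \<delta> t)))\<^sup>2 \<le> \<epsilon> * F\<^sup>2 * K\<^sup>2"
            using mult_right_mono[OF sq[OF norm_ge_zero close(1)[OF t0]], of "K\<^sup>2"] by (simp add: power_mult_distrib mult.commute)
          finally have "(norm (acceleration \<gamma> t - acceleration \<delta> t))\<^sup>2 \<le> 3 * ((B + F)\<^sup>2 * (\<kappa> t - q t)\<^sup>2 + \<epsilon> * F\<^sup>2 * (\<kappa> t)\<^sup>2 + \<epsilon> * F\<^sup>2 * K\<^sup>2)" by simp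
          moreover have "(norm (\<gamma> t - \<delta> t))\<^sup>2 \<le> \<epsilon> * F\<^sup>2" "(norm (velocity \<gamma> t - velocity \<delta> t))\<^sup>2 \<le> \<epsilon> * F\<^sup>2"
            by (rule sq[OF norm_ge_zero close(1)[OF t0]], rule sq[OF norm_ge_zero close(2)[OF t0]])
          ultimately show "(norm (\<gamma> t - \<delta> t))\<^sup>2 + (norm (velocity \<gamma> t - velocity \<delta> t))\<^sup>2 + (norm (acceleration \<gamma> t - acceleration \<delta> t))\<^sup>2 \<le> ?g t"
            unfolding c_def by (simp add: algebra_simps)
        qed
        also have "\<dots> = \<epsilon> * c * T + 3 * (B + F)\<^sup>2 * integral {0..T} (\<lambda>t. (\<kappa> t - q t)\<^sup>2) + 3 * (\<epsilon> * F\<^sup>2) * I" using gi by (rule integral_unique)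
        also have "\<dots> \<le> \<epsilon> * c * T + 3 * (B + F)\<^sup>2 * \<epsilon> + 3 * (\<epsilon> * F\<^sup>2) * I" using q2 by (intro add_right_mono add_left_mono mult_left_mono) auto
        also have "\<dots> \<le> A * \<epsilon>" unfolding A_def using \<epsilon>(1) by (simp add: algebra_simps)
        also have "\<dots> < e\<^sup>2" by (rule \<epsilon>(3))
        finally have "W22_dist T \<gamma> \<delta> < e" unfolding W22_dist_def using e by (simp add: real_less_lsqrt real_sqrt_less_iff flip: real_sqrt_abs)
        then show "\<exists>\<delta>\<in>finite_gap_curves S T. W22_dist T \<gamma> \<delta> < e" using \<delta>fg by blast
      qed
    qed
  qed
qed

end

section \<open>The plane and the quadrics\<close>

lemma surface_geometry_euclidean: "surface_geometry euclidean_plane 0 (\<lambda>_ _. 0) (\<lambda>v. vector [- v$2, v$1])"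
proof (rule surface_geometry.intro)
  show "bounded_bilinear (form euclidean_plane)" by (simp add: euclidean_plane_def bounded_bilinear_inner)
  show "form euclidean_plane v w = form euclidean_plane w v" for v w by (simp add: euclidean_plane_def inner_commute)
  show "bounded_bilinear (\<lambda>_ _ :: real^2. 0 :: real^2)"
    by (rule bounded_bilinear.intro) (auto intro: exI[of _ 0])
  show "bounded_linear (\<lambda>v :: real^2. vector [- v$2, v$1] :: real^2)"
    unfolding linear_conv_bounded_linear[symmetric] by (rule linearI) (simp_all add: vec_eq_iff forall_2 vector_2)
  fix p u n :: "real^2"
  assume u: "form euclidean_plane u u = 1" and n: "n = rot euclidean_plane p u"
  have u1: "u$1 * u$1 + u$2 * u$2 = 1" using u by (simp add: euclidean_plane_def inner_vec_def sum_2)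
  have n': "n = vector [- u$2, u$1]" using n by (simp add: euclidean_plane_def)
  have "a = (a \<bullet> u) *\<^sub>R u + (a \<bullet> n) *\<^sub>R n" for a
  proof -
    have "a$1 * (u$1 * u$1 + u$2 * u$2) = (a \<bullet> u) * u$1 + (a \<bullet> n) * n$1" "a$2 * (u$1 * u$1 + u$2 * u$2) = (a \<bullet> u) * u$2 + (a \<bullet> n) * n$2"
      unfolding n' inner_vec_def sum_2 by (simp_all add: algebra_simps)
    then show ?thesis unfolding u1 by (simp add: vec_eq_iff forall_2)
  qed
  moreover have "n \<bullet> n = 1" "u \<bullet> n = 0" unfolding n' inner_vec_def sum_2 using u1 by (simp_all add: algebra_simps)
  moreover have "vector [- n$2, n$1] = - u" unfolding n' by (simp add: vec_eq_iff forall_2)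
  ultimately show "form euclidean_plane n n = 1 \<and> form euclidean_plane u n = 0 \<and> 0 * form euclidean_plane p n = 0 \<and> rot euclidean_plane p n = - u \<and> 0 = 0 *\<^sub>R p \<and>
      (\<forall>a. a = (0 * form euclidean_plane a p) *\<^sub>R p + form euclidean_plane a u *\<^sub>R u + form euclidean_plane a n *\<^sub>R n)"
    by (simp add: euclidean_plane_def)
qed (simp_all add: euclidean_plane_def)

text \<open>The sphere and the hyperboloid are treated together as the quadrics of signature \<open>(1, 1, \<sigma>)\<close>.\<close>

definition qform :: "real \<Rightarrow> real^3 \<Rightarrow> real^3 \<Rightarrow> real" where
  "qform \<sigma> v w = v$1 * w$1 + v$2 * w$2 + \<sigma> * (v$3 * w$3)"

definition qrot :: "real \<Rightarrow> real^3 \<Rightarrow> real^3 \<Rightarrow> real^3" where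
  "qrot \<sigma> p v = vector [p$2 * v$3 - p$3 * v$2, p$3 * v$1 - p$1 * v$3, \<sigma> * (p$1 * v$2 - p$2 * v$1)]"

lemma qform_bilinear: "bounded_bilinear (qform \<sigma>)"
  unfolding bilinear_conv_bounded_bilinear[symmetric] bilinear_def qform_def
  by (auto intro!: linearI simp: algebra_simps)

lemma qrot_bilinear: "bounded_bilinear (qrot \<sigma>)"
  unfolding bilinear_conv_bounded_bilinear[symmetric] bilinear_def qrot_def
  by (auto intro!: linearI simp: vec_eq_iff forall_3 vector_3 algebra_simps)

lemma qform_qrot_orthogonal:
  assumes "\<sigma> = 1 \<or> \<sigma> = -1"
  shows "qform \<sigma> p (qrot \<sigma> p u) = 0" "qform \<sigma> u (qrot \<sigma> p u) = 0"
  using assms by (auto simp: qform_def qrot_def vector_3 algebra_simps)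

lemma qrot_qrot:
  assumes "\<sigma> = 1 \<or> \<sigma> = -1"
  shows "qrot \<sigma> p (qrot \<sigma> p u) = \<sigma> *\<^sub>R (qform \<sigma> p u *\<^sub>R p - qform \<sigma> p p *\<^sub>R u)"
    "qrot \<sigma> u (qrot \<sigma> p u) = \<sigma> *\<^sub>R (qform \<sigma> u u *\<^sub>R p - qform \<sigma> p u *\<^sub>R u)"
  using assms by (auto simp: qform_def qrot_def vec_eq_iff forall_3 vector_3 algebra_simps)

text \<open>Lagrange's identity and the expansion of a vector along \<open>p\<close>,
  \<open>u\<close> and their cross product, in signature (1, 1, \<sigma>). For an orthogonal pair
  with norms \<sigma> and 1 the second identity is the completeness relation in the axiom
  \<open>frame\<close>.\<close>

lemma qform_qrot:
  assumes "\<sigma> = 1 \<or> \<sigma> = -1"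
  shows "qform \<sigma> (qrot \<sigma> p u) (qrot \<sigma> p u) = \<sigma> * (qform \<sigma> p p * qform \<sigma> u u - qform \<sigma> p u * qform \<sigma> p u)"
    "qform \<sigma> a (qrot \<sigma> p u) *\<^sub>R qrot \<sigma> p u = \<sigma> *\<^sub>R ((qform \<sigma> p p * qform \<sigma> u u - qform \<sigma> p u * qform \<sigma> p u) *\<^sub>R a
       - (qform \<sigma> a p * qform \<sigma> u u - qform \<sigma> a u * qform \<sigma> p u) *\<^sub>R p - (qform \<sigma> a u * qform \<sigma> p p - qform \<sigma> a p * qform \<sigma> p u) *\<^sub>R u)"
  using assms by (auto simp: qform_def qrot_def vec_eq_iff forall_3 vector_3 algebra_simps)

lemma surface_geometry_quadric:
  assumes \<sigma>: "\<sigma> = 1 \<or> \<sigma> = -1" and S: "form S = qform \<sigma>" "rot S = qrot \<sigma>" and pt: "\<And>p. p \<in> points S \<Longrightarrow> qform \<sigma> p p = \<sigma>"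
    and path: "\<And>\<delta> t. continuous_on UNIV \<delta> \<Longrightarrow> (\<And>t. qform \<sigma> (\<delta> t) (\<delta> t) = \<sigma>) \<Longrightarrow> \<delta> 0 \<in> points S \<Longrightarrow> \<delta> (t::real) \<in> points S"
  shows "surface_geometry S \<sigma> (qrot \<sigma>) (\<lambda>_. 0)"
proof (rule surface_geometry.intro)
  have \<sigma>0: "\<sigma> \<noteq> 0" and \<sigma>2: "\<sigma> * \<sigma> = 1" using \<sigma> by auto
  show "bounded_bilinear (form S)" unfolding S by (rule qform_bilinear)
  show "form S v w = form S w v" for v w by (simp add: S qform_def mult.commute)
  show "bounded_bilinear (qrot \<sigma>)" by (rule qrot_bilinear)
  show "qrot \<sigma> v v = 0" for v by (simp add: qrot_def vec_eq_iff forall_3 vector_3 mult.commute)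
  show "\<sigma> * \<sigma> * \<sigma> = \<sigma>" using \<sigma>2 by simp
  show "\<sigma> * form S p p = \<sigma> * \<sigma>" if "p \<in> points S" for p using pt[OF that] by (simp add: S)
  show "\<delta> t \<in> points S" if "continuous_on UNIV \<delta>" "\<And>t. \<sigma> * form S (\<delta> t) (\<delta> t) = \<sigma> * \<sigma>" "\<delta> 0 \<in> points S" for \<delta> and t :: real
    by (rule path[OF that(1) _ that(3)]) (use that(2) \<sigma>0 in \<open>simp add: S\<close>)
  fix p u n assume p: "p \<in> points S" and u: "form S u u = 1" "\<sigma> * form S p u = 0" and n: "n = rot S p u"
  have pp: "qform \<sigma> p p = \<sigma>" "qform \<sigma> u u = 1" "qform \<sigma> p u = 0" using pt[OF p] u \<sigma>0 by (simp_all add: S)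
  have "a = (\<sigma> * qform \<sigma> a p) *\<^sub>R p + qform \<sigma> a u *\<^sub>R u + qform \<sigma> a (qrot \<sigma> p u) *\<^sub>R qrot \<sigma> p u" for a
    unfolding qform_qrot(2)[OF \<sigma>] pp using \<sigma>2 by (simp add: scaleR_diff_right algebra_simps flip: mult.assoc)
  then show "form S n n = 1 \<and> form S u n = 0 \<and> \<sigma> * form S p n = 0 \<and> rot S p n = - u \<and> qrot \<sigma> u n = \<sigma> *\<^sub>R p \<and>
      (\<forall>a. a = (\<sigma> * form S a p) *\<^sub>R p + form S a u *\<^sub>R u + form S a n *\<^sub>R n)"
    unfolding n S using qform_qrot(1)[OF \<sigma>, of p u] qform_qrot_orthogonal[OF \<sigma>, where p = p and u = u] qrot_qrot[OF \<sigma>, where p = p and u = u] \<sigma>2 by (simp add: pp)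
qed (simp_all add: S)

lemma surface_geometry_sphere: "surface_geometry round_sphere 1 (qrot 1) (\<lambda>_. 0)"
proof (rule surface_geometry_quadric)
  have q: "qform 1 v w = v \<bullet> w" for v w by (simp add: qform_def inner_vec_def sum_3)
  show "form round_sphere = qform 1" by (simp add: round_sphere_def q fun_eq_iff)
  show "rot round_sphere = qrot 1" by (simp add: round_sphere_def qrot_def cross3_def fun_eq_iff)
  show "qform 1 p p = 1" if "p \<in> points round_sphere" for p using that by (simp add: round_sphere_def q flip: norm_eq_1)
  show "\<delta> t \<in> points round_sphere" if "\<And>t. qform 1 (\<delta> t) (\<delta> t) = 1" for \<delta> and t :: real
    using that[of t] by (simp add: round_sphere_def q norm_eq_1)
qed simp

lemma surface_geometry_hyperbolic: "surface_geometry hyperbolic_plane (-1) (qrot (-1)) (\<lambda>_. 0)"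
proof (rule surface_geometry_quadric)
  have q: "qform (-1) v w = minkowski v w" for v w by (simp add: qform_def minkowski_def)
  show "form hyperbolic_plane = qform (-1)" by (simp add: hyperbolic_plane_def q fun_eq_iff)
  show "rot hyperbolic_plane = qrot (-1)" by (simp add: hyperbolic_plane_def qrot_def cross3_def fun_eq_iff vector_3)
  show "qform (-1) p p = -1" if "p \<in> points hyperbolic_plane" for p using that by (simp add: hyperbolic_plane_def q)
  show "\<delta> t \<in> points hyperbolic_plane"
    if c: "continuous_on UNIV \<delta>" and d: "\<And>t. qform (-1) (\<delta> t) (\<delta> t) = -1" and 0: "\<delta> 0 \<in> points hyperbolic_plane" for \<delta> and t :: real
  proof -
    \<comment> \<open>If the third coordinate vanished, a sum of two squares would be -1. Being
      continuous and never 0, it keeps its positive sign along the path.\<close>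
    have nz: "\<delta> s $ 3 \<noteq> 0" for s
    proof
      assume "\<delta> s $ 3 = 0"
      then have "\<delta> s $ 1 * \<delta> s $ 1 + \<delta> s $ 2 * \<delta> s $ 2 = -1" using d[of s] by (simp add: qform_def)
      then show False using zero_le_square[of "\<delta> s $ 1"] zero_le_square[of "\<delta> s $ 2"] by linarith
    qed
    have "connected ((\<lambda>s. \<delta> s $ 3) ` UNIV)" by (intro connected_continuous_image continuous_intros c connected_UNIV)
    then have "\<not> \<delta> t $ 3 \<le> 0" using connectedD_interval[of "range (\<lambda>s. \<delta> s $ 3)" "\<delta> t $ 3" "\<delta> 0 $ 3" 0] nz 0
      by (force simp: hyperbolic_plane_def)
    then show ?thesis using d[of t] by (simp add: hyperbolic_plane_def q)
  qed
qed simp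

theorem theorem6p5:
  fixes T :: real
  assumes "T > 0"
  shows "W22_dense_in T (finite_gap_curves euclidean_plane T) (closed_curves euclidean_plane T)
       \<and> W22_dense_in T (finite_gap_curves round_sphere T) (closed_curves round_sphere T)
       \<and> W22_dense_in T (finite_gap_curves hyperbolic_plane T) (closed_curves hyperbolic_plane T)"
  using surface_geometry.finite_gap_dense[OF surface_geometry_euclidean assms]
    surface_geometry.finite_gap_dense[OF surface_geometry_sphere assms]
    surface_geometry.finite_gap_dense[OF surface_geometry_hyperbolic assms]
  by blast

end
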